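(* Let $(M,g)$ be a 3-dimensional Lorentzian manifold. Then $(M,g)$ admits a metric connection with parallel twistor-free torsion having isotropic vectorial component $p$ and non-degenerate skew-symmetric component $S$ if and only if $M$ is oriented and admits an isotropic vector field $p$ such that $$\nabla^g_Xp=-g(X,p)p-\tfrac12S(X,p)\qquad\text{for all }X\in\Gamma(TM),$$ where $S=a\operatorname{Vol}_g$, $a\in\mathbb{R}$, $a\neq0$. In particular, such $(M,g)$ is a Kundt space, and locally there are coordinates $v,x,u$ in which $g$ may be written as $$g=2\,dv\,du+2av\,dx\,du+(dx)^2+\left(-2ve^{-ax}+C(x,u)\right)(du)^2,$$ where $C(x,u)$ is an arbitrary function and $p=e^{-ax}\partial_v$.
   Context: Lorentzian manifolds have signature $(-,+,\dots,+)$. $\nabla^g$ denotes the Levi-Civita connection, $\operatorname{Vol}_g$ the volume form of an oriented $(M,g)$. A connection $\nabla$ on $(M,g)$ is metric if $\nabla g=0$. Bivectors act by $(X\wedge Y)Z=g(X,Z)Y-g(Y,Z)X$. For a 3-form $S$ write $g(S(X)Y,Z)=g(S(X,Y),Z)=S(X,Y,Z)$. A metric connection with twistor-free torsion (i.e. torsion with zero twistorial component) is a connection of the form $$\nabla_X=\nabla^g_X+X\wedge\xi+\tfrac12 S(X),$$ where $\xi\in\Gamma(TM)$ is the vectorial component (here $\xi=p$) and $S\in\Omega^3(M)$ is the skew-symmetric component of the torsion; its torsion is $T(X,Y)=(X\wedge Y)\xi+S(X,Y)$. The torsion is parallel if $\nabla T=0$, which is equivalent to $\nabla\xi=0$ and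 $\nabla S=0$. A vector field $\xi$ is isotropic if it is nowhere zero and $g(\xi,\xi)=0$. $S$ is called degenerate if its $g$-norm $\|S\|_g$ is zero, otherwise non-degenerate. A Kundt space is a Lorentzian manifold admitting an isotropic vector field $p$ with $\nabla^g_pp=0$, $\operatorname{tr}\nabla^gp=0$, $\|(\nabla^gp)^{sym}\|_g=0$, $\|(\nabla^gp)^{alt}\|_g=0$, where $sym$ and $alt$ denote the symmetric and skew-symmetric parts of $\nabla^g p$ (as a bilinear form).
   Formalization: The manifold M is taken to be connected: on a disconnected M, e.g. the disjoint union of the spaces with a=1 and a=2, the connection exists but no single real constant a satisfies S = a Vol_g, since |a| is determined by Ric(p) = -(a²/2)p on each component. *)

theory Defs
  imports "HOL-Analysis.Analysis"
begin

section \<open>Smooth maps between normed spaces\<close>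

text \<open>Intended for open \<open>S\<close> in a finite-dimensional space, where it is enough to iterate
  directional derivatives.\<close>

fun times_differentiable_on ::
    "nat \<Rightarrow> 'a::real_normed_vector set \<Rightarrow> ('a \<Rightarrow> 'b::real_normed_vector) \<Rightarrow> bool" where
  "times_differentiable_on 0 S f \<longleftrightarrow> continuous_on S f"
| "times_differentiable_on (Suc k) S f \<longleftrightarrow>
     (\<forall>x\<in>S. f differentiable (at x)) \<and>
     (\<forall>v. times_differentiable_on k S (\<lambda>x. frechet_derivative f (at x) v))"

definition smooth_on :: "'a::real_normed_vector set \<Rightarrow> ('a \<Rightarrow> 'b::real_normed_vector) \<Rightarrow> bool" where
  "smooth_on S f \<longleftrightarrow> (\<forall>k. times_differentiable_on k S f)"

section \<open>Smooth manifolds\<close>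

text \<open>A chart is a pair of an open domain and a coordinate map; the values of the coordinate map
  off the domain are irrelevant.\<close>

type_synonym ('a, 'n) chart = "'a set \<times> ('a \<Rightarrow> real ^ 'n)"

definition img :: "('a, 'n::finite) chart \<Rightarrow> (real ^ 'n) set" where
  "img c = snd c ` fst c"

definition param :: "('a, 'n::finite) chart \<Rightarrow> real ^ 'n \<Rightarrow> 'a" where
  "param c = inv_into (fst c) (snd c)"

definition is_chart :: "'a topology \<Rightarrow> ('a, 'n::finite) chart \<Rightarrow> bool" where
  "is_chart M c \<longleftrightarrow> openin M (fst c) \<and> open (img c) \<and>
     homeomorphic_map (subtopology M (fst c)) (top_of_set (img c)) (snd c)"

definition overlap :: "('a, 'n::finite) chart \<Rightarrow> ('a, 'n) chart \<Rightarrow> (real ^ 'n) set" where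
  "overlap c d = snd c ` (fst c \<inter> fst d)"

definition transition ::
    "('a, 'n::finite) chart \<Rightarrow> ('a, 'n) chart \<Rightarrow> real ^ 'n \<Rightarrow> real ^ 'n" where
  "transition c d = snd d \<circ> param c"

definition jac ::
    "('a, 'n::finite) chart \<Rightarrow> ('a, 'n) chart \<Rightarrow> real ^ 'n \<Rightarrow> real ^ 'n \<Rightarrow> real ^ 'n" where
  "jac c d x = frechet_derivative (transition c d) (at x)"

definition compatible :: "('a, 'n::finite) chart \<Rightarrow> ('a, 'n) chart \<Rightarrow> bool" where
  "compatible c d \<longleftrightarrow>
     smooth_on (overlap c d) (transition c d) \<and> smooth_on (overlap d c) (transition d c)"

definition max_atlas :: "'a topology \<Rightarrow> ('a, 'n::finite) chart set \<Rightarrow> ('a, 'n) chart set" where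
  "max_atlas M B = {c. is_chart M c \<and> (\<forall>d\<in>B. compatible c d)}"

text \<open>Smooth structures are maximal atlases, so a coordinate system on an open subset of the
  manifold is just an element of \<open>A\<close>. Manifolds are connected.\<close>

definition smooth_manifold :: "'a topology \<Rightarrow> ('a, 'n::finite) chart set \<Rightarrow> bool" where
  "smooth_manifold M A \<longleftrightarrow>
     topspace M \<noteq> {} \<and> Hausdorff_space M \<and> second_countable M \<and> connected_space M \<and>
     (\<forall>c\<in>A. is_chart M c) \<and> (\<Union>c\<in>A. fst c) = topspace M \<and>
     (\<forall>c\<in>A. \<forall>d\<in>A. compatible c d) \<and> max_atlas M A \<subseteq> A"

section \<open>Functions and tensor fields\<close>

text \<open>A tensor field is the family of its coordinate expressions: one for each chart \<open>c\<close> of the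
  maximal atlas, defined at the points \<open>x\<close> of \<open>img c\<close> and subject to the tensor transformation law.
  Only the values at \<open>c \<in> A\<close> and \<open>x \<in> img c\<close> carry information.\<close>

type_synonym ('a, 'n) vfield = "('a, 'n) chart \<Rightarrow> real ^ 'n \<Rightarrow> real ^ 'n"
type_synonym ('a, 'n) form2 =
  "('a, 'n) chart \<Rightarrow> real ^ 'n \<Rightarrow> real ^ 'n \<Rightarrow> real ^ 'n \<Rightarrow> real"
type_synonym ('a, 'n) form3 =
  "('a, 'n) chart \<Rightarrow> real ^ 'n \<Rightarrow> real ^ 'n \<Rightarrow> real ^ 'n \<Rightarrow> real ^ 'n \<Rightarrow> real"

definition smooth_fun :: "('a, 'n::finite) chart set \<Rightarrow> ('a \<Rightarrow> real) \<Rightarrow> bool" where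
  "smooth_fun A f \<longleftrightarrow> (\<forall>c\<in>A. smooth_on (img c) (f \<circ> param c))"

definition vector_field :: "('a, 'n::finite) chart set \<Rightarrow> ('a, 'n) vfield \<Rightarrow> bool" where
  "vector_field A X \<longleftrightarrow>
     (\<forall>c\<in>A. smooth_on (img c) (X c)) \<and>
     (\<forall>c\<in>A. \<forall>d\<in>A. \<forall>x\<in>overlap c d. X d (transition c d x) = jac c d x (X c x))"

definition field_eq ::
    "('a, 'n::finite) chart set \<Rightarrow> ('a, 'n) vfield \<Rightarrow> ('a, 'n) vfield \<Rightarrow> bool" where
  "field_eq A X Y \<longleftrightarrow> (\<forall>c\<in>A. \<forall>x\<in>img c. X c x = Y c x)"

definition fplus :: "('a, 'n::finite) vfield \<Rightarrow> ('a, 'n) vfield \<Rightarrow> ('a, 'n) vfield" where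
  "fplus X Y = (\<lambda>c x. X c x + Y c x)"

definition fminus :: "('a, 'n::finite) vfield \<Rightarrow> ('a, 'n) vfield \<Rightarrow> ('a, 'n) vfield" where
  "fminus X Y = (\<lambda>c x. X c x - Y c x)"

definition fscale :: "('a \<Rightarrow> real) \<Rightarrow> ('a, 'n::finite) vfield \<Rightarrow> ('a, 'n) vfield" where
  "fscale f X = (\<lambda>c x. f (param c x) *\<^sub>R X c x)"

definition lie_bracket :: "('a, 'n::finite) vfield \<Rightarrow> ('a, 'n) vfield \<Rightarrow> ('a, 'n) vfield" where
  "lie_bracket X Y = (\<lambda>c x. frechet_derivative (Y c) (at x) (X c x)
                          - frechet_derivative (X c) (at x) (Y c x))"

definition tensor2 :: "('a, 'n::finite) chart set \<Rightarrow> ('a, 'n) form2 \<Rightarrow> bool" where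
  "tensor2 A g \<longleftrightarrow>
     (\<forall>c\<in>A. \<forall>x\<in>img c. bilinear (g c x)) \<and>
     (\<forall>c\<in>A. \<forall>u w. smooth_on (img c) (\<lambda>x. g c x u w)) \<and>
     (\<forall>c\<in>A. \<forall>d\<in>A. \<forall>x\<in>overlap c d. \<forall>u w.
        g d (transition c d x) (jac c d x u) (jac c d x w) = g c x u w)"

definition three_form :: "('a, 'n::finite) chart set \<Rightarrow> ('a, 'n) form3 \<Rightarrow> bool" where
  "three_form A S \<longleftrightarrow>
     (\<forall>c\<in>A. \<forall>x\<in>img c. (\<forall>u w. linear (S c x u w)) \<and>
        (\<forall>u w z. S c x u w z = - S c x w u z \<and> S c x u w z = - S c x u z w)) \<and>
     (\<forall>c\<in>A. \<forall>u w z. smooth_on (img c) (\<lambda>x. S c x u w z)) \<and>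
     (\<forall>c\<in>A. \<forall>d\<in>A. \<forall>x\<in>overlap c d. \<forall>u w z.
        S d (transition c d x) (jac c d x u) (jac c d x w) (jac c d x z) = S c x u w z)"

section \<open>Lorentzian metrics\<close>

definition lorentzian_metric :: "('a, 'n::finite) chart set \<Rightarrow> ('a, 'n) form2 \<Rightarrow> bool" where
  "lorentzian_metric A g \<longleftrightarrow> tensor2 A g \<and>
     (\<forall>c\<in>A. \<forall>x\<in>img c. (\<forall>u w. g c x u w = g c x w u) \<and>
        (\<exists>(e :: 'n \<Rightarrow> real ^ 'n) k. \<forall>i j.
           g c x (e i) (e j) = (if i \<noteq> j then 0 else if i = k then -1 else 1)))"

definition lorentzian_manifold ::
    "'a topology \<Rightarrow> ('a, 'n::finite) chart set \<Rightarrow> ('a, 'n) form2 \<Rightarrow> bool" where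
  "lorentzian_manifold M A g \<longleftrightarrow> smooth_manifold M A \<and> lorentzian_metric A g"

definition gram ::
    "('a, 'n::finite) form2 \<Rightarrow> ('a, 'n) chart \<Rightarrow> real ^ 'n \<Rightarrow> real ^ 'n ^ 'n" where
  "gram g c x = (\<chi> i j. g c x (axis i 1) (axis j 1))"

definition ginv ::
    "('a, 'n::finite) form2 \<Rightarrow> ('a, 'n) chart \<Rightarrow> real ^ 'n \<Rightarrow> real ^ 'n ^ 'n" where
  "ginv g c x = matrix_inv (gram g c x)"

text \<open>\<open>sharp g c x \<alpha>\<close> is the vector \<open>w\<close> with \<open>g(w, z) = \<alpha>(z)\<close> for all \<open>z\<close>.\<close>

definition sharp ::
    "('a, 'n::finite) form2 \<Rightarrow> ('a, 'n) chart \<Rightarrow> real ^ 'n \<Rightarrow> (real ^ 'n \<Rightarrow> real) \<Rightarrow> real ^ 'n" where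
  "sharp g c x \<alpha> = ginv g c x *v (\<chi> i. \<alpha> (axis i 1))"

text \<open>The norms induced by \<open>g\<close>, from the full contraction of a tensor with itself.\<close>

definition gnorm2 ::
    "('a, 'n::finite) form2 \<Rightarrow> ('a, 'n) chart \<Rightarrow> real ^ 'n \<Rightarrow>
     (real ^ 'n \<Rightarrow> real ^ 'n \<Rightarrow> real) \<Rightarrow> real" where
  "gnorm2 g c x B = sqrt \<bar>\<Sum>i\<in>UNIV. \<Sum>j\<in>UNIV. \<Sum>k\<in>UNIV. \<Sum>l\<in>UNIV.
     ginv g c x $ i $ k * ginv g c x $ j $ l *
     B (axis i 1) (axis j 1) * B (axis k 1) (axis l 1)\<bar>"

definition gnorm3 ::
    "('a, 'n::finite) form2 \<Rightarrow> ('a, 'n) chart \<Rightarrow> real ^ 'n \<Rightarrow>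
     (real ^ 'n \<Rightarrow> real ^ 'n \<Rightarrow> real ^ 'n \<Rightarrow> real) \<Rightarrow> real" where
  "gnorm3 g c x B = sqrt \<bar>\<Sum>i\<in>UNIV. \<Sum>j\<in>UNIV. \<Sum>k\<in>UNIV. \<Sum>l\<in>UNIV. \<Sum>m\<in>UNIV. \<Sum>n\<in>UNIV.
     ginv g c x $ i $ l * ginv g c x $ j $ m * ginv g c x $ k $ n *
     B (axis i 1) (axis j 1) (axis k 1) * B (axis l 1) (axis m 1) (axis n 1)\<bar>"

text \<open>The Christoffel symbols, contracted with \<open>u\<close> and \<open>w\<close>: \<open>\<Gamma>(u, w)\<close> is characterised by
  \<open>g(\<Gamma>(u, w), z) = (\<partial>\<^sub>u g(w, z) + \<partial>\<^sub>w g(u, z) - \<partial>\<^sub>z g(u, w)) / 2\<close> for vectors with constant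
  components.\<close>

definition christoffel ::
    "('a, 'n::finite) form2 \<Rightarrow> ('a, 'n) chart \<Rightarrow> real ^ 'n \<Rightarrow> real ^ 'n \<Rightarrow> real ^ 'n \<Rightarrow> real ^ 'n" where
  "christoffel g c x u w = sharp g c x (\<lambda>z.
     (frechet_derivative (\<lambda>y. g c y w z) (at x) u
      + frechet_derivative (\<lambda>y. g c y u z) (at x) w
      - frechet_derivative (\<lambda>y. g c y u w) (at x) z) / 2)"

definition nabla_at ::
    "('a, 'n::finite) form2 \<Rightarrow> ('a, 'n) vfield \<Rightarrow> ('a, 'n) chart \<Rightarrow> real ^ 'n \<Rightarrow> real ^ 'n \<Rightarrow> real ^ 'n" where
  "nabla_at g Y c x u = frechet_derivative (Y c) (at x) u + christoffel g c x u (Y c x)"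

definition levi_civita ::
    "('a, 'n::finite) form2 \<Rightarrow> ('a, 'n) vfield \<Rightarrow> ('a, 'n) vfield \<Rightarrow> ('a, 'n) vfield" where
  "levi_civita g X Y = (\<lambda>c x. nabla_at g Y c x (X c x))"

section \<open>Metric connections and torsion\<close>

text \<open>The first clause says that \<open>D\<close> acts on vector fields rather than on their representing
  families, whose values off the chart images are arbitrary.\<close>

definition connection ::
    "('a, 'n::finite) chart set \<Rightarrow> (('a, 'n) vfield \<Rightarrow> ('a, 'n) vfield \<Rightarrow> ('a, 'n) vfield) \<Rightarrow> bool" where
  "connection A D \<longleftrightarrow>
     (\<forall>X X' Y Y'. vector_field A X \<and> vector_field A X' \<and> vector_field A Y \<and> vector_field A Y' \<and>
        field_eq A X X' \<and> field_eq A Y Y' \<longrightarrow> field_eq A (D X Y) (D X' Y')) \<and>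
     (\<forall>X Y. vector_field A X \<and> vector_field A Y \<longrightarrow> vector_field A (D X Y)) \<and>
     (\<forall>X X' Y. vector_field A X \<and> vector_field A X' \<and> vector_field A Y \<longrightarrow>
        field_eq A (D (fplus X X') Y) (fplus (D X Y) (D X' Y))) \<and>
     (\<forall>X Y Y'. vector_field A X \<and> vector_field A Y \<and> vector_field A Y' \<longrightarrow>
        field_eq A (D X (fplus Y Y')) (fplus (D X Y) (D X Y'))) \<and>
     (\<forall>f X Y. smooth_fun A f \<and> vector_field A X \<and> vector_field A Y \<longrightarrow>
        field_eq A (D (fscale f X) Y) (fscale f (D X Y)) \<and>
        field_eq A (D X (fscale f Y))
          (\<lambda>c x. frechet_derivative (f \<circ> param c) (at x) (X c x) *\<^sub>R Y c x + fscale f (D X Y) c x))"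

definition metric_connection ::
    "('a, 'n::finite) chart set \<Rightarrow> ('a, 'n) form2 \<Rightarrow>
     (('a, 'n) vfield \<Rightarrow> ('a, 'n) vfield \<Rightarrow> ('a, 'n) vfield) \<Rightarrow> bool" where
  "metric_connection A g D \<longleftrightarrow> connection A D \<and>
     (\<forall>X Y Z. vector_field A X \<and> vector_field A Y \<and> vector_field A Z \<longrightarrow>
        (\<forall>c\<in>A. \<forall>x\<in>img c.
           frechet_derivative (\<lambda>y. g c y (Y c y) (Z c y)) (at x) (X c x) =
           g c x (D X Y c x) (Z c x) + g c x (Y c x) (D X Z c x)))"

definition torsion ::
    "(('a, 'n::finite) vfield \<Rightarrow> ('a, 'n) vfield \<Rightarrow> ('a, 'n) vfield) \<Rightarrow>
     ('a, 'n) vfield \<Rightarrow> ('a, 'n) vfield \<Rightarrow> ('a, 'n) vfield" where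
  "torsion D X Y = fminus (fminus (D X Y) (D Y X)) (lie_bracket X Y)"

definition parallel_torsion ::
    "('a, 'n::finite) chart set \<Rightarrow>
     (('a, 'n) vfield \<Rightarrow> ('a, 'n) vfield \<Rightarrow> ('a, 'n) vfield) \<Rightarrow> bool" where
  "parallel_torsion A D \<longleftrightarrow>
     (\<forall>X Y Z. vector_field A X \<and> vector_field A Y \<and> vector_field A Z \<longrightarrow>
        field_eq A
          (fminus (fminus (D X (torsion D Y Z)) (torsion D (D X Y) Z)) (torsion D Y (D X Z)))
          (\<lambda>c x. 0))"

definition bivector ::
    "('a, 'n::finite) form2 \<Rightarrow> ('a, 'n) vfield \<Rightarrow> ('a, 'n) vfield \<Rightarrow> ('a, 'n) vfield \<Rightarrow> ('a, 'n) vfield" where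
  "bivector g X Y Z = (\<lambda>c x. g c x (X c x) (Z c x) *\<^sub>R Y c x - g c x (Y c x) (Z c x) *\<^sub>R X c x)"

definition form3_vec ::
    "('a, 'n::finite) form2 \<Rightarrow> ('a, 'n) form3 \<Rightarrow> ('a, 'n) vfield \<Rightarrow> ('a, 'n) vfield \<Rightarrow> ('a, 'n) vfield" where
  "form3_vec g S X Y = (\<lambda>c x. sharp g c x (S c x (X c x) (Y c x)))"

definition twistor_free_torsion ::
    "('a, 'n::finite) chart set \<Rightarrow> ('a, 'n) form2 \<Rightarrow>
     (('a, 'n) vfield \<Rightarrow> ('a, 'n) vfield \<Rightarrow> ('a, 'n) vfield) \<Rightarrow>
     ('a, 'n) vfield \<Rightarrow> ('a, 'n) form3 \<Rightarrow> bool" where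
  "twistor_free_torsion A g D \<xi> S \<longleftrightarrow>
     vector_field A \<xi> \<and> three_form A S \<and>
     (\<forall>X Y. vector_field A X \<and> vector_field A Y \<longrightarrow>
        field_eq A (D X Y)
          (\<lambda>c x. levi_civita g X Y c x + bivector g X \<xi> Y c x + (1/2) *\<^sub>R form3_vec g S X Y c x))"

definition isotropic ::
    "('a, 'n::finite) chart set \<Rightarrow> ('a, 'n) form2 \<Rightarrow> ('a, 'n) vfield \<Rightarrow> bool" where
  "isotropic A g p \<longleftrightarrow> vector_field A p \<and>
     (\<forall>c\<in>A. \<forall>x\<in>img c. p c x \<noteq> 0 \<and> g c x (p c x) (p c x) = 0)"

definition degenerate ::
    "('a, 'n::finite) chart set \<Rightarrow> ('a, 'n) form2 \<Rightarrow> ('a, 'n) form3 \<Rightarrow> bool" where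
  "degenerate A g S \<longleftrightarrow> (\<forall>c\<in>A. \<forall>x\<in>img c. gnorm3 g c x (S c x) = 0)"

section \<open>Kundt spaces\<close>

definition kundt_space ::
    "'a topology \<Rightarrow> ('a, 'n::finite) chart set \<Rightarrow> ('a, 'n) form2 \<Rightarrow> bool" where
  "kundt_space M A g \<longleftrightarrow> lorentzian_manifold M A g \<and>
     (\<exists>p. isotropic A g p \<and> field_eq A (levi_civita g p p) (\<lambda>c x. 0) \<and>
        (\<forall>c\<in>A. \<forall>x\<in>img c.
           let B = (\<lambda>u w. g c x (nabla_at g p c x u) w) in
           trace (matrix (nabla_at g p c x)) = 0 \<and>
           gnorm2 g c x (\<lambda>u w. (B u w + B w u) / 2) = 0 \<and>
           gnorm2 g c x (\<lambda>u w. (B u w - B w u) / 2) = 0))"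

section \<open>Orientation and volume form in dimension 3\<close>

text \<open>An orientation is given by a positively oriented, not necessarily maximal, subatlas.\<close>

definition orientation ::
    "'a topology \<Rightarrow> ('a, 'n::finite) chart set \<Rightarrow> ('a, 'n) chart set \<Rightarrow> bool" where
  "orientation M A Or \<longleftrightarrow> Or \<subseteq> A \<and> (\<Union>c\<in>Or. fst c) = topspace M \<and>
     (\<forall>c\<in>Or. \<forall>d\<in>Or. \<forall>x\<in>overlap c d. det (matrix (jac c d x)) > 0)"

definition volume_form ::
    "('a, 3) chart set \<Rightarrow> ('a, 3) form2 \<Rightarrow> ('a, 3) chart set \<Rightarrow> ('a, 3) form3 \<Rightarrow> bool" where
  "volume_form A g Or V \<longleftrightarrow> three_form A V \<and>
     (\<forall>c\<in>Or. \<forall>x\<in>img c. \<forall>u w z.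
        V c x u w z = sqrt \<bar>det (gram g c x)\<bar> * det (vector [u, w, z] :: real ^ 3 ^ 3))"

definition adapted_isotropic ::
    "('a, 3) chart set \<Rightarrow> ('a, 3) form2 \<Rightarrow> ('a, 3) chart set \<Rightarrow> real \<Rightarrow> ('a, 3) vfield \<Rightarrow> bool" where
  "adapted_isotropic A g Or a p \<longleftrightarrow> isotropic A g p \<and>
     (\<exists>V. volume_form A g Or V \<and>
        (let S = (\<lambda>c x u w z. a * V c x u w z) in
         \<forall>X. vector_field A X \<longrightarrow>
           field_eq A (levi_civita g X p)
             (\<lambda>c x. - g c x (X c x) (p c x) *\<^sub>R p c x - (1/2) *\<^sub>R form3_vec g S X p c x)))"

section \<open>The local normal form\<close>

text \<open>Coordinates \<open>(v, x, u) = (y $ 1, y $ 2, y $ 3)\<close>; products of differentials in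
  \<open>2 dv du + 2 a v dx du + (dx)\<^sup>2 + (- 2 v exp(- a x) + C(x, u)) (du)\<^sup>2\<close> are symmetric products,
  so that \<open>2 dv du\<close> is the bilinear form \<open>dv \<otimes> du + du \<otimes> dv\<close>.\<close>

definition normal_metric ::
    "real \<Rightarrow> (real \<times> real \<Rightarrow> real) \<Rightarrow> real ^ 3 \<Rightarrow> real ^ 3 \<Rightarrow> real ^ 3 \<Rightarrow> real" where
  "normal_metric a C y s t =
     (s $ 1 * t $ 3 + s $ 3 * t $ 1)
     + a * y $ 1 * (s $ 2 * t $ 3 + s $ 3 * t $ 2)
     + s $ 2 * t $ 2
     + (- 2 * y $ 1 * exp (- a * y $ 2) + C (y $ 2, y $ 3)) * (s $ 3 * t $ 3)"

definition normal_null_field :: "real \<Rightarrow> real ^ 3 \<Rightarrow> real ^ 3" where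
  "normal_null_field a y = exp (- a * y $ 2) *\<^sub>R axis 1 1"

definition proj_xu :: "(real ^ 3) set \<Rightarrow> (real \<times> real) set" where
  "proj_xu W = (\<lambda>y. (y $ 2, y $ 3)) ` W"

end

(* If D_X Y = nabla^g_X Y + g(X, Y) p - g(p, Y) X + S(X, Y)/2 has parallel torsion, then evaluating
   the torsion on an orthonormal frame gives Dp = 0 and DS = 0 separately; since p is null, Dp = 0 is
   the stated equation for nabla^g p. In dimension three S(Y) S(Z) = kappa det g(Y_i, Z_j)
   for a function kappa, which is constant because S and g are D-parallel, and negative because S is
   non-degenerate and g is Lorentzian; hence S is nowhere zero, orients M, and is a multiple of the
   volume form. Conversely the volume form is parallel for every metric connection, by the same
   identity with kappa = -1.

   Normal form: the symmetric part of the equation makes the metric dual g(p, .) constant along p in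
   a chart with p = d/dy1, so its kernel and the coefficient F of g(p, .) = F dy3 descend to the
   (y2, y3)-plane, where a second flow box straightens the kernel. The skew part gives
   d_2 F = +- a F sqrt(g_22), so x = -ln|F| / a is a coordinate along the kernel; the coordinate v is
   |F| (y1 + mu), where mu is an antiderivative chosen so that g(d_x, d_u) = a v. The v-dependence of
   g(d_u, d_u) is then forced by the symmetric part of the equation.

   In the model the orientation is the one for which (d_v, d_x, d_u) is negative. *)

theory Submission
  imports Defs "HOL-Analysis.Analysis"
begin

text \<open>Two obstacles shape the argument. Connections act on fields defined on all of
  \<open>M\<close>, so a pointwise identity is reached only after tangent vectors have been extended
  to global fields by a cutoff; and a flow box requires the flow to depend smoothly on its initial
  value. The latter is the reason for the calculus of families: in an integral equation the
  integration variable enters continuously and the parameters smoothly. Tensors are families of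
  coordinate expressions, so the chart independence of the Levi-Civita derivative has to be proved,
  and the Koszul formula gives it.

  No orientation is available until \<open>S\<close> is known to be nowhere zero. Therefore
  \<open>S\<close> enters through kappa, which is quadratic in \<open>S\<close> and blind to
  orientation; one differentiated identity yields both the constancy of kappa from DS = 0 and DS = 0
  from the constancy of kappa.

  In the normal form the sign of the derivative of x along the kernel is left open: only its square,
  and the fact that it is not 0, enter the comparison with the metric. Hence the charts used there
  need not belong to the orientation.\<close>

section \<open>Calculus of parametrised families of class C^k\<close>

text \<open>The parameter \<open>s\<close> enters continuously and derivatives are taken in
  \<open>z\<close> alone, all of them jointly continuous. This is the regularity of solutions of
  integral equations, where \<open>s\<close> is the integration variable. Joint continuity reappears
  in the \<open>Suc\<close> clause because differentiability in \<open>z\<close> at each fixed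
  \<open>s\<close> does not control the dependence on \<open>s\<close>.\<close>

fun Ck_family :: "nat \<Rightarrow> 's::topological_space set \<Rightarrow> 'a::real_normed_vector set \<Rightarrow>
    ('s \<Rightarrow> 'a \<Rightarrow> 'b::real_normed_vector) \<Rightarrow> bool" where
  "Ck_family 0 T S G \<longleftrightarrow> continuous_on (T \<times> S) (\<lambda>(s, z). G s z)"
| "Ck_family (Suc k) T S G \<longleftrightarrow> continuous_on (T \<times> S) (\<lambda>(s, z). G s z) \<and>
     (\<forall>s\<in>T. \<forall>z\<in>S. G s differentiable (at z)) \<and>
     (\<forall>v. Ck_family k T S (\<lambda>s z. frechet_derivative (G s) (at z) v))"

lemma Ck_family_continuous:
  "Ck_family k T S G \<Longrightarrow> continuous_on (T \<times> S) (\<lambda>(s, z). G s z)"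
  by (cases k) auto

lemma frechet_derivative_cong_open:
  assumes "open S" "x \<in> S" "\<And>y. y \<in> S \<Longrightarrow> f y = g y"
  shows "frechet_derivative f (at x) = frechet_derivative g (at x)"
proof -
  have "(f has_derivative D) (at x) \<longleftrightarrow> (g has_derivative D) (at x)" for D
  proof
    show "(g has_derivative D) (at x)" if "(f has_derivative D) (at x)"
      by (rule has_derivative_transform_within_open[OF that assms])
    show "(f has_derivative D) (at x)" if "(g has_derivative D) (at x)"
      by (rule has_derivative_transform_within_open[OF that assms(1,2)]) (simp add: assms(3))
  qed
  then show ?thesis
    by (simp add: frechet_derivative_def)
qed

lemma differentiable_cong_open:
  assumes "open S" "x \<in> S" "\<And>y. y \<in> S \<Longrightarrow> f y = g y" "f differentiable (at x)"
  shows "g differentiable (at x)"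
proof -
  obtain D where "(f has_derivative D) (at x)"
    using assms(4) by (auto simp: differentiable_def)
  then have "(g has_derivative D) (at x)"
    by (rule has_derivative_transform_within_open[OF _ assms(1-3)])
  then show ?thesis
    by (auto simp: differentiable_def)
qed

lemma Ck_family_cong:
  assumes "open S" "\<And>s z. s \<in> T \<Longrightarrow> z \<in> S \<Longrightarrow> G s z = H s z" "Ck_family k T S G"
  shows "Ck_family k T S H"
  using assms(2,3)
proof (induction k arbitrary: G H)
  case 0
  then show ?case
    by (auto intro: continuous_on_eq[of "T \<times> S" "\<lambda>(s, z). G s z"])
next
  case (Suc k)
  have "continuous_on (T \<times> S) (\<lambda>(s, z). H s z)"
    using Suc.prems by (auto intro: continuous_on_eq[of "T \<times> S" "\<lambda>(s, z). G s z"])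
  moreover have "H s differentiable (at z)" if "s \<in> T" "z \<in> S" for s z
    using Suc.prems that differentiable_cong_open[OF assms(1) that(2), of "G s" "H s"] by auto
  moreover have "Ck_family k T S (\<lambda>s z. frechet_derivative (H s) (at z) v)" for v
  proof (rule Suc.IH)
    show "Ck_family k T S (\<lambda>s z. frechet_derivative (G s) (at z) v)"
      using Suc.prems by simp
    show "frechet_derivative (G s) (at z) v = frechet_derivative (H s) (at z) v" if "s \<in> T" "z \<in> S" for s z
      using frechet_derivative_cong_open[OF assms(1) that(2), of "G s" "H s"] Suc.prems that by simp
  qed
  ultimately show ?case by simp
qed

lemma Ck_family_SucI:
  assumes "open S" "continuous_on (T \<times> S) (\<lambda>(s, z). G s z)"
    and "\<And>s z. s \<in> T \<Longrightarrow> z \<in> S \<Longrightarrow> (G s has_derivative G' s z) (at z)"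
    and "\<And>v. Ck_family k T S (\<lambda>s z. G' s z v)"
  shows "Ck_family (Suc k) T S G"
proof -
  have "frechet_derivative (G s) (at z) = G' s z" if "s \<in> T" "z \<in> S" for s z
    using assms(3)[OF that] by (metis frechet_derivative_at)
  then have "Ck_family k T S (\<lambda>s z. frechet_derivative (G s) (at z) v)" for v
    using Ck_family_cong[OF assms(1) _ assms(4)[of v], of "\<lambda>s z. frechet_derivative (G s) (at z) v"]
    by simp
  then show ?thesis
    using assms by (auto simp: differentiable_def)
qed

lemma Ck_family_SucD:
  assumes "Ck_family (Suc k) T S G"
  shows "s \<in> T \<Longrightarrow> z \<in> S \<Longrightarrow> (G s has_derivative frechet_derivative (G s) (at z)) (at z)"
    and "Ck_family k T S (\<lambda>s z. frechet_derivative (G s) (at z) v)"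
  using assms by (auto simp: frechet_derivative_works)

lemma Ck_family_lower: "Ck_family (Suc k) T S G \<Longrightarrow> Ck_family k T S G"
  by (induction k arbitrary: G) auto

lemma Ck_family_mono: "Ck_family k T S G \<Longrightarrow> j \<le> k \<Longrightarrow> Ck_family j T S G"
  by (induction k) (auto simp: le_Suc_eq simp del: Ck_family.simps dest: Ck_family_lower)

lemma Ck_family_subset:
  "Ck_family k T S G \<Longrightarrow> T' \<subseteq> T \<Longrightarrow> S' \<subseteq> S \<Longrightarrow> Ck_family k T' S' G"
proof (induction k arbitrary: G)
  case 0
  then show ?case
    by (auto elim!: continuous_on_subset)
next
  case (Suc k)
  from Suc.prems have "T' \<times> S' \<subseteq> T \<times> S" by auto
  then have "continuous_on (T' \<times> S') (\<lambda>(s, z). G s z)"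
    using Suc.prems(1) continuous_on_subset by (metis Ck_family.simps(2))
  moreover have "\<forall>s\<in>T'. \<forall>z\<in>S'. G s differentiable (at z)"
    using Suc.prems by (meson Ck_family.simps(2) subsetD)
  ultimately show ?case using Suc by auto
qed

lemma Ck_family_param:
  assumes "continuous_on T c"
  shows "Ck_family k T S (\<lambda>s z. c s)"
  using assms
proof (induction k arbitrary: c)
  case 0
  then show ?case
    by (auto simp: case_prod_unfold intro!: continuous_intros continuous_on_compose2[OF 0])
next
  case (Suc k)
  then show ?case
    by (auto simp: case_prod_unfold intro!: continuous_intros continuous_on_compose2[OF Suc.prems])
qed

lemma Ck_family_const [simp]: "Ck_family k T S (\<lambda>s z. c)"
  by (rule Ck_family_param) auto

lemma Ck_family_bounded_linear:
  assumes "open S" "bounded_linear L" "Ck_family k T S G"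
  shows "Ck_family k T S (\<lambda>s z. L (G s z))"
  using assms(3)
proof (induction k arbitrary: G)
  case 0
  then show ?case
    using bounded_linear.continuous_on[OF assms(2)] by (simp add: case_prod_unfold)
next
  case (Suc k)
  show ?case
  proof (rule Ck_family_SucI[OF assms(1), where G' = "\<lambda>s z v. L (frechet_derivative (G s) (at z) v)"])
    show "continuous_on (T \<times> S) (\<lambda>(s, z). L (G s z))"
      using bounded_linear.continuous_on[OF assms(2)] Ck_family_continuous[OF Suc.prems]
      by (simp add: case_prod_unfold)
    show "((\<lambda>z. L (G s z)) has_derivative (\<lambda>v. L (frechet_derivative (G s) (at z) v))) (at z)"
      if "s \<in> T" "z \<in> S" for s z
      using bounded_linear.has_derivative[OF assms(2) Ck_family_SucD(1)[OF Suc.prems that]] .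
    show "Ck_family k T S (\<lambda>s z. L (frechet_derivative (G s) (at z) v))" for v
      using Suc.IH[OF Ck_family_SucD(2)[OF Suc.prems]] .
  qed
qed

lemma Ck_family_id: "open S \<Longrightarrow> Ck_family k T S (\<lambda>s z. z)"
proof (cases k)
  case 0
  then show ?thesis by (auto simp: case_prod_unfold intro!: continuous_intros)
next
  case (Suc j)
  assume "open S"
  then show ?thesis unfolding Suc
    by (rule Ck_family_SucI[where G' = "\<lambda>s z v. v"])
      (auto simp: case_prod_unfold intro!: continuous_intros)
qed

lemma Ck_family_add:
  assumes "open S" "Ck_family k T S G" "Ck_family k T S H"
  shows "Ck_family k T S (\<lambda>s z. G s z + H s z)"
  using assms(2,3)
proof (induction k arbitrary: G H)
  case 0
  then show ?case
    by (auto simp: case_prod_unfold intro!: continuous_intros)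
next
  case (Suc k)
  show ?case
  proof (rule Ck_family_SucI[OF assms(1), where
        G' = "\<lambda>s z v. frechet_derivative (G s) (at z) v + frechet_derivative (H s) (at z) v"])
    show "continuous_on (T \<times> S) (\<lambda>(s, z). G s z + H s z)"
      using Suc.prems[THEN Ck_family_continuous]
      by (auto simp: case_prod_unfold intro!: continuous_intros)
  qed (auto intro!: Suc.IH has_derivative_add Ck_family_SucD(1)[OF Suc.prems(1)] Ck_family_SucD(1)[OF Suc.prems(2)]
       Ck_family_SucD(2)[OF Suc.prems(1)] Ck_family_SucD(2)[OF Suc.prems(2)])
qed

lemma Ck_family_sum:
  assumes "open S" "\<And>i. i \<in> I \<Longrightarrow> Ck_family k T S (G i)"
  shows "Ck_family k T S (\<lambda>s z. \<Sum>i\<in>I. G i s z)"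
  using assms(2)
  by (induction I rule: infinite_finite_induct) (auto intro!: Ck_family_add[OF assms(1)])

lemma Ck_family_bilinear:
  assumes "open S" "bounded_bilinear m" "Ck_family k T S G" "Ck_family k T S H"
  shows "Ck_family k T S (\<lambda>s z. m (G s z) (H s z))"
  using assms(3,4)
proof (induction k arbitrary: G H)
  case 0
  then show ?case
    using bounded_bilinear.continuous_on[OF assms(2)] by (auto simp: case_prod_unfold)
next
  case (Suc k)
  show ?case
  proof (rule Ck_family_SucI[OF assms(1), where
        G' = "\<lambda>s z v. m (G s z) (frechet_derivative (H s) (at z) v)
                    + m (frechet_derivative (G s) (at z) v) (H s z)"])
    show "continuous_on (T \<times> S) (\<lambda>(s, z). m (G s z) (H s z))"
      using Suc.prems[THEN Ck_family_continuous] bounded_bilinear.continuous_on[OF assms(2)]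
      by (auto simp: case_prod_unfold)
    show "((\<lambda>z. m (G s z) (H s z)) has_derivative (\<lambda>v. m (G s z) (frechet_derivative (H s) (at z) v)
                    + m (frechet_derivative (G s) (at z) v) (H s z))) (at z)"
      if "s \<in> T" "z \<in> S" for s z
      using bounded_bilinear.FDERIV[OF assms(2) Ck_family_SucD(1)[OF Suc.prems(1) that]
          Ck_family_SucD(1)[OF Suc.prems(2) that]] .
    show "Ck_family k T S (\<lambda>s z. m (G s z) (frechet_derivative (H s) (at z) v)
                    + m (frechet_derivative (G s) (at z) v) (H s z))" for v
      by (intro Ck_family_add[OF assms(1)] Suc.IH Ck_family_lower[OF Suc.prems(1)]
          Ck_family_lower[OF Suc.prems(2)] Ck_family_SucD(2)[OF Suc.prems(1)] Ck_family_SucD(2)[OF Suc.prems(2)])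
  qed
qed

lemma linear_basis_expansion:
  fixes L :: "'a::euclidean_space \<Rightarrow> 'b::real_vector"
  assumes "linear L"
  shows "L v = (\<Sum>i\<in>Basis. (v \<bullet> i) *\<^sub>R L i)"
proof -
  have "L v = L (\<Sum>i\<in>Basis. (v \<bullet> i) *\<^sub>R i)"
    by (simp add: euclidean_representation)
  also have "\<dots> = (\<Sum>i\<in>Basis. (v \<bullet> i) *\<^sub>R L i)"
    by (simp add: linear_sum[OF assms] linear_scale[OF assms] o_def)
  finally show ?thesis .
qed

lemma continuous_on_family_compose:
  assumes "continuous_on (T \<times> S') (\<lambda>(s, z). G s z)" "continuous_on (T \<times> S) (\<lambda>(s, z). H s z)"
    and "\<And>s z. s \<in> T \<Longrightarrow> z \<in> S \<Longrightarrow> H s z \<in> S'"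
  shows "continuous_on (T \<times> S) (\<lambda>(s, z). G s (H s z))"
proof -
  have "continuous_on (T \<times> S) (\<lambda>x. (fst x, H (fst x) (snd x)))"
    using assms(2) by (intro continuous_on_Pair continuous_on_fst continuous_on_id) (simp add: case_prod_unfold)
  then have "continuous_on (T \<times> S) (\<lambda>x. (\<lambda>(s, z). G s z) (fst x, H (fst x) (snd x)))"
    by (rule continuous_on_compose2[OF assms(1)]) (use assms(3) in auto)
  then show ?thesis
    by (simp add: case_prod_unfold)
qed

text \<open>By the chain rule the derivative of \<open>G s\<close> is taken in a direction that
  varies with \<open>z\<close>, while the derivatives of a family are controlled for fixed
  directions. Expanding the direction in \<open>Basis\<close> leaves sums of products of families to
  which the induction applies.\<close>

lemma Ck_family_compose:
  fixes H :: "'s::topological_space \<Rightarrow> 'a::real_normed_vector \<Rightarrow> 'c::euclidean_space"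
  assumes "open S" "open S'" "Ck_family k T S' G" "Ck_family k T S H"
    and "\<And>s z. s \<in> T \<Longrightarrow> z \<in> S \<Longrightarrow> H s z \<in> S'"
  shows "Ck_family k T S (\<lambda>s z. G s (H s z))"
  using assms(3,4)
proof (induction k arbitrary: G)
  case 0
  then show ?case
    using continuous_on_family_compose[OF _ _ assms(5)] by simp
next
  case (Suc k)
  let ?G' = "\<lambda>s z v. \<Sum>i\<in>Basis. (frechet_derivative (H s) (at z) v \<bullet> i) *\<^sub>R
                frechet_derivative (G s) (at (H s z)) i"
  show ?case
  proof (rule Ck_family_SucI[OF assms(1), where G' = ?G'])
    show "continuous_on (T \<times> S) (\<lambda>(s, z). G s (H s z))"
      by (rule continuous_on_family_compose[OF Ck_family_continuous[OF Suc.prems(1)]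
            Ck_family_continuous[OF Suc.prems(2)] assms(5)])
  next
    fix s z assume sz: "s \<in> T" "z \<in> S"
    have d: "(G s has_derivative frechet_derivative (G s) (at (H s z))) (at (H s z))"
      using Ck_family_SucD(1)[OF Suc.prems(1) sz(1) assms(5)[OF sz]] .
    have "((\<lambda>z. G s (H s z)) has_derivative (\<lambda>v. frechet_derivative (G s) (at (H s z))
        (frechet_derivative (H s) (at z) v))) (at z)"
      using has_derivative_compose[OF Ck_family_SucD(1)[OF Suc.prems(2) sz] d] .
    moreover have "(\<lambda>v. frechet_derivative (G s) (at (H s z)) (frechet_derivative (H s) (at z) v)) = ?G' s z"
      by (rule ext, rule linear_basis_expansion) (rule has_derivative_linear[OF d])
    ultimately show "((\<lambda>z. G s (H s z)) has_derivative ?G' s z) (at z)"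
      by simp
  next
    fix v
    show "Ck_family k T S (\<lambda>s z. ?G' s z v)"
    proof (intro Ck_family_sum[OF assms(1)] Ck_family_bilinear[OF assms(1) bounded_bilinear_scaleR]
        Ck_family_bounded_linear[OF assms(1) bounded_linear_inner_left] Ck_family_SucD(2)[OF Suc.prems(2)])
      fix i :: 'c
      show "Ck_family k T S (\<lambda>s z. frechet_derivative (G s) (at (H s z)) i)"
        by (rule Suc.IH[OF Ck_family_SucD(2)[OF Suc.prems(1)] Ck_family_lower[OF Suc.prems(2)]])
    qed
  qed
qed

lemma Ck_family_of_times_differentiable:
  "times_differentiable_on k S f \<Longrightarrow> Ck_family k T S (\<lambda>s. f)"
proof (induction k arbitrary: f)
  case 0
  then have "continuous_on (T \<times> S) (\<lambda>x. f (snd x))"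
    by (intro continuous_on_compose2[of S f _ snd] continuous_on_snd continuous_on_id) auto
  then show ?case
    by (simp add: case_prod_unfold)
next
  case (Suc k)
  have "continuous_on S f"
    using Suc.prems by (auto intro!: continuous_at_imp_continuous_on differentiable_imp_continuous_within)
  then have "continuous_on (T \<times> S) (\<lambda>x. f (snd x))"
    by (intro continuous_on_compose2[of S f _ snd] continuous_on_snd continuous_on_id) auto
  moreover have "Ck_family k T S (\<lambda>s z. frechet_derivative f (at z) v)" for v
    by (rule Suc.IH) (use Suc.prems in simp)
  ultimately show ?case
    using Suc.prems by (simp add: case_prod_unfold)
qed

lemma times_differentiable_of_Ck_family:
  assumes "t \<in> T" "Ck_family k T S f"
  shows "times_differentiable_on k S (f t)"
  using assms(2)
proof (induction k arbitrary: f)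
  case 0
  have "continuous_on S (\<lambda>z. (\<lambda>(s, z). f s z) (t, z))"
    by (rule continuous_on_compose2[of "T \<times> S"])
      (use 0 assms(1) in \<open>auto intro!: continuous_intros\<close>)
  then show ?case by simp
next
  case (Suc k)
  have "times_differentiable_on k S (\<lambda>x. frechet_derivative (f t) (at x) v)" for v
    using Suc.IH[OF Ck_family_SucD(2)[OF Suc.prems]] .
  moreover have "f t differentiable (at z)" if "z \<in> S" for z
    using Ck_family_SucD(1)[OF Suc.prems assms(1) that] by (auto simp: differentiable_def)
  ultimately show ?case
    by simp
qed

definition smooth_family :: "'s::topological_space set \<Rightarrow> 'a::real_normed_vector set \<Rightarrow>
    ('s \<Rightarrow> 'a \<Rightarrow> 'b::real_normed_vector) \<Rightarrow> bool" where
  "smooth_family T S G \<longleftrightarrow> (\<forall>k. Ck_family k T S G)"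

text \<open>Over a one-point parameter set joint continuity is continuity in \<open>z\<close>, so
  the rules for smooth maps below are the family rules read at a constant family.\<close>

lemma smooth_on_iff_family: "smooth_on S f \<longleftrightarrow> smooth_family {0::real} S (\<lambda>s. f)"
proof -
  have "times_differentiable_on k S f" if "Ck_family k {0::real} S (\<lambda>s. f)" for k
    using times_differentiable_of_Ck_family[OF singletonI that] .
  then show ?thesis
    unfolding smooth_on_def smooth_family_def using Ck_family_of_times_differentiable by metis
qed

lemma smooth_family_of_smooth_on: "smooth_on S f \<Longrightarrow> smooth_family T S (\<lambda>s. f)"
  unfolding smooth_on_def smooth_family_def
  by (intro allI) (rule Ck_family_of_times_differentiable, simp)

lemma smooth_on_of_family: "smooth_family T S f \<Longrightarrow> t \<in> T \<Longrightarrow> smooth_on S (f t)"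
  unfolding smooth_on_def smooth_family_def
  by (meson times_differentiable_of_Ck_family)

section \<open>Smooth maps\<close>

lemma smooth_on_cong: "open S \<Longrightarrow> smooth_on S f \<Longrightarrow> (\<And>x. x \<in> S \<Longrightarrow> f x = g x) \<Longrightarrow> smooth_on S g"
  unfolding smooth_on_iff_family smooth_family_def
  by (intro allI Ck_family_cong[of S "{0::real}" "\<lambda>s. f" "\<lambda>s. g"]) auto

lemma smooth_on_subset: "smooth_on S f \<Longrightarrow> S' \<subseteq> S \<Longrightarrow> smooth_on S' f"
  unfolding smooth_on_iff_family smooth_family_def
  by (intro allI, rule Ck_family_subset[of _ "{0::real}" S "\<lambda>s. f"]) auto

lemma smooth_on_has_derivative:
  "smooth_on S f \<Longrightarrow> x \<in> S \<Longrightarrow> (f has_derivative frechet_derivative f (at x)) (at x)"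
  unfolding smooth_on_def by (metis frechet_derivative_works times_differentiable_on.simps(2))

lemma smooth_on_derivative: "smooth_on S f \<Longrightarrow> smooth_on S (\<lambda>x. frechet_derivative f (at x) v)"
  unfolding smooth_on_def by (metis times_differentiable_on.simps(2))

lemma smooth_on_imp_continuous_on: "smooth_on S f \<Longrightarrow> continuous_on S f"
  unfolding smooth_on_def by (metis times_differentiable_on.simps(1))

lemma smooth_on_const [simp]: "smooth_on S (\<lambda>x. c)"
  unfolding smooth_on_iff_family smooth_family_def by simp

lemma smooth_on_id: "open S \<Longrightarrow> smooth_on S (\<lambda>x. x)"
  unfolding smooth_on_iff_family smooth_family_def
  by (simp add: Ck_family_id)

lemma smooth_on_bounded_linear:
  "open S \<Longrightarrow> bounded_linear L \<Longrightarrow> smooth_on S f \<Longrightarrow> smooth_on S (\<lambda>x. L (f x))"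
  unfolding smooth_on_iff_family smooth_family_def
  by (intro allI Ck_family_bounded_linear[of S L _ "{0::real}" "\<lambda>s. f"]) auto

lemma smooth_on_linear:
  fixes L :: "'a::euclidean_space \<Rightarrow> 'b::real_normed_vector"
  shows "open S \<Longrightarrow> linear L \<Longrightarrow> smooth_on S L"
  using smooth_on_bounded_linear[OF _ _ smooth_on_id] linear_conv_bounded_linear by blast

lemma smooth_on_add:
  "open S \<Longrightarrow> smooth_on S f \<Longrightarrow> smooth_on S g \<Longrightarrow> smooth_on S (\<lambda>x. f x + g x)"
  unfolding smooth_on_iff_family smooth_family_def
  by (intro allI Ck_family_add[of S _ "{0::real}" "\<lambda>s. f" "\<lambda>s. g"]) auto

lemma smooth_on_sum:
  "open S \<Longrightarrow> (\<And>i. i \<in> I \<Longrightarrow> smooth_on S (f i)) \<Longrightarrow> smooth_on S (\<lambda>x. \<Sum>i\<in>I. f i x)"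
  unfolding smooth_on_iff_family smooth_family_def
  by (intro allI Ck_family_sum[of S I _ "{0::real}" "\<lambda>i s. f i"]) auto

lemma smooth_on_bilinear:
  "open S \<Longrightarrow> bounded_bilinear m \<Longrightarrow> smooth_on S f \<Longrightarrow> smooth_on S g \<Longrightarrow> smooth_on S (\<lambda>x. m (f x) (g x))"
  unfolding smooth_on_iff_family smooth_family_def
  by (intro allI Ck_family_bilinear[of S m _ "{0::real}" "\<lambda>s. f" "\<lambda>s. g"]) auto

lemma smooth_on_compose:
  fixes f :: "'a::real_normed_vector \<Rightarrow> 'c::euclidean_space"
  shows "open S \<Longrightarrow> open S' \<Longrightarrow> smooth_on S' g \<Longrightarrow> smooth_on S f \<Longrightarrow> (\<And>x. x \<in> S \<Longrightarrow> f x \<in> S') \<Longrightarrow>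
    smooth_on S (\<lambda>x. g (f x))"
  unfolding smooth_on_iff_family smooth_family_def
  by (intro allI Ck_family_compose[of S S' _ "{0::real}" "\<lambda>s. g" "\<lambda>s. f"]) auto

lemma smooth_on_uminus: "open S \<Longrightarrow> smooth_on S f \<Longrightarrow> smooth_on S (\<lambda>x. - f x)"
  by (rule smooth_on_bounded_linear[OF _ bounded_linear_minus[OF bounded_linear_ident]])

lemma smooth_on_diff:
  "open S \<Longrightarrow> smooth_on S f \<Longrightarrow> smooth_on S g \<Longrightarrow> smooth_on S (\<lambda>x. f x - g x)"
  using smooth_on_add[of S f "\<lambda>x. - g x"] smooth_on_uminus[of S g] by simp

lemma smooth_on_mult:
  fixes f g :: "'a::real_normed_vector \<Rightarrow> real"
  shows "open S \<Longrightarrow> smooth_on S f \<Longrightarrow> smooth_on S g \<Longrightarrow> smooth_on S (\<lambda>x. f x * g x)"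
  by (rule smooth_on_bilinear[OF _ bounded_bilinear_mult])

lemma smooth_on_scaleR:
  "open S \<Longrightarrow> smooth_on S f \<Longrightarrow> smooth_on S g \<Longrightarrow> smooth_on S (\<lambda>x. f x *\<^sub>R g x)"
  by (rule smooth_on_bilinear[OF _ bounded_bilinear_scaleR])

lemma smooth_on_vec_nth: "open S \<Longrightarrow> smooth_on S f \<Longrightarrow> smooth_on S (\<lambda>x. f x $ i)"
  by (rule smooth_on_bounded_linear[OF _ bounded_linear_vec_nth])

lemma smooth_on_vec_lambda:
  fixes f :: "'n::finite \<Rightarrow> 'a::real_normed_vector \<Rightarrow> real"
  assumes "open S" "\<And>i. smooth_on S (f i)"
  shows "smooth_on S (\<lambda>x. \<chi> i. f i x)"
proof -
  have "(\<chi> i. f i x) = (\<Sum>i\<in>UNIV. f i x *\<^sub>R axis i (1::real))" for x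
    by (simp add: vec_eq_iff axis_def sum.delta' if_distrib cong: if_cong)
  then show ?thesis
    by (simp only:) (intro smooth_on_sum smooth_on_scaleR assms smooth_on_const)
qed

lemma smooth_on_Pair:
  fixes f :: "'a::real_normed_vector \<Rightarrow> 'b::real_normed_vector" and g :: "'a \<Rightarrow> 'c::real_normed_vector"
  assumes "open S" "smooth_on S f" "smooth_on S g"
  shows "smooth_on S (\<lambda>x. (f x, g x))"
proof -
  have "smooth_on S (\<lambda>x. (f x, 0 :: 'c))"
    by (rule smooth_on_bounded_linear[OF assms(1) _ assms(2)])
      (simp add: bounded_linear_Pair bounded_linear_ident bounded_linear_zero)
  moreover have "smooth_on S (\<lambda>x. (0 :: 'b, g x))"
    by (rule smooth_on_bounded_linear[OF assms(1) _ assms(3)])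
      (simp add: bounded_linear_Pair bounded_linear_ident bounded_linear_zero)
  ultimately have "smooth_on S (\<lambda>x. (f x, 0) + (0, g x))"
    by (rule smooth_on_add[OF assms(1)])
  then show ?thesis by simp
qed

lemma smooth_on_inner_left: "open S \<Longrightarrow> smooth_on S f \<Longrightarrow> smooth_on S (\<lambda>x. f x \<bullet> i)"
  by (rule smooth_on_bounded_linear[OF _ bounded_linear_inner_left])

lemma smooth_on_fst: "open S \<Longrightarrow> smooth_on S f \<Longrightarrow> smooth_on S (\<lambda>x. fst (f x))"
  by (rule smooth_on_bounded_linear[OF _ bounded_linear_fst])

lemma smooth_on_snd: "open S \<Longrightarrow> smooth_on S f \<Longrightarrow> smooth_on S (\<lambda>x. snd (f x))"
  by (rule smooth_on_bounded_linear[OF _ bounded_linear_snd])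

lemma smooth_on_derivative_apply:
  fixes f :: "'a::euclidean_space \<Rightarrow> 'b::real_normed_vector"
  assumes "open S" "smooth_on S f" "smooth_on S v"
  shows "smooth_on S (\<lambda>x. frechet_derivative f (at x) (v x))"
proof (rule smooth_on_cong[OF assms(1)])
  show "smooth_on S (\<lambda>x. \<Sum>i\<in>Basis. (v x \<bullet> i) *\<^sub>R frechet_derivative f (at x) i)"
    by (intro smooth_on_sum smooth_on_scaleR smooth_on_derivative smooth_on_inner_left assms)
  show "(\<Sum>i\<in>Basis. (v x \<bullet> i) *\<^sub>R frechet_derivative f (at x) i) = frechet_derivative f (at x) (v x)"
    if "x \<in> S" for x
    by (rule linear_basis_expansion[OF has_derivative_linear[OF smooth_on_has_derivative[OF assms(2) that]], symmetric])
qed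

text \<open>Induction on the order: differentiability at a point is seen on a neighbourhood, and the
  derivatives inherit the local hypothesis. It serves maps defined by cases, whose formulas are
  smooth on different open sets.\<close>

lemma smooth_on_local:
  assumes "open S" "\<And>x. x \<in> S \<Longrightarrow> \<exists>U. open U \<and> x \<in> U \<and> smooth_on (U \<inter> S) f"
  shows "smooth_on S f"
  unfolding smooth_on_def
proof
  fix k
  have "\<forall>x\<in>S. \<exists>U. open U \<and> x \<in> U \<and> times_differentiable_on k (U \<inter> S) f"
    using assms(2) unfolding smooth_on_def by meson
  then show "times_differentiable_on k S f"
  proof (induction k arbitrary: f)
    case 0
    then have "\<forall>x\<in>S. \<exists>U. open U \<and> x \<in> U \<and> continuous_on (U \<inter> S) f" by simp
    then have "continuous (at x) f" if "x \<in> S" for x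
      using that assms(1) by (metis IntI continuous_on_eq_continuous_at open_Int)
    then show ?case
      by (simp add: continuous_at_imp_continuous_on)
  next
    case (Suc k)
    have "f differentiable (at x)" if "x \<in> S" for x
      using Suc.prems that by fastforce
    moreover have "times_differentiable_on k S (\<lambda>x. frechet_derivative f (at x) v)" for v
    proof (rule Suc.IH, safe)
      fix x assume "x \<in> S"
      then obtain U where "open U" "x \<in> U" "times_differentiable_on (Suc k) (U \<inter> S) f"
        using Suc.prems by blast
      then show "\<exists>U. open U \<and> x \<in> U \<and> times_differentiable_on k (U \<inter> S) (\<lambda>x. frechet_derivative f (at x) v)"
        by auto
    qed
    ultimately show ?case by simp
  qed
qed

text \<open>Differentiability to order \<open>k\<close> follows for all members of \<open>F\<close>
  at once, by induction on \<open>k\<close>. For \<open>exp\<close> the class consists of its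
  multiples, for \<open>inverse\<close> of the multiples of its powers.\<close>

lemma smooth_on_by_derivative_closed:
  assumes "open S" "f \<in> F"
    and diff: "\<And>f x. f \<in> F \<Longrightarrow> x \<in> S \<Longrightarrow> f differentiable (at x)"
    and closed: "\<And>f v. f \<in> F \<Longrightarrow> \<exists>h\<in>F. \<forall>x\<in>S. frechet_derivative f (at x) v = h x"
  shows "smooth_on S f"
  unfolding smooth_on_def
proof
  fix k
  show "times_differentiable_on k S f"
    using assms(2)
  proof (induction k arbitrary: f)
    case 0
    then show ?case
      by (auto intro!: continuous_at_imp_continuous_on differentiable_imp_continuous_within diff)
  next
    case (Suc k)
    have "times_differentiable_on k S (\<lambda>x. frechet_derivative f (at x) v)" for v
    proof -
      obtain h where h: "h \<in> F" "\<forall>x\<in>S. frechet_derivative f (at x) v = h x"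
        using closed Suc.prems by blast
      have "Ck_family k {0::real} S (\<lambda>s. h)"
        using Suc.IH[OF h(1)] Ck_family_of_times_differentiable by blast
      then have "Ck_family k {0::real} S (\<lambda>s x. frechet_derivative f (at x) v)"
        by (rule Ck_family_cong[OF assms(1), rotated]) (use h in auto)
      then show ?thesis
        using times_differentiable_of_Ck_family[of "0::real" "{0::real}" k S "\<lambda>s x. frechet_derivative f (at x) v"]
        by simp
    qed
    then show ?case using Suc.prems diff by auto
  qed
qed

lemma smooth_on_exp_real: "smooth_on UNIV (exp :: real \<Rightarrow> real)"
proof (rule smooth_on_by_derivative_closed[where F = "range (\<lambda>c x. exp x * c)"])
  show "exp \<in> range (\<lambda>c x::real. exp x * c)"
    by (rule image_eqI[of _ _ 1]) auto
  have d: "((\<lambda>x. exp x * c) has_derivative (\<lambda>v. exp x * (v * c))) (at x)" for c x :: real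
    by (auto intro!: derivative_eq_intros)
  show "f differentiable (at x)" if "f \<in> range (\<lambda>c x. exp x * c)" for f and x :: real
    using that d by (auto simp: differentiable_def)
  show "\<exists>h\<in>range (\<lambda>c x. exp x * c). \<forall>x\<in>UNIV. frechet_derivative f (at x) v = h x"
    if "f \<in> range (\<lambda>c x. exp x * c)" for f and v :: real
    using that d by (auto simp flip: frechet_derivative_at[OF d])
qed auto

lemma smooth_on_exp: "open S \<Longrightarrow> smooth_on S f \<Longrightarrow> smooth_on S (\<lambda>x. exp (f x :: real))"
  by (rule smooth_on_compose[OF _ open_UNIV smooth_on_exp_real]) auto

lemma smooth_on_inverse_real: "smooth_on (- {0}) (inverse :: real \<Rightarrow> real)"
proof (rule smooth_on_by_derivative_closed[where F = "range (\<lambda>(c, n) x. inverse x ^ Suc n * c)"])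
  show "open (- {0::real})" by auto
  show "inverse \<in> range (\<lambda>(c, n) x::real. inverse x ^ Suc n * c)"
    by (rule image_eqI[of _ _ "(1, 0)"]) auto
  have d: "((\<lambda>x. inverse x ^ Suc n * c) has_derivative
      (\<lambda>v. inverse x ^ Suc (Suc n) * (- real (Suc n) * v * c))) (at x)" if "x \<noteq> 0" for c x :: real and n
    using that by (auto intro!: derivative_eq_intros simp: field_simps simp del: power_Suc) 
      (auto simp: field_simps)
  show "f differentiable (at x)" if "f \<in> range (\<lambda>(c, n) x. inverse x ^ Suc n * c)" "x \<in> - {0}" for f and x :: real
    using that d by (fastforce simp: differentiable_def)
  show "\<exists>h\<in>range (\<lambda>(c, n) x. inverse x ^ Suc n * c). \<forall>x\<in>- {0}. frechet_derivative f (at x) v = h x"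
    if "f \<in> range (\<lambda>(c, n) x. inverse x ^ Suc n * c)" for f and v :: real
  proof -
    from that obtain c n where f: "f = (\<lambda>x. inverse x ^ Suc n * c)" by auto
    show ?thesis
    proof (rule bexI[of _ "\<lambda>x. inverse x ^ Suc (Suc n) * (- real (Suc n) * v * c)"], rule ballI)
      fix x :: real assume "x \<in> - {0}"
      then have "x \<noteq> 0" by simp
      from frechet_derivative_at[OF d[OF this, of n c], symmetric]
      show "frechet_derivative f (at x) v = inverse x ^ Suc (Suc n) * (- real (Suc n) * v * c)"
        unfolding f by (rule fun_cong)
    qed (rule range_eqI[of _ _ "(- real (Suc n) * v * c, Suc n)"], simp)
  qed
qed

lemma smooth_on_inverse:
  "open S \<Longrightarrow> smooth_on S f \<Longrightarrow> (\<And>x. x \<in> S \<Longrightarrow> f x \<noteq> 0) \<Longrightarrow> smooth_on S (\<lambda>x. inverse (f x :: real))"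
  by (rule smooth_on_compose[OF _ _ smooth_on_inverse_real]) auto

lemma smooth_on_divide:
  "open S \<Longrightarrow> smooth_on S f \<Longrightarrow> smooth_on S h \<Longrightarrow> (\<And>x. x \<in> S \<Longrightarrow> h x \<noteq> 0) \<Longrightarrow>
    smooth_on S (\<lambda>x. f x / h x :: real)"
  unfolding divide_inverse by (intro smooth_on_mult smooth_on_inverse) auto

lemma smooth_on_Suc_by_derivative:
  assumes "open S" "\<And>x. x \<in> S \<Longrightarrow> (f has_derivative f' x) (at x)" "\<And>v. smooth_on S (\<lambda>x. f' x v)"
  shows "smooth_on S f"
  unfolding smooth_on_def
proof
  fix k
  have "continuous_on S f"
    using assms(2) by (meson continuous_at_imp_continuous_on has_derivative_continuous)
  moreover have "times_differentiable_on k S (\<lambda>x. frechet_derivative f (at x) v)" for k v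
  proof -
    have "smooth_on S (\<lambda>x. frechet_derivative f (at x) v)"
      by (rule smooth_on_cong[OF assms(1) assms(3)[of v]]) (metis assms(2) frechet_derivative_at)
    then show ?thesis by (simp add: smooth_on_def)
  qed
  moreover have "f differentiable (at x)" if "x \<in> S" for x
    using assms(2)[OF that] by (auto simp: differentiable_def)
  ultimately show "times_differentiable_on k S f"
    by (cases k) auto
qed

lemma smooth_on_ln: 
  assumes "open S" "smooth_on S f" "\<And>x. x \<in> S \<Longrightarrow> f x > 0"
  shows "smooth_on S (\<lambda>x. ln (f x :: real))"
proof (rule smooth_on_compose[of S "{0<..}" ln f])
  show "smooth_on {0<..} (ln :: real \<Rightarrow> real)"
  proof (rule smooth_on_Suc_by_derivative[where f' = "\<lambda>x v. inverse x * v"])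
    show "(ln has_derivative (\<lambda>v. inverse x * v)) (at x)" if "x \<in> {0<..}" for x :: real
      using that by (auto intro!: derivative_eq_intros simp: field_simps)
    show "smooth_on {0<..} (\<lambda>x. inverse x * v)" for v :: real
      by (intro smooth_on_mult smooth_on_inverse smooth_on_id) auto
  qed auto
qed (use assms in auto)

section \<open>Cutoff functions\<close>

text \<open>For n = 0 this is the flat function exp(-1/t). The factors (1/t)^n are carried along
  because differentiation produces them: the span of all \<open>flat_exp n\<close> is closed under
  the derivative.\<close>

definition flat_exp :: "nat \<Rightarrow> real \<Rightarrow> real" where
  "flat_exp n t = (if t > 0 then (1 / t) ^ n * exp (- (1 / t)) else 0)"

lemma flat_exp_tendsto_0: "(flat_exp n \<longlongrightarrow> 0) (at_right 0)"
proof -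
  have "((\<lambda>x. x ^ n / exp x) \<longlongrightarrow> (0::real)) at_top"
    by (rule tendsto_power_div_exp_0)
  then have "((\<lambda>t. inverse t ^ n / exp (inverse t)) \<longlongrightarrow> (0::real)) (at_right 0)"
    by (rule filterlim_compose[OF _ filterlim_inverse_at_top_right])
  then show ?thesis
  proof (rule Lim_transform_eventually)
    show "\<forall>\<^sub>F t in at_right 0. inverse t ^ n / exp (inverse t) = flat_exp n t"
      by (rule eventually_mono[OF eventually_at_right_less])
        (auto simp: flat_exp_def exp_minus field_simps)
  qed
qed

text \<open>At 0 the right difference quotient of \<open>flat_exp n\<close> is
  \<open>flat_exp (Suc n)\<close>, which tends to 0, and the left one vanishes.\<close>

lemma flat_exp_has_derivative:
  "(flat_exp n has_derivative (\<lambda>v. v * (flat_exp (n + 2) t - real n * flat_exp (n + 1) t))) (at t)"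
proof -
  consider "t < 0" | "t > 0" | "t = 0" by linarith
  then show ?thesis
  proof cases
    case 1
    have "((\<lambda>t. 0::real) has_derivative (\<lambda>v. 0)) (at t)"
      by simp
    then have "(flat_exp n has_derivative (\<lambda>v. 0)) (at t)"
      by (rule has_derivative_transform_within_open[of _ _ _ _ "{..<0}"]) (use 1 in \<open>auto simp: flat_exp_def\<close>)
    then show ?thesis using 1 by (simp add: flat_exp_def)
  next
    case 2
    have "((\<lambda>t. (1 / t) ^ n * exp (- (1 / t))) has_field_derivative
        (1 / t) ^ (n + 2) * exp (- (1 / t)) - real n * ((1 / t) ^ (n + 1) * exp (- (1 / t)))) (at t)"
      using 2 by (cases n) (auto intro!: derivative_eq_intros simp: field_simps power2_eq_square,
        metis One_nat_def mult.commute not_gr_zero power_minus_mult)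
    then have "((\<lambda>t. (1 / t) ^ n * exp (- (1 / t))) has_derivative
        (\<lambda>v. v * (flat_exp (n + 2) t - real n * flat_exp (n + 1) t))) (at t)"
      unfolding has_field_derivative_def
      by (rule has_derivative_eq_rhs) (use 2 in \<open>simp add: flat_exp_def fun_eq_iff mult.commute\<close>)
    then show ?thesis
      by (rule has_derivative_transform_within_open[of _ _ _ _ "{0<..}"]) (use 2 in \<open>auto simp: flat_exp_def\<close>)
  next
    case 3
    have "((\<lambda>h. flat_exp n h / h) \<longlongrightarrow> 0) (at_right 0)"
    proof (rule Lim_transform_eventually[OF flat_exp_tendsto_0[of "Suc n"]])
      show "\<forall>\<^sub>F h in at_right 0. flat_exp (Suc n) h = flat_exp n h / h"
        by (rule eventually_mono[OF eventually_at_right_less]) (auto simp: flat_exp_def)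
    qed
    moreover have "((\<lambda>h. flat_exp n h / h) \<longlongrightarrow> 0) (at_left 0)"
      by (rule tendsto_eventually) (auto simp: eventually_at_left_field flat_exp_def intro!: exI[of _ "-1"])
    ultimately have "((\<lambda>h. flat_exp n h / h) \<longlongrightarrow> 0) (at 0)"
      by (simp add: filterlim_at_split)
    then have "(flat_exp n has_field_derivative 0) (at 0)"
      by (simp add: DERIV_def flat_exp_def)
    then show ?thesis
      unfolding has_field_derivative_def 3
      by (rule has_derivative_eq_rhs) (simp add: flat_exp_def fun_eq_iff)
  qed
qed

lemma smooth_on_flat_exp: "smooth_on UNIV (flat_exp n)"
  unfolding smooth_on_iff_family smooth_family_def
proof
  fix k
  show "Ck_family k {0::real} UNIV (\<lambda>s. flat_exp n)"
  proof (induction k arbitrary: n)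
    case 0
    have "continuous_on UNIV (flat_exp n)"
      using flat_exp_has_derivative by (meson continuous_at_imp_continuous_on has_derivative_continuous)
    then have "times_differentiable_on 0 UNIV (flat_exp n)" by simp
    then show ?case by (rule Ck_family_of_times_differentiable)
  next
    case (Suc k)
    have "continuous_on UNIV (flat_exp n)"
      using flat_exp_has_derivative by (meson continuous_at_imp_continuous_on has_derivative_continuous)
    then have "times_differentiable_on 0 UNIV (flat_exp n)" by simp
    then have c: "Ck_family 0 {0::real} UNIV (\<lambda>s. flat_exp n)" by (rule Ck_family_of_times_differentiable)
    show ?case
    proof (rule Ck_family_SucI[OF open_UNIV _ flat_exp_has_derivative])
      show "Ck_family k {0::real} UNIV (\<lambda>s z. v * (flat_exp (n + 2) z - real n * flat_exp (n + 1) z))" for v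
      proof -
        have "Ck_family k {0::real} UNIV (\<lambda>s z. v * (flat_exp (n + 2) z + (- real n) * flat_exp (n + 1) z))"
          by (intro Ck_family_bilinear[OF open_UNIV bounded_bilinear_mult] Ck_family_add[OF open_UNIV] Suc.IH
              Ck_family_const)
        then show ?thesis by simp
      qed
    qed (use c in simp)
  qed
qed

lemma smooth_on_norm_squared:
  fixes c :: "'a::euclidean_space"
  shows "smooth_on UNIV (\<lambda>x. (norm (x - c))\<^sup>2)"
proof -
  have "smooth_on UNIV (\<lambda>x. (x - c) \<bullet> (x - c))"
    by (rule smooth_on_bilinear[OF open_UNIV bounded_bilinear_inner];
        rule smooth_on_diff[OF open_UNIV smooth_on_id[OF open_UNIV] smooth_on_const])
  then show ?thesis by (simp add: power2_norm_eq_inner)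
qed

text \<open>A quotient p / (p + q) of flat functions of the squared distance, with p positive inside
  radius 2r and q positive outside radius r. At every point one of the two is positive, so the
  denominator never vanishes.\<close>

lemma bump_function:
  fixes c :: "'a::euclidean_space"
  assumes "0 < r"
  obtains b :: "'a \<Rightarrow> real" where "smooth_on UNIV b" "\<And>x. x \<in> cball c r \<Longrightarrow> b x = 1"
    "\<And>x. x \<notin> ball c (2 * r) \<Longrightarrow> b x = 0"
proof -
  let ?p = "\<lambda>x. flat_exp 0 (4 * r\<^sup>2 - (norm (x - c))\<^sup>2)"
  let ?q = "\<lambda>x. flat_exp 0 ((norm (x - c))\<^sup>2 - r\<^sup>2)"
  have p: "smooth_on UNIV ?p"
    by (rule smooth_on_compose[OF open_UNIV open_UNIV smooth_on_flat_exp])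
      (auto intro: smooth_on_diff[OF open_UNIV smooth_on_const smooth_on_norm_squared])
  have q: "smooth_on UNIV ?q"
    by (rule smooth_on_compose[OF open_UNIV open_UNIV smooth_on_flat_exp])
      (auto intro: smooth_on_diff[OF open_UNIV smooth_on_norm_squared smooth_on_const])
  have nn: "flat_exp 0 t \<ge> 0" "flat_exp 0 t > 0 \<longleftrightarrow> t > 0" for t
    by (auto simp: flat_exp_def)
  have pos: "?p x + ?q x \<noteq> 0" for x
  proof -
    have "(norm (x - c))\<^sup>2 < 4 * r\<^sup>2 \<or> (norm (x - c))\<^sup>2 > r\<^sup>2"
      using assms by (smt (verit) zero_less_power)
    then show ?thesis
      using nn[of "4 * r\<^sup>2 - (norm (x - c))\<^sup>2"] nn[of "(norm (x - c))\<^sup>2 - r\<^sup>2"] by (smt (verit))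
  qed
  have "smooth_on UNIV (\<lambda>x. ?p x / (?p x + ?q x))"
    by (rule smooth_on_divide[OF open_UNIV p smooth_on_add[OF open_UNIV p q] pos])
  moreover have "?p x / (?p x + ?q x) = 1" if "x \<in> cball c r" for x
  proof -
    have "norm (x - c) \<le> r" using that by (simp add: dist_norm norm_minus_commute)
    then have "(norm (x - c))\<^sup>2 \<le> r\<^sup>2" by (simp add: power_mono)
    then have "?q x = 0" by (simp add: flat_exp_def)
    then show ?thesis using pos[of x] by simp
  qed
  moreover have "?p x / (?p x + ?q x) = 0" if "x \<notin> ball c (2 * r)" for x
  proof -
    have "norm (x - c) \<ge> 2 * r" using that by (simp add: dist_norm norm_minus_commute)
    then have "(norm (x - c))\<^sup>2 \<ge> (2 * r)\<^sup>2" using assms by (intro power_mono) auto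
    then have "?p x = 0" by (simp add: flat_exp_def power_mult_distrib)
    then show ?thesis by simp
  qed
  ultimately show ?thesis by (rule that)
qed

text \<open>Extension by zero of \<open>f\<close> times a bump function: smooth on \<open>U\<close>,
  and zero near every other point. It carries local data to the whole space, where flows,
  antiderivatives and second derivatives are treated.\<close>

lemma smooth_cutoff:
  fixes f :: "'a::euclidean_space \<Rightarrow> 'b::real_normed_vector"
  assumes "open U" "x0 \<in> U" "smooth_on U f"
  obtains r h where "r > 0" "cball x0 (2 * r) \<subseteq> U" "smooth_on UNIV h"
    "\<And>x. x \<in> cball x0 r \<Longrightarrow> h x = f x" "\<And>x. x \<notin> ball x0 (2 * r) \<Longrightarrow> h x = 0"
proof -
  obtain e where e: "e > 0" "cball x0 e \<subseteq> U"
    using assms(1,2) open_contains_cball by blast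
  define r where "r = e / 2"
  have r: "r > 0" "cball x0 (2 * r) \<subseteq> U" using e by (auto simp: r_def)
  obtain b :: "'a \<Rightarrow> real" where b: "smooth_on UNIV b" "\<And>x. x \<in> cball x0 r \<Longrightarrow> b x = 1"
    "\<And>x. x \<notin> ball x0 (2 * r) \<Longrightarrow> b x = 0"
    using bump_function[OF r(1)] by blast
  define h where "h x = (if x \<in> ball x0 (2 * r) then b x *\<^sub>R f x else 0)" for x
  have "smooth_on UNIV h"
  proof (rule smooth_on_local[OF open_UNIV], goal_cases)
    case (1 x)
    show ?case
    proof (cases "x \<in> U")
      case True
      have "smooth_on U (\<lambda>x. b x *\<^sub>R f x)"
        by (rule smooth_on_scaleR[OF assms(1) smooth_on_subset[OF b(1)] assms(3)]) simp
      then have "smooth_on U h"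
        by (rule smooth_on_cong[OF assms(1)]) (auto simp: h_def b(3))
      then show ?thesis using True assms(1) by auto
    next
      case False
      have "smooth_on (- cball x0 (2 * r)) h"
        by (rule smooth_on_cong[OF _ smooth_on_const[of _ 0]]) (auto simp: h_def)
      moreover have "x \<in> - cball x0 (2 * r)" using False r by auto
      ultimately show ?thesis by (metis Int_UNIV_right closed_cball open_Compl)
    qed
  qed
  then show ?thesis
    using that[OF r] b(2) r(1) by (simp add: h_def)
qed

text \<open>The partial derivatives are continuous on the closed ball and vanish off it, hence are
  bounded, and the mean value inequality applies. This is the global Lipschitz bound under which a
  cut-off field has a flow for all times.\<close>

lemma smooth_compact_support_lipschitz:
  fixes h :: "'a::euclidean_space \<Rightarrow> 'b::real_normed_vector"
  assumes "smooth_on UNIV h" "\<And>x. x \<notin> ball x0 R \<Longrightarrow> h x = 0"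
  obtains L where "L \<ge> 0" "\<And>x y. norm (h x - h y) \<le> L * norm (x - y)"
proof -
  let ?D = "\<lambda>x. frechet_derivative h (at x)"
  have hd: "(h has_derivative ?D x) (at x)" for x
    using smooth_on_has_derivative[OF assms(1)] by simp
  have "\<exists>M. \<forall>x. norm (?D x i) \<le> M" for i
  proof -
    have "continuous_on (cball x0 R) (\<lambda>x. ?D x i)"
      using smooth_on_imp_continuous_on[OF smooth_on_derivative[OF assms(1)]] continuous_on_subset by blast
    then have "bounded ((\<lambda>x. ?D x i) ` cball x0 R)"
      using compact_continuous_image compact_cball compact_imp_bounded by blast
    then obtain M where M: "\<And>x. x \<in> cball x0 R \<Longrightarrow> norm (?D x i) \<le> M"
      unfolding bounded_iff by blast
    have "?D x i = 0" if "x \<notin> cball x0 R" for x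
    proof -
      have "?D x = frechet_derivative (\<lambda>x. 0) (at x)"
        by (rule frechet_derivative_cong_open[of "- cball x0 R"]) (use that assms(2) in \<open>auto simp: closed_cball open_Compl\<close>)
      then show ?thesis by simp
    qed
    then have "\<forall>x. norm (?D x i) \<le> max M 0"
      using M by (metis max.coboundedI1 max.cobounded2 norm_zero)
    then show ?thesis by blast
  qed
  then obtain M where M: "\<And>i x. norm (?D x i) \<le> M i" by metis
  define L where "L = (\<Sum>i\<in>Basis. M i)"
  have M0: "M i \<ge> 0" for i using M[of x0 i] norm_ge_zero order_trans by blast
  have on: "onorm (?D x) \<le> L" for x
  proof (rule onorm_bound)
    show "0 \<le> L" by (simp add: L_def M0 sum_nonneg)
    fix v
    have "norm (?D x v) = norm (\<Sum>i\<in>Basis. (v \<bullet> i) *\<^sub>R ?D x i)"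
      by (rule arg_cong[OF linear_basis_expansion]) (rule has_derivative_linear[OF hd])
    also have "\<dots> \<le> (\<Sum>i\<in>Basis. norm v * M i)"
      by (rule sum_norm_le) (auto intro!: mult_mono Basis_le_norm M)
    also have "\<dots> = L * norm v" by (simp add: L_def sum_distrib_left mult.commute)
    finally show "norm (?D x v) \<le> L * norm v" .
  qed
  have "norm (h x - h y) \<le> L * norm (x - y)" for x y
    by (rule differentiable_bound[OF convex_UNIV, of h ?D]) (auto simp: on intro: has_derivative_at_withinI hd)
  moreover have "L \<ge> 0" by (simp add: L_def M0 sum_nonneg)
  ultimately show ?thesis by (rule that[rotated])
qed

section \<open>Integral equations with parameters\<close>

lemma continuous_on_fix_param:
  assumes "continuous_on (T \<times> S) (\<lambda>(r, z). G r z)" "z \<in> S" "T' \<subseteq> T"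
  shows "continuous_on T' (\<lambda>r. G r z)"
proof -
  have "continuous_on T' (\<lambda>r. (\<lambda>(r, z). G r z) (r, z))"
    by (rule continuous_on_compose2[OF assms(1)])
      (use assms in \<open>auto intro!: continuous_on_Pair continuous_on_id continuous_on_const\<close>)
  then show ?thesis by simp
qed

lemma integral_rescale:
  fixes f :: "real \<Rightarrow> 'b::euclidean_space"
  assumes "continuous_on {0..s} f" "0 \<le> s"
  shows "integral {0..s} f = s *\<^sub>R integral {0..1} (\<lambda>r. f (s * r))"
proof (cases "s = 0")
  case False
  then have s: "s > 0" using assms by simp
  have im: "(\<lambda>x. x / s) ` {0..s} = {0..1}"
  proof -
    have "x \<in> (\<lambda>x. x / s) ` {0..s}" if "x \<in> {0..1}" for x
      by (rule image_eqI[of _ _ "x * s"]) (use that s in \<open>auto simp: mult_left_le_one_le\<close>)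
    then show ?thesis using s by (auto simp: field_simps)
  qed
  have "integral ((\<lambda>x. x / s) ` {0..s}) (\<lambda>x. f (s * x)) = (1 / \<bar>s\<bar>) *\<^sub>R integral {0..s} f"
    by (rule integral_stretch_real) (use s in simp)
  then show ?thesis using s by (simp add: im)
qed simp

text \<open>Rescaling to the fixed interval {0..1} moves the upper limit into the integrand, where
  the continuity of integrals in a parameter applies.\<close>

lemma continuous_on_integral_upper_param:
  fixes G :: "real \<Rightarrow> 'p::topological_space \<Rightarrow> 'b::euclidean_space"
  assumes "continuous_on ({0..1} \<times> S) (\<lambda>(r, z). G r z)"
  shows "continuous_on ({0..1} \<times> S) (\<lambda>(s, z). integral {0..s} (\<lambda>r. G r z))"
proof -
  have "continuous_on (({0..1} \<times> S) \<times> {0..1}) (\<lambda>y. (\<lambda>(r, z). G r z) (fst (fst y) * snd y, snd (fst y)))"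
    by (rule continuous_on_compose2[OF assms])
      (auto intro!: continuous_intros simp: mult_le_one)
  then have "continuous_on (({0..1} \<times> S) \<times> cbox 0 1) (\<lambda>(x, r). G (fst x * r) (snd x))"
    by (simp add: case_prod_unfold)
  then have "continuous_on ({0..1} \<times> S) (\<lambda>x. integral (cbox 0 1) (\<lambda>r. G (fst x * r) (snd x)))"
    by (rule integral_continuous_on_param)
  then have "continuous_on ({0..1} \<times> S) (\<lambda>x. fst x *\<^sub>R integral {0..1} (\<lambda>r. G (fst x * r) (snd x)))"
    by (intro continuous_on_scaleR continuous_on_fst continuous_on_id) simp
  then show ?thesis
  proof (rule continuous_on_eq)
    fix x assume "x \<in> {0..1::real} \<times> S"
    then obtain s z where x: "x = (s, z)" "0 \<le> s" "s \<le> 1" "z \<in> S" by auto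
    have "continuous_on {0..s} (\<lambda>r. G r z)"
      using continuous_on_fix_param[OF assms x(4), of "{0..s}"] x by auto
    from integral_rescale[OF this x(2)]
    show "fst x *\<^sub>R integral {0..1} (\<lambda>r. G (fst x * r) (snd x)) = (case x of (s, z) \<Rightarrow> integral {0..s} (\<lambda>r. G r z))"
      by (simp add: x(1))
  qed
qed

lemma integral_exp_le:
  fixes L s :: real
  assumes "L \<ge> 0" "0 \<le> s"
  shows "L * integral {0..s} (\<lambda>r. exp (2 * L * r)) \<le> exp (2 * L * s) / 2"
proof (cases "L = 0")
  case False
  have "((\<lambda>r. exp (2 * L * r)) has_integral (exp (2 * L * s) / (2 * L) - exp (2 * L * 0) / (2 * L))) {0..s}"
    by (rule fundamental_theorem_of_calculus[OF assms(2)])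
      (use False in \<open>auto intro!: derivative_eq_intros simp: has_real_derivative_iff_has_vector_derivative[symmetric]\<close>)
  then have "integral {0..s} (\<lambda>r. exp (2 * L * r)) = exp (2 * L * s) / (2 * L) - 1 / (2 * L)"
    by (simp add: integral_unique)
  then show ?thesis using False by (simp add: field_simps)
qed simp

text \<open>Measured with the weight exp(2 L r), integration against a Lipschitz constant
  \<open>L\<close> contracts by the factor 1/2, however long the interval is. The 2 in the exponent
  is what leaves this factor.\<close>

lemma integral_exp_weighted_le:
  fixes u :: "real \<Rightarrow> 'b::euclidean_space"
  assumes "L \<ge> 0" "0 \<le> s" "B \<ge> 0" "continuous_on {0..s} u"
    and "\<And>r. r \<in> {0..s} \<Longrightarrow> norm (u r) \<le> L * (B * exp (2 * L * r))"
  shows "norm (integral {0..s} u) \<le> B / 2 * exp (2 * L * s)"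
proof -
  have "norm (integral {0..s} u) \<le> integral {0..s} (\<lambda>r. L * (B * exp (2 * L * r)))"
    by (rule integral_norm_bound_integral)
      (auto intro!: integrable_continuous_real assms continuous_intros)
  also have "\<dots> = B * (L * integral {0..s} (\<lambda>r. exp (2 * L * r)))"
    by simp
  also have "\<dots> \<le> B * (exp (2 * L * s) / 2)"
    by (rule mult_left_mono[OF integral_exp_le[OF assms(1,2)] assms(3)])
  finally show ?thesis by simp
qed

text \<open>The weighted distance of two solutions attains a maximum m on {0..1}, and the
  contraction gives m \<le> m/2 there.\<close>

lemma integral_equation_unique:
  fixes w1 w2 :: "real \<Rightarrow> 'a::euclidean_space"
  assumes c: "continuous_on {0..1} w1" "continuous_on {0..1} w2"
    and F1: "continuous_on {0..1} (\<lambda>r. F r (w1 r))" and F2: "continuous_on {0..1} (\<lambda>r. F r (w2 r))"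
    and L: "L \<ge> 0" "\<And>r x y. r \<in> {0..1} \<Longrightarrow> norm (F r x - F r y) \<le> L * norm (x - y)"
    and e1: "\<And>s. s \<in> {0..1} \<Longrightarrow> w1 s = c0 + integral {0..s} (\<lambda>r. F r (w1 r))"
    and e2: "\<And>s. s \<in> {0..1} \<Longrightarrow> w2 s = c0 + integral {0..s} (\<lambda>r. F r (w2 r))"
    and s: "s \<in> {0..1::real}"
  shows "w1 s = w2 s"
proof -
  let ?u = "\<lambda>s. norm (w1 s - w2 s) * exp (- (2 * L * s))"
  have "continuous_on {0..1} ?u" by (intro continuous_intros c)
  then obtain s0 where s0: "s0 \<in> {0..1}" "\<And>s. s \<in> {0..1} \<Longrightarrow> ?u s \<le> ?u s0"
    using continuous_attains_sup[of "{0..1::real}" ?u] by auto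
  define m where "m = ?u s0"
  have m0: "m \<ge> 0" by (simp add: m_def)
  have le: "norm (w1 r - w2 r) \<le> m * exp (2 * L * r)" if "r \<in> {0..1}" for r
    using s0(2)[OF that] by (simp add: m_def exp_minus field_simps)
  have sub: "{0..s0} \<subseteq> {0..1}" using s0(1) by auto
  have i: "(\<lambda>r. F r (w1 r)) integrable_on {0..s0}" "(\<lambda>r. F r (w2 r)) integrable_on {0..s0}"
    using F1 F2 continuous_on_subset[OF _ sub] by (auto intro: integrable_continuous_real)
  have "w1 s0 - w2 s0 = integral {0..s0} (\<lambda>r. F r (w1 r) - F r (w2 r))"
    using e1[OF s0(1)] e2[OF s0(1)] integral_diff[OF i] by simp
  also have "norm \<dots> \<le> m / 2 * exp (2 * L * s0)"
  proof (rule integral_exp_weighted_le[OF L(1) _ m0])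
    show "continuous_on {0..s0} (\<lambda>r. F r (w1 r) - F r (w2 r))"
      by (rule continuous_on_diff[OF continuous_on_subset[OF F1 sub] continuous_on_subset[OF F2 sub]])
    fix r assume "r \<in> {0..s0}"
    then have r: "r \<in> {0..1}" using sub by auto
    show "norm (F r (w1 r) - F r (w2 r)) \<le> L * (m * exp (2 * L * r))"
      using L(2)[OF r] mult_left_mono[OF le[OF r] L(1)] order_trans by blast
  qed (use s0 in auto)
  finally have "m * exp (2 * L * s0) \<le> m / 2 * exp (2 * L * s0)"
    by (simp add: m_def exp_minus field_simps)
  then have "m * exp (2 * L * s0) \<le> 0" by simp
  then have "m = 0" using m0 by (smt (verit) exp_gt_zero mult_pos_pos)
  then show ?thesis using le[OF s] by simp
qed

text \<open>The bound is global in the unknown, so that solutions exist on all of {0..1}, and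
  uniform on unit balls of the parameter, so that the iteration converges uniformly there and its
  limit is continuous in the parameter.\<close>

definition locally_uniformly_lipschitz ::
    "(real \<Rightarrow> 'p::metric_space \<times> 'a::real_normed_vector \<Rightarrow> 'a) \<Rightarrow> bool" where
  "locally_uniformly_lipschitz F \<longleftrightarrow> (\<forall>z0. \<exists>L\<ge>0. \<forall>z\<in>cball z0 1. \<forall>r\<in>{0..1}. \<forall>x y.
     norm (F r (z, x) - F r (z, y)) \<le> L * norm (x - y))"

text \<open>The initial value problem w' = F r (z, w) with w(0) = w0 z, for all parameter values
  \<open>z\<close> at once. In integral form joint continuity of \<open>w\<close> is the whole
  regularity requirement.\<close>

definition solves_integral_equation ::
    "(real \<Rightarrow> 'p::topological_space \<times> 'a::euclidean_space \<Rightarrow> 'a) \<Rightarrow> ('p \<Rightarrow> 'a) \<Rightarrow> (real \<Rightarrow> 'p \<Rightarrow> 'a) \<Rightarrow> bool" where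
  "solves_integral_equation F w0 w \<longleftrightarrow> continuous_on ({0..1} \<times> UNIV) (\<lambda>(s, z). w s z) \<and>
     (\<forall>s\<in>{0..1}. \<forall>z. w s z = w0 z + integral {0..s} (\<lambda>r. F r (z, w r z)))"

lemma continuous_on_field_along:
  assumes "continuous_on ({0..1::real} \<times> UNIV) (\<lambda>(r, y). F r y)"
    and "continuous_on ({0..1} \<times> UNIV) (\<lambda>(s, z). w s z)"
  shows "continuous_on ({0..1} \<times> UNIV) (\<lambda>(r, z). F r (z, w r z))"
proof -
  have "continuous_on ({0..1} \<times> UNIV) (\<lambda>(r, z). (z, w r z))"
    using assms(2) by (auto simp: case_prod_unfold intro!: continuous_on_Pair continuous_on_snd continuous_on_id)
  from continuous_on_family_compose[OF assms(1) this] show ?thesis by simp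
qed

lemma solves_integral_equation_unique:
  fixes F :: "real \<Rightarrow> 'p::euclidean_space \<times> 'a::euclidean_space \<Rightarrow> 'a"
  assumes F: "continuous_on ({0..1} \<times> UNIV) (\<lambda>(r, y). F r y)" "locally_uniformly_lipschitz F"
    and w: "solves_integral_equation F w0 w"
    and v: "continuous_on {0..1} v" "\<And>s. s \<in> {0..1} \<Longrightarrow> v s = w0 z + integral {0..s} (\<lambda>r. F r (z, v r))"
    and s: "s \<in> {0..1}"
  shows "v s = w s z"
proof -
  obtain L where L: "L \<ge> 0" "\<forall>z'\<in>cball z 1. \<forall>r\<in>{0..1}. \<forall>x y. norm (F r (z', x) - F r (z', y)) \<le> L * norm (x - y)"
    using F(2) unfolding locally_uniformly_lipschitz_def by blast
  have wc: "continuous_on ({0..1} \<times> UNIV) (\<lambda>(s, z). w s z)"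
    using w by (simp add: solves_integral_equation_def)
  have "continuous_on {0..1} (\<lambda>r. (r, (z, v r)))"
    by (intro continuous_on_Pair continuous_on_id continuous_on_const v(1))
  then have "continuous_on {0..1} (\<lambda>r. (\<lambda>(r, y). F r y) (r, (z, v r)))"
    by (rule continuous_on_compose2[OF F(1)]) auto
  then have Fv: "continuous_on {0..1} (\<lambda>r. F r (z, v r))" by simp
  show ?thesis
  proof (rule integral_equation_unique[where ?w1.0 = v and ?w2.0 = "\<lambda>s. w s z" and F = "\<lambda>r x. F r (z, x)" and L = L and ?c0.0 = "w0 z"])
    show "continuous_on {0..1} (\<lambda>s. w s z)"
      by (rule continuous_on_fix_param[OF wc]) auto
    show "continuous_on {0..1} (\<lambda>r. F r (z, w r z))"
      by (rule continuous_on_fix_param[OF continuous_on_field_along[OF F(1) wc]]) auto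
    show "w s z = w0 z + integral {0..s} (\<lambda>r. F r (z, w r z))" if "s \<in> {0..1}" for s
      using w that by (simp add: solves_integral_equation_def)
  qed (use L v s Fv in auto)
qed

primrec picard :: "(real \<Rightarrow> 'p \<times> 'a::euclidean_space \<Rightarrow> 'a) \<Rightarrow> ('p \<Rightarrow> 'a) \<Rightarrow> nat \<Rightarrow> real \<Rightarrow> 'p \<Rightarrow> 'a" where
  "picard F w0 0 = (\<lambda>s z. w0 z)"
| "picard F w0 (Suc n) = (\<lambda>s z. w0 z + integral {0..s} (\<lambda>r. F r (z, picard F w0 n r z)))"

text \<open>Picard iteration. Uniform convergence is obtained near each parameter value separately,
  which suffices because continuity of the limit is a local matter.\<close>

lemma integral_equation_solvable:
  fixes F :: "real \<Rightarrow> 'p::euclidean_space \<times> 'a::euclidean_space \<Rightarrow> 'a"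
  assumes F: "continuous_on ({0..1} \<times> UNIV) (\<lambda>(r, y). F r y)" "locally_uniformly_lipschitz F"
    and w0: "continuous_on UNIV w0"
  obtains w where "solves_integral_equation F w0 w"
proof -
  let ?W = "picard F w0"
  have wc0: "continuous_on ({0..1::real} \<times> UNIV) (\<lambda>(s, z). w0 z)"
    by (simp add: case_prod_unfold) (rule continuous_on_compose2[OF w0], auto intro: continuous_on_snd continuous_on_id)
  have Wc: "continuous_on ({0..1} \<times> UNIV) (\<lambda>(s, z). ?W n s z)" for n
  proof (induction n)
    case 0
    then show ?case using wc0 by simp
  next
    case (Suc n)
    have "continuous_on ({0..1} \<times> UNIV) (\<lambda>(s, z). integral {0..s} (\<lambda>r. F r (z, ?W n r z)))"
      by (rule continuous_on_integral_upper_param[OF continuous_on_field_along[OF F(1) Suc]])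
    from continuous_on_add[OF wc0 this] show ?case by (simp add: case_prod_unfold)
  qed
  have FWc: "continuous_on {0..s} (\<lambda>r. F r (z, ?W n r z))" if "s \<in> {0..1}" for n s z
    by (rule continuous_on_fix_param[OF continuous_on_field_along[OF F(1) Wc]]) (use that in auto)
  let ?D = "\<lambda>n (s, z). ?W (Suc n) s z - ?W n s z"
  have unif: "\<exists>l. uniform_limit ({0..1} \<times> cball z0 1) (\<lambda>n (s, z). ?W n s z) l sequentially" for z0
  proof -
    obtain L where L: "L \<ge> 0" "\<forall>z\<in>cball z0 1. \<forall>r\<in>{0..1}. \<forall>x y. norm (F r (z, x) - F r (z, y)) \<le> L * norm (x - y)"
      using F(2) unfolding locally_uniformly_lipschitz_def by blast
    have "continuous_on ({0..1} \<times> cball z0 1) (?D 0)"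
    proof -
      have "continuous_on ({0..1} \<times> UNIV) (\<lambda>y. (\<lambda>(s, z). ?W (Suc 0) s z) y - (\<lambda>(s, z). ?W 0 s z) y)"
        by (rule continuous_on_diff[OF Wc Wc])
      then have "continuous_on ({0..1} \<times> UNIV) (?D 0)" by (simp add: case_prod_unfold)
      then show ?thesis by (rule continuous_on_subset) auto
    qed
    then have "bounded (?D 0 ` ({0..1} \<times> cball z0 1))"
      by (intro compact_imp_bounded compact_continuous_image compact_Times) auto
    then obtain M where M: "\<And>y. y \<in> {0..1} \<times> cball z0 1 \<Longrightarrow> norm (?D 0 y) \<le> M"
      unfolding bounded_iff by blast
    have M0: "M \<ge> 0" using M[of "(0, z0)"] norm_ge_zero order_trans by force
    \<comment> \<open>The weighted contraction halves the distance of consecutive iterates, so that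
      their differences are dominated by a geometric series.\<close>
    have est: "norm (?W (Suc n) s z - ?W n s z) \<le> M * (1 / 2) ^ n * exp (2 * L * s)"
      if "s \<in> {0..1}" "z \<in> cball z0 1" for n s z
      using that(1)
    proof (induction n arbitrary: s)
      case 0
      have "norm (?W (Suc 0) s z - ?W 0 s z) \<le> M" using M[of "(s, z)"] 0 that(2) by auto
      also have "\<dots> \<le> M * exp (2 * L * s)" using M0 L(1) 0 by (simp add: mult_le_cancel_left1)
      finally show ?case by simp
    next
      case (Suc n)
      have "?W (Suc (Suc n)) s z - ?W (Suc n) s z
          = integral {0..s} (\<lambda>r. F r (z, ?W (Suc n) r z)) - integral {0..s} (\<lambda>r. F r (z, ?W n r z))"
        by (simp only: picard.simps add_diff_cancel_left)
      also have "\<dots> = integral {0..s} (\<lambda>r. F r (z, ?W (Suc n) r z) - F r (z, ?W n r z))"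
        by (rule integral_diff[symmetric]; rule integrable_continuous_real[OF FWc[OF Suc.prems]])
      also have "norm \<dots> \<le> (M * (1 / 2) ^ n) / 2 * exp (2 * L * s)"
      proof (rule integral_exp_weighted_le[OF L(1)])
        show "continuous_on {0..s} (\<lambda>r. F r (z, ?W (Suc n) r z) - F r (z, ?W n r z))"
          by (rule continuous_on_diff[OF FWc[OF Suc.prems] FWc[OF Suc.prems]])
        fix r assume r: "r \<in> {0..s}"
        then have r1: "r \<in> {0..1}" using Suc.prems by auto
        have "norm (F r (z, ?W (Suc n) r z) - F r (z, ?W n r z)) \<le> L * norm (?W (Suc n) r z - ?W n r z)"
          using L(2) that(2) r1 by blast
        also have "\<dots> \<le> L * (M * (1 / 2) ^ n * exp (2 * L * r))"
          by (rule mult_left_mono[OF Suc.IH[OF r1] L(1)])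
        finally show "norm (F r (z, ?W (Suc n) r z) - F r (z, ?W n r z)) \<le> L * (M * (1 / 2) ^ n * exp (2 * L * r))" .
      qed (use M0 Suc.prems in auto)
      finally show ?case by simp
    qed
    have "norm (?D n y) \<le> (M * exp (2 * L)) * (1 / 2) ^ n" if "y \<in> {0..1} \<times> cball z0 1" for n y
    proof -
      obtain s z where y: "y = (s, z)" "s \<in> {0..1}" "z \<in> cball z0 1" using \<open>y \<in> _\<close> by auto
      have "exp (2 * L * s) \<le> exp (2 * L)" using y(2) L(1) by (simp add: mult_left_le)
      then have "M * (1 / 2) ^ n * exp (2 * L * s) \<le> M * (1 / 2) ^ n * exp (2 * L)"
        using M0 by (intro mult_left_mono) auto
      then show ?thesis using est[OF y(2,3), of n] by (simp add: y(1) mult_ac)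
    qed
    moreover have "summable (\<lambda>n. (M * exp (2 * L)) * (1 / 2) ^ n)"
      by (intro summable_mult summable_geometric) simp
    ultimately have "uniform_limit ({0..1} \<times> cball z0 1) (\<lambda>n y. \<Sum>i<n. ?D i y)
        (\<lambda>y. suminf (\<lambda>i. ?D i y)) sequentially"
      by (rule Weierstrass_m_test)
    then have "uniform_limit ({0..1} \<times> cball z0 1) (\<lambda>n y. (\<Sum>i<n. ?D i y) + w0 (snd y))
        (\<lambda>y. suminf (\<lambda>i. ?D i y) + w0 (snd y)) sequentially"
      by (intro uniform_limit_intros)
    moreover have "(\<Sum>i<n. ?D i y) + w0 (snd y) = (\<lambda>(s, z). ?W n s z) y" for n y
    proof -
      have "(\<Sum>i<n. ?D i y) = (\<Sum>i<n. ?W (Suc i) (fst y) (snd y) - ?W i (fst y) (snd y))"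
        by (simp add: case_prod_unfold)
      also have "\<dots> = ?W n (fst y) (snd y) - ?W 0 (fst y) (snd y)"
        by (rule sum_lessThan_telescope)
      finally show ?thesis by (simp add: case_prod_unfold)
    qed
    ultimately show ?thesis by (auto simp only: intro!: exI)
  qed
  \<comment> \<open>A pointwise limit gives one function for all parameter balls; on each ball it
    agrees with the uniform limit just found.\<close>
  define w where "w s z = lim (\<lambda>n. ?W n s z)" for s z
  have ul: "uniform_limit ({0..1} \<times> cball z0 1) (\<lambda>n (s, z). ?W n s z) (\<lambda>(s, z). w s z) sequentially" for z0
  proof -
    obtain l where l: "uniform_limit ({0..1} \<times> cball z0 1) (\<lambda>n (s, z). ?W n s z) l sequentially"
      using unif by blast
    have "l y = (\<lambda>(s, z). w s z) y" if "y \<in> {0..1} \<times> cball z0 1" for y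
    proof -
      have "(\<lambda>n. (\<lambda>(s, z). ?W n s z) y) \<longlonglongrightarrow> l y" by (rule tendsto_uniform_limitI[OF l that])
      then show ?thesis by (simp add: w_def case_prod_unfold limI)
    qed
    then show ?thesis using l uniform_limit_cong'[of "{0..1} \<times> cball z0 1" "\<lambda>n (s, z). ?W n s z" "\<lambda>n (s, z). ?W n s z" l] 
      by blast
  qed
  have wc: "continuous_on ({0..1} \<times> UNIV) (\<lambda>(s, z). w s z)"
  proof -
    have loc: "continuous_on ({0..1} \<times> cball z0 1) (\<lambda>(s, z). w s z)" for z0
      by (rule uniform_limit_theorem[OF _ ul]) (auto intro!: always_eventually continuous_on_subset[OF Wc])
    show ?thesis
      unfolding continuous_on_eq_continuous_within
    proof
      fix y :: "real \<times> 'p" assume y: "y \<in> {0..1} \<times> UNIV"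
      have "continuous (at y within ({0..1} \<times> UNIV) \<inter> (UNIV \<times> ball (snd y) 1)) (\<lambda>(s, z). w s z)"
      proof (rule continuous_within_subset)
        show "continuous (at y within {0..1} \<times> cball (snd y) 1) (\<lambda>(s, z). w s z)"
          by (rule bspec[OF loc[of "snd y", unfolded continuous_on_eq_continuous_within]])
            (use y in \<open>auto simp: mem_Times_iff\<close>)
      qed auto
      moreover have "at y within ({0..1} \<times> UNIV) \<inter> (UNIV \<times> ball (snd y) 1) = at y within ({0..1} \<times> UNIV)"
        by (rule at_within_nhd[of _ "UNIV \<times> ball (snd y) 1"]) (auto simp: mem_Times_iff open_Times)
      ultimately show "continuous (at y within {0..1} \<times> UNIV) (\<lambda>(s, z). w s z)" by simp
    qed
  qed
  have "w s z = w0 z + integral {0..s} (\<lambda>r. F r (z, w r z))" if s: "s \<in> {0..1}" for s z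
  proof -
    obtain L where L: "L \<ge> 0" "\<forall>z'\<in>cball z 1. \<forall>r\<in>{0..1}. \<forall>x y. norm (F r (z', x) - F r (z', y)) \<le> L * norm (x - y)"
      using F(2) unfolding locally_uniformly_lipschitz_def by blast
    have ulz: "uniform_limit {0..s} (\<lambda>n r. ?W n r z) (\<lambda>r. w r z) sequentially"
    proof (rule uniform_limitI)
      fix e :: real assume "e > 0"
      from uniform_limitD[OF ul[of z] this]
      show "\<forall>\<^sub>F n in sequentially. \<forall>r\<in>{0..s}. dist (?W n r z) (w r z) < e"
        by eventually_elim (use s in auto)
    qed
    have ulF: "uniform_limit {0..s} (\<lambda>n r. F r (z, ?W n r z)) (\<lambda>r. F r (z, w r z)) sequentially"
    proof (rule uniform_limitI)
      fix e :: real assume e: "e > 0"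
      then have "e / (L + 1) > 0" using L by simp
      from uniform_limitD[OF ulz this]
      show "\<forall>\<^sub>F n in sequentially. \<forall>r\<in>{0..s}. dist (F r (z, ?W n r z)) (F r (z, w r z)) < e"
      proof eventually_elim
        case (elim n)
        show ?case
        proof
          fix r assume r: "r \<in> {0..s}"
          have "dist (F r (z, ?W n r z)) (F r (z, w r z)) \<le> L * dist (?W n r z) (w r z)"
            using L(2) r s by (auto simp: dist_norm)
          also have "\<dots> \<le> L * (e / (L + 1))" by (rule mult_left_mono[OF less_imp_le[OF bspec[OF elim r]] L(1)])
          also have "\<dots> < e" using L(1) e by (simp add: field_simps)
          finally show "dist (F r (z, ?W n r z)) (F r (z, w r z)) < e" .
        qed
      qed
    qed
    obtain I J where IJ: "\<And>n. ((\<lambda>r. F r (z, ?W n r z)) has_integral I n) {0..s}"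
      "((\<lambda>r. F r (z, w r z)) has_integral J) {0..s}" "I \<longlonglongrightarrow> J"
      by (rule uniform_limit_integral[OF ulF FWc[OF s] sequentially_bot]) blast
    have "(\<lambda>n. w0 z + I n) \<longlonglongrightarrow> w0 z + J" by (intro tendsto_intros IJ)
    moreover have "w0 z + I n = ?W (Suc n) s z" for n using IJ(1)[of n] by (simp add: integral_unique)
    ultimately have "(\<lambda>n. ?W (Suc n) s z) \<longlonglongrightarrow> w0 z + J" by simp
    then have "(\<lambda>n. ?W n s z) \<longlonglongrightarrow> w0 z + J" by (rule LIMSEQ_imp_Suc)
    moreover have "(\<lambda>n. ?W n s z) \<longlonglongrightarrow> w s z"
      by (rule tendsto_uniform_limitI[OF ulz]) (use s in auto)
    ultimately have "w s z = w0 z + J" using LIMSEQ_unique by blast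
    then show ?thesis using IJ(2) by (simp add: integral_unique)
  qed
  then show ?thesis using that[of w] wc by (simp add: solves_integral_equation_def)
qed

section \<open>Smooth dependence on parameters\<close>

lemma Ck_family_Pair:
  fixes G :: "'s::topological_space \<Rightarrow> 'a::real_normed_vector \<Rightarrow> 'b::real_normed_vector"
    and H :: "'s \<Rightarrow> 'a \<Rightarrow> 'c::real_normed_vector"
  assumes "open S" "Ck_family k T S G" "Ck_family k T S H"
  shows "Ck_family k T S (\<lambda>s z. (G s z, H s z))"
proof -
  have "Ck_family k T S (\<lambda>s z. (G s z, 0 :: 'c))"
    by (rule Ck_family_bounded_linear[OF assms(1) _ assms(2)])
      (simp add: bounded_linear_Pair bounded_linear_ident bounded_linear_zero)
  moreover have "Ck_family k T S (\<lambda>s z. (0 :: 'b, H s z))"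
    by (rule Ck_family_bounded_linear[OF assms(1) _ assms(3)])
      (simp add: bounded_linear_Pair bounded_linear_ident bounded_linear_zero)
  ultimately have "Ck_family k T S (\<lambda>s z. (G s z, 0) + (0, H s z))"
    by (rule Ck_family_add[OF assms(1)])
  then show ?thesis by simp
qed

text \<open>Solutions depend differentiably on parameters because a difference quotient of two solutions
  solves an integral equation whose coefficients are these quotients, also where the increment is
  zero; its solution is continuous up to there, and its value there is the derivative.\<close>

definition hadamard_quotient ::
    "(real \<Rightarrow> 'q::euclidean_space \<Rightarrow> 'b::euclidean_space) \<Rightarrow> 'q \<Rightarrow> real \<Rightarrow> 'q \<times> 'q \<Rightarrow> 'b" where
  "hadamard_quotient G i r y =
     integral {0..1} (\<lambda>\<theta>. frechet_derivative (G r) (at (fst y + \<theta> *\<^sub>R snd y)) i)"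

lemma hadamard_quotient_0: "hadamard_quotient G i r (z, 0) = frechet_derivative (G r) (at z) i"
  by (simp add: hadamard_quotient_def)

lemma continuous_on_hadamard_quotient:
  assumes "Ck_family (Suc 0) {0..1} UNIV G"
  shows "continuous_on ({0..1} \<times> UNIV) (\<lambda>(r, y). hadamard_quotient G i r y)"
proof -
  have c: "continuous_on ({0..1} \<times> UNIV) (\<lambda>(r, z). frechet_derivative (G r) (at z) i)"
    using assms by simp
  have "continuous_on (({0..1} \<times> UNIV) \<times> {0..1})
      (\<lambda>x. (\<lambda>(r, z). frechet_derivative (G r) (at z) i) (fst (fst x), fst (snd (fst x)) + snd x *\<^sub>R snd (snd (fst x))))"
    by (rule continuous_on_compose2[OF c]) (auto intro!: continuous_intros)
  then have "continuous_on (({0..1} \<times> UNIV) \<times> cbox 0 1)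
      (\<lambda>(x, \<theta>). frechet_derivative (G (fst x)) (at (fst (snd x) + \<theta> *\<^sub>R snd (snd x))) i)"
    by (simp add: case_prod_unfold)
  from integral_continuous_on_param[OF this] show ?thesis
    by (simp add: case_prod_unfold hadamard_quotient_def)
qed

text \<open>Hadamard's lemma: the derivative of \<open>G r\<close> is integrated along the segment
  from \<open>z\<close> to \<open>z + h\<close>, and the direction \<open>h\<close> is expanded in
  \<open>Basis\<close>.\<close>

lemma hadamard_quotient_eq:
  fixes G :: "real \<Rightarrow> 'q::euclidean_space \<Rightarrow> 'b::euclidean_space"
  assumes "Ck_family (Suc 0) {0..1} UNIV G" "r \<in> {0..1}"
  shows "G r (z + h) - G r z = (\<Sum>i\<in>Basis. (h \<bullet> i) *\<^sub>R hadamard_quotient G i r (z, h))"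
proof -
  let ?D = "\<lambda>x. frechet_derivative (G r) (at x)"
  have d: "(G r has_derivative ?D x) (at x)" for x
    using Ck_family_SucD(1)[OF assms] by simp
  have cD: "continuous_on {0..1} (\<lambda>\<theta>::real. ?D (z + \<theta> *\<^sub>R h) i)" for i
  proof -
    have c: "continuous_on ({0..1} \<times> UNIV) (\<lambda>(r, z). frechet_derivative (G r) (at z) i)"
      using assms by simp
    have "continuous_on UNIV (\<lambda>x. ?D x i)"
      by (rule continuous_on_compose2[OF c, of UNIV "\<lambda>x. (r, x)", simplified])
        (use assms(2) in \<open>auto intro!: continuous_intros\<close>)
    then show ?thesis
      by (rule continuous_on_compose2) (auto intro!: continuous_intros)
  qed
  have "((\<lambda>\<theta>. ?D (z + \<theta> *\<^sub>R h) h) has_integral (G r (z + 1 *\<^sub>R h) - G r (z + 0 *\<^sub>R h))) {0..1}"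
  proof (rule fundamental_theorem_of_calculus)
    fix \<theta> :: real assume "\<theta> \<in> {0..1}"
    have "((\<lambda>\<theta>. G r (z + \<theta> *\<^sub>R h)) has_derivative (\<lambda>v. ?D (z + \<theta> *\<^sub>R h) (v *\<^sub>R h))) (at \<theta> within {0..1})"
      by (rule has_derivative_compose[OF _ d]) (auto intro!: derivative_eq_intros)
    then show "((\<lambda>\<theta>. G r (z + \<theta> *\<^sub>R h)) has_vector_derivative ?D (z + \<theta> *\<^sub>R h) h) (at \<theta> within {0..1})"
      by (simp add: has_vector_derivative_def linear_scale[OF has_derivative_linear[OF d]])
  qed simp
  then have "G r (z + h) - G r z = integral {0..1} (\<lambda>\<theta>. ?D (z + \<theta> *\<^sub>R h) h)"
    by (simp add: integral_unique)
  also have "\<dots> = integral {0..1} (\<lambda>\<theta>. \<Sum>i\<in>Basis. (h \<bullet> i) *\<^sub>R ?D (z + \<theta> *\<^sub>R h) i)"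
    by (rule integral_cong) (rule linear_basis_expansion[OF has_derivative_linear[OF d]])
  also have "\<dots> = (\<Sum>i\<in>Basis. integral {0..1} (\<lambda>\<theta>. (h \<bullet> i) *\<^sub>R ?D (z + \<theta> *\<^sub>R h) i))"
    by (rule integral_sum) (auto intro!: integrable_continuous_real continuous_on_scaleR cD)
  finally show ?thesis by (simp add: hadamard_quotient_def)
qed

text \<open>Caratheodory's form of differentiability: the difference is linear in the increment with
  coefficients that depend on it, and these are continuous at increment 0.\<close>

lemma has_derivative_of_continuous_quotient:
  fixes f :: "'p::euclidean_space \<Rightarrow> 'b::real_normed_vector"
  assumes eq: "\<And>h. f (z + h) - f z = (\<Sum>i\<in>Basis. (h \<bullet> i) *\<^sub>R Q i h)"
    and c: "\<And>i. i \<in> Basis \<Longrightarrow> continuous (at 0) (Q i)"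
  shows "(f has_derivative (\<lambda>v. \<Sum>i\<in>Basis. (v \<bullet> i) *\<^sub>R Q i 0)) (at z)"
  unfolding has_derivative_at
proof
  show "bounded_linear (\<lambda>v. \<Sum>i\<in>Basis. (v \<bullet> i) *\<^sub>R Q i 0)"
    by (intro bounded_linear_sum bounded_linear_scaleR_const bounded_linear_inner_left)
  have "((\<lambda>h. \<Sum>i\<in>Basis. norm (Q i h - Q i 0)) \<longlongrightarrow> (\<Sum>i\<in>(Basis::'p set). norm (Q i 0 - Q i 0))) (at 0)"
    by (intro tendsto_sum tendsto_norm tendsto_diff tendsto_const) (use c in \<open>auto simp: continuous_at\<close>)
  then have lim: "((\<lambda>h. \<Sum>i\<in>Basis. norm (Q i h - Q i 0)) \<longlongrightarrow> 0) (at 0)" by simp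
  show "((\<lambda>h. norm (f (z + h) - f z - (\<Sum>i\<in>Basis. (h \<bullet> i) *\<^sub>R Q i 0)) / norm h) \<longlongrightarrow> 0) (at 0)"
  proof (rule tendsto_sandwich[OF _ _ tendsto_const lim])
    show "\<forall>\<^sub>F h in at 0. norm (f (z + h) - f z - (\<Sum>i\<in>Basis. (h \<bullet> i) *\<^sub>R Q i 0)) / norm h
        \<le> (\<Sum>i\<in>Basis. norm (Q i h - Q i 0))"
    proof (rule always_eventually, rule allI)
      fix h :: 'p
      have "norm (f (z + h) - f z - (\<Sum>i\<in>Basis. (h \<bullet> i) *\<^sub>R Q i 0))
          = norm (\<Sum>i\<in>Basis. (h \<bullet> i) *\<^sub>R (Q i h - Q i 0))"
        by (simp add: eq sum_subtractf scaleR_diff_right)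
      also have "\<dots> \<le> (\<Sum>i\<in>Basis. norm h * norm (Q i h - Q i 0))"
        by (rule sum_norm_le) (auto intro!: mult_right_mono Basis_le_norm)
      also have "\<dots> = norm h * (\<Sum>i\<in>Basis. norm (Q i h - Q i 0))"
        by (simp add: sum_distrib_left)
      finally show "norm (f (z + h) - f z - (\<Sum>i\<in>Basis. (h \<bullet> i) *\<^sub>R Q i 0)) / norm h
          \<le> (\<Sum>i\<in>Basis. norm (Q i h - Q i 0))"
        by (cases "h = 0") (auto simp: field_simps sum_nonneg)
    qed
  qed (auto intro!: always_eventually)
qed

lemma locally_uniformly_lipschitz_at:
  assumes "locally_uniformly_lipschitz F"
  obtains L where "L \<ge> 0" "\<And>r x y. r \<in> {0..1} \<Longrightarrow> norm (F r (z, x) - F r (z, y)) \<le> L * norm (x - y)"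
  using assms unfolding locally_uniformly_lipschitz_def by (meson centre_in_cball zero_le_one)

text \<open>Continuous coefficients are bounded on the compact set formed by {0..1} and
  \<open>cball z0 1\<close>. Linearised equations have this affine form, so the same existence lemma
  solves them.\<close>

lemma locally_uniformly_lipschitz_affine:
  fixes a :: "'a::euclidean_space \<Rightarrow> real \<Rightarrow> 'p::euclidean_space \<Rightarrow> 'a"
  assumes "\<And>j. continuous_on ({0..1} \<times> UNIV) (\<lambda>(r, z). a j r z)"
  shows "locally_uniformly_lipschitz (\<lambda>r (z, x). c r z + (\<Sum>j\<in>Basis. (x \<bullet> j) *\<^sub>R a j r z))"
  unfolding locally_uniformly_lipschitz_def
proof
  fix z0 :: 'p
  have "\<exists>M. \<forall>y\<in>{0..1} \<times> cball z0 1. norm ((\<lambda>(r, z). a j r z) y) \<le> M" for j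
  proof -
    have "compact ((\<lambda>(r, z). a j r z) ` ({0..1} \<times> cball z0 1))"
      by (rule compact_continuous_image[OF continuous_on_subset[OF assms]]) (auto intro: compact_Times)
    then have "bounded ((\<lambda>(r, z). a j r z) ` ({0..1} \<times> cball z0 1))" by (rule compact_imp_bounded)
    then show ?thesis by (simp only: bounded_iff ball_simps)
  qed
  then obtain M where "\<And>j y. y \<in> {0..1} \<times> cball z0 1 \<Longrightarrow> norm ((\<lambda>(r, z). a j r z) y) \<le> M j"
    by metis
  then have M: "\<And>j r z. r \<in> {0..1} \<Longrightarrow> z \<in> cball z0 1 \<Longrightarrow> norm (a j r z) \<le> M j" by fastforce
  have M0: "M j \<ge> 0" for j using order_trans[OF norm_ge_zero M[of 0 z0 j]] by simp
  show "\<exists>L\<ge>0. \<forall>z\<in>cball z0 1. \<forall>r\<in>{0..1}. \<forall>x y.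
     norm ((case (z, x) of (z, x) \<Rightarrow> c r z + (\<Sum>j\<in>Basis. (x \<bullet> j) *\<^sub>R a j r z))
         - (case (z, y) of (z, x) \<Rightarrow> c r z + (\<Sum>j\<in>Basis. (x \<bullet> j) *\<^sub>R a j r z))) \<le> L * norm (x - y)"
  proof (intro exI[of _ "\<Sum>j\<in>Basis. M j"] conjI ballI allI)
    show "0 \<le> (\<Sum>j\<in>Basis. M j)" by (simp add: M0 sum_nonneg)
    fix z r x y assume z: "z \<in> cball z0 1" and r: "r \<in> {0..1::real}"
    have "norm ((\<Sum>j\<in>Basis. (x \<bullet> j) *\<^sub>R a j r z) - (\<Sum>j\<in>Basis. (y \<bullet> j) *\<^sub>R a j r z))
        = norm (\<Sum>j\<in>Basis. ((x - y) \<bullet> j) *\<^sub>R a j r z)"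
      by (simp add: sum_subtractf scaleR_diff_left inner_diff_left)
    also have "\<dots> \<le> (\<Sum>j\<in>Basis. M j * norm (x - y))"
      by (rule sum_norm_le) (auto simp: mult.commute[of "M _"] intro!: mult_mono Basis_le_norm M[OF r z])
    finally show "norm ((case (z, x) of (z, x) \<Rightarrow> c r z + (\<Sum>j\<in>Basis. (x \<bullet> j) *\<^sub>R a j r z))
         - (case (z, y) of (z, x) \<Rightarrow> c r z + (\<Sum>j\<in>Basis. (x \<bullet> j) *\<^sub>R a j r z))) \<le> (\<Sum>j\<in>Basis. M j) * norm (x - y)"
      by (simp add: sum_distrib_right)
  qed
qed

lemma continuous_on_affine_field:
  fixes a :: "'a::euclidean_space \<Rightarrow> real \<Rightarrow> 'p::euclidean_space \<Rightarrow> 'a"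
  assumes "\<And>j. continuous_on ({0..1} \<times> UNIV) (\<lambda>(r, z). a j r z)"
    and "continuous_on ({0..1} \<times> UNIV) (\<lambda>(r, z). c r z)"
  shows "continuous_on ({0..1} \<times> UNIV)
    (\<lambda>(r, y). (\<lambda>(z, x). c r z + (\<Sum>j\<in>Basis. (x \<bullet> j) *\<^sub>R a j r z)) y)"
proof -
  have p: "continuous_on ({0..1} \<times> UNIV) (\<lambda>y::real \<times> 'p \<times> 'a. (\<lambda>(r, z). b r z) (fst y, fst (snd y)))"
    if "continuous_on ({0..1} \<times> UNIV) (\<lambda>(r, z). b r z)" for b :: "real \<Rightarrow> 'p \<Rightarrow> 'a"
    by (rule continuous_on_compose2[OF that]) (auto intro!: continuous_intros)
  have p': "continuous_on ({0..1} \<times> UNIV) (\<lambda>y::real \<times> 'p \<times> 'a. b (fst y) (fst (snd y)))"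
    if "continuous_on ({0..1} \<times> UNIV) (\<lambda>(r, z). b r z)" for b :: "real \<Rightarrow> 'p \<Rightarrow> 'a"
    using p[OF that] by simp
  show ?thesis
    unfolding case_prod_unfold
    by (intro continuous_on_add continuous_on_sum continuous_on_scaleR continuous_on_inner
        continuous_on_snd continuous_on_const continuous_on_id p' assms)
qed

lemma sum_Basis_Pair:
  fixes f :: "'a::euclidean_space \<times> 'b::euclidean_space \<Rightarrow> 'c::comm_monoid_add"
  shows "(\<Sum>k\<in>Basis. f k) = (\<Sum>i\<in>Basis. f (i, 0)) + (\<Sum>j\<in>Basis. f (0, j))"
proof -
  have "inj_on (\<lambda>u. (u::'a, 0::'b)) Basis" "inj_on (\<lambda>u. (0::'a, u::'b)) Basis"
    by (auto intro!: inj_onI)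
  then show ?thesis
    unfolding Basis_prod_def by (subst sum.union_disjoint) (auto simp: sum.reindex)
qed

text \<open>The increment of \<open>w\<close> from \<open>z\<close> to \<open>z + h\<close> and the
  combination of the auxiliary solutions \<open>q i\<close> with the components of \<open>h\<close>
  solve one and the same affine equation, so uniqueness identifies them. The parameter of the
  auxiliary equations is the pair (z, h); at h = 0 they become the linearised equation of the
  conclusion.\<close>

lemma solution_derivative:
  fixes F :: "real \<Rightarrow> 'p::euclidean_space \<times> 'a::euclidean_space \<Rightarrow> 'a"
  assumes F: "Ck_family (Suc 0) {0..1} UNIV F" "locally_uniformly_lipschitz F"
    and w0: "Ck_family (Suc 0) {0..1::real} UNIV (\<lambda>r. w0)"
    and w: "solves_integral_equation F w0 w"
  obtains y where
    "\<And>s z. s \<in> {0..1} \<Longrightarrow> (w s has_derivative (\<lambda>v. \<Sum>i\<in>Basis. (v \<bullet> i) *\<^sub>R y i s z)) (at z)"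
    "\<And>i. solves_integral_equation
       (\<lambda>r (z, x). frechet_derivative (F r) (at (z, w r z)) (i, 0)
          + (\<Sum>j\<in>Basis. (x \<bullet> j) *\<^sub>R frechet_derivative (F r) (at (z, w r z)) (0, j)))
       (\<lambda>z. frechet_derivative w0 (at z) i) (y i)"
proof -
  have wc: "continuous_on ({0..1} \<times> UNIV) (\<lambda>(s, z). w s z)"
    and we: "\<And>s z. s \<in> {0..1} \<Longrightarrow> w s z = w0 z + integral {0..s} (\<lambda>r. F r (z, w r z))"
    using w by (auto simp: solves_integral_equation_def)
  have Fc: "continuous_on ({0..1} \<times> UNIV) (\<lambda>(r, y). F r y)"
    using F(1) by simp
  have Fwc: "continuous_on ({0..1} \<times> UNIV) (\<lambda>(r, z). F r (z, w r z))"
    by (rule continuous_on_field_along[OF Fc wc])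
  \<comment> \<open>With x = (z, h): the base point (z, w z) together with the increment (h, w (z +
    h) - w z), the place where the Hadamard quotients of \<open>F\<close> are taken.\<close>
  let ?pt = "\<lambda>r x. ((fst x, w r (fst x)), (snd x, w r (fst x + snd x) - w r (fst x)))"
  have ptc: "continuous_on ({0..1} \<times> UNIV) (\<lambda>(r, x). ?pt r x)"
  proof -
    have "continuous_on ({0..1} \<times> UNIV) (\<lambda>x::real \<times> 'p \<times> 'p. (\<lambda>(r, z). w r z) (fst x, fst (snd x)))"
      by (rule continuous_on_compose2[OF wc]) (auto intro!: continuous_intros)
    moreover have "continuous_on ({0..1} \<times> UNIV) (\<lambda>x::real \<times> 'p \<times> 'p. (\<lambda>(r, z). w r z) (fst x, fst (snd x) + snd (snd x)))"
      by (rule continuous_on_compose2[OF wc]) (auto intro!: continuous_intros)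
    ultimately show ?thesis
      unfolding case_prod_unfold fst_conv snd_conv
      by (intro continuous_on_Pair continuous_on_diff continuous_on_fst continuous_on_snd continuous_on_id)
  qed
  define b where "b k r x = hadamard_quotient F k r (?pt r x)" for k r x
  have bc: "continuous_on ({0..1} \<times> UNIV) (\<lambda>(r, x). b k r x)" for k
    unfolding b_def
    by (rule continuous_on_family_compose[OF continuous_on_hadamard_quotient[OF F(1)] ptc]) auto
  define G where "G i = (\<lambda>r (x, q). b (i, 0) r x + (\<Sum>j\<in>Basis. (q \<bullet> j) *\<^sub>R b (0, j) r x))" for i
  have Gc: "continuous_on ({0..1} \<times> UNIV) (\<lambda>(r, y). G i r y)" for i
    unfolding G_def by (rule continuous_on_affine_field[OF bc bc])
  have Gl: "locally_uniformly_lipschitz (G i)" for i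
    unfolding G_def by (rule locally_uniformly_lipschitz_affine[OF bc])
  define q0 where "q0 i x = hadamard_quotient (\<lambda>r. w0) i 0 x" for i x
  have q0c: "continuous_on UNIV (q0 i)" for i
  proof -
    have "continuous_on UNIV (\<lambda>x. (\<lambda>(r, y). hadamard_quotient (\<lambda>r. w0) i r y) (0, x))"
      by (rule continuous_on_compose2[OF continuous_on_hadamard_quotient[OF w0]]) (auto intro!: continuous_intros)
    then show ?thesis by (simp add: q0_def[abs_def])
  qed
  have "\<exists>q. solves_integral_equation (G i) (q0 i) q" for i
    using integral_equation_solvable[OF Gc Gl q0c] by metis
  then obtain q where q: "\<And>i. solves_integral_equation (G i) (q0 i) (q i)" by metis
  then have qc: "\<And>i. continuous_on ({0..1} \<times> UNIV) (\<lambda>(s, x). q i s x)"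
    and qe: "\<And>i s x. s \<in> {0..1} \<Longrightarrow> q i s x = q0 i x + integral {0..s} (\<lambda>r. G i r (x, q i r x))"
    by (auto simp: solves_integral_equation_def)
  have Gqi: "(\<lambda>r. G i r (x, q i r x)) integrable_on {0..s}" if "s \<in> {0..1}" for i s x
    by (rule integrable_continuous_real, rule continuous_on_fix_param[OF continuous_on_field_along[OF Gc qc]])
      (use that in auto)
  have quotient: "w s (z + h) - w s z = (\<Sum>i\<in>Basis. (h \<bullet> i) *\<^sub>R q i s (z, h))" if s: "s \<in> {0..1}" for s z h
  proof -
    let ?E = "\<lambda>r x. (\<Sum>i\<in>Basis. (h \<bullet> i) *\<^sub>R b (i, 0) r (z, h)) + (\<Sum>j\<in>Basis. (x \<bullet> j) *\<^sub>R b (0, j) r (z, h))"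
    let ?d = "\<lambda>s. w s (z + h) - w s z" and ?m = "\<lambda>s. \<Sum>i\<in>Basis. (h \<bullet> i) *\<^sub>R q i s (z, h)"
    have wcz: "continuous_on {0..1} (\<lambda>s. w s z)" for z by (rule continuous_on_fix_param[OF wc]) auto
    have qcz: "continuous_on {0..1} (\<lambda>s. q i s (z, h))" for i by (rule continuous_on_fix_param[OF qc]) auto
    have bcz: "continuous_on {0..1} (\<lambda>s. b k s (z, h))" for k by (rule continuous_on_fix_param[OF bc]) auto
    have dc: "continuous_on {0..1} ?d" by (intro continuous_on_diff wcz)
    have mc: "continuous_on {0..1} ?m" by (intro continuous_on_sum continuous_on_scaleR continuous_on_const qcz)
    have Ec: "continuous_on {0..1} (\<lambda>r. ?E r (x r))" if "continuous_on {0..1} x" for x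
      by (intro continuous_on_add continuous_on_sum continuous_on_scaleR continuous_on_inner continuous_on_const that bcz)
    have Fdiff: "F r (z + h, w r (z + h)) - F r (z, w r z) = ?E r (?d r)" if "r \<in> {0..1}" for r
      using hadamard_quotient_eq[OF F(1) that, of "(z, w r z)" "(h, ?d r)"]
      by (simp add: b_def sum_Basis_Pair)
    have dE: "?d s = (w0 (z + h) - w0 z) + integral {0..s} (\<lambda>r. ?E r (?d r))" if s: "s \<in> {0..1}" for s
    proof -
      have i: "(\<lambda>r. F r (z, w r z)) integrable_on {0..s}" for z
        by (rule integrable_continuous_real, rule continuous_on_fix_param[OF Fwc]) (use s in auto)
      have "?d s = (w0 (z + h) - w0 z) + (integral {0..s} (\<lambda>r. F r (z + h, w r (z + h))) - integral {0..s} (\<lambda>r. F r (z, w r z)))"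
        using we[OF s] by simp
      also have "integral {0..s} (\<lambda>r. F r (z + h, w r (z + h))) - integral {0..s} (\<lambda>r. F r (z, w r z))
          = integral {0..s} (\<lambda>r. F r (z + h, w r (z + h)) - F r (z, w r z))"
        by (rule integral_diff[OF i i, symmetric])
      also have "\<dots> = integral {0..s} (\<lambda>r. ?E r (?d r))"
        by (rule integral_cong) (rule Fdiff, use s in auto)
      finally show ?thesis .
    qed
    have mE: "?m s = (w0 (z + h) - w0 z) + integral {0..s} (\<lambda>r. ?E r (?m r))" if s: "s \<in> {0..1}" for s
    proof -
      have "?m s = (\<Sum>i\<in>Basis. (h \<bullet> i) *\<^sub>R q0 i (z, h)) + (\<Sum>i\<in>Basis. (h \<bullet> i) *\<^sub>R integral {0..s} (\<lambda>r. G i r ((z, h), q i r (z, h))))"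
        using qe[OF s] by (simp add: scaleR_add_right sum.distrib)
      also have "(\<Sum>i\<in>Basis. (h \<bullet> i) *\<^sub>R q0 i (z, h)) = w0 (z + h) - w0 z"
        using hadamard_quotient_eq[OF w0, of 0 z h] by (simp add: q0_def)
      also have "(\<Sum>i\<in>Basis. (h \<bullet> i) *\<^sub>R integral {0..s} (\<lambda>r. G i r ((z, h), q i r (z, h))))
          = integral {0..s} (\<lambda>r. \<Sum>i\<in>Basis. (h \<bullet> i) *\<^sub>R G i r ((z, h), q i r (z, h)))"
        by (subst integral_sum) (auto intro!: integrable_cmul Gqi[OF s])
      also have "\<dots> = integral {0..s} (\<lambda>r. ?E r (?m r))"
      proof (rule integral_cong)
        fix r
        have "(\<Sum>i\<in>Basis. (h \<bullet> i) *\<^sub>R (\<Sum>j\<in>Basis. (q i r (z, h) \<bullet> j) *\<^sub>R b (0, j) r (z, h)))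
            = (\<Sum>i\<in>Basis. \<Sum>j\<in>Basis. ((h \<bullet> i) * (q i r (z, h) \<bullet> j)) *\<^sub>R b (0, j) r (z, h))"
          by (simp add: scaleR_sum_right)
        also have "\<dots> = (\<Sum>j\<in>Basis. \<Sum>i\<in>Basis. ((h \<bullet> i) * (q i r (z, h) \<bullet> j)) *\<^sub>R b (0, j) r (z, h))"
          by (rule sum.swap)
        also have "\<dots> = (\<Sum>j\<in>Basis. (?m r \<bullet> j) *\<^sub>R b (0, j) r (z, h))"
          by (simp add: inner_sum_left scaleR_sum_left)
        finally show "(\<Sum>i\<in>Basis. (h \<bullet> i) *\<^sub>R G i r ((z, h), q i r (z, h))) = ?E r (?m r)"
          by (simp add: G_def scaleR_add_right sum.distrib)
      qed
      finally show ?thesis .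
    qed
    have "locally_uniformly_lipschitz (\<lambda>r (x, y). (\<Sum>i\<in>Basis. (h \<bullet> i) *\<^sub>R b (i, 0) r x) + (\<Sum>j\<in>Basis. (y \<bullet> j) *\<^sub>R b (0, j) r x))"
      by (rule locally_uniformly_lipschitz_affine[OF bc])
    then obtain L where "L \<ge> 0" and L': "\<And>r x y. r \<in> {0..1} \<Longrightarrow>
        norm ((case ((z, h), x) of (x, y) \<Rightarrow> (\<Sum>i\<in>Basis. (h \<bullet> i) *\<^sub>R b (i, 0) r x) + (\<Sum>j\<in>Basis. (y \<bullet> j) *\<^sub>R b (0, j) r x))
          - (case ((z, h), y) of (x, y) \<Rightarrow> (\<Sum>i\<in>Basis. (h \<bullet> i) *\<^sub>R b (i, 0) r x) + (\<Sum>j\<in>Basis. (y \<bullet> j) *\<^sub>R b (0, j) r x)))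
        \<le> L * norm (x - y)"
      by (rule locally_uniformly_lipschitz_at[of _ "(z, h)"]) blast
    note L = this(1) L'[unfolded case_prod_conv]
    show ?thesis
      by (rule integral_equation_unique[OF dc mc Ec[OF dc] Ec[OF mc] L dE mE s])
  qed
  define y where "y i s z = q i s (z, 0)" for i s z
  show ?thesis
  proof (rule that[of y])
    fix s z assume s: "s \<in> {0..1::real}"
    show "(w s has_derivative (\<lambda>v. \<Sum>i\<in>Basis. (v \<bullet> i) *\<^sub>R y i s z)) (at z)"
      unfolding y_def
    proof (rule has_derivative_of_continuous_quotient[OF quotient[OF s]])
      fix i :: 'p
      have "continuous_on UNIV (\<lambda>h. (\<lambda>(s, x). q i s x) (s, (z, h)))"
        by (rule continuous_on_compose2[OF qc]) (use s in \<open>auto intro!: continuous_intros\<close>)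
      then show "continuous (at 0) (\<lambda>h. q i s (z, h))"
        by (simp add: continuous_on_eq_continuous_at)
    qed
  next
    fix i
    have "continuous_on ({0..1} \<times> UNIV) (\<lambda>x. (\<lambda>(s, x). q i s x) (fst x, (snd x, 0)))"
      by (rule continuous_on_compose2[OF qc]) (auto intro!: continuous_intros)
    then show "solves_integral_equation
       (\<lambda>r (z, x). frechet_derivative (F r) (at (z, w r z)) (i, 0)
          + (\<Sum>j\<in>Basis. (x \<bullet> j) *\<^sub>R frechet_derivative (F r) (at (z, w r z)) (0, j)))
       (\<lambda>z. frechet_derivative w0 (at z) i) (y i)"
      using qe by (simp add: solves_integral_equation_def y_def G_def q0_def b_def hadamard_quotient_0
          case_prod_unfold zero_prod_def[symmetric])
  qed
qed

text \<open>Induction on the order. The derivatives of \<open>w\<close> in the parameter solve the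
  linearised equation, whose coefficients are derivatives of \<open>F\<close> at (z, w r z). These
  are of class \<open>k\<close> because \<open>F\<close> is of class \<open>Suc k\<close> and
  \<open>w\<close>, by the induction hypothesis, of class \<open>k\<close>.\<close>

theorem solution_Ck:
  fixes F :: "real \<Rightarrow> 'p::euclidean_space \<times> 'a::euclidean_space \<Rightarrow> 'a"
  assumes "Ck_family k {0..1} UNIV F" "locally_uniformly_lipschitz F"
    "Ck_family k {0..1::real} UNIV (\<lambda>r. w0)" "solves_integral_equation F w0 w"
  shows "Ck_family k {0..1} UNIV w"
  using assms
proof (induction k arbitrary: F w0 w)
  case 0
  then show ?case by (simp add: solves_integral_equation_def)
next
  case (Suc k)
  have F1: "Ck_family (Suc 0) {0..1} UNIV F" and w01: "Ck_family (Suc 0) {0..1::real} UNIV (\<lambda>r. w0)"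
    using Ck_family_mono[OF Suc.prems(1)] Ck_family_mono[OF Suc.prems(3)] by (simp_all del: Ck_family.simps)
  obtain y where y: "\<And>s z. s \<in> {0..1} \<Longrightarrow> (w s has_derivative (\<lambda>v. \<Sum>i\<in>Basis. (v \<bullet> i) *\<^sub>R y i s z)) (at z)"
    "\<And>i. solves_integral_equation
       (\<lambda>r (z, x). frechet_derivative (F r) (at (z, w r z)) (i, 0)
          + (\<Sum>j\<in>Basis. (x \<bullet> j) *\<^sub>R frechet_derivative (F r) (at (z, w r z)) (0, j)))
       (\<lambda>z. frechet_derivative w0 (at z) i) (y i)"
    using solution_derivative[OF F1 Suc.prems(2) w01 Suc.prems(4)] by blast
  have w: "Ck_family k {0..1} UNIV w"
    by (rule Suc.IH[OF Ck_family_lower[OF Suc.prems(1)] Suc.prems(2) Ck_family_lower[OF Suc.prems(3)] Suc.prems(4)])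
  have pt: "Ck_family k {0..1} UNIV (\<lambda>r z. (z, w r z))"
    by (rule Ck_family_Pair[OF open_UNIV Ck_family_id[OF open_UNIV] w])
  have D: "Ck_family k {0..1} UNIV (\<lambda>r z. frechet_derivative (F r) (at (z, w r z)) v)" for v
    by (rule Ck_family_compose[OF open_UNIV open_UNIV Ck_family_SucD(2)[OF Suc.prems(1)] pt]) simp
  have D': "Ck_family k {0..1} UNIV (\<lambda>r (x::'p \<times> 'a). frechet_derivative (F r) (at (fst x, w r (fst x))) v)" for v
    by (rule Ck_family_compose[OF open_UNIV open_UNIV D])
      (auto intro: Ck_family_bounded_linear[OF open_UNIV bounded_linear_fst Ck_family_id[OF open_UNIV]])
  have "Ck_family k {0..1} UNIV (y i)" for i
  proof (rule Suc.IH[OF _ _ Ck_family_SucD(2)[OF Suc.prems(3)] y(2)])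
    show "Ck_family k {0..1} UNIV (\<lambda>r (z, x). frechet_derivative (F r) (at (z, w r z)) (i, 0)
          + (\<Sum>j\<in>Basis. (x \<bullet> j) *\<^sub>R frechet_derivative (F r) (at (z, w r z)) (0, j)))"
      unfolding case_prod_unfold
      by (intro Ck_family_add[OF open_UNIV] Ck_family_sum[OF open_UNIV] D'
          Ck_family_bilinear[OF open_UNIV bounded_bilinear_scaleR]
          Ck_family_bounded_linear[OF open_UNIV bounded_linear_compose[OF bounded_linear_inner_left bounded_linear_snd]
            Ck_family_id[OF open_UNIV], unfolded o_def])
    show "locally_uniformly_lipschitz (\<lambda>r (z, x). frechet_derivative (F r) (at (z, w r z)) (i, 0)
          + (\<Sum>j\<in>Basis. (x \<bullet> j) *\<^sub>R frechet_derivative (F r) (at (z, w r z)) (0, j)))"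
      by (rule locally_uniformly_lipschitz_affine) (rule Ck_family_continuous[OF D])
  qed
  then have "Ck_family k {0..1} UNIV (\<lambda>s z. \<Sum>i\<in>Basis. (v \<bullet> i) *\<^sub>R y i s z)" for v
    by (intro Ck_family_sum[OF open_UNIV] Ck_family_bilinear[OF open_UNIV bounded_bilinear_scaleR] Ck_family_const)
  then show ?case
    by (intro Ck_family_SucI[OF open_UNIV Ck_family_continuous[OF w] y(1)])
qed

text \<open>Differentiation under the integral sign as a special case: an equation whose right-hand
  side does not involve the unknown is solved by the integral.\<close>

corollary smooth_integral_param:
  fixes K :: "real \<Rightarrow> 'p::euclidean_space \<Rightarrow> 'a::euclidean_space"
  assumes "smooth_family {0..1} UNIV K"
  shows "smooth_on UNIV (\<lambda>z. integral {0..1} (\<lambda>r. K r z))"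
proof -
  let ?w = "\<lambda>s z. integral {0..s} (\<lambda>r. K r z)"
  have K: "Ck_family k {0..1} UNIV K" for k using assms by (simp add: smooth_family_def)
  have "Ck_family k {0..1} UNIV ?w" for k
  proof (rule solution_Ck)
    show "Ck_family k {0..1} UNIV (\<lambda>r (x :: 'p \<times> 'a). K r (fst x))"
      by (rule Ck_family_compose[OF open_UNIV open_UNIV K])
        (auto intro: Ck_family_bounded_linear[OF open_UNIV bounded_linear_fst Ck_family_id[OF open_UNIV]])
    show "locally_uniformly_lipschitz (\<lambda>r (x :: 'p \<times> 'a). K r (fst x))"
      by (auto simp: locally_uniformly_lipschitz_def intro: exI[of _ 0])
    show "Ck_family k {0..1::real} UNIV (\<lambda>r z. 0)" by simp
    show "solves_integral_equation (\<lambda>r (x :: 'p \<times> 'a). K r (fst x)) (\<lambda>z. 0) ?w"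
      using continuous_on_integral_upper_param[OF Ck_family_continuous[OF K]]
      by (simp add: solves_integral_equation_def)
  qed
  then have "smooth_family {0..1} UNIV ?w" by (simp add: smooth_family_def)
  from smooth_on_of_family[OF this, of 1] show ?thesis by simp
qed

text \<open>Time is made a parameter: w' = t f(w) is solved on the fixed interval {0..1} for z = (t,
  x), and the flow is the value at 1. Smooth dependence on parameters then covers time as well as
  the initial point.\<close>

theorem smooth_flow:
  fixes f :: "'a::euclidean_space \<Rightarrow> 'a"
  assumes f: "smooth_on UNIV f" and L: "L \<ge> 0" "\<And>x y. norm (f x - f y) \<le> L * norm (x - y)"
  shows "\<exists>\<Phi> :: real \<times> 'a \<Rightarrow> 'a. smooth_on UNIV \<Phi> \<and> (\<forall>x. \<Phi> (0, x) = x) \<and>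
    (\<forall>t x. frechet_derivative \<Phi> (at (t, x)) (1, 0) = f (\<Phi> (t, x)))"
proof -
  let ?F = "\<lambda>(r::real) y :: (real \<times> 'a) \<times> 'a. fst (fst y) *\<^sub>R f (snd y) :: 'a" and ?w0 = "\<lambda>z::real \<times> 'a. snd z"
  have fk: "Ck_family k {0..1::real} UNIV (\<lambda>r. f)" for k
    using smooth_family_of_smooth_on[OF f] by (auto simp: smooth_family_def)
  have F: "Ck_family k {0..1} UNIV ?F" for k
  proof -
    have lin: "bounded_linear (\<lambda>z :: (real \<times> 'a) \<times> 'a. fst (fst z))"
      by (rule bounded_linear_compose[OF bounded_linear_fst bounded_linear_fst])
    have 1: "Ck_family k {0..1} UNIV (\<lambda>(s::real) z :: (real \<times> 'a) \<times> 'a. fst (fst z))"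
      by (rule Ck_family_bounded_linear[OF open_UNIV lin Ck_family_id[OF open_UNIV]])
    have 2: "Ck_family k {0..1} UNIV (\<lambda>(s::real) z :: (real \<times> 'a) \<times> 'a. f (snd z))"
      by (rule Ck_family_compose[OF open_UNIV open_UNIV fk])
        (auto intro: Ck_family_bounded_linear[OF open_UNIV bounded_linear_snd Ck_family_id[OF open_UNIV]])
    show ?thesis by (rule Ck_family_bilinear[OF open_UNIV bounded_bilinear_scaleR 1 2])
  qed
  have Fl: "locally_uniformly_lipschitz ?F"
    unfolding locally_uniformly_lipschitz_def
  proof
    fix z0 :: "real \<times> 'a"
    show "\<exists>L'\<ge>0. \<forall>z\<in>cball z0 1. \<forall>r\<in>{0..1}. \<forall>x y. norm (?F r (z, x) - ?F r (z, y)) \<le> L' * norm (x - y)"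
    proof (intro exI[of _ "(\<bar>fst z0\<bar> + 1) * L"] conjI ballI allI)
      show "0 \<le> (\<bar>fst z0\<bar> + 1) * L" using L by simp
      fix z x y and r :: real assume "z \<in> cball z0 1"
      then have "dist (fst z) (fst z0) \<le> 1"
        by (metis dist_commute dist_fst_le mem_cball order_trans)
      then have "\<bar>fst z\<bar> \<le> \<bar>fst z0\<bar> + 1" by (auto simp: dist_real_def)
      then have "\<bar>fst z\<bar> * norm (f x - f y) \<le> (\<bar>fst z0\<bar> + 1) * (L * norm (x - y))"
        by (intro mult_mono L) auto
      then show "norm (?F r (z, x) - ?F r (z, y)) \<le> (\<bar>fst z0\<bar> + 1) * L * norm (x - y)"
        by (simp add: scaleR_diff_right[symmetric] mult.assoc)
    qed
  qed
  have w0: "Ck_family k {0..1::real} UNIV (\<lambda>r. ?w0)" for k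
    by (rule Ck_family_bounded_linear[OF open_UNIV bounded_linear_snd Ck_family_id[OF open_UNIV]])
  obtain w where w: "solves_integral_equation ?F ?w0 w"
    using integral_equation_solvable[OF Ck_family_continuous[OF F] Fl, of ?w0]
      continuous_on_snd[OF continuous_on_id] by blast
  have wk: "Ck_family k {0..1} UNIV w" for k
    by (rule solution_Ck[OF F Fl w0 w])
  have wc: "continuous_on ({0..1} \<times> UNIV) (\<lambda>(s, z). w s z)"
    and we: "\<And>s t x. s \<in> {0..1} \<Longrightarrow> w s (t, x) = x + integral {0..s} (\<lambda>r. t *\<^sub>R f (w r (t, x)))"
    using w by (auto simp: solves_integral_equation_def)
  have sm: "smooth_on UNIV (w 1)"
    by (rule smooth_on_of_family[of "{0..1}"]) (use wk in \<open>auto simp: smooth_family_def\<close>)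
  have wcz: "continuous_on {0..1} (\<lambda>s. w s (t, x))" for t x
    by (rule continuous_on_fix_param[OF wc]) auto
  have fwc: "continuous_on {0..1} (\<lambda>s. t *\<^sub>R f (w s (t, x)))" for t x
    by (intro continuous_on_scaleR continuous_on_const)
      (rule continuous_on_compose2[OF smooth_on_imp_continuous_on[OF f] wcz], simp)
  \<comment> \<open>Slowing the solution for \<open>t\<close> down by the factor \<open>s\<close>
    gives a solution for \<open>s * t\<close>, and uniqueness identifies the two.\<close>
  have scale: "w s (t, x) = w 1 (s * t, x)" if s: "s \<in> {0..1}" for s t x
  proof -
    have mem: "s * r \<in> {0..1}" if "r \<in> {0..1}" for r using s that by (auto simp: mult_le_one)
    have "(\<lambda>r. w (s * r) (t, x)) 1 = w 1 (s * t, x)"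
    proof (rule solves_integral_equation_unique[OF Ck_family_continuous[OF F] Fl w])
      show "continuous_on {0..1} (\<lambda>r. w (s * r) (t, x))"
        by (rule continuous_on_compose2[OF wcz, of _ "\<lambda>r. s * r"], intro continuous_intros) (use mem in blast)
      fix r :: real assume r: "r \<in> {0..1}"
      have sub: "{0..s * r} \<subseteq> {0..1}" using mem[OF r] by auto
      have "w (s * r) (t, x) = x + integral {0..s * r} (\<lambda>\<rho>. t *\<^sub>R f (w \<rho> (t, x)))"
        by (rule we[OF mem[OF r]])
      also have "integral {0..s * r} (\<lambda>\<rho>. t *\<^sub>R f (w \<rho> (t, x)))
          = (s * r) *\<^sub>R integral {0..1} (\<lambda>\<rho>. t *\<^sub>R f (w (s * r * \<rho>) (t, x)))"
        by (rule integral_rescale[OF continuous_on_subset[OF fwc sub]]) (use s r in auto)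
      also have "\<dots> = r *\<^sub>R integral {0..1} (\<lambda>\<rho>. (s * t) *\<^sub>R f (w (s * (r * \<rho>)) (t, x)))"
        by (simp add: mult_ac)
      also have "\<dots> = integral {0..r} (\<lambda>\<rho>. (s * t) *\<^sub>R f (w (s * \<rho>) (t, x)))"
      proof (rule integral_rescale[symmetric])
        have "continuous_on {0..r} (\<lambda>\<rho>. s * \<rho>)" by (intro continuous_intros)
        from continuous_on_compose2[OF wcz this] have "continuous_on {0..r} (\<lambda>\<rho>. w (s * \<rho>) (t, x))"
          using mem r by force
        then have "continuous_on {0..r} (\<lambda>\<rho>. f (w (s * \<rho>) (t, x)))"
          by (rule continuous_on_compose2[OF smooth_on_imp_continuous_on[OF f]]) simp
        then show "continuous_on {0..r} (\<lambda>\<rho>. (s * t) *\<^sub>R f (w (s * \<rho>) (t, x)))"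
          by (intro continuous_on_scaleR continuous_on_const)
      qed (use r in auto)
      finally show "w (s * r) (t, x) = snd (s * t, x) + integral {0..r} (\<lambda>\<rho>. ?F \<rho> ((s * t, x), w (s * \<rho>) (t, x)))"
        by simp
    qed simp
    then show ?thesis by simp
  qed
  have hd: "(w 1 has_derivative frechet_derivative (w 1) (at z)) (at z)" for z
    using smooth_on_has_derivative[OF sm] by simp
  \<comment> \<open>The equation for the parameter 2t is read at s = 1/2, an interior point of
    {0..1}; reading the one for t at s = 1 would give a one-sided derivative.\<close>
  have D: "frechet_derivative (w 1) (at (t, x)) (1, 0) = f (w 1 (t, x))" if t: "t \<noteq> 0" for t x
  proof -
    have "((\<lambda>s. integral {0..s} (\<lambda>r. (2 * t) *\<^sub>R f (w r (2 * t, x)))) has_vector_derivative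
        (2 * t) *\<^sub>R f (w (1/2) (2 * t, x))) (at (1/2) within {0..1})"
      by (rule integral_has_vector_derivative[OF fwc]) simp
    from has_vector_derivative_add[OF has_vector_derivative_const[of x] this] have "((\<lambda>s. x + integral {0..s} (\<lambda>r. (2 * t) *\<^sub>R f (w r (2 * t, x)))) has_vector_derivative
        (2 * t) *\<^sub>R f (w (1/2) (2 * t, x))) (at (1/2) within {0..1})"
      by (simp only: add_0_left)
    then have "((\<lambda>s. w 1 (s * (2 * t), x)) has_vector_derivative
        (2 * t) *\<^sub>R f (w (1/2) (2 * t, x))) (at (1/2) within {0..1})"
    proof (rule has_vector_derivative_transform[rotated 2])
      show "w 1 (s * (2 * t), x) = x + integral {0..s} (\<lambda>r. (2 * t) *\<^sub>R f (w r (2 * t, x)))" if "s \<in> {0..1}" for s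
        using we[OF that, of "2 * t" x] scale[OF that, of "2 * t" x] by simp
    qed simp
    moreover have "at (1/2::real) within {0..1} = at (1/2)"
      by (rule at_within_interior) (simp add: interior_atLeastAtMost_real)
    ultimately have 1: "((\<lambda>s. w 1 (s * (2 * t), x)) has_vector_derivative (2 * t) *\<^sub>R f (w 1 (t, x))) (at (1/2))"
      using scale[of "1/2" "2 * t" x] by simp
    have "((\<lambda>s. w 1 (s * (2 * t), x)) has_derivative
        (\<lambda>h. frechet_derivative (w 1) (at ((1/2) * (2 * t), x)) (h * (2 * t), 0))) (at (1/2))"
      by (rule has_derivative_compose[OF _ hd]) (auto intro!: derivative_eq_intros)
    moreover have "frechet_derivative (w 1) (at (t, x)) (h * (2 * t), 0) = h *\<^sub>R ((2 * t) *\<^sub>R frechet_derivative (w 1) (at (t, x)) (1, 0))" for h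
      using linear_scale[OF has_derivative_linear[OF hd[of "(t, x)"]], of "h * (2 * t)" "(1, 0)"] by simp
    ultimately have 2: "((\<lambda>s. w 1 (s * (2 * t), x)) has_vector_derivative
        (2 * t) *\<^sub>R frechet_derivative (w 1) (at (t, x)) (1, 0)) (at (1/2))"
      by (simp add: has_vector_derivative_def)
    from vector_derivative_unique_at[OF 1 2] show ?thesis using t by simp
  qed
  \<comment> \<open>At t = 0 the rescaling carries no information, and the identity follows from t
    \<noteq> 0 by continuity.\<close>
  have D0: "frechet_derivative (w 1) (at (0, x)) (1, 0) = f (w 1 (0, x))" for x
  proof -
    let ?d = "\<lambda>t. frechet_derivative (w 1) (at (t, x)) (1, 0) - f (w 1 (t, x))"
    have "continuous_on UNIV ?d"
    proof (rule continuous_on_diff)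
      show "continuous_on UNIV (\<lambda>t. frechet_derivative (w 1) (at (t, x)) (1, 0))"
        by (rule continuous_on_compose2[OF smooth_on_imp_continuous_on[OF smooth_on_derivative[OF sm]]])
          (auto intro!: continuous_intros)
      show "continuous_on UNIV (\<lambda>t. f (w 1 (t, x)))"
        by (rule continuous_on_compose2[OF smooth_on_imp_continuous_on[OF f]
              continuous_on_compose2[OF smooth_on_imp_continuous_on[OF sm]]])
          (auto intro!: continuous_intros)
    qed
    then have "(?d \<longlongrightarrow> ?d 0) (at 0)"
      by (simp add: continuous_on_eq_continuous_at isCont_def)
    moreover have "(?d \<longlongrightarrow> 0) (at 0)"
      by (rule tendsto_eventually) (auto simp: eventually_at_filter D)
    ultimately have "?d 0 = 0" using tendsto_unique[OF trivial_limit_at] by blast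
    then show ?thesis by simp
  qed
  show ?thesis
  proof (intro exI[of _ "w 1"] conjI allI sm)
    show "w 1 (0, x) = x" for x using we[of 1 0 x] by simp
    show "frechet_derivative (w 1) (at (t, x)) (1, 0) = f (w 1 (t, x))" for t x
      using D D0 by (cases "t = 0") auto
  qed
qed

section \<open>Inverse functions and straightening of vector fields\<close>

definition smooth_diffeo ::
    "'a::real_normed_vector set \<Rightarrow> 'b::real_normed_vector set \<Rightarrow> ('a \<Rightarrow> 'b) \<Rightarrow> ('b \<Rightarrow> 'a) \<Rightarrow> bool" where
  "smooth_diffeo U V f h \<longleftrightarrow> open U \<and> open V \<and> homeomorphism U V f h \<and> smooth_on U f \<and> smooth_on V h"

lemma smooth_on_prod:
  fixes f :: "'i \<Rightarrow> 'a::real_normed_vector \<Rightarrow> real"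
  assumes "open S" "\<And>i. i \<in> I \<Longrightarrow> smooth_on S (f i)"
  shows "smooth_on S (\<lambda>x. \<Prod>i\<in>I. f i x)"
  using assms(2)
  by (induction I rule: infinite_finite_induct) (auto intro!: smooth_on_mult[OF assms(1)])

lemma smooth_on_det:
  fixes A :: "'a::real_normed_vector \<Rightarrow> real^'n^'n"
  assumes "open S" "\<And>i j. smooth_on S (\<lambda>x. A x $ i $ j)"
  shows "smooth_on S (\<lambda>x. det (A x))"
  unfolding det_def
  by (intro smooth_on_sum[OF assms(1)] smooth_on_mult[OF assms(1)] smooth_on_prod[OF assms(1)]
      smooth_on_const assms(2))

lemma matrix_inv_left_right:
  fixes A :: "real^'n^'n"
  assumes "det A \<noteq> 0"
  shows "A ** matrix_inv A = mat 1" "matrix_inv A ** A = mat 1"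
proof -
  have "\<exists>B. A ** B = mat 1 \<and> B ** A = mat 1"
    using assms invertible_det_nz[of A] by (simp add: invertible_def)
  from someI_ex[OF this] show "A ** matrix_inv A = mat 1" "matrix_inv A ** A = mat 1"
    by (auto simp: matrix_inv_def)
qed

lemma matrix_inv_mult_vector:
  fixes A :: "real^'n^'n"
  assumes "det A \<noteq> 0"
  shows "A *v (matrix_inv A *v b) = b" "matrix_inv A *v (A *v b) = b"
  by (simp_all add: matrix_vector_mul_assoc matrix_inv_left_right[OF assms])

text \<open>Cramer's rule writes the components as quotients of determinants, which are polynomial
  in the entries.\<close>

lemma smooth_on_matrix_inv_mult:
  fixes A :: "'a::real_normed_vector \<Rightarrow> real^'n^'n"
  assumes S: "open S" and A: "\<And>i j. smooth_on S (\<lambda>x. A x $ i $ j)" and b: "smooth_on S b"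
    and d: "\<And>x. x \<in> S \<Longrightarrow> det (A x) \<noteq> 0"
  shows "smooth_on S (\<lambda>x. matrix_inv (A x) *v b x)"
proof (rule smooth_on_cong[OF S])
  show "smooth_on S (\<lambda>x. \<chi> k. det (\<chi> i j. if j = k then b x $ i else A x $ i $ j) / det (A x))"
  proof (intro smooth_on_vec_lambda[OF S] smooth_on_divide[OF S] smooth_on_det[OF S])
    show "smooth_on S (\<lambda>x. (\<chi> i j. if j = k then b x $ i else A x $ i $ j) $ i $ j)" for i j k
      using A[of i j] smooth_on_vec_nth[OF S b, of i] by (cases "j = k") auto
  qed (use A d in auto)
  show "(\<chi> k. det (\<chi> i j. if j = k then b x $ i else A x $ i $ j) / det (A x)) = matrix_inv (A x) *v b x"
    if "x \<in> S" for x
    using cramer[OF d[OF that], of "matrix_inv (A x) *v b x" "b x"] matrix_inv_mult_vector[OF d[OF that]]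
    by simp
qed

text \<open>The derivative of \<open>g\<close> at y is the inverse of the derivative of
  \<open>f\<close> at g(y). It is of class k whenever \<open>g\<close> is, so the class of
  \<open>g\<close> rises by one at each step of an induction.\<close>

lemma smooth_on_inverse_function:
  fixes f :: "real^'n \<Rightarrow> real^'n"
  assumes U: "open U" "smooth_on U f" and V: "open V" and g: "\<And>y. y \<in> V \<Longrightarrow> g y \<in> U"
    and dg: "\<And>y. y \<in> V \<Longrightarrow> (g has_derivative g' y) (at y)"
    and inv: "\<And>y v. y \<in> V \<Longrightarrow> frechet_derivative f (at (g y)) (g' y v) = v"
    and bij: "\<And>x. x \<in> U \<Longrightarrow> inj (frechet_derivative f (at x))"
  shows "smooth_on V g"
proof -
  define A where "A x = matrix (frechet_derivative f (at x))" for x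
  have lin: "linear (frechet_derivative f (at x))" if "x \<in> U" for x
    using smooth_on_has_derivative[OF U(2) that] by (rule has_derivative_linear)
  have det: "det (A x) \<noteq> 0" if "x \<in> U" for x
    using det_nz_iff_inj[OF lin[OF that]] bij[OF that] by (simp add: A_def)
  have Av: "A x *v v = frechet_derivative f (at x) v" if "x \<in> U" for x v
    using matrix_vector_mul(2)[OF lin[OF that]] by (metis A_def)
  have h: "smooth_on U (\<lambda>x. matrix_inv (A x) *v v)" for v
  proof (rule smooth_on_matrix_inv_mult[OF U(1) _ smooth_on_const det])
    show "smooth_on U (\<lambda>x. A x $ i $ j)" for i j
      by (simp add: A_def matrix_def smooth_on_vec_nth[OF U(1) smooth_on_derivative[OF U(2)]])
  qed
  have g': "g' y v = matrix_inv (A (g y)) *v v" if "y \<in> V" for y v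
    using inv[OF that, of v] Av[OF g[OF that]] matrix_inv_mult_vector(2)[OF det[OF g[OF that]], of "g' y v"]
    by simp
  have cg: "continuous_on V g"
    using dg by (meson continuous_at_imp_continuous_on has_derivative_continuous)
  have "Ck_family k {0::real} V (\<lambda>s. g)" for k
  proof (induction k)
    case 0
    then show ?case using Ck_family_of_times_differentiable[of 0 V g] cg by simp
  next
    case (Suc k)
    show ?case
    proof (rule Ck_family_SucI[OF V Ck_family_continuous[OF Suc] dg])
      fix v
      have "Ck_family k {0::real} V (\<lambda>s z. (\<lambda>x. matrix_inv (A x) *v v) (g z))"
        by (rule Ck_family_compose[OF V U(1) _ Suc])
          (use h[of v] g in \<open>auto simp: smooth_on_iff_family smooth_family_def\<close>)
      then show "Ck_family k {0::real} V (\<lambda>s z. g' z v)"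
        by (rule Ck_family_cong[OF V, rotated]) (simp add: g')
    qed
  qed
  then show ?thesis by (simp add: smooth_on_iff_family smooth_family_def)
qed

theorem smooth_inverse_function:
  fixes f :: "real^'n \<Rightarrow> real^'n"
  assumes U: "open U" "smooth_on U f" "x0 \<in> U" and inj: "inj (frechet_derivative f (at x0))"
  obtains U' V g where "U' \<subseteq> U" "x0 \<in> U'" "smooth_diffeo U' V f g"
    "\<And>x. x \<in> U' \<Longrightarrow> inj (frechet_derivative f (at x))"
proof -
  let ?D = "\<lambda>x. frechet_derivative f (at x)"
  have hd: "(f has_derivative ?D x) (at x)" if "x \<in> U" for x
    using smooth_on_has_derivative[OF U(2) that] .
  define f' where "f' x = Blinfun (?D x)" for x
  have app: "blinfun_apply (f' x) = ?D x" if "x \<in> U" for x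
    unfolding f'_def by (rule bounded_linear_Blinfun_apply[OF has_derivative_bounded_linear[OF hd[OF that]]])
  have cont: "continuous_on U f'"
  proof (rule continuous_on_blinfun_componentwise)
    show "continuous_on U (\<lambda>x. f' x i)" for i
      using smooth_on_imp_continuous_on[OF smooth_on_derivative[OF U(2), of i]]
      by (rule continuous_on_eq) (simp add: app)
  qed
  obtain h where h: "linear h" "h \<circ> ?D x0 = id"
    using linear_injective_left_inverse[OF has_derivative_linear[OF hd[OF U(3)]] inj] by blast
  have "Blinfun h o\<^sub>L f' x0 = id_blinfun"
  proof (rule blinfun_eqI)
    fix v
    show "(Blinfun h o\<^sub>L f' x0) v = id_blinfun v"
      using h by (simp add: app[OF U(3)] bounded_linear_Blinfun_apply linear_conv_bounded_linear[symmetric] o_def fun_eq_iff)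
  qed
  from inverse_function_theorem[OF U(1) _ cont U(3) this]
  obtain U' V g g' where G: "open U'" "U' \<subseteq> U" "x0 \<in> U'" "open V" "homeomorphism U' V f g"
    "\<And>y. y \<in> V \<Longrightarrow> (g has_derivative (g' y)) (at y)"
    "\<And>y. y \<in> V \<Longrightarrow> g' y = inv (blinfun_apply (f' (g y)))"
    "\<And>y. y \<in> V \<Longrightarrow> bij (blinfun_apply (f' (g y)))"
    using hd app by metis
  have gU: "g y \<in> U'" if "y \<in> V" for y using G(5) that by (auto simp: homeomorphism_def)
  have bij: "bij (?D (g y))" if "y \<in> V" for y
    using G(8)[OF that] app gU[OF that] G(2) by auto
  have bij': "inj (?D x)" if "x \<in> U'" for x
    using bij[of "f x"] G(5) that by (auto simp: homeomorphism_def bij_def)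
  have "smooth_on V g"
  proof (rule smooth_on_inverse_function[OF G(1) smooth_on_subset[OF U(2) G(2)] G(4) gU G(6)])
    fix y v assume y: "y \<in> V"
    then have "g' y = inv (?D (g y))" using G(7) app gU G(2) by (metis subsetD)
    then show "?D (g y) (g' y v) = v" using bij[OF y] by (simp add: bij_is_surj surj_f_inv_f)
  qed (use bij' in auto)
  then show ?thesis
    using that[of U' V g] G bij' smooth_on_subset[OF U(2) G(2)] by (simp add: smooth_diffeo_def)
qed

lemma smooth_diffeo_derivative_inverse:
  assumes d: "smooth_diffeo U V f h" and y: "y \<in> V"
  shows "frechet_derivative f (at (h y)) (frechet_derivative h (at y) w) = w"
proof -
  have hy: "h y \<in> U" using d y by (auto simp: smooth_diffeo_def homeomorphism_def)
  have "((\<lambda>y. f (h y)) has_derivative (\<lambda>w. frechet_derivative f (at (h y)) (frechet_derivative h (at y) w))) (at y)"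
    using d y hy by (intro has_derivative_compose[OF smooth_on_has_derivative smooth_on_has_derivative])
      (auto simp: smooth_diffeo_def)
  moreover have "((\<lambda>y. f (h y)) has_derivative (\<lambda>w. w)) (at y)"
    by (rule has_derivative_transform_within_open[OF has_derivative_ident, of V])
      (use d y in \<open>auto simp: smooth_diffeo_def homeomorphism_def\<close>)
  ultimately show ?thesis
    using has_derivative_unique by metis
qed

lemma smooth_diffeo_sym: "smooth_diffeo U V f h \<Longrightarrow> smooth_diffeo V U h f"
  by (auto simp: smooth_diffeo_def homeomorphism_symD)

text \<open>The straightening map follows the flow for the time given by coordinate
  \<open>k\<close>, starting on a hyperplane through \<open>x0\<close> transversal to
  \<open>X x0\<close>. Its derivative at 0 is the injective map \<open>T\<close>, so the inverse
  function theorem applies.\<close>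

theorem flow_box:
  fixes X :: "real^'n \<Rightarrow> real^'n" and k :: 'n
  assumes U: "open U" "smooth_on U X" "x0 \<in> U" and X0: "X x0 \<noteq> 0"
  obtains U' V and \<psi> :: "real^'n \<Rightarrow> real^'n" and \<phi> where "smooth_diffeo V U' \<psi> \<phi>" "U' \<subseteq> U" "x0 \<in> U'"
    "\<And>y. y \<in> V \<Longrightarrow> frechet_derivative \<psi> (at y) (axis k 1) = X (\<psi> y)"
proof -
  obtain r h where r: "r > 0" "cball x0 (2 * r) \<subseteq> U" and h: "smooth_on UNIV h"
    "\<And>x. x \<in> cball x0 r \<Longrightarrow> h x = X x" "\<And>x. x \<notin> ball x0 (2 * r) \<Longrightarrow> h x = 0"
    using smooth_cutoff[OF U(1,3,2)] by blast
  obtain L where L: "L \<ge> 0" "\<And>x y. norm (h x - h y) \<le> L * norm (x - y)"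
    using smooth_compact_support_lipschitz[OF h(1,3)] by blast
  obtain \<Phi> :: "real \<times> (real^'n) \<Rightarrow> real^'n" where "smooth_on UNIV \<Phi> \<and> (\<forall>x. \<Phi> (0, x) = x) \<and>
      (\<forall>t x. frechet_derivative \<Phi> (at (t, x)) (1, 0) = h (\<Phi> (t, x)))"
    using smooth_flow[OF h(1) L] ..
  then have \<Phi>: "smooth_on UNIV \<Phi>" "\<And>x. \<Phi> (0, x) = x"
    "\<And>t x. frechet_derivative \<Phi> (at (t, x)) (1, 0) = h (\<Phi> (t, x))"
    by simp_all
  let ?e = "axis k 1 :: real^'n"
  have "norm (norm (X x0) *\<^sub>R ?e) = norm (X x0)" by simp
  \<comment> \<open>An orthogonal map scaled by the length of \<open>X x0\<close> is injective and
    sends the chosen basis vector to \<open>X x0\<close>; its values on the other basis vectors span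
    the hyperplane.\<close>
  then obtain R where R: "orthogonal_transformation R" "R (norm (X x0) *\<^sub>R ?e) = X x0"
    using orthogonal_transformation_exists by blast
  define T where "T v = norm (X x0) *\<^sub>R R v" for v
  have lR: "linear R" using R(1) by (rule orthogonal_transformation_linear)
  have lT: "linear T" unfolding T_def by (rule linear_compose_scale_right[OF lR])
  have Te: "T ?e = X x0" using R(2) by (simp add: T_def linear_scale[OF lR])
  have injT: "v = 0" if "T v = 0" for v
    using that X0 orthogonal_transformation_norm[OF R(1), of v] by (auto simp: T_def)
  define P where "P y = (y $ k, x0 + T (y - (y $ k) *\<^sub>R ?e))" for y
  define P' where "P' w = (w $ k, T (w - (w $ k) *\<^sub>R ?e))" for w
  have bT: "bounded_linear T" using lT by (simp add: linear_linear)
  have bP': "bounded_linear P'"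
    unfolding P'_def[abs_def]
    by (intro bounded_linear_Pair bounded_linear_vec_nth bounded_linear_compose[OF bT] bounded_linear_sub
        bounded_linear_ident bounded_linear_scaleR_const)
  have Pd: "(P has_derivative P') (at y)" for y
  proof -
    have "P = (\<lambda>y. (0, x0) + P' y)" by (simp add: P_def P'_def fun_eq_iff)
    then show ?thesis
      using has_derivative_add[OF has_derivative_const[of "(0, x0)"] bounded_linear_imp_has_derivative[OF bP']]
      by simp
  qed
  define \<Psi> where "\<Psi> y = \<Phi> (P y)" for y
  have Psm: "smooth_on UNIV P"
  proof (rule smooth_on_Suc_by_derivative[OF open_UNIV Pd])
  qed simp
  have \<Psi>sm: "smooth_on UNIV \<Psi>"
    unfolding \<Psi>_def[abs_def] by (rule smooth_on_compose[OF open_UNIV open_UNIV \<Phi>(1) Psm]) simp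
  have \<Phi>d: "(\<Phi> has_derivative frechet_derivative \<Phi> (at z)) (at z)" for z
    using smooth_on_has_derivative[OF \<Phi>(1)] by simp
  have \<Psi>d: "frechet_derivative \<Psi> (at y) w = frechet_derivative \<Phi> (at (P y)) (P' w)" for y w
    using frechet_derivative_at[OF has_derivative_compose[OF Pd \<Phi>d, of y]] by (simp add: \<Psi>_def[abs_def] fun_eq_iff)
  have P0: "P 0 = (0, x0)" using linear_0[OF lT] by (simp add: P_def)
  have \<Psi>0: "\<Psi> 0 = x0" by (simp add: \<Psi>_def P0 \<Phi>(2))
  have d0: "frechet_derivative \<Phi> (at (0, x)) (0, \<xi>) = \<xi>" for x \<xi>
  proof -
    have "((\<lambda>x. \<Phi> (0, x)) has_derivative (\<lambda>\<xi>. frechet_derivative \<Phi> (at (0, x)) (0, \<xi>))) (at x)"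
      by (rule has_derivative_compose[OF _ \<Phi>d]) (auto intro!: derivative_eq_intros)
    moreover have "((\<lambda>x. \<Phi> (0, x)) has_derivative (\<lambda>\<xi>. \<xi>)) (at x)"
      by (simp add: \<Phi>(2))
    ultimately show ?thesis using has_derivative_unique by metis
  qed
  have D0: "frechet_derivative \<Psi> (at 0) w = T w" for w
  proof -
    have lin: "linear (frechet_derivative \<Phi> (at (0, x0)))" by (rule has_derivative_linear[OF \<Phi>d])
    have "frechet_derivative \<Psi> (at 0) w
        = frechet_derivative \<Phi> (at (0, x0)) ((w $ k) *\<^sub>R (1, 0) + (0, T (w - (w $ k) *\<^sub>R ?e)))"
      by (simp add: \<Psi>d P0 P'_def)
    also have "\<dots> = (w $ k) *\<^sub>R h x0 + T (w - (w $ k) *\<^sub>R ?e)"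
      using \<Phi>(2,3) by (simp only: linear_add[OF lin] linear_scale[OF lin] d0)
    also have "\<dots> = T w"
      using h(2)[of x0] r(1) by (simp add: linear_diff[OF lT] linear_scale[OF lT] Te)
    finally show ?thesis .
  qed
  \<comment> \<open>On this preimage the flow lands in the ball on which the cut-off field agrees
    with \<open>X\<close>.\<close>
  define U1 where "U1 = \<Psi> -` ball x0 r"
  have U1: "open U1" unfolding U1_def
    by (rule open_vimage[OF open_ball smooth_on_imp_continuous_on[OF \<Psi>sm]])
  have "inj (frechet_derivative \<Psi> (at 0))"
    using injT linear_injective_0[OF lT] by (simp add: D0[abs_def])
  moreover have "0 \<in> U1" using r(1) by (simp add: U1_def \<Psi>0)
  moreover have "smooth_on U1 \<Psi>" using smooth_on_subset[OF \<Psi>sm] by simp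
  ultimately obtain V U' \<phi> where V: "V \<subseteq> U1" "0 \<in> V" "smooth_diffeo V U' \<Psi> \<phi>"
    using smooth_inverse_function[OF U1] by metis
  show ?thesis
  proof (rule that[OF V(3)])
    have U': "U' = \<Psi> ` V" using V(3) by (auto simp: smooth_diffeo_def homeomorphism_def)
    then have "U' \<subseteq> ball x0 r" using V(1) by (auto simp: U1_def)
    moreover have "ball x0 r \<subseteq> cball x0 (2 * r)" using r(1) by auto
    ultimately show "U' \<subseteq> U" using r(2) by blast
    show "x0 \<in> U'" using U' V(2) \<Psi>0 by force
    show "frechet_derivative \<Psi> (at y) ?e = X (\<Psi> y)" if "y \<in> V" for y
    proof -
      have "P' ?e = (1, 0)" using linear_0[OF lT] by (simp add: P'_def)
      then have "frechet_derivative \<Psi> (at y) ?e = h (\<Psi> y)"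
        using \<Phi>(3)[of "fst (P y)" "snd (P y)"] by (simp add: \<Psi>d \<Psi>_def)
      also have "\<dots> = X (\<Psi> y)" using V(1) that by (intro h(2)) (auto simp: U1_def)
      finally show ?thesis .
    qed
  qed
qed

section \<open>Charts of a smooth manifold\<close>

locale smooth_mfd =
  fixes M :: "'a topology" and A :: "('a, 'n::finite) chart set"
  assumes smooth_manifold: "smooth_manifold M A"
begin

lemma is_chart: "c \<in> A \<Longrightarrow> is_chart M c"
  and compatible: "c \<in> A \<Longrightarrow> d \<in> A \<Longrightarrow> compatible c d"
  and covers: "(\<Union>c\<in>A. fst c) = topspace M"
  and maximal: "max_atlas M A \<subseteq> A"
  and Hausdorff: "Hausdorff_space M" and connected: "connected_space M"
  and nonempty: "topspace M \<noteq> {}"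
  using smooth_manifold by (auto simp: smooth_manifold_def)

lemma openin_domain: "c \<in> A \<Longrightarrow> openin M (fst c)"
  and open_img: "c \<in> A \<Longrightarrow> open (img c)"
  and homeomorphic_chart: "c \<in> A \<Longrightarrow> homeomorphic_map (subtopology M (fst c)) (top_of_set (img c)) (snd c)"
  using is_chart by (auto simp: is_chart_def)

lemma domain_subset: "c \<in> A \<Longrightarrow> fst c \<subseteq> topspace M"
  using openin_domain openin_subset by blast

lemma topspace_domain: "c \<in> A \<Longrightarrow> topspace (subtopology M (fst c)) = fst c"
  using domain_subset[of c] by auto

lemma inj_on_chart: "c \<in> A \<Longrightarrow> inj_on (snd c) (fst c)"
  using homeomorphic_chart[of c] topspace_domain[of c] by (metis homeomorphic_imp_injective_map)

lemma param_chart [simp]: "c \<in> A \<Longrightarrow> m \<in> fst c \<Longrightarrow> param c (snd c m) = m"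
  unfolding param_def using inj_on_chart by (rule inv_into_f_f)

lemma chart_param [simp]: "x \<in> img c \<Longrightarrow> snd c (param c x) = x"
  unfolding param_def img_def by (rule f_inv_into_f)

lemma param_in_domain [simp]: "x \<in> img c \<Longrightarrow> param c x \<in> fst c"
  unfolding param_def img_def by (rule inv_into_into)

lemma chart_in_img [simp]: "m \<in> fst c \<Longrightarrow> snd c m \<in> img c"
  by (auto simp: img_def)

lemma overlap_iff: "c \<in> A \<Longrightarrow> x \<in> overlap c d \<longleftrightarrow> x \<in> img c \<and> param c x \<in> fst d"
proof
  assume c: "c \<in> A" and "x \<in> overlap c d"
  then obtain m where "m \<in> fst c" "m \<in> fst d" "x = snd c m" by (auto simp: overlap_def)
  then show "x \<in> img c \<and> param c x \<in> fst d" using c by simp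
next
  assume "c \<in> A" "x \<in> img c \<and> param c x \<in> fst d"
  then show "x \<in> overlap c d"
    unfolding overlap_def by (intro image_eqI[of _ _ "param c x"]) auto
qed

lemma overlap_self: "c \<in> A \<Longrightarrow> overlap c c = img c"
  by (auto simp: overlap_def img_def)

lemma transition_eq: "transition c d x = snd d (param c x)"
  by (simp add: transition_def)

lemma transition_in_overlap:
  "c \<in> A \<Longrightarrow> d \<in> A \<Longrightarrow> x \<in> overlap c d \<Longrightarrow> transition c d x \<in> overlap d c"
  by (auto simp: overlap_iff transition_eq)

lemma transition_in_img: "c \<in> A \<Longrightarrow> d \<in> A \<Longrightarrow> x \<in> overlap c d \<Longrightarrow> transition c d x \<in> img d"
  by (auto simp: overlap_iff transition_eq)

lemma param_transition: "c \<in> A \<Longrightarrow> d \<in> A \<Longrightarrow> x \<in> overlap c d \<Longrightarrow> param d (transition c d x) = param c x"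
  by (auto simp: overlap_iff transition_eq)

lemma transition_inverse:
  "c \<in> A \<Longrightarrow> d \<in> A \<Longrightarrow> x \<in> overlap c d \<Longrightarrow> transition d c (transition c d x) = x"
  by (auto simp: overlap_iff transition_eq)

lemma transition_trans:
  "c \<in> A \<Longrightarrow> d \<in> A \<Longrightarrow> x \<in> overlap c d \<Longrightarrow> transition d e (transition c d x) = transition c e x"
  by (auto simp: overlap_iff transition_eq)

lemma open_chart_image:
  assumes "c \<in> A" "openin M U" "U \<subseteq> fst c"
  shows "open (snd c ` U)"
proof -
  have "openin (subtopology M (fst c)) U"
    using assms openin_subtopology by (metis Int_absorb2)
  then have "openin (top_of_set (img c)) (snd c ` U)"
    using homeomorphic_imp_open_map[OF homeomorphic_chart[OF assms(1)]] by (auto simp: open_map_def)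
  then show ?thesis using open_img[OF assms(1)] by (metis openin_open_eq)
qed

lemma open_overlap: "c \<in> A \<Longrightarrow> d \<in> A \<Longrightarrow> open (overlap c d)"
  unfolding overlap_def using openin_domain[of c] openin_domain[of d] by (intro open_chart_image) auto

lemma continuous_map_chart: "c \<in> A \<Longrightarrow> continuous_map (subtopology M (fst c)) euclidean (snd c)"
  using homeomorphic_imp_continuous_map[OF homeomorphic_chart] by (simp add: continuous_map_in_subtopology)

lemma continuous_map_param: "c \<in> A \<Longrightarrow> continuous_map (top_of_set (img c)) M (param c)"
proof -
  assume c: "c \<in> A"
  obtain g where g: "homeomorphic_maps (subtopology M (fst c)) (top_of_set (img c)) (snd c) g"
    using homeomorphic_chart[OF c] homeomorphic_map_maps by blast
  then have "continuous_map (top_of_set (img c)) (subtopology M (fst c)) g"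
    by (simp add: homeomorphic_maps_def)
  moreover have "g x = param c x" if "x \<in> img c" for x
    using g that c param_chart[OF c] topspace_domain[OF c]
    by (metis chart_param homeomorphic_maps_def param_in_domain)
  ultimately have "continuous_map (top_of_set (img c)) (subtopology M (fst c)) (param c)"
    by (rule continuous_map_eq) simp
  then show ?thesis by (simp add: continuous_map_in_subtopology)
qed

lemma openin_param_image:
  assumes c: "c \<in> A" and "open U" "U \<subseteq> img c"
  shows "openin M (param c ` U)"
proof -
  have "param c ` U = {m \<in> topspace (subtopology M (fst c)). snd c m \<in> U}"
  proof (safe, goal_cases)
    case (2 x) then show ?case using assms topspace_domain[OF c] by auto
  next
    case (3 m) then show ?case using assms topspace_domain[OF c]
      by (intro image_eqI[of _ _ "snd c m"]) auto
  qed (use assms topspace_domain[OF c] in auto)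
  moreover have "openin (subtopology M (fst c)) {m \<in> topspace (subtopology M (fst c)). snd c m \<in> U}"
    using continuous_map_chart[OF c] assms(2) by (auto simp: continuous_map_def)
  ultimately show ?thesis
    using openin_trans_full[OF _ openin_domain[OF c]] by simp
qed

lemma smooth_on_transition: "c \<in> A \<Longrightarrow> d \<in> A \<Longrightarrow> smooth_on (overlap c d) (transition c d)"
  using compatible by (auto simp: compatible_def)

lemma transition_has_derivative:
  "c \<in> A \<Longrightarrow> d \<in> A \<Longrightarrow> x \<in> overlap c d \<Longrightarrow> (transition c d has_derivative jac c d x) (at x)"
  unfolding jac_def by (rule smooth_on_has_derivative[OF smooth_on_transition])

lemma linear_jac: "c \<in> A \<Longrightarrow> d \<in> A \<Longrightarrow> x \<in> overlap c d \<Longrightarrow> linear (jac c d x)"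
  using transition_has_derivative has_derivative_linear by blast

lemma jac_trans:
  assumes "c \<in> A" "d \<in> A" "e \<in> A" "x \<in> overlap c d" "x \<in> overlap c e"
  shows "jac d e (transition c d x) (jac c d x u) = jac c e x u"
proof -
  have o: "transition c d x \<in> overlap d e"
    using assms by (auto simp: overlap_iff transition_eq)
  have "((\<lambda>x. transition d e (transition c d x)) has_derivative
      (\<lambda>u. jac d e (transition c d x) (jac c d x u))) (at x)"
    by (rule has_derivative_compose[OF transition_has_derivative transition_has_derivative[OF _ _ o]])
      (use assms in auto)
  then have "(transition c e has_derivative (\<lambda>u. jac d e (transition c d x) (jac c d x u))) (at x)"
    by (rule has_derivative_transform_within_open[OF _ open_overlap[OF assms(1,2)] assms(4)])
      (use assms transition_trans in auto)
  then show ?thesis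
    using has_derivative_unique[OF _ transition_has_derivative[OF assms(1,3,5)]] by metis
qed

lemma jac_self: "c \<in> A \<Longrightarrow> x \<in> img c \<Longrightarrow> jac c c x u = u"
proof -
  assume c: "c \<in> A" "x \<in> img c"
  have "((\<lambda>x. x) has_derivative (\<lambda>u. u)) (at x)" by (rule has_derivative_ident)
  then have "(transition c c has_derivative (\<lambda>u. u)) (at x)"
    by (rule has_derivative_transform_within_open[OF _ open_img[OF c(1)] c(2)])
      (simp add: transition_eq)
  then show ?thesis
    using has_derivative_unique[OF _ transition_has_derivative[OF c(1,1)]] c overlap_self by metis
qed

lemma jac_inverse:
  assumes "c \<in> A" "d \<in> A" "x \<in> overlap c d"
  shows "jac d c (transition c d x) (jac c d x u) = u"
  using jac_trans[OF assms(1,2,1,3)] assms overlap_self jac_self by (simp add: overlap_iff)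

lemma jac_inverse':
  assumes "c \<in> A" "d \<in> A" "x \<in> overlap c d"
  shows "jac c d x (jac d c (transition c d x) u) = u"
  using jac_inverse[OF assms(2,1) transition_in_overlap[OF assms]] transition_inverse[OF assms] by simp

lemma in_some_chart:
  assumes "m \<in> topspace M"
  obtains c where "c \<in> A" "m \<in> fst c"
  using covers assms by blast

lemma smooth_on_jac: "c \<in> A \<Longrightarrow> d \<in> A \<Longrightarrow> smooth_on (overlap c d) (\<lambda>x. jac c d x u)"
  unfolding jac_def by (rule smooth_on_derivative[OF smooth_on_transition])

text \<open>A diffeomorphism of an open part of a chart image, composed with the chart, is
  compatible with all of \<open>A\<close>, and by maximality the result belongs to \<open>A\<close>.
  Every change of coordinates below is carried out through this lemma.\<close>

lemma new_chart:
  assumes c: "c \<in> A" and f: "smooth_diffeo U V f h" and U: "U \<subseteq> img c"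
  obtains d where "d \<in> A" "fst d = param c ` U" "img d = V" "overlap c d = U"
    "\<And>x. x \<in> U \<Longrightarrow> transition c d x = f x" "\<And>x. x \<in> U \<Longrightarrow> jac c d x = frechet_derivative f (at x)"
proof -
  have f': "open U" "open V" "\<And>x. x \<in> U \<Longrightarrow> h (f x) = x" "f ` U = V" "\<And>y. y \<in> V \<Longrightarrow> f (h y) = y" "h ` V = U"
    "smooth_on U f" "smooth_on V h" "continuous_on U f" "continuous_on V h"
    using f by (auto simp: smooth_diffeo_def homeomorphism_def)
  define d where "d = (param c ` U, f \<circ> snd c)"
  have dom: "fst d = param c ` U" by (simp add: d_def)
  have sc: "snd c (param c x) = x" if "x \<in> U" for x using that U by auto
  have im: "img d = V"
    using f'(4) by (auto simp: img_def d_def image_image sc cong: image_cong)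
  have domc: "fst d \<subseteq> fst c" using U by (auto simp: dom)
  have cs: "snd c ` fst d = U" by (auto simp: dom image_image sc cong: image_cong)
  have par: "param d y = param c (h y)" if y: "y \<in> V" for y
  proof -
    have hy: "h y \<in> U" using f'(6) y by auto
    have "inj_on (snd d) (fst d)"
    proof (rule inj_onI)
      fix m m' assume m: "m \<in> fst d" "m' \<in> fst d" "snd d m = snd d m'"
      then have "snd c m = snd c m'" using f'(3) cs by (metis comp_apply d_def imageI snd_conv)
      then show "m = m'" using inj_on_chart[OF c] m domc by (meson inj_onD subsetD)
    qed
    moreover have "snd d (param c (h y)) = y" using hy f'(5)[OF y] by (simp add: d_def sc)
    moreover have "param c (h y) \<in> fst d" using hy by (simp add: dom)
    ultimately show ?thesis unfolding param_def[of d] by (metis inv_into_f_f)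
  qed
  have op: "openin M (fst d)" unfolding dom by (rule openin_param_image[OF c f'(1) U])
  have "homeomorphic_maps (subtopology M (fst d)) (top_of_set (img d)) (snd d) (param c \<circ> h)"
    unfolding homeomorphic_maps_def
  proof (intro conjI ballI)
    have "continuous_map (subtopology M (fst d)) euclidean (snd c)"
      using continuous_map_from_subtopology_mono[OF continuous_map_chart[OF c] domc] .
    then have "continuous_map (subtopology M (fst d)) (top_of_set U) (snd c)"
      using cs by (auto simp: continuous_map_in_subtopology)
    moreover have "continuous_map (top_of_set U) (top_of_set V) f"
      using f'(4,9) by (auto simp: continuous_map_in_subtopology)
    ultimately have "continuous_map (subtopology M (fst d)) (top_of_set V) (f \<circ> snd c)"
      by (rule continuous_map_compose)
    then show "continuous_map (subtopology M (fst d)) (top_of_set (img d)) (snd d)"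
      by (simp add: im) (simp add: d_def)
    have "continuous_map (top_of_set V) (top_of_set (img c)) h"
      using f'(6,10) U by (auto simp: continuous_map_in_subtopology)
    then have "continuous_map (top_of_set V) M (param c \<circ> h)"
      using continuous_map_param[OF c] by (rule continuous_map_compose)
    then show "continuous_map (top_of_set (img d)) (subtopology M (fst d)) (param c \<circ> h)"
      using f'(6) by (auto simp: continuous_map_in_subtopology im dom)
  next
    fix m assume "m \<in> topspace (subtopology M (fst d))"
    then obtain x where x: "m = param c x" "x \<in> U" by (auto simp: dom)
    then show "(param c \<circ> h) (snd d m) = m" by (simp add: d_def sc f'(3))
  next
    fix y assume "y \<in> topspace (top_of_set (img d))"
    then have "y \<in> V" by (simp add: im)
    then have "h y \<in> U" using f'(6) by auto
    then show "snd d ((param c \<circ> h) y) = y" using f'(5)[OF \<open>y \<in> V\<close>] by (simp add: d_def sc)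
  qed
  then have "is_chart M d"
    unfolding is_chart_def using op f'(2) im homeomorphic_maps_imp_map by fastforce
  moreover have "compatible d e" if e: "e \<in> A" for e
    unfolding compatible_def
  proof
    have ov: "overlap d e = {y \<in> V. h y \<in> overlap c e}" (is "_ = ?S")
    proof (intro set_eqI iffI)
      fix y assume "y \<in> overlap d e"
      then obtain m where m: "m \<in> fst d" "m \<in> fst e" "y = snd d m" by (auto simp: overlap_def)
      then have "snd c m \<in> U" using cs by auto
      then have "y \<in> V" "h y = snd c m" using m f'(3,4) by (auto simp: d_def)
      then show "y \<in> ?S" using m domc by (auto simp: overlap_def)
    next
      fix y assume y: "y \<in> ?S"
      then have hy: "h y \<in> U" using f'(6) by auto
      have "param c (h y) \<in> fst d \<inter> fst e" using y hy c by (auto simp: dom overlap_iff)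
      moreover have "snd d (param c (h y)) = y" using hy y f'(5) by (simp add: d_def sc)
      ultimately show "y \<in> overlap d e" unfolding overlap_def by force
    qed
    have opS: "open ?S"
    proof -
      have "?S = V \<inter> h -` overlap c e" by auto
      then show ?thesis
        using continuous_open_preimage[OF f'(10,2) open_overlap[OF c e]] by simp
    qed
    have "smooth_on ?S (\<lambda>y. transition c e (h y))"
      by (rule smooth_on_compose[OF opS open_overlap[OF c e] smooth_on_transition[OF c e] smooth_on_subset[OF f'(8)]]) auto
    then have "smooth_on ?S (transition d e)"
      by (rule smooth_on_cong[OF opS]) (simp add: transition_eq par)
    then show "smooth_on (overlap d e) (transition d e)" by (simp add: ov)
    have ov': "overlap e d = {x \<in> overlap e c. transition e c x \<in> U}" (is "_ = ?R")
    proof (intro set_eqI iffI)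
      fix x assume "x \<in> overlap e d"
      then obtain m where m: "m \<in> fst e" "m \<in> fst d" "x = snd e m" by (auto simp: overlap_def)
      then have "snd c m \<in> U" using cs by auto
      then show "x \<in> ?R" using m domc e by (auto simp: overlap_def transition_eq)
    next
      fix x assume x: "x \<in> ?R"
      then have "snd c (param e x) \<in> U" "param e x \<in> fst c" "x \<in> img e" using e by (auto simp: transition_eq overlap_iff)
      then have "param e x \<in> fst d" using c unfolding dom by (metis imageI param_chart)
      then show "x \<in> overlap e d" using \<open>x \<in> img e\<close> e by (simp add: overlap_iff)
    qed
    have opR: "open ?R"
    proof -
      have "?R = overlap e c \<inter> transition e c -` U" by auto
      then show ?thesis
        using continuous_open_preimage[OF smooth_on_imp_continuous_on[OF smooth_on_transition[OF e c]] open_overlap[OF e c] f'(1)]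
        by simp
    qed
    have "smooth_on ?R (\<lambda>x. f (transition e c x))"
      by (rule smooth_on_compose[OF opR f'(1,7) smooth_on_subset[OF smooth_on_transition[OF e c]]]) auto
    then have "smooth_on ?R (transition e d)"
      by (rule smooth_on_cong[OF opR]) (simp add: transition_eq d_def)
    then show "smooth_on (overlap e d) (transition e d)" by (simp add: ov')
  qed
  ultimately have dA: "d \<in> A" using maximal by (auto simp: max_atlas_def)
  have ov: "overlap c d = U" using domc cs by (auto simp: overlap_def Int_absorb1)
  have tr: "transition c d x = f x" if "x \<in> U" for x using that by (simp add: transition_eq d_def sc)
  have "jac c d x = frechet_derivative f (at x)" if "x \<in> U" for x
    unfolding jac_def by (rule frechet_derivative_cong_open[OF f'(1) that tr])
  then show ?thesis using that[OF dA dom im ov tr] by blast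
qed

lemma vector_field_smooth: "vector_field A X \<Longrightarrow> c \<in> A \<Longrightarrow> smooth_on (img c) (X c)"
  and vector_field_transition: "vector_field A X \<Longrightarrow> c \<in> A \<Longrightarrow> d \<in> A \<Longrightarrow> x \<in> overlap c d \<Longrightarrow>
    X d (transition c d x) = jac c d x (X c x)"
  by (auto simp: vector_field_def)

text \<open>Statements about all fields can thereby be evaluated at single vectors. The field has
  constant components \<open>w\<close> near \<open>x0\<close> in the chart \<open>c\<close>; it is
  cut off there and transported to the other charts by their Jacobians.\<close>

lemma extend_vector:
  assumes c: "c \<in> A" and x0: "x0 \<in> img c"
  obtains X where "vector_field A X" "X c x0 = w"
proof -
  obtain e where e: "e > 0" "cball x0 e \<subseteq> img c"
    using open_img[OF c] x0 open_contains_cball by blast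
  define r where "r = e / 2"
  have r: "r > 0" "cball x0 (2 * r) \<subseteq> img c" using e by (auto simp: r_def)
  obtain b :: "real^'n \<Rightarrow> real" where b: "smooth_on UNIV b" "\<And>x. x \<in> cball x0 r \<Longrightarrow> b x = 1"
    "\<And>x. x \<notin> ball x0 (2 * r) \<Longrightarrow> b x = 0"
    using bump_function[OF r(1)] by blast
  define X where "X d x = (if param d x \<in> fst c then b (transition d c x) *\<^sub>R jac c d (transition d c x) w else 0)" for d x
  define K where "K = param c ` cball x0 (2 * r)"
  \<comment> \<open>A compact set in a Hausdorff space is closed, so its complement is an open set
    on which the field vanishes; this gives smoothness at the points outside the domain of
    \<open>c\<close>.\<close>
  have "compactin M K"
    unfolding K_def using r(2)
    by (intro image_compactin[OF _ continuous_map_param[OF c]]) (simp add: compactin_subtopology)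
  then have K: "closedin M K" by (rule compactin_imp_closedin[OF Hausdorff])
  have "vector_field A X"
    unfolding vector_field_def
  proof (intro conjI ballI)
    fix d assume d: "d \<in> A"
    show "smooth_on (img d) (X d)"
    proof (rule smooth_on_local[OF open_img[OF d]])
      fix x assume x: "x \<in> img d"
      show "\<exists>U. open U \<and> x \<in> U \<and> smooth_on (U \<inter> img d) (X d)"
      proof (cases "param d x \<in> fst c")
        case True
        have op: "open (overlap d c)" by (rule open_overlap[OF d c])
        have 1: "smooth_on (overlap d c) (\<lambda>x. b (transition d c x))"
          by (rule smooth_on_compose[OF op open_UNIV b(1) smooth_on_transition[OF d c]]) simp
        have 2: "smooth_on (overlap d c) (\<lambda>x. jac c d (transition d c x) w)"
          by (rule smooth_on_compose[OF op open_overlap[OF c d] smooth_on_jac[OF c d] smooth_on_transition[OF d c]])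
            (rule transition_in_overlap[OF d c])
        have "smooth_on (overlap d c) (X d)"
          by (rule smooth_on_cong[OF op smooth_on_scaleR[OF op 1 2]]) (simp add: X_def overlap_iff[OF d])
        moreover have "overlap d c \<inter> img d = overlap d c" by (auto simp: overlap_iff[OF d])
        ultimately show ?thesis using True x op by (intro exI[of _ "overlap d c"]) (auto simp: overlap_iff[OF d])
      next
        case False
        define W where "W = snd d ` (fst d - K)"
        have W: "open W" unfolding W_def
          by (rule open_chart_image[OF d openin_diff[OF openin_domain[OF d] K]]) auto
        have zero: "0 = X d y" if y: "y \<in> W" for y
        proof -
          obtain m where m: "y = snd d m" "m \<in> fst d" "m \<notin> K" using y by (auto simp: W_def)
          show ?thesis
          proof (cases "m \<in> fst c")
            case True
            have "snd c m \<notin> cball x0 (2 * r)"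
              using m(3) True c unfolding K_def by (metis imageI param_chart)
            then have "b (transition d c y) = 0" using m d by (intro b(3)) (auto simp: transition_eq)
            then show ?thesis by (simp add: X_def)
          next
            case False
            then show ?thesis using m d by (simp add: X_def)
          qed
        qed
        have "smooth_on W (X d)" by (rule smooth_on_cong[OF W smooth_on_const zero])
        then have "smooth_on (W \<inter> img d) (X d)" by (rule smooth_on_subset) simp
        moreover have "x \<in> W"
        proof -
          have "param d x \<notin> K" using False r(2) by (auto simp: K_def)
          then show ?thesis unfolding W_def using x by (intro image_eqI[of _ _ "param d x"]) auto
        qed
        ultimately show ?thesis using W by blast
      qed
    qed
  next
    fix d1 d2 x assume d: "d1 \<in> A" "d2 \<in> A" "x \<in> overlap d1 d2"
    have p: "param d2 (transition d1 d2 x) = param d1 x" by (rule param_transition[OF d])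
    show "X d2 (transition d1 d2 x) = jac d1 d2 x (X d1 x)"
    proof (cases "param d1 x \<in> fst c")
      case True
      have o: "x \<in> overlap d1 c" using d True by (simp add: overlap_iff)
      have t: "transition d2 c (transition d1 d2 x) = transition d1 c x" by (rule transition_trans[OF d])
      have i: "transition c d1 (transition d1 c x) = x" by (rule transition_inverse[OF d(1) c o])
      have oc: "transition d1 c x \<in> overlap c d1" "transition d1 c x \<in> overlap c d2"
        using d o c by (auto simp: overlap_iff transition_eq)
      have "jac c d2 (transition d1 c x) w = jac d1 d2 x (jac c d1 (transition d1 c x) w)"
        using jac_trans[OF c d(1,2) oc] i by simp
      then show ?thesis
        using True by (simp add: X_def p t linear_scale[OF linear_jac[OF d]])
    next
      case False
      then show ?thesis by (simp add: X_def p linear_0[OF linear_jac[OF d]])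
    qed
  qed
  moreover have "X c x0 = w"
    using x0 c r(1) b(2)[of x0] by (simp add: X_def transition_eq jac_self)
  ultimately show ?thesis by (rule that)
qed

end

section \<open>Symmetry of second derivatives\<close>

text \<open>The increment of \<open>f\<close> along \<open>u\<close> is the integral of its
  \<open>u\<close>-derivative. Differentiating this in direction \<open>v\<close> under the integral
  sign, and then in the length of the segment at 0, produces the two iterated derivatives.\<close>

lemma second_derivative_symmetric_UNIV:
  fixes f :: "'a::euclidean_space \<Rightarrow> 'b::euclidean_space"
  assumes f: "smooth_on UNIV f"
  shows "frechet_derivative (\<lambda>y. frechet_derivative f (at y) u) (at x) v
       = frechet_derivative (\<lambda>y. frechet_derivative f (at y) v) (at x) u"
proof -
  let ?D = "\<lambda>w y. frechet_derivative f (at y) w"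
  let ?DD = "\<lambda>w y. frechet_derivative (?D u) (at y) w"
  have d1: "(f has_derivative (\<lambda>w. ?D w y)) (at y)" for y
    using smooth_on_has_derivative[OF f] by simp
  have d2: "(?D w has_derivative frechet_derivative (?D w) (at y)) (at y)" for w y
    using smooth_on_has_derivative[OF smooth_on_derivative[OF f]] by simp
  have cD: "continuous_on UNIV (?D u)"
    by (rule smooth_on_imp_continuous_on[OF smooth_on_derivative[OF f]])
  have cDD: "continuous_on UNIV (?DD v)"
    by (rule smooth_on_imp_continuous_on[OF smooth_on_derivative[OF smooth_on_derivative[OF f]]])
  have line: "((\<lambda>r. h (a + r *\<^sub>R w)) has_vector_derivative h' (a + r0 *\<^sub>R w) w) (at r0 within S)"
    if "\<And>y. (h has_derivative h' y) (at y)" for h :: "'a \<Rightarrow> 'b" and h' a w r0 S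
  proof -
    have "((\<lambda>r. h (a + r *\<^sub>R w)) has_derivative (\<lambda>t. h' (a + r0 *\<^sub>R w) (t *\<^sub>R w))) (at r0 within S)"
      by (rule has_derivative_compose[OF _ that]) (auto intro!: derivative_eq_intros)
    then show ?thesis
      by (simp add: has_vector_derivative_def linear_scale[OF has_derivative_linear[OF that]])
  qed
  have ftc: "integral {0..s} (\<lambda>r. ?D u (a + r *\<^sub>R u)) = f (a + s *\<^sub>R u) - f a" if "0 \<le> s" for s a
  proof -
    have "((\<lambda>r. ?D u (a + r *\<^sub>R u)) has_integral f (a + s *\<^sub>R u) - f (a + 0 *\<^sub>R u)) {0..s}"
      by (rule fundamental_theorem_of_calculus[OF that]) (rule line[OF d1])
    then show ?thesis by (simp add: integral_unique)
  qed
  have key: "integral {0..s} (\<lambda>r. ?DD v (x + r *\<^sub>R u)) = ?D v (x + s *\<^sub>R u) - ?D v x" if s: "0 \<le> s" for s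
  proof -
    have 1: "((\<lambda>t. integral (cbox 0 s) (\<lambda>r. ?D u ((x + r *\<^sub>R u) + t *\<^sub>R v))) has_vector_derivative
        integral (cbox 0 s) (\<lambda>r. ?DD v ((x + r *\<^sub>R u) + 0 *\<^sub>R v))) (at 0 within UNIV)"
    proof (rule leibniz_rule_vector_derivative[where U = UNIV])
      show "((\<lambda>t. ?D u ((x + r *\<^sub>R u) + t *\<^sub>R v)) has_vector_derivative ?DD v ((x + r *\<^sub>R u) + t *\<^sub>R v)) (at t within UNIV)" for t r
        by (rule line[OF d2])
      have "continuous_on {0..s} (\<lambda>r. ?D u ((x + r *\<^sub>R u) + t *\<^sub>R v))" for t
        by (rule continuous_on_compose2[OF cD]) (auto intro!: continuous_intros)
      then show "(\<lambda>r. ?D u ((x + r *\<^sub>R u) + t *\<^sub>R v)) integrable_on cbox 0 s" for t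
        unfolding cbox_interval by (rule integrable_continuous_real)
      have "continuous_on (UNIV \<times> cbox 0 s) (\<lambda>p. ?DD v ((x + snd p *\<^sub>R u) + fst p *\<^sub>R v))"
        by (rule continuous_on_compose2[OF cDD]) (auto intro!: continuous_intros)
      then show "continuous_on (UNIV \<times> cbox 0 s) (\<lambda>(t, r). ?DD v ((x + r *\<^sub>R u) + t *\<^sub>R v))"
        by (simp add: case_prod_unfold)
    qed auto
    have "integral (cbox 0 s) (\<lambda>r. ?D u ((x + r *\<^sub>R u) + t *\<^sub>R v)) = f ((x + s *\<^sub>R u) + t *\<^sub>R v) - f (x + t *\<^sub>R v)" for t
      using ftc[OF s, of "x + t *\<^sub>R v"] by (simp add: cbox_interval add_ac)
    with 1 have "((\<lambda>t. f ((x + s *\<^sub>R u) + t *\<^sub>R v) - f (x + t *\<^sub>R v)) has_vector_derivative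
        integral {0..s} (\<lambda>r. ?DD v (x + r *\<^sub>R u))) (at 0)"
      by (simp add: cbox_interval)
    moreover have "((\<lambda>t. f ((x + s *\<^sub>R u) + t *\<^sub>R v) - f (x + t *\<^sub>R v)) has_vector_derivative
        ?D v ((x + s *\<^sub>R u) + 0 *\<^sub>R v) - ?D v (x + 0 *\<^sub>R v)) (at 0)"
      by (intro has_vector_derivative_diff line[OF d1])
    ultimately show ?thesis
      using vector_derivative_unique_at by fastforce
  qed
  have "continuous_on {0..1} (\<lambda>r. ?DD v (x + r *\<^sub>R u))"
    by (rule continuous_on_compose2[OF cDD]) (auto intro!: continuous_intros)
  from integral_has_vector_derivative[OF this, of 0]
  have "((\<lambda>s. integral {0..s} (\<lambda>r. ?DD v (x + r *\<^sub>R u))) has_vector_derivative ?DD v x) (at 0 within {0..1})"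
    by simp
  then have "((\<lambda>s. ?D v (x + s *\<^sub>R u) - ?D v x) has_vector_derivative ?DD v x) (at 0 within {0..1})"
    by (rule has_vector_derivative_transform[rotated 2]) (auto simp: key)
  moreover have "((\<lambda>s. ?D v (x + s *\<^sub>R u) - ?D v x) has_vector_derivative
      frechet_derivative (?D v) (at (x + 0 *\<^sub>R u)) u - 0) (at 0 within {0..1})"
    by (intro has_vector_derivative_diff line[OF d2] has_vector_derivative_const)
  ultimately show ?thesis
    using vector_derivative_unique_within_closed_interval[of 0 "1::real" 0 "\<lambda>s. ?D v (x + s *\<^sub>R u) - ?D v x"]
    by (simp add: cbox_interval)
qed

lemma second_derivative_symmetric:
  fixes f :: "'a::euclidean_space \<Rightarrow> 'b::euclidean_space"
  assumes S: "open S" "x \<in> S" "smooth_on S f"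
  shows "frechet_derivative (\<lambda>y. frechet_derivative f (at y) u) (at x) v
       = frechet_derivative (\<lambda>y. frechet_derivative f (at y) v) (at x) u"
proof -
  obtain r h where r: "r > 0" and h: "smooth_on UNIV h" "\<And>y. y \<in> cball x r \<Longrightarrow> h y = f y"
    using smooth_cutoff[OF S] by metis
  have 1: "frechet_derivative h (at y) = frechet_derivative f (at y)" if "y \<in> ball x r" for y
    by (rule frechet_derivative_cong_open[OF open_ball that]) (simp add: h)
  have 2: "frechet_derivative (\<lambda>y. frechet_derivative h (at y) w) (at x)
      = frechet_derivative (\<lambda>y. frechet_derivative f (at y) w) (at x)" for w
    by (rule frechet_derivative_cong_open[of "ball x r"]) (use r 1 in auto)
  show ?thesis
    using second_derivative_symmetric_UNIV[OF h(1)] by (simp add: 2[symmetric])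
qed

section \<open>Lorentzian manifolds and the Levi-Civita connection\<close>

lemma vec_eq_sum_axis: "(x :: real^'n) = (\<Sum>i\<in>UNIV. x $ i *\<^sub>R axis i 1)"
  by (simp add: vec_eq_iff axis_def sum.delta' if_distrib cong: if_cong)

lemma bilinear_expand:
  fixes b :: "real^'n \<Rightarrow> real^'m \<Rightarrow> real"
  assumes b: "bilinear b"
  shows "b u w = (\<Sum>i\<in>UNIV. \<Sum>j\<in>UNIV. u $ i * w $ j * b (axis i 1) (axis j 1))"
proof -
  have "b u w = b (\<Sum>i\<in>UNIV. u $ i *\<^sub>R axis i 1) (\<Sum>j\<in>UNIV. w $ j *\<^sub>R axis j 1)"
    using vec_eq_sum_axis[of u] vec_eq_sum_axis[of w] by simp
  also have "\<dots> = (\<Sum>(i,j)\<in>UNIV \<times> UNIV. b (u $ i *\<^sub>R axis i 1) (w $ j *\<^sub>R axis j 1))"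
    by (rule bilinear_sum[OF b])
  also have "\<dots> = (\<Sum>i\<in>UNIV. \<Sum>j\<in>UNIV. u $ i * w $ j * b (axis i 1) (axis j 1))"
    by (simp add: sum.cartesian_product bilinear_lmul[OF b] bilinear_rmul[OF b] mult.assoc mult.left_commute)
  finally show ?thesis .
qed

locale lorentz_mfd = smooth_mfd M A for M :: "'a topology" and A :: "('a, 'n::finite) chart set" +
  fixes g :: "('a, 'n) form2"
  assumes lorentzian_metric: "lorentzian_metric A g"
begin

lemma g_bilinear: "c \<in> A \<Longrightarrow> x \<in> img c \<Longrightarrow> bilinear (g c x)"
  and g_smooth: "c \<in> A \<Longrightarrow> smooth_on (img c) (\<lambda>x. g c x u w)"
  and g_transition: "c \<in> A \<Longrightarrow> d \<in> A \<Longrightarrow> x \<in> overlap c d \<Longrightarrow>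
    g d (transition c d x) (jac c d x u) (jac c d x w) = g c x u w"
  and g_sym: "c \<in> A \<Longrightarrow> x \<in> img c \<Longrightarrow> g c x u w = g c x w u"
  using lorentzian_metric by (auto simp: lorentzian_metric_def tensor2_def)

lemma orthonormal_frame:
  assumes "c \<in> A" "x \<in> img c"
  obtains e :: "'n \<Rightarrow> real^'n" and k where
    "\<And>i j. g c x (e i) (e j) = (if i \<noteq> j then 0 else if i = k then -1 else 1)"
  using lorentzian_metric assms unfolding lorentzian_metric_def by metis

lemmas g_lin = bilinear_ladd[OF g_bilinear] bilinear_radd[OF g_bilinear] bilinear_lmul[OF g_bilinear]
  bilinear_rmul[OF g_bilinear] bilinear_lneg[OF g_bilinear] bilinear_rneg[OF g_bilinear]
  bilinear_lsub[OF g_bilinear] bilinear_rsub[OF g_bilinear] bilinear_lzero[OF g_bilinear] bilinear_rzero[OF g_bilinear]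

lemma linear_g_right: "c \<in> A \<Longrightarrow> x \<in> img c \<Longrightarrow> linear (g c x u)"
  using g_bilinear by (auto simp: bilinear_def)

lemma g_expand:
  assumes "c \<in> A" "x \<in> img c"
  shows "g c x u w = (\<Sum>i\<in>UNIV. \<Sum>j\<in>UNIV. u $ i * w $ j * g c x (axis i 1) (axis j 1))"
  by (rule bilinear_expand[OF g_bilinear[OF assms]])

lemma g_gram: "c \<in> A \<Longrightarrow> x \<in> img c \<Longrightarrow> g c x u w = u \<bullet> (gram g c x *v w)"
  by (subst g_expand) (auto simp: inner_vec_def gram_def matrix_vector_mult_def sum_distrib_left mult_ac)

text \<open>In an orthonormal frame the Gram matrix is diagonal with determinant -1, and a change of
  basis multiplies the determinant by a square.\<close>

lemma det_gram_neg: 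
  assumes "c \<in> A" "x \<in> img c"
  shows "det (gram g c x) < 0"
proof -
  obtain e :: "'n \<Rightarrow> real^'n" and k
    where e: "\<And>i j. g c x (e i) (e j) = (if i \<noteq> j then 0 else if i = k then -1 else 1)"
    using orthonormal_frame[OF assms] by metis
  define E where "E = (\<chi> i j. e i $ j)"
  have "E ** gram g c x ** transpose E = (\<chi> i j. if i \<noteq> j then 0 else if i = k then -1 else 1)"
  proof -
    have "(E ** (gram g c x ** transpose E)) $ i $ j = e i \<bullet> (gram g c x *v e j)" for i j
      by (simp add: matrix_matrix_mult_def matrix_vector_mult_def transpose_def E_def inner_vec_def)
    then show ?thesis
      using e by (simp add: vec_eq_iff matrix_mul_assoc[symmetric] g_gram[OF assms])
  qed
  moreover have "det ((\<chi> i j. if i \<noteq> j then 0 else if i = k then -1 else 1) :: real^'n^'n) = -1"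
  proof -
    have "det ((\<chi> i j. if i \<noteq> j then 0 else if i = k then -1 else 1) :: real^'n^'n)
      = (\<Prod>i\<in>UNIV. if i = k then -1 else (1::real))"
      by (subst det_diagonal) auto
    also have "\<dots> = -1" by (simp add: prod.delta)
    finally show ?thesis .
  qed
  ultimately have "det (E ** gram g c x ** transpose E) = -1" by simp
  then have "det E * det (gram g c x) * det E = -1"
    by (simp add: det_mul)
  then have "(det E)\<^sup>2 * det (gram g c x) = -1"
    by (simp add: power2_eq_square mult_ac)
  then show ?thesis
    by (smt (verit) mult_nonneg_nonneg zero_le_power2)
qed

lemma det_gram_nonzero: "c \<in> A \<Longrightarrow> x \<in> img c \<Longrightarrow> det (gram g c x) \<noteq> 0"
  using det_gram_neg by (metis less_irrefl)

lemma nondegenerate: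
  assumes "c \<in> A" "x \<in> img c" "\<And>z. g c x u z = g c x w z"
  shows "u = w"
proof -
  have "g c x z (u - w) = 0" for z
    using assms(3)[of z] g_sym[OF assms(1,2)] by (simp add: g_lin[OF assms(1,2)])
  then have "z \<bullet> (gram g c x *v (u - w)) = 0" for z
    by (simp add: g_gram[OF assms(1,2)])
  then have "gram g c x *v (u - w) = 0" by (metis inner_eq_zero_iff)
  then have "u - w = 0"
    using matrix_inv_mult_vector(2)[OF det_gram_nonzero[OF assms(1,2)], of "u - w"] by simp
  then show ?thesis by simp
qed

text \<open>Orthonormality makes the frame independent, hence a basis by counting, and a vector
  orthogonal to a basis is 0 by nondegeneracy.\<close>

lemma frame_nondegenerate:
  fixes e :: "'n \<Rightarrow> real^'n"
  assumes c: "c \<in> A" "x \<in> img c"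
    and e: "\<And>i j. g c x (e i) (e j) = (if i \<noteq> j then 0 else if i = k then -1 else 1)"
    and w: "\<And>i. g c x w (e i) = 0"
  shows "w = 0"
proof -
  have "inj e" 
  proof (rule injI, rule ccontr)
    fix i j assume ij: "e i = e j" "i \<noteq> j"
    then show False using e[of i j] e[of i i] by (auto split: if_splits)
  qed
  have "independent (range e)"
    unfolding independent_explicit
  proof (intro conjI allI impI ballI)
    fix u v assume s: "(\<Sum>v\<in>range e. u v *\<^sub>R v) = 0" and "v \<in> range e"
    then obtain i where i: "v = e i" by auto
    have "0 = g c x (e i) (\<Sum>v\<in>range e. u v *\<^sub>R v)" by (simp add: s g_lin[OF c])
    also have "\<dots> = g c x (e i) (\<Sum>j\<in>UNIV. u (e j) *\<^sub>R e j)" by (simp add: sum.reindex[OF \<open>inj e\<close>])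
    also have "\<dots> = (\<Sum>j\<in>UNIV. u (e j) * g c x (e i) (e j))"
      by (simp add: linear_sum[OF linear_g_right[OF c]] linear_scale[OF linear_g_right[OF c]])
    also have "\<dots> = u (e i) * g c x (e i) (e i)"
      by (subst sum.mono_neutral_right[of UNIV "{i}"]) (auto simp: e)
    finally show "u v = 0" using e[of i i] by (auto simp: i split: if_splits)
  qed auto
  moreover have "card (range e) = DIM(real^'n)"
    using \<open>inj e\<close> by (simp add: card_image)
  ultimately have "span (range e) = UNIV"
    using card_ge_dim_independent[of "range e" UNIV] by auto
  then have "g c x w z = 0" for z
    using linear_eq_0_on_span[OF linear_g_right[OF c], of "range e" w z] w by auto
  then show ?thesis using nondegenerate[OF c, of w 0] by (simp add: g_lin[OF c])
qed

lemma g_sharp: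
  assumes "c \<in> A" "x \<in> img c" "linear \<alpha>"
  shows "g c x (sharp g c x \<alpha>) z = \<alpha> z"
proof -
  have "g c x (sharp g c x \<alpha>) z = z \<bullet> (gram g c x *v (ginv g c x *v (\<chi> i. \<alpha> (axis i 1))))"
    using g_sym[OF assms(1,2)] g_gram[OF assms(1,2)] by (metis sharp_def)
  also have "\<dots> = z \<bullet> (\<chi> i. \<alpha> (axis i 1))"
    by (simp add: ginv_def matrix_inv_mult_vector(1)[OF det_gram_nonzero[OF assms(1,2)]])
  also have "\<dots> = \<alpha> (\<Sum>i\<in>UNIV. z $ i *\<^sub>R axis i 1)"
    by (simp add: inner_vec_def linear_sum[OF assms(3)] linear_scale[OF assms(3)])
  finally show ?thesis using vec_eq_sum_axis[of z] by simp
qed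

lemma smooth_on_g:
  assumes "c \<in> A" "smooth_on S X" "smooth_on S Y" "open S" "S \<subseteq> img c"
  shows "smooth_on S (\<lambda>x. g c x (X x) (Y x))"
proof (rule smooth_on_cong[OF assms(4)])
  show "smooth_on S (\<lambda>x. \<Sum>i\<in>UNIV. \<Sum>j\<in>UNIV. X x $ i * Y x $ j * g c x (axis i 1) (axis j 1))"
    by (intro smooth_on_sum smooth_on_mult smooth_on_vec_nth assms
        smooth_on_subset[OF g_smooth[OF assms(1)] assms(5)])
qed (use assms g_expand[OF assms(1)] in auto)

lemma smooth_on_sharp:
  assumes "c \<in> A" "\<And>i. smooth_on (img c) (\<lambda>x. \<alpha> x (axis i 1))"
  shows "smooth_on (img c) (\<lambda>x. sharp g c x (\<alpha> x))"
  unfolding sharp_def ginv_def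
  by (rule smooth_on_matrix_inv_mult[OF open_img[OF assms(1)] _
        smooth_on_vec_lambda[OF open_img[OF assms(1)] assms(2)] det_gram_nonzero[OF assms(1)]])
    (simp add: gram_def g_smooth[OF assms(1)])

text \<open>The derivative in direction \<open>u\<close> of the coordinate expression of
  \<open>g\<close>, for arguments of constant components. It is not a tensor; the first-order
  identities in a single chart are written in it.\<close>

definition dmetric :: "('a, 'n) chart \<Rightarrow> real^'n \<Rightarrow> real^'n \<Rightarrow> real^'n \<Rightarrow> real^'n \<Rightarrow> real" where
  "dmetric c x u w z = frechet_derivative (\<lambda>y. g c y w z) (at x) u"

lemma metric_has_derivative:
  "c \<in> A \<Longrightarrow> x \<in> img c \<Longrightarrow> ((\<lambda>y. g c y w z) has_derivative (\<lambda>u. dmetric c x u w z)) (at x)"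
  unfolding dmetric_def by (rule smooth_on_has_derivative[OF g_smooth])

lemma g_fields_has_derivative:
  assumes c: "c \<in> A" "x \<in> img c" and Y: "(Y has_derivative Y') (at x)" and Z: "(Z has_derivative Z') (at x)"
  shows "((\<lambda>y. g c y (Y y) (Z y)) has_derivative
    (\<lambda>u. dmetric c x u (Y x) (Z x) + g c x (Y' u) (Z x) + g c x (Y x) (Z' u))) (at x)"
proof -
  let ?h = "\<lambda>y. \<Sum>i\<in>UNIV. \<Sum>j\<in>UNIV. Y y $ i * Z y $ j * g c y (axis i 1) (axis j 1)"
  let ?h' = "\<lambda>u. \<Sum>i\<in>UNIV. \<Sum>j\<in>UNIV. Y x $ i * Z x $ j * dmetric c x u (axis i 1) (axis j 1)
      + (Y x $ i * Z' u $ j + Y' u $ i * Z x $ j) * g c x (axis i 1) (axis j 1)"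
  have d: "(?h has_derivative ?h') (at x)"
    by (intro has_derivative_sum has_derivative_mult metric_has_derivative[OF c]
        bounded_linear.has_derivative[OF bounded_linear_vec_nth] Y Z)
  have D: "((\<lambda>y. g c y w z) has_derivative
      (\<lambda>u. \<Sum>i\<in>UNIV. \<Sum>j\<in>UNIV. w $ i * z $ j * dmetric c x u (axis i 1) (axis j 1))) (at x)" for w z
  proof (rule has_derivative_transform_within_open[OF _ open_img[OF c(1)] c(2)])
    show "((\<lambda>y. \<Sum>i\<in>UNIV. \<Sum>j\<in>UNIV. w $ i * z $ j * g c y (axis i 1) (axis j 1)) has_derivative
      (\<lambda>u. \<Sum>i\<in>UNIV. \<Sum>j\<in>UNIV. w $ i * z $ j * dmetric c x u (axis i 1) (axis j 1))) (at x)"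
      by (intro has_derivative_sum has_derivative_mult_right metric_has_derivative[OF c])
  qed (use g_expand[OF c(1)] in auto)
  have exp: "dmetric c x u w z = (\<Sum>i\<in>UNIV. \<Sum>j\<in>UNIV. w $ i * z $ j * dmetric c x u (axis i 1) (axis j 1))" for u w z
    by (rule fun_cong[OF has_derivative_unique[OF metric_has_derivative[OF c] D]])
  have "?h' u = dmetric c x u (Y x) (Z x) + g c x (Y' u) (Z x) + g c x (Y x) (Z' u)" for u
    unfolding exp[of u "Y x" "Z x"] g_expand[OF c, of "Y' u" "Z x"] g_expand[OF c, of "Y x" "Z' u"]
    by (simp add: sum.distrib ring_distribs add_ac)
  then have "(?h has_derivative (\<lambda>u. dmetric c x u (Y x) (Z x) + g c x (Y' u) (Z x) + g c x (Y x) (Z' u))) (at x)"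
    using d by simp
  then show ?thesis
    by (rule has_derivative_transform_within_open[OF _ open_img[OF c(1)] c(2)])
      (use g_expand[OF c(1)] in auto)
qed

lemma dmetric_eqI:
  assumes "c \<in> A" "x \<in> img c" "\<And>y. y \<in> img c \<Longrightarrow> g c y w z = h y" "(h has_derivative h') (at x)"
  shows "dmetric c x u w z = h' u"
proof -
  have "((\<lambda>y. g c y w z) has_derivative h') (at x)"
    by (rule has_derivative_transform_within_open[OF assms(4) open_img[OF assms(1)] assms(2)])
      (simp add: assms(3))
  then show ?thesis
    using has_derivative_unique[OF metric_has_derivative[OF assms(1,2)]] by metis
qed

lemma dmetric_linear:
  assumes c: "c \<in> A" "x \<in> img c"
  shows "linear (\<lambda>u. dmetric c x u w z)" "linear (\<lambda>w. dmetric c x u w z)" "linear (\<lambda>z. dmetric c x u w z)"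
proof -
  have d: "((\<lambda>y. g c y w z) has_derivative (\<lambda>u. dmetric c x u w z)) (at x)" for w z
    by (rule metric_has_derivative[OF c])
  show "linear (\<lambda>u. dmetric c x u w z)" by (rule has_derivative_linear[OF d])
  show "linear (\<lambda>w. dmetric c x u w z)"
  proof (rule linearI)
    show "dmetric c x u (w + w') z = dmetric c x u w z + dmetric c x u w' z" for w w'
      by (rule dmetric_eqI[OF c _ has_derivative_add[OF d d]]) (simp add: g_lin[OF c(1)])
    show "dmetric c x u (r *\<^sub>R w) z = r *\<^sub>R dmetric c x u w z" for r w
      by (rule dmetric_eqI[OF c _ has_derivative_scaleR_right[OF d]]) (simp add: g_lin[OF c(1)])
  qed
  show "linear (\<lambda>z. dmetric c x u w z)"
  proof (rule linearI)
    show "dmetric c x u w (z + z') = dmetric c x u w z + dmetric c x u w z'" for z z'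
      by (rule dmetric_eqI[OF c _ has_derivative_add[OF d d]]) (simp add: g_lin[OF c(1)])
    show "dmetric c x u w (r *\<^sub>R z) = r *\<^sub>R dmetric c x u w z" for r z
      by (rule dmetric_eqI[OF c _ has_derivative_scaleR_right[OF d]]) (simp add: g_lin[OF c(1)])
  qed
qed

lemma dmetric_sym: "c \<in> A \<Longrightarrow> x \<in> img c \<Longrightarrow> dmetric c x u w z = dmetric c x u z w"
  by (rule dmetric_eqI[OF _ _ _ metric_has_derivative]) (auto intro: g_sym)

lemma g_christoffel:
  assumes c: "c \<in> A" "x \<in> img c"
  shows "g c x (christoffel g c x u w) z = (dmetric c x u w z + dmetric c x w u z - dmetric c x z u w) / 2"
proof -
  have "linear (\<lambda>z. (dmetric c x u w z + dmetric c x w u z - dmetric c x z u w) / 2)"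
    using dmetric_linear[OF c] by (auto simp: linear_iff field_simps)
  from g_sharp[OF c this] show ?thesis
    by (simp add: christoffel_def dmetric_def)
qed

lemma christoffel_sym: "c \<in> A \<Longrightarrow> x \<in> img c \<Longrightarrow> christoffel g c x u w = christoffel g c x w u"
  by (rule nondegenerate) (auto simp: g_christoffel dmetric_sym)

lemma christoffel_metric:
  "c \<in> A \<Longrightarrow> x \<in> img c \<Longrightarrow>
    g c x (christoffel g c x u w) z + g c x w (christoffel g c x u z) = dmetric c x u w z"
  using g_sym[of c x w "christoffel g c x u z"] dmetric_sym[of c x u w z] dmetric_sym[of c x w u z] dmetric_sym[of c x z u w]
  by (simp add: g_christoffel field_simps)

lemma linear_christoffel:
  assumes c: "c \<in> A" "x \<in> img c"
  shows "linear (\<lambda>u. christoffel g c x u w)" "linear (\<lambda>w. christoffel g c x u w)"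
proof -
  have lin: "linear (\<lambda>u. christoffel g c x u w)" for w
  proof (rule linearI)
    show "christoffel g c x (u + u') w = christoffel g c x u w + christoffel g c x u' w" for u u'
      by (rule nondegenerate[OF c])
        (simp add: g_lin[OF c] g_christoffel[OF c] linear_add[OF dmetric_linear(1)[OF c]]
          linear_add[OF dmetric_linear(2)[OF c]] field_simps)
    show "christoffel g c x (r *\<^sub>R u) w = r *\<^sub>R christoffel g c x u w" for r u
      by (rule nondegenerate[OF c])
        (simp add: g_lin[OF c] g_christoffel[OF c] linear_scale[OF dmetric_linear(1)[OF c]]
          linear_scale[OF dmetric_linear(2)[OF c]] field_simps)
  qed
  then show "linear (\<lambda>u. christoffel g c x u w)" .
  show "linear (\<lambda>w. christoffel g c x u w)"
    using lin[of u] by (simp add: christoffel_sym[OF c, of u])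
qed

lemma smooth_on_christoffel:
  assumes c: "c \<in> A" and X: "smooth_on (img c) X" and Y: "smooth_on (img c) Y"
  shows "smooth_on (img c) (\<lambda>x. christoffel g c x (X x) (Y x))"
proof -
  have o: "open (img c)" by (rule open_img[OF c])
  have exp: "dmetric c x (U x) (W x) (Z x)
      = (\<Sum>i\<in>UNIV. \<Sum>j\<in>UNIV. W x $ i * Z x $ j * dmetric c x (U x) (axis i 1) (axis j 1))"
    if x: "x \<in> img c" for U W Z x
  proof -
    have "dmetric c x (U x) (W x) (Z x) = dmetric c x (U x) (\<Sum>i\<in>UNIV. W x $ i *\<^sub>R axis i 1) (\<Sum>j\<in>UNIV. Z x $ j *\<^sub>R axis j 1)"
      using vec_eq_sum_axis[of "W x"] vec_eq_sum_axis[of "Z x"] by simp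
    then show ?thesis
      by (simp add: linear_sum[OF dmetric_linear(2)[OF c x]] linear_sum[OF dmetric_linear(3)[OF c x]]
          linear_scale[OF dmetric_linear(2)[OF c x]] linear_scale[OF dmetric_linear(3)[OF c x]]
          sum_distrib_left mult.assoc)
        (subst sum.swap, simp add: mult.left_commute)
  qed
  have sm: "smooth_on (img c) (\<lambda>x. dmetric c x (U x) (W x) (Z x))"
    if "smooth_on (img c) U" "smooth_on (img c) W" "smooth_on (img c) Z" for U W Z
  proof (rule smooth_on_cong[OF o])
    show "smooth_on (img c) (\<lambda>x. \<Sum>i\<in>UNIV. \<Sum>j\<in>UNIV. W x $ i * Z x $ j * dmetric c x (U x) (axis i 1) (axis j 1))"
      unfolding dmetric_def
      by (intro smooth_on_sum[OF o] smooth_on_mult[OF o] smooth_on_vec_nth[OF o] that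
          smooth_on_derivative_apply[OF o g_smooth[OF c]])
  qed (simp add: exp)
  show ?thesis
    unfolding christoffel_def dmetric_def[symmetric]
    by (intro smooth_on_sharp[OF c] smooth_on_divide[OF o] smooth_on_diff[OF o] smooth_on_add[OF o] sm X Y
        smooth_on_const) simp
qed

lemma nabla_linear:
  assumes c: "c \<in> A" "x \<in> img c" and "vector_field A Y"
  shows "linear (nabla_at g Y c x)"
proof -
  have "linear (frechet_derivative (Y c) (at x))"
    using smooth_on_has_derivative[OF vector_field_smooth[OF assms(3) c(1)] c(2)] has_derivative_linear by blast
  then show ?thesis
    unfolding nabla_at_def[abs_def] using linear_christoffel(1)[OF c] by (rule linear_compose_add)
qed

lemma vector_field_has_derivative:
  "vector_field A Y \<Longrightarrow> c \<in> A \<Longrightarrow> x \<in> img c \<Longrightarrow> (Y c has_derivative frechet_derivative (Y c) (at x)) (at x)"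
  by (rule smooth_on_has_derivative[OF vector_field_smooth])

lemma nabla_metric:
  assumes c: "c \<in> A" "x \<in> img c" and Y: "vector_field A Y" and Z: "vector_field A Z"
  shows "frechet_derivative (\<lambda>y. g c y (Y c y) (Z c y)) (at x) u
    = g c x (nabla_at g Y c x u) (Z c x) + g c x (Y c x) (nabla_at g Z c x u)"
  unfolding frechet_derivative_at[OF g_fields_has_derivative[OF c vector_field_has_derivative[OF Y c]
      vector_field_has_derivative[OF Z c]], symmetric]
  by (simp add: nabla_at_def g_lin[OF c] christoffel_metric[OF c, symmetric])

text \<open>The right-hand side consists of derivatives of functions, metric products and Lie
  brackets. It reduces the transformation law of the Levi-Civita derivative to that of the
  bracket.\<close>

lemma koszul:
  assumes c: "c \<in> A" "x \<in> img c" and X: "vector_field A X" and Y: "vector_field A Y" and Z: "vector_field A Z"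
  shows "2 * g c x (nabla_at g Y c x (X c x)) (Z c x) =
      frechet_derivative (\<lambda>y. g c y (Y c y) (Z c y)) (at x) (X c x)
    + frechet_derivative (\<lambda>y. g c y (X c y) (Z c y)) (at x) (Y c x)
    - frechet_derivative (\<lambda>y. g c y (X c y) (Y c y)) (at x) (Z c x)
    + g c x (lie_bracket X Y c x) (Z c x) - g c x (lie_bracket X Z c x) (Y c x) - g c x (lie_bracket Y Z c x) (X c x)"
  unfolding nabla_metric[OF c Y Z] nabla_metric[OF c X Z] nabla_metric[OF c X Y]
  by (simp add: lie_bracket_def nabla_at_def g_lin[OF c] christoffel_sym[OF c, of "Y c x" "X c x"]
      christoffel_sym[OF c, of "Z c x" "X c x"] christoffel_sym[OF c, of "Z c x" "Y c x"] g_sym[OF c, of "X c x"]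
      g_sym[OF c, of "Y c x"] g_sym[OF c, of "Z c x"] algebra_simps)

text \<open>Differentiating the transformation law of a field brings in the second derivative of the
  transition map; in the bracket these terms cancel by symmetry.\<close>

lemma lie_bracket_transition:
  assumes c: "c \<in> A" and d: "d \<in> A" and x: "x \<in> overlap c d" and X: "vector_field A X" and Y: "vector_field A Y"
  shows "lie_bracket X Y d (transition c d x) = jac c d x (lie_bracket X Y c x)"
proof -
  let ?t = "transition c d" and ?J = "jac c d"
  have xc: "x \<in> img c" using x c by (simp add: overlap_iff)
  have td: "?t x \<in> img d" by (rule transition_in_img[OF c d x])
  have o: "open (overlap c d)" by (rule open_overlap[OF c d])
  let ?H = "\<lambda>v u. frechet_derivative (\<lambda>y. ?J y v) (at x) u"
  have Hd: "((\<lambda>y. ?J y v) has_derivative ?H v) (at x)" for v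
    by (rule smooth_on_has_derivative[OF smooth_on_jac[OF c d] x])
  have key: "frechet_derivative (Y d) (at (?t x)) (?J x u)
      = (\<Sum>i\<in>Basis. (Y c x \<bullet> i) *\<^sub>R ?H i u) + ?J x (frechet_derivative (Y c) (at x) u)"
    if Y: "vector_field A Y" for Y u
  proof -
    have "((\<lambda>y. Y d (?t y)) has_derivative (\<lambda>u. frechet_derivative (Y d) (at (?t x)) (?J x u))) (at x)"
      by (rule has_derivative_compose[OF transition_has_derivative[OF c d x] vector_field_has_derivative[OF Y d td]])
    moreover have "((\<lambda>y. \<Sum>i\<in>Basis. (Y c y \<bullet> i) *\<^sub>R ?J y i) has_derivative
        (\<lambda>u. \<Sum>i\<in>Basis. (Y c x \<bullet> i) *\<^sub>R ?H i u + (frechet_derivative (Y c) (at x) u \<bullet> i) *\<^sub>R ?J x i)) (at x)"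
      by (intro has_derivative_sum has_derivative_scaleR Hd has_derivative_inner_left
          vector_field_has_derivative[OF Y c xc])
    then have "((\<lambda>y. Y d (?t y)) has_derivative
        (\<lambda>u. \<Sum>i\<in>Basis. (Y c x \<bullet> i) *\<^sub>R ?H i u + (frechet_derivative (Y c) (at x) u \<bullet> i) *\<^sub>R ?J x i)) (at x)"
    proof (rule has_derivative_transform_within_open[OF _ o x])
      fix y assume "y \<in> overlap c d"
      then show "(\<Sum>i\<in>Basis. (Y c y \<bullet> i) *\<^sub>R ?J y i) = Y d (?t y)"
        using linear_basis_expansion[OF linear_jac[OF c d], of y "Y c y"] vector_field_transition[OF Y c d] by simp
    qed
    ultimately have "(\<lambda>u. frechet_derivative (Y d) (at (?t x)) (?J x u))
      = (\<lambda>u. \<Sum>i\<in>Basis. (Y c x \<bullet> i) *\<^sub>R ?H i u + (frechet_derivative (Y c) (at x) u \<bullet> i) *\<^sub>R ?J x i)"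
      by (rule has_derivative_unique)
    then have "frechet_derivative (Y d) (at (?t x)) (?J x u)
      = (\<Sum>i\<in>Basis. (Y c x \<bullet> i) *\<^sub>R ?H i u) + (\<Sum>i\<in>Basis. (frechet_derivative (Y c) (at x) u \<bullet> i) *\<^sub>R ?J x i)"
      by (metis (no_types, lifting) sum.distrib sum.cong)
    then show ?thesis
      by (simp only: linear_basis_expansion[OF linear_jac[OF c d x], of "frechet_derivative (Y c) (at x) u"])
  qed
  have sym: "?H i j = ?H j i" for i j
    unfolding jac_def by (rule second_derivative_symmetric[OF o x smooth_on_transition[OF c d]])
  have "(\<Sum>i\<in>Basis. (Y c x \<bullet> i) *\<^sub>R ?H i (X c x)) = (\<Sum>i\<in>Basis. \<Sum>j\<in>Basis. ((Y c x \<bullet> i) * (X c x \<bullet> j)) *\<^sub>R ?H i j)"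
    by (subst linear_basis_expansion[OF has_derivative_linear[OF Hd], of _ "X c x"]) (simp add: scaleR_sum_right)
  also have "\<dots> = (\<Sum>i\<in>Basis. \<Sum>j\<in>Basis. ((Y c x \<bullet> j) * (X c x \<bullet> i)) *\<^sub>R ?H i j)"
    by (subst sum.swap) (simp add: sym)
  also have "\<dots> = (\<Sum>i\<in>Basis. (X c x \<bullet> i) *\<^sub>R ?H i (Y c x))"
    by (subst linear_basis_expansion[OF has_derivative_linear[OF Hd], of _ "Y c x"])
      (simp add: scaleR_sum_right mult.commute)
  finally have H: "(\<Sum>i\<in>Basis. (Y c x \<bullet> i) *\<^sub>R ?H i (X c x)) = (\<Sum>i\<in>Basis. (X c x \<bullet> i) *\<^sub>R ?H i (Y c x))" .
  show ?thesis
    unfolding lie_bracket_def vector_field_transition[OF X c d x] vector_field_transition[OF Y c d x] key[OF X] key[OF Y]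
    by (simp add: H linear_diff[OF linear_jac[OF c d x]])
qed

lemma g_fields_transition:
  assumes c: "c \<in> A" and d: "d \<in> A" and x: "x \<in> overlap c d" and Y: "vector_field A Y" and Z: "vector_field A Z"
  shows "frechet_derivative (\<lambda>y. g d y (Y d y) (Z d y)) (at (transition c d x)) (jac c d x u)
    = frechet_derivative (\<lambda>y. g c y (Y c y) (Z c y)) (at x) u"
proof -
  have td: "transition c d x \<in> img d" by (rule transition_in_img[OF c d x])
  have "smooth_on (img d) (\<lambda>y. g d y (Y d y) (Z d y))"
    by (rule smooth_on_g[OF d vector_field_smooth[OF Y d] vector_field_smooth[OF Z d] open_img[OF d] order_refl])
  from has_derivative_compose[OF transition_has_derivative[OF c d x] smooth_on_has_derivative[OF this td]]
  have "((\<lambda>y. g d (transition c d y) (Y d (transition c d y)) (Z d (transition c d y))) has_derivative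
     (\<lambda>u. frechet_derivative (\<lambda>y. g d y (Y d y) (Z d y)) (at (transition c d x)) (jac c d x u))) (at x)" .
  then have "((\<lambda>y. g c y (Y c y) (Z c y)) has_derivative
     (\<lambda>u. frechet_derivative (\<lambda>y. g d y (Y d y) (Z d y)) (at (transition c d x)) (jac c d x u))) (at x)"
    by (rule has_derivative_transform_within_open[OF _ open_overlap[OF c d] x])
      (simp add: vector_field_transition[OF Y c d] vector_field_transition[OF Z c d] g_transition[OF c d])
  from frechet_derivative_at[OF this] show ?thesis by metis
qed

text \<open>Both vectors are tested against \<open>z\<close>, after \<open>u\<close> and
  \<open>z\<close> have been extended to global fields, to which the Koszul formula applies in both
  charts.\<close>

lemma nabla_transition:
  assumes c: "c \<in> A" and d: "d \<in> A" and x: "x \<in> overlap c d" and Y: "vector_field A Y"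
  shows "nabla_at g Y d (transition c d x) (jac c d x u) = jac c d x (nabla_at g Y c x u)"
proof (rule nondegenerate[OF d transition_in_img[OF c d x]])
  fix z
  have xc: "x \<in> img c" using x c by (simp add: overlap_iff)
  have td: "transition c d x \<in> img d" by (rule transition_in_img[OF c d x])
  obtain X where X: "vector_field A X" "X c x = u" using extend_vector[OF c xc] by metis
  obtain Z where Z: "vector_field A Z" "Z c x = jac d c (transition c d x) z" using extend_vector[OF c xc] by metis
  have z: "Z d (transition c d x) = z"
    using vector_field_transition[OF Z(1) c d x] jac_inverse'[OF c d x] by (simp add: Z(2))
  have u: "X d (transition c d x) = jac c d x u"
    using vector_field_transition[OF X(1) c d x] X(2) by simp
  have "2 * g d (transition c d x) (nabla_at g Y d (transition c d x) (X d (transition c d x))) (Z d (transition c d x))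
      = 2 * g c x (nabla_at g Y c x (X c x)) (Z c x)"
    unfolding koszul[OF d td X(1) Y Z(1)] koszul[OF c xc X(1) Y Z(1)]
    unfolding vector_field_transition[OF X(1) c d x] vector_field_transition[OF Y c d x] vector_field_transition[OF Z(1) c d x]
      lie_bracket_transition[OF c d x X(1) Y] lie_bracket_transition[OF c d x X(1) Z(1)] lie_bracket_transition[OF c d x Y Z(1)]
      g_fields_transition[OF c d x Y Z(1)] g_fields_transition[OF c d x X(1) Z(1)] g_fields_transition[OF c d x X(1) Y]
      g_transition[OF c d x] ..
  then have "g d (transition c d x) (nabla_at g Y d (transition c d x) (jac c d x u)) z
      = g c x (nabla_at g Y c x u) (Z c x)"
    by (simp add: z u X(2))
  also have "\<dots> = g d (transition c d x) (jac c d x (nabla_at g Y c x u)) (jac c d x (Z c x))"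
    by (rule g_transition[OF c d x, symmetric])
  also have "jac c d x (Z c x) = z" using vector_field_transition[OF Z(1) c d x] z by simp
  finally show "g d (transition c d x) (nabla_at g Y d (transition c d x) (jac c d x u)) z
      = g d (transition c d x) (jac c d x (nabla_at g Y c x u)) z" .
qed

lemma vector_field_levi_civita:
  assumes X: "vector_field A X" and Y: "vector_field A Y"
  shows "vector_field A (levi_civita g X Y)"
  unfolding vector_field_def
proof (intro conjI ballI)
  fix c assume c: "c \<in> A"
  show "smooth_on (img c) (levi_civita g X Y c)"
    unfolding levi_civita_def nabla_at_def
    by (intro smooth_on_add open_img[OF c] smooth_on_derivative_apply smooth_on_christoffel[OF c]
        vector_field_smooth[OF X c] vector_field_smooth[OF Y c])
next
  fix c d x assume "c \<in> A" "d \<in> A" "x \<in> overlap c d"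
  then show "levi_civita g X Y d (transition c d x) = jac c d x (levi_civita g X Y c x)"
    by (simp add: levi_civita_def vector_field_transition[OF X] nabla_transition[OF _ _ _ Y])
qed

lemma vector_field_lie_bracket:
  assumes X: "vector_field A X" and Y: "vector_field A Y"
  shows "vector_field A (lie_bracket X Y)"
  unfolding vector_field_def
proof (intro conjI ballI)
  fix c assume c: "c \<in> A"
  show "smooth_on (img c) (lie_bracket X Y c)"
    unfolding lie_bracket_def
    by (intro smooth_on_diff open_img[OF c] smooth_on_derivative_apply
        vector_field_smooth[OF X c] vector_field_smooth[OF Y c])
next
  fix c d x assume "c \<in> A" "d \<in> A" "x \<in> overlap c d"
  then show "lie_bracket X Y d (transition c d x) = jac c d x (lie_bracket X Y c x)"
    by (rule lie_bracket_transition[OF _ _ _ X Y])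
qed

end

section \<open>Three-forms in dimension three\<close>

definition det3 :: "real^3 \<Rightarrow> real^3 \<Rightarrow> real^3 \<Rightarrow> real" where
  "det3 u w z = u$1 * (w$2 * z$3 - w$3 * z$2) - u$2 * (w$1 * z$3 - w$3 * z$1) + u$3 * (w$1 * z$2 - w$2 * z$1)"

lemma det_vector3: "det (vector [u, w, z] :: real^3^3) = det3 u w z"
  by (simp add: det_3 det3_def vector_3 algebra_simps)

lemma axis_3_simps [simp]:
  "axis 1 (1::real) $ (1::3) = 1" "axis 1 (1::real) $ (2::3) = 0" "axis 1 (1::real) $ (3::3) = 0"
  "axis 2 (1::real) $ (1::3) = 0" "axis 2 (1::real) $ (2::3) = 1" "axis 2 (1::real) $ (3::3) = 0"
  "axis 3 (1::real) $ (1::3) = 0" "axis 3 (1::real) $ (2::3) = 0" "axis 3 (1::real) $ (3::3) = 1"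
  by (simp_all add: axis_def)

lemma vec3_eq: "(u :: real^3) = u$1 *\<^sub>R axis 1 1 + u$2 *\<^sub>R axis 2 1 + u$3 *\<^sub>R axis 3 1"
  by (simp add: vec_eq_iff forall_3)

text \<open>The alternating trilinear forms on a three-dimensional space form a line: multilinear
  expansion leaves the permutations of the basis, and these differ by their signs.\<close>

lemma alternating_eq_det3:
  fixes S :: "real^3 \<Rightarrow> real^3 \<Rightarrow> real^3 \<Rightarrow> real"
  assumes lin: "\<And>u w. linear (S u w)" and a1: "\<And>u w z. S u w z = - S w u z" and a2: "\<And>u w z. S u w z = - S u z w"
  shows "S u w z = S (axis 1 1) (axis 2 1) (axis 3 1) * det3 u w z"
proof -
  have r3: "S u w z = z$1 * S u w (axis 1 1) + z$2 * S u w (axis 2 1) + z$3 * S u w (axis 3 1)" for u w z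
    by (subst vec3_eq[of z]) (simp add: linear_add[OF lin] linear_scale[OF lin])
  have r2: "S u w z = w$1 * S u (axis 1 1) z + w$2 * S u (axis 2 1) z + w$3 * S u (axis 3 1) z" for u w z
    using r3[of u z w] a2[of u w z] a2[of u _ z] by simp
  have r1: "S u w z = u$1 * S (axis 1 1) w z + u$2 * S (axis 2 1) w z + u$3 * S (axis 3 1) w z" for u w z
    using r2[of w u z] a1[of u w z] a1[of _ w z] by simp
  have z1: "S v v z = 0" and z2: "S z v v = 0" for v z
    using a1[of v v z] a2[of z v v] by simp_all
  have z3: "S v z v = 0" for v z
    using a2[of v z v] z1[of v z] by simp
  let ?e = "\<lambda>i. axis i (1::real) :: real^3" and ?s = "S (axis 1 1) (axis 2 1) (axis 3 1)"
  have p: "S (?e 1) (?e 3) (?e 2) = - ?s" "S (?e 2) (?e 1) (?e 3) = - ?s"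
    by (rule a2, rule a1)
  have p': "S (?e 2) (?e 3) (?e 1) = ?s" "S (?e 3) (?e 1) (?e 2) = ?s"
    using a2[of "?e 2" "?e 3" "?e 1"] a1[of "?e 3" "?e 1" "?e 2"] p by simp_all
  have p'': "S (?e 3) (?e 2) (?e 1) = - ?s"
    using a1[of "?e 3" "?e 2" "?e 1"] p' by simp
  have "S u w z = u$1 * (w$1 * (z$1 * S (?e 1) (?e 1) (?e 1) + z$2 * S (?e 1) (?e 1) (?e 2) + z$3 * S (?e 1) (?e 1) (?e 3))
        + w$2 * (z$1 * S (?e 1) (?e 2) (?e 1) + z$2 * S (?e 1) (?e 2) (?e 2) + z$3 * S (?e 1) (?e 2) (?e 3))
        + w$3 * (z$1 * S (?e 1) (?e 3) (?e 1) + z$2 * S (?e 1) (?e 3) (?e 2) + z$3 * S (?e 1) (?e 3) (?e 3)))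
      + u$2 * (w$1 * (z$1 * S (?e 2) (?e 1) (?e 1) + z$2 * S (?e 2) (?e 1) (?e 2) + z$3 * S (?e 2) (?e 1) (?e 3))
        + w$2 * (z$1 * S (?e 2) (?e 2) (?e 1) + z$2 * S (?e 2) (?e 2) (?e 2) + z$3 * S (?e 2) (?e 2) (?e 3))
        + w$3 * (z$1 * S (?e 2) (?e 3) (?e 1) + z$2 * S (?e 2) (?e 3) (?e 2) + z$3 * S (?e 2) (?e 3) (?e 3)))
      + u$3 * (w$1 * (z$1 * S (?e 3) (?e 1) (?e 1) + z$2 * S (?e 3) (?e 1) (?e 2) + z$3 * S (?e 3) (?e 1) (?e 3))
        + w$2 * (z$1 * S (?e 3) (?e 2) (?e 1) + z$2 * S (?e 3) (?e 2) (?e 2) + z$3 * S (?e 3) (?e 2) (?e 3))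
        + w$3 * (z$1 * S (?e 3) (?e 3) (?e 1) + z$2 * S (?e 3) (?e 3) (?e 2) + z$3 * S (?e 3) (?e 3) (?e 3)))"
    by (simp only: r1[of u w z] r2[of "?e 1" w z] r2[of "?e 2" w z] r2[of "?e 3" w z]
        r3[of "?e 1" "?e 1" z] r3[of "?e 1" "?e 2" z] r3[of "?e 1" "?e 3" z]
        r3[of "?e 2" "?e 1" z] r3[of "?e 2" "?e 2" z] r3[of "?e 2" "?e 3" z]
        r3[of "?e 3" "?e 1" z] r3[of "?e 3" "?e 2" z] r3[of "?e 3" "?e 3" z])
  then show ?thesis
    by (simp add: z1 z2 z3 p p' p'' det3_def algebra_simps)
qed

locale lorentz3 = lorentz_mfd M A g for M :: "'a topology" and A :: "('a, 3) chart set" and g :: "('a, 3) form2"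
begin

abbreviation top_coeff :: "('a, 3) form3 \<Rightarrow> ('a, 3) chart \<Rightarrow> real^3 \<Rightarrow> real" where
  "top_coeff S c x \<equiv> S c x (axis 1 1) (axis 2 1) (axis 3 1)"

lemma three_form_swap:
  assumes "three_form A S" "c \<in> A" "x \<in> img c"
  shows "S c x u w z = - S c x w u z" "S c x u w z = - S c x u z w"
  using assms unfolding three_form_def by metis+

lemma three_form_det3:
  assumes "three_form A S" "c \<in> A" "x \<in> img c"
  shows "S c x u w z = top_coeff S c x * det3 u w z"
proof (rule alternating_eq_det3)
  show "linear (S c x u w)" for u w using assms by (auto simp: three_form_def)
  show "S c x u w z = - S c x w u z" "S c x u w z = - S c x u z w" for u w z
    by (rule three_form_swap[OF assms])+
qed

lemma three_form_smooth: "three_form A S \<Longrightarrow> c \<in> A \<Longrightarrow> smooth_on (img c) (\<lambda>x. S c x u w z)"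
  and three_form_transition: "three_form A S \<Longrightarrow> c \<in> A \<Longrightarrow> d \<in> A \<Longrightarrow> x \<in> overlap c d \<Longrightarrow>
    S d (transition c d x) (jac c d x u) (jac c d x w) (jac c d x z) = S c x u w z"
  and three_form_linear: "three_form A S \<Longrightarrow> c \<in> A \<Longrightarrow> x \<in> img c \<Longrightarrow> linear (S c x u w)"
  by (simp_all add: three_form_def)

lemma smooth_on_three_form:
  assumes S: "three_form A S" and c: "c \<in> A" and X: "smooth_on (img c) X" and Y: "smooth_on (img c) Y"
    and Z: "smooth_on (img c) Z"
  shows "smooth_on (img c) (\<lambda>x. S c x (X x) (Y x) (Z x))"
proof (rule smooth_on_cong[OF open_img[OF c]])
  show "smooth_on (img c) (\<lambda>x. top_coeff S c x * det3 (X x) (Y x) (Z x))"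
    unfolding det3_def
    by (intro smooth_on_mult smooth_on_add smooth_on_diff smooth_on_vec_nth open_img[OF c] X Y Z
        three_form_smooth[OF S c])
qed (rule three_form_det3[OF S c, symmetric])

text \<open>Numerator and denominator both acquire the squared Jacobian determinant under a change
  of chart, so this is a function on \<open>M\<close>, insensitive to the sign of \<open>S\<close>.
  Its value for \<open>a\<close> times a volume form is -a^2.\<close>

definition kap :: "('a, 3) form3 \<Rightarrow> ('a, 3) chart \<Rightarrow> real^3 \<Rightarrow> real" where
  "kap S c x = (top_coeff S c x)\<^sup>2 / det (gram g c x)"

text \<open>The determinant of the 3 x 3 matrix with entries g(u_i, w_j), written out so that it can
  be differentiated as a polynomial in values of \<open>g\<close>.\<close>

definition gdet :: "('a, 3) chart \<Rightarrow> real^3 \<Rightarrow> real^3 \<Rightarrow> real^3 \<Rightarrow> real^3 \<Rightarrow> real^3 \<Rightarrow> real^3 \<Rightarrow> real^3 \<Rightarrow> real" where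
  "gdet c x u1 u2 u3 w1 w2 w3 =
     g c x u1 w1 * (g c x u2 w2 * g c x u3 w3 - g c x u2 w3 * g c x u3 w2)
   - g c x u1 w2 * (g c x u2 w1 * g c x u3 w3 - g c x u2 w3 * g c x u3 w1)
   + g c x u1 w3 * (g c x u2 w1 * g c x u3 w2 - g c x u2 w2 * g c x u3 w1)"

lemma gdet_eq:
  assumes "c \<in> A" "x \<in> img c"
  shows "gdet c x u1 u2 u3 w1 w2 w3 = det3 u1 u2 u3 * det3 w1 w2 w3 * det (gram g c x)"
proof -
  let ?U = "vector [u1, u2, u3] :: real^3^3" and ?W = "vector [w1, w2, w3] :: real^3^3"
  have e: "(?U ** (gram g c x ** transpose ?W)) $ i $ j = g c x (?U $ i) (?W $ j)" for i j
    by (simp add: g_gram[OF assms] matrix_matrix_mult_def matrix_vector_mult_def transpose_def inner_vec_def)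
  have "det (?U ** (gram g c x ** transpose ?W)) = gdet c x u1 u2 u3 w1 w2 w3"
    unfolding det_3 e by (simp add: vector_3 gdet_def algebra_simps)
  moreover have "det (?U ** (gram g c x ** transpose ?W)) = det ?U * det ?W * det (gram g c x)"
    by (simp add: det_mul)
  ultimately show ?thesis by (simp add: det_vector3)
qed

lemma three_form_mult:
  assumes S: "three_form A S" and c: "c \<in> A" "x \<in> img c"
  shows "S c x u1 u2 u3 * S c x w1 w2 w3 = kap S c x * gdet c x u1 u2 u3 w1 w2 w3"
proof -
  have "S c x u1 u2 u3 * S c x w1 w2 w3
      = (top_coeff S c x * det3 u1 u2 u3) * (top_coeff S c x * det3 w1 w2 w3)"
    using three_form_det3[OF S c] by metis
  then show ?thesis
    using det_gram_nonzero[OF c] by (simp add: kap_def gdet_eq[OF c] power2_eq_square)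
qed

lemma kap_transition:
  assumes S: "three_form A S" and c: "c \<in> A" and d: "d \<in> A" and x: "x \<in> overlap c d"
  shows "kap S d (transition c d x) = kap S c x"
proof -
  let ?e = "\<lambda>i. axis i (1::real) :: real^3"
  have xc: "x \<in> img c" using x c by (simp add: overlap_iff)
  have td: "transition c d x \<in> img d" by (rule transition_in_img[OF c d x])
  have "kap S d (transition c d x) * gdet d (transition c d x) (jac c d x (?e 1)) (jac c d x (?e 2)) (jac c d x (?e 3))
      (jac c d x (?e 1)) (jac c d x (?e 2)) (jac c d x (?e 3))
    = kap S c x * gdet c x (?e 1) (?e 2) (?e 3) (?e 1) (?e 2) (?e 3)"
    unfolding three_form_mult[OF S d td, symmetric] three_form_mult[OF S c xc, symmetric]
    by (simp add: three_form_transition[OF S c d x])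
  moreover have "gdet d (transition c d x) (jac c d x (?e 1)) (jac c d x (?e 2)) (jac c d x (?e 3))
      (jac c d x (?e 1)) (jac c d x (?e 2)) (jac c d x (?e 3)) = gdet c x (?e 1) (?e 2) (?e 3) (?e 1) (?e 2) (?e 3)"
    by (simp add: gdet_def g_transition[OF c d x])
  moreover have "gdet c x (?e 1) (?e 2) (?e 3) (?e 1) (?e 2) (?e 3) \<noteq> 0"
    by (simp add: gdet_eq[OF c xc] det3_def det_gram_nonzero[OF c xc])
  ultimately show ?thesis by simp
qed

lemma smooth_on_kap:
  assumes S: "three_form A S" and c: "c \<in> A"
  shows "smooth_on (img c) (kap S c)"
  unfolding kap_def[abs_def] power2_eq_square
  by (intro smooth_on_divide smooth_on_mult smooth_on_det open_img[OF c] three_form_smooth[OF S c] det_gram_nonzero[OF c])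
    (simp_all add: gram_def g_smooth[OF c])

section \<open>Connections with twistor-free torsion\<close>

text \<open>The value of \<open>\<nabla>\<^sub>u Y\<close> for the connection determined by \<open>p\<close> and \<open>S\<close>.\<close>

definition cov :: "('a, 3) vfield \<Rightarrow> ('a, 3) form3 \<Rightarrow> ('a, 3) vfield \<Rightarrow> ('a, 3) chart \<Rightarrow> real^3 \<Rightarrow> real^3 \<Rightarrow> real^3" where
  "cov p S Y c x u = nabla_at g Y c x u + (g c x u (Y c x) *\<^sub>R p c x - g c x (p c x) (Y c x) *\<^sub>R u)
     + (1/2) *\<^sub>R sharp g c x (S c x u (Y c x))"

text \<open>The two terms added to the Levi-Civita derivative are skew with respect to
  \<open>g\<close>, being a bivector and a three-form with one slot fixed, so they cancel in the
  sum.\<close>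

lemma cov_metric:
  assumes c: "c \<in> A" "x \<in> img c" and Y: "vector_field A Y" and Z: "vector_field A Z" and S: "three_form A S"
  shows "((\<lambda>y. g c y (Y c y) (Z c y)) has_derivative
    (\<lambda>u. g c x (cov p S Y c x u) (Z c x) + g c x (Y c x) (cov p S Z c x u))) (at x)"
proof -
  have "smooth_on (img c) (\<lambda>y. g c y (Y c y) (Z c y))"
    by (rule smooth_on_g[OF c(1) vector_field_smooth[OF Y c(1)] vector_field_smooth[OF Z c(1)] open_img[OF c(1)] order_refl])
  from smooth_on_has_derivative[OF this c(2)]
  have "((\<lambda>y. g c y (Y c y) (Z c y)) has_derivative
      (\<lambda>u. g c x (nabla_at g Y c x u) (Z c x) + g c x (Y c x) (nabla_at g Z c x u))) (at x)"
    by (simp add: nabla_metric[OF c Y Z, symmetric])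
  moreover have "g c x (nabla_at g Y c x u) (Z c x) + g c x (Y c x) (nabla_at g Z c x u)
      = g c x (cov p S Y c x u) (Z c x) + g c x (Y c x) (cov p S Z c x u)" for u
  proof -
    have "S c x u (Y c x) (Z c x) = - S c x u (Z c x) (Y c x)"
      by (rule three_form_swap[OF S c])
    then show ?thesis
      using g_sharp[OF c three_form_linear[OF S c]]
      by (simp add: cov_def g_lin[OF c] g_sym[OF c, of "Y c x"])
  qed
  ultimately show ?thesis by simp
qed

text \<open>The value (D_u S)(Y1, Y2, Y3), where D is the connection determined by \<open>p\<close>
  and the same form \<open>S\<close>.\<close>

definition form_derivative ::
    "('a, 3) vfield \<Rightarrow> ('a, 3) form3 \<Rightarrow> ('a, 3) vfield \<Rightarrow> ('a, 3) vfield \<Rightarrow> ('a, 3) vfield \<Rightarrow> ('a, 3) chart \<Rightarrow> real^3 \<Rightarrow> real^3 \<Rightarrow> real" where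
  "form_derivative p S Y1 Y2 Y3 c x u = frechet_derivative (\<lambda>y. S c y (Y1 c y) (Y2 c y) (Y3 c y)) (at x) u
     - S c x (cov p S Y1 c x u) (Y2 c x) (Y3 c x) - S c x (Y1 c x) (cov p S Y2 c x u) (Y3 c x)
     - S c x (Y1 c x) (Y2 c x) (cov p S Y3 c x u)"

text \<open>Since the connection is metric, differentiating \<open>gdet\<close> of fields merely
  moves the derivative onto its six arguments. Differentiating S(Y) S(Z) = kappa gdet(Y, Z)
  therefore leaves D S on one side and the derivative of kappa on the other.\<close>

lemma form_derivative_mult:
  assumes S: "three_form A S" and c: "c \<in> A" "x \<in> img c"
    and Y: "vector_field A Y1" "vector_field A Y2" "vector_field A Y3"
    and Z: "vector_field A Z1" "vector_field A Z2" "vector_field A Z3"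
  shows "form_derivative p S Y1 Y2 Y3 c x u * S c x (Z1 c x) (Z2 c x) (Z3 c x)
      + S c x (Y1 c x) (Y2 c x) (Y3 c x) * form_derivative p S Z1 Z2 Z3 c x u
    = frechet_derivative (kap S c) (at x) u * gdet c x (Y1 c x) (Y2 c x) (Y3 c x) (Z1 c x) (Z2 c x) (Z3 c x)"
proof -
  let ?F = "\<lambda>y. S c y (Y1 c y) (Y2 c y) (Y3 c y)" and ?H = "\<lambda>y. S c y (Z1 c y) (Z2 c y) (Z3 c y)"
  have F: "(?F has_derivative frechet_derivative ?F (at x)) (at x)"
    by (rule smooth_on_has_derivative[OF smooth_on_three_form[OF S c(1)] c(2)]) (intro vector_field_smooth Y c)+
  have H: "(?H has_derivative frechet_derivative ?H (at x)) (at x)"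
    by (rule smooth_on_has_derivative[OF smooth_on_three_form[OF S c(1)] c(2)]) (intro vector_field_smooth Z c)+
  have K: "(kap S c has_derivative frechet_derivative (kap S c) (at x)) (at x)"
    by (rule smooth_on_has_derivative[OF smooth_on_kap[OF S c(1)] c(2)])
  have G: "((\<lambda>y. g c y (Y c y) (Z c y)) has_derivative
      (\<lambda>u. g c x (cov p S Y c x u) (Z c x) + g c x (Y c x) (cov p S Z c x u))) (at x)"
    if "vector_field A Y" "vector_field A Z" for Y Z
    by (rule cov_metric[OF c that S])
  note m = has_derivative_mult
  have "((\<lambda>y. kap S c y * gdet c y (Y1 c y) (Y2 c y) (Y3 c y) (Z1 c y) (Z2 c y) (Z3 c y)) has_derivative
     (\<lambda>u. frechet_derivative ?F (at x) u * ?H x + ?F x * frechet_derivative ?H (at x) u)) (at x)"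
    by (rule has_derivative_transform_within_open[OF _ open_img[OF c(1)] c(2)], rule has_derivative_eq_rhs,
        rule has_derivative_mult[OF F H]) (auto simp: three_form_mult[OF S c(1)] algebra_simps)
  moreover have "((\<lambda>y. kap S c y * gdet c y (Y1 c y) (Y2 c y) (Y3 c y) (Z1 c y) (Z2 c y) (Z3 c y)) has_derivative
     (\<lambda>u. frechet_derivative (kap S c) (at x) u * gdet c x (Y1 c x) (Y2 c x) (Y3 c x) (Z1 c x) (Z2 c x) (Z3 c x)
       + kap S c x * (gdet c x (cov p S Y1 c x u) (Y2 c x) (Y3 c x) (Z1 c x) (Z2 c x) (Z3 c x)
         + gdet c x (Y1 c x) (cov p S Y2 c x u) (Y3 c x) (Z1 c x) (Z2 c x) (Z3 c x)
         + gdet c x (Y1 c x) (Y2 c x) (cov p S Y3 c x u) (Z1 c x) (Z2 c x) (Z3 c x)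
         + gdet c x (Y1 c x) (Y2 c x) (Y3 c x) (cov p S Z1 c x u) (Z2 c x) (Z3 c x)
         + gdet c x (Y1 c x) (Y2 c x) (Y3 c x) (Z1 c x) (cov p S Z2 c x u) (Z3 c x)
         + gdet c x (Y1 c x) (Y2 c x) (Y3 c x) (Z1 c x) (Z2 c x) (cov p S Z3 c x u)))) (at x)"
    unfolding gdet_def
    by (rule has_derivative_eq_rhs[OF has_derivative_mult[OF K has_derivative_add[OF has_derivative_diff[OF
            m[OF G[OF Y(1) Z(1)] has_derivative_diff[OF m[OF G[OF Y(2) Z(2)] G[OF Y(3) Z(3)]] m[OF G[OF Y(2) Z(3)] G[OF Y(3) Z(2)]]]]
            m[OF G[OF Y(1) Z(2)] has_derivative_diff[OF m[OF G[OF Y(2) Z(1)] G[OF Y(3) Z(3)]] m[OF G[OF Y(2) Z(3)] G[OF Y(3) Z(1)]]]]]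
            m[OF G[OF Y(1) Z(3)] has_derivative_diff[OF m[OF G[OF Y(2) Z(1)] G[OF Y(3) Z(2)]] m[OF G[OF Y(2) Z(2)] G[OF Y(3) Z(1)]]]]]]])
      (rule ext, simp add: algebra_simps)
  ultimately have "frechet_derivative ?F (at x) u * ?H x + ?F x * frechet_derivative ?H (at x) u
    = frechet_derivative (kap S c) (at x) u * gdet c x (Y1 c x) (Y2 c x) (Y3 c x) (Z1 c x) (Z2 c x) (Z3 c x)
       + kap S c x * (gdet c x (cov p S Y1 c x u) (Y2 c x) (Y3 c x) (Z1 c x) (Z2 c x) (Z3 c x)
         + gdet c x (Y1 c x) (cov p S Y2 c x u) (Y3 c x) (Z1 c x) (Z2 c x) (Z3 c x)
         + gdet c x (Y1 c x) (Y2 c x) (cov p S Y3 c x u) (Z1 c x) (Z2 c x) (Z3 c x)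
         + gdet c x (Y1 c x) (Y2 c x) (Y3 c x) (cov p S Z1 c x u) (Z2 c x) (Z3 c x)
         + gdet c x (Y1 c x) (Y2 c x) (Y3 c x) (Z1 c x) (cov p S Z2 c x u) (Z3 c x)
         + gdet c x (Y1 c x) (Y2 c x) (Y3 c x) (Z1 c x) (Z2 c x) (cov p S Z3 c x u))"
    by (rule fun_cong[OF has_derivative_unique])
  then show ?thesis
    by (simp add: form_derivative_def ring_distribs three_form_mult[OF S c, symmetric])
qed

text \<open>The expected torsion (Y \<and> Z) p + S(Y, Z), built from \<open>p\<close> and
  \<open>S\<close> alone.\<close>

definition tor :: "('a, 3) vfield \<Rightarrow> ('a, 3) form3 \<Rightarrow> ('a, 3) vfield \<Rightarrow> ('a, 3) vfield \<Rightarrow> ('a, 3) vfield" where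
  "tor p S Y Z = (\<lambda>c x. g c x (p c x) (Y c x) *\<^sub>R Z c x - g c x (p c x) (Z c x) *\<^sub>R Y c x + sharp g c x (S c x (Y c x) (Z c x)))"

lemma torsion_eq_tor:
  assumes S: "three_form A S" and c: "c \<in> A" "x \<in> img c" and Y: "vector_field A Y" and Z: "vector_field A Z"
  shows "cov p S Z c x (Y c x) - cov p S Y c x (Z c x) - lie_bracket Y Z c x = tor p S Y Z c x"
proof (rule nondegenerate[OF c])
  fix w
  have "S c x (Z c x) (Y c x) w = - S c x (Y c x) (Z c x) w"
    by (rule three_form_swap[OF S c])
  then show "g c x (cov p S Z c x (Y c x) - cov p S Y c x (Z c x) - lie_bracket Y Z c x) w = g c x (tor p S Y Z c x) w"
    using g_sharp[OF c three_form_linear[OF S c]] christoffel_sym[OF c, of "Y c x" "Z c x"]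
    by (simp add: cov_def tor_def nabla_at_def lie_bracket_def g_lin[OF c] g_sym[OF c, of "Z c x" "Y c x"])
qed

text \<open>Because \<open>g\<close> is parallel, pairing with \<open>W\<close> turns the derivative
  of the torsion into derivatives of functions such as g(p, Y), g(Z, W) and S(Y, Z, W). The families
  \<open>DY\<close> and \<open>DZ\<close> are prescribed at \<open>x\<close> alone, since the
  torsion is pointwise in its arguments.\<close>

lemma cov_tor:
  assumes S: "three_form A S" and c: "c \<in> A" "x \<in> img c" and p: "vector_field A p"
    and Y: "vector_field A Y" and Z: "vector_field A Z" and T: "vector_field A (tor p S Y Z)" and W: "vector_field A W"
    and DY: "DY c x = cov p S Y c x u" and DZ: "DZ c x = cov p S Z c x u"
  shows "g c x (cov p S (tor p S Y Z) c x u - tor p S DY Z c x - tor p S Y DZ c x) (W c x)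
    = g c x (cov p S p c x u) (Y c x) * g c x (Z c x) (W c x) - g c x (cov p S p c x u) (Z c x) * g c x (Y c x) (W c x)
      + form_derivative p S Y Z W c x u"
proof -
  let ?F = "\<lambda>y. S c y (Y c y) (Z c y) (W c y)"
  have F: "(?F has_derivative frechet_derivative ?F (at x)) (at x)"
    by (rule smooth_on_has_derivative[OF smooth_on_three_form[OF S c(1)] c(2)]) (intro vector_field_smooth Y Z W c)+
  have G: "((\<lambda>y. g c y (Y c y) (Z c y)) has_derivative
      (\<lambda>u. g c x (cov p S Y c x u) (Z c x) + g c x (Y c x) (cov p S Z c x u))) (at x)"
    if "vector_field A Y" "vector_field A Z" for Y Z
    by (rule cov_metric[OF c that S])
  have "g c y (tor p S Y Z c y) (W c y) = g c y (p c y) (Y c y) * g c y (Z c y) (W c y)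
      - g c y (p c y) (Z c y) * g c y (Y c y) (W c y) + ?F y" if "y \<in> img c" for y
    using g_sharp[OF c(1) that three_form_linear[OF S c(1) that]] that
    by (simp add: tor_def g_lin[OF c(1) that])
  then have "((\<lambda>y. g c y (p c y) (Y c y) * g c y (Z c y) (W c y)
      - g c y (p c y) (Z c y) * g c y (Y c y) (W c y) + ?F y) has_derivative
      (\<lambda>u. g c x (cov p S (tor p S Y Z) c x u) (W c x) + g c x (tor p S Y Z c x) (cov p S W c x u))) (at x)"
    by (intro has_derivative_transform_within_open[OF G[OF T W] open_img[OF c(1)] c(2)]) simp
  moreover have "((\<lambda>y. g c y (p c y) (Y c y) * g c y (Z c y) (W c y)
      - g c y (p c y) (Z c y) * g c y (Y c y) (W c y) + ?F y) has_derivative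
      (\<lambda>u. g c x (p c x) (Y c x) * (g c x (cov p S Z c x u) (W c x) + g c x (Z c x) (cov p S W c x u))
        + (g c x (cov p S p c x u) (Y c x) + g c x (p c x) (cov p S Y c x u)) * g c x (Z c x) (W c x)
        - (g c x (p c x) (Z c x) * (g c x (cov p S Y c x u) (W c x) + g c x (Y c x) (cov p S W c x u))
        + (g c x (cov p S p c x u) (Z c x) + g c x (p c x) (cov p S Z c x u)) * g c x (Y c x) (W c x))
        + frechet_derivative ?F (at x) u)) (at x)"
    by (intro has_derivative_add has_derivative_diff has_derivative_mult G[OF p Y] G[OF Z W] G[OF p Z] G[OF Y W] F)
  ultimately have "g c x (cov p S (tor p S Y Z) c x u) (W c x) + g c x (tor p S Y Z c x) (cov p S W c x u)
    = g c x (p c x) (Y c x) * (g c x (cov p S Z c x u) (W c x) + g c x (Z c x) (cov p S W c x u))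
        + (g c x (cov p S p c x u) (Y c x) + g c x (p c x) (cov p S Y c x u)) * g c x (Z c x) (W c x)
        - (g c x (p c x) (Z c x) * (g c x (cov p S Y c x u) (W c x) + g c x (Y c x) (cov p S W c x u))
        + (g c x (cov p S p c x u) (Z c x) + g c x (p c x) (cov p S Z c x u)) * g c x (Y c x) (W c x))
        + frechet_derivative ?F (at x) u"
    by (rule fun_cong[OF has_derivative_unique])
  then show ?thesis
    using g_sharp[OF c three_form_linear[OF S c]]
    by (simp add: tor_def form_derivative_def DY DZ g_lin[OF c] algebra_simps)
qed

lemma vector_field_cong: "vector_field A X \<Longrightarrow> field_eq A X Y \<Longrightarrow> vector_field A Y"
  unfolding vector_field_def field_eq_def
  using smooth_on_cong[OF open_img] overlap_iff transition_in_img by (metis (no_types, lifting))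

lemma twistor_free_cov:
  assumes "twistor_free_torsion A g D p S" "vector_field A X" "vector_field A Y" "c \<in> A" "x \<in> img c"
  shows "D X Y c x = cov p S Y c x (X c x)"
  using assms unfolding twistor_free_torsion_def field_eq_def
  by (simp add: cov_def levi_civita_def bivector_def form3_vec_def)

lemma twistor_free_torsion_tor:
  assumes D: "twistor_free_torsion A g D p S" and X: "vector_field A X" and Y: "vector_field A Y"
  shows "field_eq A (torsion D X Y) (tor p S X Y)"
  unfolding field_eq_def
proof (intro ballI)
  fix c x assume c: "c \<in> A" "x \<in> img c"
  have S: "three_form A S" using D by (simp add: twistor_free_torsion_def)
  show "torsion D X Y c x = tor p S X Y c x"
    using torsion_eq_tor[OF S c X Y, of p]
    by (simp add: torsion_def fminus_def twistor_free_cov[OF D X Y c] twistor_free_cov[OF D Y X c])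
qed

lemma connection_vector_field: "connection A D \<Longrightarrow> vector_field A X \<Longrightarrow> vector_field A Y \<Longrightarrow> vector_field A (D X Y)"
  by (simp add: connection_def)

lemma vector_field_fminus: "vector_field A X \<Longrightarrow> vector_field A Y \<Longrightarrow> vector_field A (fminus X Y)"
  unfolding vector_field_def fminus_def
  by (auto intro!: smooth_on_diff open_img simp: linear_diff[OF linear_jac])

text \<open>The field property is read off from the torsion of \<open>D\<close>, because a
  connection maps fields to fields; \<open>tor\<close> agrees with it on the chart images.\<close>

lemma vector_field_tor:
  assumes C: "connection A D" and D: "twistor_free_torsion A g D p S" and X: "vector_field A X" and Y: "vector_field A Y"
  shows "vector_field A (tor p S X Y)" "vector_field A (torsion D X Y)"
proof -
  show "vector_field A (torsion D X Y)"
    unfolding torsion_def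
    by (intro vector_field_fminus connection_vector_field[OF C] vector_field_lie_bracket X Y)
  from vector_field_cong[OF this twistor_free_torsion_tor[OF D X Y]] show "vector_field A (tor p S X Y)" .
qed

text \<open>By nondegeneracy the vector equation for parallel torsion amounts to its pairings with
  all \<open>W\<close>, and \<open>cov_tor\<close> evaluates them. The result is a single equation
  in which D p and D S are still mixed.\<close>

lemma parallel_torsion_iff:
  assumes C: "connection A D" and D: "twistor_free_torsion A g D p S"
  shows "parallel_torsion A D \<longleftrightarrow> (\<forall>X Y Z W. vector_field A X \<and> vector_field A Y \<and> vector_field A Z \<and> vector_field A W \<longrightarrow>
    (\<forall>c\<in>A. \<forall>x\<in>img c. g c x (cov p S p c x (X c x)) (Y c x) * g c x (Z c x) (W c x)
      - g c x (cov p S p c x (X c x)) (Z c x) * g c x (Y c x) (W c x) + form_derivative p S Y Z W c x (X c x) = 0))"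
proof -
  have S: "three_form A S" and p: "vector_field A p" using D by (simp_all add: twistor_free_torsion_def)
  have key: "g c x (fminus (fminus (D X (torsion D Y Z)) (torsion D (D X Y) Z)) (torsion D Y (D X Z)) c x) (W c x)
    = g c x (cov p S p c x (X c x)) (Y c x) * g c x (Z c x) (W c x)
      - g c x (cov p S p c x (X c x)) (Z c x) * g c x (Y c x) (W c x) + form_derivative p S Y Z W c x (X c x)"
    if v: "vector_field A X" "vector_field A Y" "vector_field A Z" "vector_field A W" and c: "c \<in> A" "x \<in> img c"
    for X Y Z W c x
  proof -
    note T = vector_field_tor[OF C D v(2,3)]
    have "field_eq A (D X (torsion D Y Z)) (D X (tor p S Y Z))"
      using C v(1) T twistor_free_torsion_tor[OF D v(2,3)] unfolding connection_def by (auto simp: field_eq_def)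
    then have 1: "D X (torsion D Y Z) c x = cov p S (tor p S Y Z) c x (X c x)"
      using c twistor_free_cov[OF D v(1) T(1) c] by (simp add: field_eq_def)
    have 2: "torsion D (D X Y) Z c x = tor p S (D X Y) Z c x"
      using twistor_free_torsion_tor[OF D connection_vector_field[OF C v(1,2)] v(3)] c by (simp add: field_eq_def)
    have 3: "torsion D Y (D X Z) c x = tor p S Y (D X Z) c x"
      using twistor_free_torsion_tor[OF D v(2) connection_vector_field[OF C v(1,3)]] c by (simp add: field_eq_def)
    show ?thesis
      unfolding fminus_def 1 2 3
      by (rule cov_tor[OF S c p v(2,3) T(1) v(4)]) (rule twistor_free_cov[OF D v(1) _ c], rule v)+
  qed
  show ?thesis
  proof
    assume "parallel_torsion A D"
    then show "\<forall>X Y Z W. vector_field A X \<and> vector_field A Y \<and> vector_field A Z \<and> vector_field A W \<longrightarrow>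
    (\<forall>c\<in>A. \<forall>x\<in>img c. g c x (cov p S p c x (X c x)) (Y c x) * g c x (Z c x) (W c x)
      - g c x (cov p S p c x (X c x)) (Z c x) * g c x (Y c x) (W c x) + form_derivative p S Y Z W c x (X c x) = 0)"
      by (simp add: parallel_torsion_def field_eq_def key[symmetric] g_lin)
  next
    assume H: "\<forall>X Y Z W. vector_field A X \<and> vector_field A Y \<and> vector_field A Z \<and> vector_field A W \<longrightarrow>
    (\<forall>c\<in>A. \<forall>x\<in>img c. g c x (cov p S p c x (X c x)) (Y c x) * g c x (Z c x) (W c x)
      - g c x (cov p S p c x (X c x)) (Z c x) * g c x (Y c x) (W c x) + form_derivative p S Y Z W c x (X c x) = 0)"
    show "parallel_torsion A D"
      unfolding parallel_torsion_def field_eq_def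
    proof (intro allI impI ballI)
      fix X Y Z c x assume v: "vector_field A X \<and> vector_field A Y \<and> vector_field A Z" and c: "c \<in> A" "x \<in> img c"
      show "fminus (fminus (D X (torsion D Y Z)) (torsion D (D X Y) Z)) (torsion D Y (D X Z)) c x = 0"
      proof (rule nondegenerate[OF c])
        fix w
        obtain W where W: "vector_field A W" "W c x = w" using extend_vector[OF c] by metis
        show "g c x (fminus (fminus (D X (torsion D Y Z)) (torsion D (D X Y) Z)) (torsion D Y (D X Z)) c x) w = g c x 0 w"
          using key[of X Y Z W c x] H[rule_format, of X Y Z W c x] v W c by (simp add: g_lin[OF c])
      qed
    qed
  qed
qed

end

section \<open>Consequences of parallel torsion: constancy of kappa and the induced
  orientation\<close>

context smooth_mfd
begin

text \<open>The points at which \<open>f\<close> has a given property form an open set, so a fibre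
  is open and closed.\<close>

lemma locally_constant_imp_constant:
  assumes loc: "\<And>m. m \<in> topspace M \<Longrightarrow> \<exists>U. openin M U \<and> m \<in> U \<and> (\<forall>m'\<in>U. f m' = f m)"
    and m: "m \<in> topspace M" "m' \<in> topspace M"
  shows "f m' = f m"
proof -
  let ?T = "{q \<in> topspace M. f q = f m}"
  have op: "openin M {q \<in> topspace M. P (f q)}" for P
  proof (subst openin_subopen, intro ballI)
    fix q assume q: "q \<in> {q \<in> topspace M. P (f q)}"
    then obtain U where U: "openin M U" "q \<in> U" "\<forall>m'\<in>U. f m' = f q" using loc by blast
    have "U \<subseteq> {q \<in> topspace M. P (f q)}"
    proof
      fix m' assume m': "m' \<in> U"
      then have "f m' = f q" using U(3) by blast
      moreover have "m' \<in> topspace M" using m' openin_subset[OF U(1)] by blast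
      ultimately show "m' \<in> {q \<in> topspace M. P (f q)}" using q by simp
    qed
    then show "\<exists>T. openin M T \<and> q \<in> T \<and> T \<subseteq> {q \<in> topspace M. P (f q)}"
      using U(1,2) by blast
  qed
  have "openin M ?T" by (rule op)
  moreover have "topspace M - ?T = {q \<in> topspace M. f q \<noteq> f m}" by auto
  then have "openin M (topspace M - ?T)" using op[of "\<lambda>r. r \<noteq> f m"] by simp
  then have "closedin M ?T" by (auto simp: closedin_def)
  ultimately have "?T = {} \<or> ?T = topspace M"
    using connected connected_space_clopen_in by blast
  then show ?thesis using m by blast
qed

end

context lorentz3
begin

lemma form_derivative_repeated:
  assumes S: "three_form A S" and c: "c \<in> A" "x \<in> img c"
  shows "form_derivative p S Y Z Z c x u = 0"
proof -
  have z: "S c y v w w = 0" if "y \<in> img c" for y v w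
    using three_form_swap(2)[OF S c(1) that, of v w w] by simp
  have "frechet_derivative (\<lambda>y. S c y (Y c y) (Z c y) (Z c y)) (at x) = frechet_derivative (\<lambda>y. 0) (at x)"
    by (rule frechet_derivative_cong_open[OF open_img[OF c(1)] c(2)]) (rule z)
  then show ?thesis
    using three_form_swap(2)[OF S c, of "Y c x" "cov p S Z c x u" "Z c x"] by (simp add: form_derivative_def z[OF c(2)])
qed

text \<open>Setting W = Z removes D S by skewness and leaves g(D p, Y) g(Z, Z) = g(D p, Z) g(Y, Z).
  For two distinct frame vectors the right side is 0, while g(Z, Z) is not.\<close>

lemma parallel_torsion_parallel_vector:
  assumes C: "connection A D" and D: "twistor_free_torsion A g D p S" and P: "parallel_torsion A D"
    and c: "c \<in> A" "x \<in> img c"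
  shows "cov p S p c x u = 0"
proof -
  have S: "three_form A S" using D by (simp add: twistor_free_torsion_def)
  obtain e :: "3 \<Rightarrow> real^3" and k
    where e: "\<And>i j. g c x (e i) (e j) = (if i \<noteq> j then 0 else if i = k then -1 else 1)"
    using orthonormal_frame[OF c] by metis
  obtain X where X: "vector_field A X" "X c x = u" using extend_vector[OF c] by metis
  show ?thesis
  proof (rule frame_nondegenerate[OF c e])
    fix i :: 3
    obtain j :: 3 where j: "j \<noteq> i"
      using that[of 1] that[of 2] by (cases "i = 1") auto
    obtain Y where Y: "vector_field A Y" "Y c x = e i" using extend_vector[OF c] by metis
    obtain Z where Z: "vector_field A Z" "Z c x = e j" using extend_vector[OF c] by metis
    have "g c x (cov p S p c x (X c x)) (Y c x) * g c x (Z c x) (Z c x)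
      - g c x (cov p S p c x (X c x)) (Z c x) * g c x (Y c x) (Z c x) + form_derivative p S Y Z Z c x (X c x) = 0"
      using P[unfolded parallel_torsion_iff[OF C D]] X(1) Y(1) Z(1) c by blast
    then show "g c x (cov p S p c x u) (e i) = 0"
      using j by (simp add: X Y Z form_derivative_repeated[OF S c] e split: if_splits)
  qed
qed

text \<open>With D S = 0 the differentiated product identity, for a frame against itself, says that
  the derivative of kappa times \<open>gdet\<close> of the frame is 0; that determinant is not
  0.\<close>

lemma kap_constant:
  assumes S: "three_form A S"
    and 0: "\<And>Y1 Y2 Y3 c x u. vector_field A Y1 \<Longrightarrow> vector_field A Y2 \<Longrightarrow> vector_field A Y3 \<Longrightarrow> c \<in> A \<Longrightarrow> x \<in> img c \<Longrightarrow>
      form_derivative p S Y1 Y2 Y3 c x u = 0"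
    and c: "c \<in> A" "x \<in> img c" and d: "d \<in> A" "y \<in> img d"
  shows "kap S c x = kap S d y"
proof -
  have dk: "frechet_derivative (kap S c) (at x) u = 0" if c: "c \<in> A" "x \<in> img c" for c x u
  proof -
    obtain Y1 where Y1: "vector_field A Y1" "Y1 c x = axis 1 1" using extend_vector[OF c] by metis
    obtain Y2 where Y2: "vector_field A Y2" "Y2 c x = axis 2 1" using extend_vector[OF c] by metis
    obtain Y3 where Y3: "vector_field A Y3" "Y3 c x = axis 3 1" using extend_vector[OF c] by metis
    have "gdet c x (Y1 c x) (Y2 c x) (Y3 c x) (Y1 c x) (Y2 c x) (Y3 c x) \<noteq> 0"
      by (simp add: gdet_eq[OF c] Y1 Y2 Y3 det3_def det_gram_nonzero[OF c])
    then show ?thesis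
      using form_derivative_mult[OF S c Y1(1) Y2(1) Y3(1) Y1(1) Y2(1) Y3(1), of p u] 0[OF Y1(1) Y2(1) Y3(1) c]
      by simp
  qed
  \<comment> \<open>Kappa as a function on \<open>M\<close>, read at each point in some chart; by
    \<open>kap_transition\<close> the choice has no effect on the value.\<close>
  define f where "f m = kap S (SOME c. c \<in> A \<and> m \<in> fst c) (snd (SOME c. c \<in> A \<and> m \<in> fst c) m)" for m
  have f: "f m = kap S c (snd c m)" if c: "c \<in> A" "m \<in> fst c" for c m
  proof -
    define d where "d = (SOME c. c \<in> A \<and> m \<in> fst c)"
    have d: "d \<in> A" "m \<in> fst d"
      using someI_ex[of "\<lambda>c. c \<in> A \<and> m \<in> fst c"] c unfolding d_def by blast+
    have "snd c m \<in> overlap c d" using c d by (auto simp: overlap_def)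
    from kap_transition[OF S c(1) d(1) this] show ?thesis
      using c d by (simp add: f_def d_def[symmetric] transition_eq)
  qed
  have "f (param d y) = f (param c x)"
  proof (rule locally_constant_imp_constant)
    fix m assume "m \<in> topspace M"
    then obtain c where c: "c \<in> A" "m \<in> fst c" by (rule in_some_chart)
    obtain e where e: "e > 0" "ball (snd c m) e \<subseteq> img c"
      using open_img[OF c(1)] chart_in_img[OF c(2)] open_contains_ball by blast
    let ?U = "param c ` ball (snd c m) e"
    have "f m' = f m" if m': "m' \<in> ?U" for m'
    proof -
      obtain z where z: "m' = param c z" "z \<in> ball (snd c m) e" using m' by auto
      have "kap S c z = kap S c (snd c m)"
      proof (rule has_derivative_zero_unique[of "ball (snd c m) e" "kap S c"])
        fix y assume y: "y \<in> ball (snd c m) e"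
        then have yc: "y \<in> img c" using e by auto
        have "(kap S c has_derivative frechet_derivative (kap S c) (at y)) (at y)"
          by (rule smooth_on_has_derivative[OF smooth_on_kap[OF S c(1)] yc])
        then have "(kap S c has_derivative (\<lambda>u. 0)) (at y)"
          using dk[OF c(1) yc] by (simp add: ext[of "frechet_derivative (kap S c) (at y)" "\<lambda>u. 0"])
        then show "(kap S c has_derivative (\<lambda>u. 0)) (at y within ball (snd c m) e)"
          by (rule has_derivative_at_withinI)
      qed (use z e in auto)
      moreover have "z \<in> img c" using z e by auto
      ultimately show ?thesis using f[OF c] f[OF c(1), of m'] z by simp
    qed
    moreover have "openin M ?U" by (rule openin_param_image[OF c(1) open_ball e(2)])
    moreover have "m \<in> ?U" using c e(1) by (intro image_eqI[of _ _ "snd c m"]) auto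
    ultimately show "\<exists>U. openin M U \<and> m \<in> U \<and> (\<forall>m'\<in>U. f m' = f m)" by blast
  qed (use c d domain_subset param_in_domain in blast)+
  then show ?thesis using f[OF c(1) param_in_domain[OF c(2)]] f[OF d(1) param_in_domain[OF d(2)]] c d by simp
qed

text \<open>The reflection in the first coordinate reverses the orientation of a chart; being
  linear, it is its own derivative.\<close>

lemma smooth_diffeo_reflection: 
  "smooth_diffeo U ((\<lambda>y. \<chi> i. if i = 1 then - y$i else y$i) ` U)
     (\<lambda>y::real^3. \<chi> i. if i = 1 then - y$i else y$i) (\<lambda>y. \<chi> i. if i = 1 then - y$i else y$i)"
  "linear (\<lambda>y::real^3. (\<chi> i. if i = 1 then - y$i else y$i) :: real^3)" if "open U"
proof -
  define R where "R y = ((\<chi> i. if i = 1 then - y$i else y$i) :: real^3)" for y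
  have lin: "linear R" by (rule linearI) (auto simp: R_def vec_eq_iff)
  have RR: "R (R y) = y" for y by (simp add: R_def vec_eq_iff)
  have R: "R ` U = R -` U"
  proof (intro set_eqI iffI)
    fix y assume "y \<in> R -` U"
    then show "y \<in> R ` U" using RR[of y] by (metis imageI vimageE)
  qed (auto simp: RR)
  have c: "continuous_on S R" for S using linear_continuous_on[OF lin[unfolded linear_conv_bounded_linear]] .
  have o: "open (R ` U)" unfolding R by (rule open_vimage[OF that c])
  have "smooth_diffeo U (R ` U) R R"
    unfolding smooth_diffeo_def using that o smooth_on_linear[OF _ lin]
    by (auto intro!: homeomorphismI c simp: RR image_image)
  then show "smooth_diffeo U ((\<lambda>y. \<chi> i. if i = 1 then - y$i else y$i) ` U)
     (\<lambda>y::real^3. \<chi> i. if i = 1 then - y$i else y$i) (\<lambda>y. \<chi> i. if i = 1 then - y$i else y$i)"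
    "linear (\<lambda>y::real^3. (\<chi> i. if i = 1 then - y$i else y$i) :: real^3)"
    using lin by (simp_all add: R_def[abs_def])
qed

text \<open>Around each point a chart with positive coefficient exists: the coefficient keeps its
  sign on a neighbourhood, and a negative sign is repaired by a reflection. Between two such charts
  the Jacobian determinant is a quotient of positive coefficients.\<close>

lemma three_form_orientation:
  assumes S: "three_form A S" and nz: "\<And>c x. c \<in> A \<Longrightarrow> x \<in> img c \<Longrightarrow> top_coeff S c x \<noteq> 0"
  shows "orientation M A {c \<in> A. \<forall>x\<in>img c. top_coeff S c x > 0}" (is "orientation M A ?Or")
  unfolding orientation_def
proof (intro conjI ballI)
  show "?Or \<subseteq> A" by auto
  show "(\<Union>c\<in>?Or. fst c) = topspace M"
  proof (intro equalityI subsetI)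
    fix m assume "m \<in> topspace M"
    then obtain c where c: "c \<in> A" "m \<in> fst c" by (rule in_some_chart)
    let ?s = "sgn (top_coeff S c (snd c m))"
    have x: "snd c m \<in> img c" using c by simp
    have s: "?s * top_coeff S c (snd c m) > 0" using nz[OF c(1) x] by (simp add: sgn_mult_self_eq mult_sgn_abs sgn_if)
    let ?U = "{y \<in> img c. ?s * top_coeff S c y > 0}"
    have "continuous_on (img c) (\<lambda>y. ?s * top_coeff S c y)"
      by (intro continuous_on_mult continuous_on_const smooth_on_imp_continuous_on[OF three_form_smooth[OF S c(1)]])
    then have U: "open ?U"
      using continuous_open_preimage[OF _ open_img[OF c(1)] open_greaterThan[of 0]]
      by (simp add: vimage_def Int_def)
    have mU: "snd c m \<in> ?U" using x s by simp
    show "m \<in> (\<Union>c\<in>?Or. fst c)"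
    proof (cases "top_coeff S c (snd c m) > 0")
      case True
      have "smooth_diffeo ?U ?U (\<lambda>y. y) (\<lambda>y. y)"
        using U smooth_on_id[OF U] by (auto simp: smooth_diffeo_def intro!: homeomorphismI)
      then obtain d where d: "d \<in> A" "fst d = param c ` ?U" "img d = ?U" "overlap c d = ?U"
        "\<And>x. x \<in> ?U \<Longrightarrow> transition c d x = x" "\<And>x. x \<in> ?U \<Longrightarrow> jac c d x = frechet_derivative (\<lambda>y. y) (at x)"
        using new_chart[OF c(1), of ?U ?U "\<lambda>y. y" "\<lambda>y. y"] by blast
      have "top_coeff S d y > 0" if y: "y \<in> img d" for y
        using three_form_transition[OF S c(1) d(1), of y] y True d by simp
      moreover have "m \<in> fst d" unfolding d(2) using c mU by (intro image_eqI[of _ _ "snd c m"]) simp_all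
      ultimately show ?thesis using d(1) by (intro UN_I[of d]) simp_all
    next
      case False
      let ?R = "\<lambda>y::real^3. (\<chi> i. if i = 1 then - y$i else y$i) :: real^3"
      obtain d where d: "d \<in> A" "fst d = param c ` ?U" "img d = ?R ` ?U" "overlap c d = ?U"
        "\<And>x. x \<in> ?U \<Longrightarrow> transition c d x = ?R x" "\<And>x. x \<in> ?U \<Longrightarrow> jac c d x = frechet_derivative ?R (at x)"
        using new_chart[OF c(1) smooth_diffeo_reflection(1)[OF U]] by blast
      have J: "jac c d x = ?R" if "x \<in> ?U" for x
        unfolding d(6)[OF that] by (rule frechet_derivative_at[symmetric])
          (rule bounded_linear_imp_has_derivative, use smooth_diffeo_reflection(2)[OF U] in \<open>simp add: linear_conv_bounded_linear\<close>)
      have "top_coeff S d y > 0" if y: "y \<in> img d" for y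
      proof -
        obtain z where z: "y = ?R z" "z \<in> ?U" using y d(3) by auto
        have zc: "z \<in> img c" using z by simp
        have 1: "?R (axis 1 1) = - axis 1 1" "?R (axis 2 1) = axis 2 1" "?R (axis 3 1) = axis 3 1"
          by (simp_all add: vec_eq_iff forall_3)
        have "S d y (- axis 1 1) (axis 2 1) (axis 3 1) = top_coeff S c z"
          using three_form_transition[OF S c(1) d(1), of z "axis 1 1" "axis 2 1" "axis 3 1"] z d(4) d(5)[OF z(2)] J[OF z(2)]
          by (simp only: 1 z(1))
        moreover have "S d y (- axis 1 1) (axis 2 1) (axis 3 1) = - top_coeff S d y"
          by (subst three_form_det3[OF S d(1) y]) (simp add: det3_def)
        moreover have "top_coeff S c z < 0"
        proof -
          have "?s = -1" using False nz[OF c(1) x] by (simp add: sgn_if)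
          then show ?thesis using z(2) by simp
        qed
        ultimately show ?thesis by simp
      qed
      moreover have "m \<in> fst d" unfolding d(2) using c mU by (intro image_eqI[of _ _ "snd c m"]) simp_all
      ultimately show ?thesis using d(1) by (intro UN_I[of d]) simp_all
    qed
  next
    fix m assume "m \<in> (\<Union>c\<in>?Or. fst c)"
    then show "m \<in> topspace M" using domain_subset by blast
  qed
  fix c d x assume c: "c \<in> ?Or" and d: "d \<in> ?Or" and x: "x \<in> overlap c d"
  then have A: "c \<in> A" "d \<in> A" by auto
  have xc: "x \<in> img c" using x A by (simp add: overlap_iff)
  have td: "transition c d x \<in> img d" by (rule transition_in_img[OF A x])
  let ?J = "jac c d x"
  have "top_coeff S c x = top_coeff S d (transition c d x) * det3 (?J (axis 1 1)) (?J (axis 2 1)) (?J (axis 3 1))"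
    using three_form_transition[OF S A x, of "axis 1 1" "axis 2 1" "axis 3 1"] three_form_det3[OF S A(2) td] by metis
  moreover have "det3 (?J (axis 1 1)) (?J (axis 2 1)) (?J (axis 3 1)) = det (matrix ?J)"
    by (simp add: det3_def det_3 matrix_def algebra_simps)
  ultimately have "top_coeff S d (transition c d x) * det (matrix ?J) > 0"
    using c xc by auto
  moreover have "top_coeff S d (transition c d x) > 0" using d td by auto
  ultimately show "det (matrix ?J) > 0" by (simp add: zero_less_mult_iff)
qed

lemma parallel_torsion_imp_adapted:
  assumes C: "connection A D" and D: "twistor_free_torsion A g D p S" and P: "parallel_torsion A D"
    and I: "isotropic A g p" and nd: "\<not> degenerate A g S"
  shows "\<exists>Or. orientation M A Or \<and> (\<exists>p a. a \<noteq> 0 \<and> adapted_isotropic A g Or a p)"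
proof -
  have S: "three_form A S" and p: "vector_field A p" using D by (simp_all add: twistor_free_torsion_def)
  have Dp: "cov p S p c x u = 0" if "c \<in> A" "x \<in> img c" for c x u
    by (rule parallel_torsion_parallel_vector[OF C D P that])
  have DS: "form_derivative p S Y Z W c x u = 0"
    if v: "vector_field A Y" "vector_field A Z" "vector_field A W" and c: "c \<in> A" "x \<in> img c" for Y Z W c x u
  proof -
    obtain X where X: "vector_field A X" "X c x = u" using extend_vector[OF c] by metis
    have "g c x (cov p S p c x (X c x)) (Y c x) * g c x (Z c x) (W c x)
      - g c x (cov p S p c x (X c x)) (Z c x) * g c x (Y c x) (W c x) + form_derivative p S Y Z W c x (X c x) = 0"
      using P[unfolded parallel_torsion_iff[OF C D]] X(1) v c by blast
    then show ?thesis by (simp add: Dp[OF c] g_lin[OF c] X)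
  qed
  obtain c0 x0 where c0: "c0 \<in> A" "x0 \<in> img c0" and "gnorm3 g c0 x0 (S c0 x0) \<noteq> 0"
    using nd unfolding degenerate_def by blast
  have s0: "top_coeff S c0 x0 \<noteq> 0"
  proof
    assume "top_coeff S c0 x0 = 0"
    then have "S c0 x0 u w z = 0" for u w z using three_form_det3[OF S c0] by (metis mult_zero_left)
    then show False using \<open>gnorm3 g c0 x0 (S c0 x0) \<noteq> 0\<close> by (simp add: gnorm3_def)
  qed
  define k where "k = kap S c0 x0"
  have k: "kap S c x = k" if "c \<in> A" "x \<in> img c" for c x
    unfolding k_def by (rule kap_constant[OF S DS that c0])
  have k0: "k < 0"
    using s0 det_gram_neg[OF c0] by (simp add: k_def kap_def divide_pos_neg)
  \<comment> \<open>The positive root is the right one, because the orientation is taken from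
    \<open>S\<close> itself.\<close>
  define a where "a = sqrt (- k)"
  have a: "a > 0" "a\<^sup>2 = - k" using k0 by (simp_all add: a_def)
  have s2: "(top_coeff S c x)\<^sup>2 = a\<^sup>2 * \<bar>det (gram g c x)\<bar>" if "c \<in> A" "x \<in> img c" for c x
    using k[OF that] det_gram_neg[OF that] a(2) by (simp add: kap_def field_simps)
  have nz: "top_coeff S c x \<noteq> 0" if "c \<in> A" "x \<in> img c" for c x
    using s2[OF that] det_gram_nonzero[OF that] a(1) by auto
  let ?Or = "{c \<in> A. \<forall>x\<in>img c. top_coeff S c x > 0}"
  define V where "V c x u w z = S c x u w z / a" for c x u w z
  have "three_form A V"
    unfolding three_form_def
  proof (intro conjI ballI allI)
    show "linear (V c x u w)" if "c \<in> A" "x \<in> img c" for c x u w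
      using three_form_linear[OF S that, of u w] by (simp add: V_def[abs_def] linear_iff add_divide_distrib)
    show "V c x u w z = - V c x w u z" "V c x u w z = - V c x u z w" if "c \<in> A" "x \<in> img c" for c x u w z
      using three_form_swap[OF S that, of u w z] by (simp_all add: V_def)
    show "smooth_on (img c) (\<lambda>x. V c x u w z)" if "c \<in> A" for c u w z
      unfolding V_def using a(1) by (intro smooth_on_divide open_img that three_form_smooth[OF S that] smooth_on_const) simp
    show "V d (transition c d x) (jac c d x u) (jac c d x w) (jac c d x z) = V c x u w z"
      if "c \<in> A" "d \<in> A" "x \<in> overlap c d" for c d x u w z
      using three_form_transition[OF S that] by (simp add: V_def)
  qed
  moreover have "V c x u w z = sqrt \<bar>det (gram g c x)\<bar> * det (vector [u, w, z])" if "c \<in> ?Or" "x \<in> img c" for c x u w z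
  proof -
    have c: "c \<in> A" using that by auto
    have "top_coeff S c x = sqrt ((top_coeff S c x)\<^sup>2)" using that by (simp add: less_imp_le)
    also have "\<dots> = a * sqrt \<bar>det (gram g c x)\<bar>" using a(1) by (simp add: s2[OF c that(2)] real_sqrt_mult)
    finally show ?thesis
      using a(1) by (subst V_def, subst three_form_det3[OF S c that(2)]) (simp add: det_vector3)
  qed
  ultimately have V: "volume_form A g ?Or V" by (simp add: volume_form_def)
  have aV: "(\<lambda>c x u w z. a * V c x u w z) = S" using a(1) by (simp add: V_def fun_eq_iff)
  have "adapted_isotropic A g ?Or a p"
    unfolding adapted_isotropic_def
  proof (intro conjI exI[of _ V] I V)
    show "let S = \<lambda>c x u w z. a * V c x u w z in \<forall>X. vector_field A X \<longrightarrow> field_eq A (levi_civita g X p)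
             (\<lambda>c x. - g c x (X c x) (p c x) *\<^sub>R p c x - (1/2) *\<^sub>R form3_vec g S X p c x)"
      unfolding aV Let_def field_eq_def
    proof (intro allI impI ballI)
      fix X c x assume X: "vector_field A X" and c: "c \<in> A" "x \<in> img c"
      have "g c x (p c x) (p c x) = 0" using I c by (simp add: isotropic_def)
      then show "levi_civita g X p c x = - g c x (X c x) (p c x) *\<^sub>R p c x - (1/2) *\<^sub>R form3_vec g S X p c x"
        using Dp[OF c, of "X c x"] by (simp add: cov_def levi_civita_def form3_vec_def algebra_simps eq_neg_iff_add_eq_0)
    qed
  qed
  moreover have "orientation M A ?Or" by (rule three_form_orientation[OF S nz])
  moreover have "a \<noteq> 0" using a(1) by simp
  ultimately show ?thesis by blast
qed

text \<open>Passes from fields to single vectors by extending \<open>u\<close> to a field; in this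
  form the equation can be inserted into pointwise computations.\<close>

lemma adapted_nabla:
  assumes "adapted_isotropic A g Or a p"
  obtains V where "volume_form A g Or V"
    "\<And>c x u. c \<in> A \<Longrightarrow> x \<in> img c \<Longrightarrow>
      nabla_at g p c x u = - g c x u (p c x) *\<^sub>R p c x - (1/2) *\<^sub>R sharp g c x (\<lambda>z. a * V c x u (p c x) z)"
proof -
  obtain V where V: "volume_form A g Or V" "\<And>X c x. vector_field A X \<Longrightarrow> c \<in> A \<Longrightarrow> x \<in> img c \<Longrightarrow>
      levi_civita g X p c x = - g c x (X c x) (p c x) *\<^sub>R p c x
        - (1/2) *\<^sub>R form3_vec g (\<lambda>c x u w z. a * V c x u w z) X p c x"
    using assms unfolding adapted_isotropic_def Let_def field_eq_def by blast
  have "nabla_at g p c x u = - g c x u (p c x) *\<^sub>R p c x - (1/2) *\<^sub>R sharp g c x (\<lambda>z. a * V c x u (p c x) z)"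
    if c: "c \<in> A" "x \<in> img c" for c x u
  proof -
    obtain X where X: "vector_field A X" "X c x = u" using extend_vector[OF c] by metis
    show ?thesis using V(2)[OF X(1) c] by (simp add: X(2) levi_civita_def form3_vec_def)
  qed
  with V(1) show ?thesis by (rule that)
qed

lemma three_form_scale:
  assumes "three_form A V"
  shows "three_form A (\<lambda>c x u w z. a * V c x u w z)"
  unfolding three_form_def
proof (intro conjI ballI allI)
  show "linear (\<lambda>z. a * V c x u w z)" if "c \<in> A" "x \<in> img c" for c x u w
    using three_form_linear[OF assms that, of u w] by (simp add: linear_iff ring_distribs)
  show "a * V c x u w z = - (a * V c x w u z)" "a * V c x u w z = - (a * V c x u z w)" if "c \<in> A" "x \<in> img c" for c x u w z
    using three_form_swap[OF assms that, of u w z] by simp_all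
  show "smooth_on (img c) (\<lambda>x. a * V c x u w z)" if "c \<in> A" for c u w z
    by (intro smooth_on_mult open_img that three_form_smooth[OF assms that] smooth_on_const)
  show "a * V d (transition c d x) (jac c d x u) (jac c d x w) (jac c d x z) = a * V c x u w z"
    if "c \<in> A" "d \<in> A" "x \<in> overlap c d" for c d x u w z
    using three_form_transition[OF assms that] by simp
qed

text \<open>Kappa is computed in a chart of the orientation, where the volume form is explicit, and
  carried to \<open>c\<close> by \<open>kap_transition\<close>.\<close>

lemma kap_volume_form:
  assumes Or: "orientation M A Or" and V: "volume_form A g Or V" and c: "c \<in> A" "x \<in> img c"
  shows "kap (\<lambda>c x u w z. a * V c x u w z) c x = - a\<^sup>2"
proof -
  have 3: "three_form A V" using V by (simp add: volume_form_def)
  have "param c x \<in> topspace M" using c domain_subset param_in_domain by blast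
  then obtain d where d: "d \<in> Or" "param c x \<in> fst d" using Or unfolding orientation_def by blast
  then have dA: "d \<in> A" using Or by (auto simp: orientation_def)
  have o: "x \<in> overlap c d" using c d by (simp add: overlap_iff)
  have td: "transition c d x \<in> img d" by (rule transition_in_img[OF c(1) dA o])
  have "top_coeff V d (transition c d x) = sqrt \<bar>det (gram g d (transition c d x))\<bar>"
    using V d(1) td by (simp add: volume_form_def det_vector3 det3_def)
  then have "kap (\<lambda>c x u w z. a * V c x u w z) d (transition c d x) = - a\<^sup>2"
    using det_gram_neg[OF dA td] by (simp add: kap_def power_mult_distrib field_simps)
  then show ?thesis using kap_transition[OF three_form_scale[OF 3] c(1) dA o] by simp
qed

end

section \<open>From the equation for the null field to parallel torsion and to the Kundt
  conditions\<close>

context lorentz3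
begin

lemma det3_linear:
  "det3 (u + u') w z = det3 u w z + det3 u' w z" "det3 u (w + w') z = det3 u w z + det3 u w' z"
  "det3 (r *\<^sub>R u) w z = r * det3 u w z" "det3 u (r *\<^sub>R w) z = r * det3 u w z"
  by (simp_all add: det3_def algebra_simps)

lemma det3_expand_outer:
  "(\<Sum>k\<in>UNIV. \<Sum>l\<in>UNIV. h$k * h'$l * det3 (axis k 1) w (axis l 1)) = det3 h w h'"
  by (simp add: sum_3 det3_def algebra_simps)

lemma det3_expand:
  "(\<Sum>l\<in>UNIV. \<Sum>m\<in>UNIV. \<Sum>n\<in>UNIV. u$l * w$m * z$n * det3 (axis l 1) (axis m 1) (axis n 1)) = det3 u w z"
  by (simp add: sum_3 det3_def algebra_simps)

lemma sharp_add: "sharp g c x (\<lambda>z. \<alpha> z + \<beta> z) = sharp g c x \<alpha> + sharp g c x \<beta>"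
proof -
  have "(\<chi> i. \<alpha> (axis i 1) + \<beta> (axis i 1)) = (\<chi> i. \<alpha> (axis i 1)) + (\<chi> i. \<beta> (axis i 1))"
    by (simp add: vec_eq_iff)
  then show ?thesis by (simp add: sharp_def matrix_vector_right_distrib)
qed

lemma sharp_scale: "sharp g c x (\<lambda>z. r * \<alpha> z) = r *\<^sub>R sharp g c x \<alpha>"
proof -
  have "(\<chi> i. r * \<alpha> (axis i 1)) = r *\<^sub>R (\<chi> i. \<alpha> (axis i 1))"
    by (simp add: vec_eq_iff)
  then show ?thesis by (simp add: sharp_def matrix_vector_mult_scaleR)
qed

lemma sharp_three_form:
  assumes S: "three_form A S" and c: "c \<in> A" "x \<in> img c"
  shows "sharp g c x (S c x (u + u') w) = sharp g c x (S c x u w) + sharp g c x (S c x u' w)"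
    "sharp g c x (S c x u (w + w')) = sharp g c x (S c x u w) + sharp g c x (S c x u w')"
    "sharp g c x (S c x (r *\<^sub>R u) w) = r *\<^sub>R sharp g c x (S c x u w)"
    "sharp g c x (S c x u (r *\<^sub>R w)) = r *\<^sub>R sharp g c x (S c x u w)"
proof -
  note e = three_form_det3[OF S c]
  have 1: "S c x (u + u') w = (\<lambda>z. S c x u w z + S c x u' w z)"
    by (rule ext) (simp only: e[of "u + u'" w] e[of u w] e[of u' w] det3_linear ring_distribs)
  have 2: "S c x u (w + w') = (\<lambda>z. S c x u w z + S c x u w' z)"
    by (rule ext) (simp only: e[of u "w + w'"] e[of u w] e[of u w'] det3_linear ring_distribs)
  have 3: "S c x (r *\<^sub>R u) w = (\<lambda>z. r * S c x u w z)"
    by (rule ext) (simp only: e[of "r *\<^sub>R u" w] e[of u w] det3_linear mult.left_commute)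
  have 4: "S c x u (r *\<^sub>R w) = (\<lambda>z. r * S c x u w z)"
    by (rule ext) (simp only: e[of u "r *\<^sub>R w"] e[of u w] det3_linear mult.left_commute)
  show "sharp g c x (S c x (u + u') w) = sharp g c x (S c x u w) + sharp g c x (S c x u' w)"
    unfolding 1 by (rule sharp_add)
  show "sharp g c x (S c x u (w + w')) = sharp g c x (S c x u w) + sharp g c x (S c x u w')"
    unfolding 2 by (rule sharp_add)
  show "sharp g c x (S c x (r *\<^sub>R u) w) = r *\<^sub>R sharp g c x (S c x u w)"
    unfolding 3 by (rule sharp_scale)
  show "sharp g c x (S c x u (r *\<^sub>R w)) = r *\<^sub>R sharp g c x (S c x u w)"
    unfolding 4 by (rule sharp_scale)
qed

lemma vector_field_cov:
  assumes p: "vector_field A p" and S: "three_form A S" and X: "vector_field A X" and Y: "vector_field A Y"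
  shows "vector_field A (\<lambda>c x. cov p S Y c x (X c x))"
  unfolding vector_field_def
proof (intro conjI ballI)
  fix c assume c: "c \<in> A"
  note o = open_img[OF c]
  have lc: "smooth_on (img c) (\<lambda>x. nabla_at g Y c x (X c x))"
    using vector_field_smooth[OF vector_field_levi_civita[OF X Y] c] by (simp add: levi_civita_def)
  show "smooth_on (img c) (\<lambda>x. cov p S Y c x (X c x))"
    unfolding cov_def
    by (intro smooth_on_add[OF o] smooth_on_diff[OF o] smooth_on_scaleR[OF o] smooth_on_const lc
        smooth_on_g[OF c _ _ o order_refl] smooth_on_sharp[OF c] smooth_on_three_form[OF S c]
        vector_field_smooth[OF _ c] p X Y)
next
  fix c d x assume c: "c \<in> A" and d: "d \<in> A" and x: "x \<in> overlap c d"
  have xc: "x \<in> img c" using x c by (simp add: overlap_iff)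
  have td: "transition c d x \<in> img d" by (rule transition_in_img[OF c d x])
  let ?J = "jac c d x"
  have "sharp g d (transition c d x) (S d (transition c d x) (?J u) (?J w)) = ?J (sharp g c x (S c x u w))" for u w
  proof (rule nondegenerate[OF d td])
    fix z
    have z: "?J (jac d c (transition c d x) z) = z" by (rule jac_inverse'[OF c d x])
    have "g d (transition c d x) (sharp g d (transition c d x) (S d (transition c d x) (?J u) (?J w))) z
        = S d (transition c d x) (?J u) (?J w) (?J (jac d c (transition c d x) z))"
      by (simp add: g_sharp[OF d td three_form_linear[OF S d td]] z)
    also have "\<dots> = g c x (sharp g c x (S c x u w)) (jac d c (transition c d x) z)"
      by (simp add: three_form_transition[OF S c d x] g_sharp[OF c xc three_form_linear[OF S c xc]])
    also have "\<dots> = g d (transition c d x) (?J (sharp g c x (S c x u w))) (?J (jac d c (transition c d x) z))"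
      by (rule g_transition[OF c d x, symmetric])
    finally show "g d (transition c d x) (sharp g d (transition c d x) (S d (transition c d x) (?J u) (?J w))) z
        = g d (transition c d x) (?J (sharp g c x (S c x u w))) z" by (simp add: z)
  qed
  then show "cov p S Y d (transition c d x) (X d (transition c d x)) = ?J (cov p S Y c x (X c x))"
    by (simp add: cov_def vector_field_transition[OF _ c d x] X Y p nabla_transition[OF c d x Y] g_transition[OF c d x]
        linear_add[OF linear_jac[OF c d x]] linear_diff[OF linear_jac[OF c d x]] linear_scale[OF linear_jac[OF c d x]])
qed

lemma cov_cong:
  assumes "c \<in> A" "x \<in> img c" "field_eq A Y Y'"
  shows "cov p S Y c x u = cov p S Y' c x u"
proof -
  have "frechet_derivative (Y c) (at x) = frechet_derivative (Y' c) (at x)"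
    by (rule frechet_derivative_cong_open[OF open_img[OF assms(1)] assms(2)]) (use assms in \<open>auto simp: field_eq_def\<close>)
  then show ?thesis using assms by (simp add: cov_def nabla_at_def field_eq_def)
qed

lemma connection_cov:
  assumes p: "vector_field A p" and S: "three_form A S"
  shows "connection A (\<lambda>X Y c x. cov p S Y c x (X c x))"
  unfolding connection_def
proof (intro conjI allI impI)
  fix X X' Y Y' assume "vector_field A X \<and> vector_field A X' \<and> vector_field A Y \<and> vector_field A Y' \<and> field_eq A X X' \<and> field_eq A Y Y'"
  then show "field_eq A (\<lambda>c x. cov p S Y c x (X c x)) (\<lambda>c x. cov p S Y' c x (X' c x))"
    using cov_cong[of _ _ Y Y'] by (simp add: field_eq_def)
next
  fix X Y assume "vector_field A X \<and> vector_field A Y"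
  then show "vector_field A (\<lambda>c x. cov p S Y c x (X c x))" using vector_field_cov[OF p S] by blast
next
  fix X X' Y assume v: "vector_field A X \<and> vector_field A X' \<and> vector_field A Y"
  show "field_eq A (\<lambda>c x. cov p S Y c x (fplus X X' c x)) (fplus (\<lambda>c x. cov p S Y c x (X c x)) (\<lambda>c x. cov p S Y c x (X' c x)))"
    using v by (auto simp: field_eq_def fplus_def cov_def g_lin linear_add[OF nabla_linear] sharp_three_form[OF S] algebra_simps)
next
  fix X Y Y' assume v: "vector_field A X \<and> vector_field A Y \<and> vector_field A Y'"
  show "field_eq A (\<lambda>c x. cov p S (fplus Y Y') c x (X c x)) (fplus (\<lambda>c x. cov p S Y c x (X c x)) (\<lambda>c x. cov p S Y' c x (X c x)))"
    unfolding field_eq_def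
  proof (intro ballI)
    fix c x assume c: "c \<in> A" "x \<in> img c"
    have "(fplus Y Y' c has_derivative (\<lambda>u. frechet_derivative (Y c) (at x) u + frechet_derivative (Y' c) (at x) u)) (at x)"
      unfolding fplus_def using v by (intro has_derivative_add vector_field_has_derivative c) auto
    from frechet_derivative_at[OF this, symmetric]
    have "cov p S (fplus Y Y') c x (X c x) = cov p S Y c x (X c x) + cov p S Y' c x (X c x)"
      unfolding cov_def nabla_at_def
      by (simp add: fplus_def[of Y Y', THEN fun_cong, THEN fun_cong, of c x] g_lin[OF c] linear_add[OF linear_christoffel(2)[OF c]]
          sharp_three_form[OF S c] algebra_simps)
    then show "cov p S (fplus Y Y') c x (X c x) = fplus (\<lambda>c x. cov p S Y c x (X c x)) (\<lambda>c x. cov p S Y' c x (X c x)) c x"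
      by (simp add: fplus_def)
  qed
next
  fix f X Y assume v: "smooth_fun A f \<and> vector_field A X \<and> vector_field A Y"
  show "field_eq A (\<lambda>c x. cov p S Y c x (fscale f X c x)) (fscale f (\<lambda>c x. cov p S Y c x (X c x)))"
    using v by (auto simp: field_eq_def fscale_def cov_def g_lin linear_scale[OF nabla_linear] sharp_three_form[OF S] algebra_simps)
  show "field_eq A (\<lambda>c x. cov p S (fscale f Y) c x (X c x))
          (\<lambda>c x. frechet_derivative (f \<circ> param c) (at x) (X c x) *\<^sub>R Y c x + fscale f (\<lambda>c x. cov p S Y c x (X c x)) c x)"
    unfolding field_eq_def
  proof (intro ballI)
    fix c x assume c: "c \<in> A" "x \<in> img c"
    have "((f \<circ> param c) has_derivative frechet_derivative (f \<circ> param c) (at x)) (at x)"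
      using v c by (auto simp: smooth_fun_def intro: smooth_on_has_derivative)
    from has_derivative_scaleR[OF this vector_field_has_derivative[of Y, OF _ c]]
    have "(fscale f Y c has_derivative (\<lambda>u. f (param c x) *\<^sub>R frechet_derivative (Y c) (at x) u
        + frechet_derivative (f \<circ> param c) (at x) u *\<^sub>R Y c x)) (at x)"
      using v by (simp add: fscale_def)
    from frechet_derivative_at[OF this, symmetric]
    have "cov p S (fscale f Y) c x (X c x) = frechet_derivative (f \<circ> param c) (at x) (X c x) *\<^sub>R Y c x
        + f (param c x) *\<^sub>R cov p S Y c x (X c x)"
      unfolding cov_def nabla_at_def
      by (simp add: fscale_def[of f Y, THEN fun_cong, THEN fun_cong, of c x] g_lin[OF c] linear_scale[OF linear_christoffel(2)[OF c]]
          sharp_three_form[OF S c] algebra_simps)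
    then show "cov p S (fscale f Y) c x (X c x) = frechet_derivative (f \<circ> param c) (at x) (X c x) *\<^sub>R Y c x
        + fscale f (\<lambda>c x. cov p S Y c x (X c x)) c x"
      by (simp add: fscale_def)
  qed
qed

lemma ginv_sym: 
  assumes "c \<in> A" "x \<in> img c"
  shows "ginv g c x $ i $ j = ginv g c x $ j $ i"
proof -
  let ?G = "gram g c x" and ?H = "ginv g c x"
  note d = det_gram_nonzero[OF assms]
  have GG: "?G ** ?H = mat 1" "?H ** ?G = mat 1" using matrix_inv_left_right[OF d] by (simp_all add: ginv_def)
  have "transpose ?G = ?G" using g_sym[OF assms] by (simp add: vec_eq_iff transpose_def gram_def)
  then have "transpose ?H ** ?G = mat 1"
    using arg_cong[OF GG(1), of transpose] by (simp add: matrix_transpose_mul transpose_mat)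
  then have "transpose ?H ** (?G ** ?H) = ?H"
    by (simp only: matrix_mul_assoc matrix_mul_lid)
  then have "transpose ?H = ?H"
    by (simp only: GG(1) matrix_mul_rid)
  then show ?thesis by (metis (no_types, lifting) transpose_def vec_lambda_beta)
qed

text \<open>The full contraction of the determinant form with itself is 3! times the determinant of
  the inverse metric, hence not 0.\<close>

lemma gnorm3_nonzero:
  assumes S: "three_form A S" and c: "c \<in> A" "x \<in> img c" and s: "top_coeff S c x \<noteq> 0"
  shows "gnorm3 g c x (S c x) \<noteq> 0"
proof -
  define t where "t = top_coeff S c x"
  let ?H = "ginv g c x" and ?e = "\<lambda>i. axis i (1::real) :: real^3"
  have e: "S c x u w z = t * det3 u w z" for u w z unfolding t_def by (rule three_form_det3[OF S c])
  have "(\<Sum>i\<in>UNIV. \<Sum>j\<in>UNIV. \<Sum>k\<in>UNIV. \<Sum>l\<in>UNIV. \<Sum>m\<in>UNIV. \<Sum>n\<in>UNIV.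
     ?H $ i $ l * ?H $ j $ m * ?H $ k $ n * S c x (?e i) (?e j) (?e k) * S c x (?e l) (?e m) (?e n))
    = t\<^sup>2 * (\<Sum>i\<in>UNIV. \<Sum>j\<in>UNIV. \<Sum>k\<in>UNIV. det3 (?e i) (?e j) (?e k) *
        (\<Sum>l\<in>UNIV. \<Sum>m\<in>UNIV. \<Sum>n\<in>UNIV. ?H $ i $ l * ?H $ j $ m * ?H $ k $ n * det3 (?e l) (?e m) (?e n)))"
    unfolding e[of "?e _" "?e _" "?e _"] sum_distrib_left
    by (intro sum.cong refl) (simp add: power2_eq_square mult_ac)
  also have "\<dots> = t\<^sup>2 * (\<Sum>i\<in>UNIV. \<Sum>j\<in>UNIV. \<Sum>k\<in>UNIV. det3 (?e i) (?e j) (?e k) * det3 (?H $ i) (?H $ j) (?H $ k))"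
    by (simp only: det3_expand)
  also have "\<dots> = t\<^sup>2 * (6 * det ?H)"
    by (simp add: sum_3 det3_def det_3 algebra_simps)
  finally have *: "(\<Sum>i\<in>UNIV. \<Sum>j\<in>UNIV. \<Sum>k\<in>UNIV. \<Sum>l\<in>UNIV. \<Sum>m\<in>UNIV. \<Sum>n\<in>UNIV.
     ?H $ i $ l * ?H $ j $ m * ?H $ k $ n * S c x (?e i) (?e j) (?e k) * S c x (?e l) (?e m) (?e n)) = t\<^sup>2 * (6 * det ?H)" .
  have "det (gram g c x ** ?H) = 1"
    using matrix_inv_left_right(1)[OF det_gram_nonzero[OF c]] by (simp add: ginv_def)
  then have "det ?H \<noteq> 0" by (auto simp: det_mul)
  then show ?thesis using s by (simp add: gnorm3_def * t_def[symmetric])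
qed

lemma adapted_imp_parallel_torsion:
  assumes Or: "orientation M A Or" and a: "a \<noteq> 0" and ad: "adapted_isotropic A g Or a p"
  shows "\<exists>D p S. metric_connection A g D \<and> twistor_free_torsion A g D p S \<and> parallel_torsion A D \<and>
          isotropic A g p \<and> \<not> degenerate A g S"
proof -
  obtain V where V: "volume_form A g Or V" and n: "\<And>c x u. c \<in> A \<Longrightarrow> x \<in> img c \<Longrightarrow>
      nabla_at g p c x u = - g c x u (p c x) *\<^sub>R p c x - (1/2) *\<^sub>R sharp g c x (\<lambda>z. a * V c x u (p c x) z)"
    using adapted_nabla[OF ad] by metis
  define S where "S c x u w z = a * V c x u w z" for c x u w z
  have S: "three_form A S"
    using three_form_scale[of V a] V by (simp add: S_def[abs_def] volume_form_def)
  have I: "isotropic A g p" using ad by (simp add: adapted_isotropic_def)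
  then have p: "vector_field A p" by (simp add: isotropic_def)
  have kap: "kap S c x = - a\<^sup>2" if "c \<in> A" "x \<in> img c" for c x
    using kap_volume_form[OF Or V that, of a] by (simp add: S_def[abs_def])
  define D where "D X Y c x = cov p S Y c x (X c x)" for X Y :: "('a, 3) vfield" and c x
  have C: "connection A D" using connection_cov[OF p S] by (simp add: D_def[abs_def])
  have tf: "twistor_free_torsion A g D p S"
    unfolding twistor_free_torsion_def
    using p S by (auto simp: field_eq_def D_def cov_def levi_civita_def bivector_def form3_vec_def)
  have m: "metric_connection A g D"
    unfolding metric_connection_def
  proof (intro conjI C allI impI ballI)
    fix X Y Z c x assume v: "vector_field A X \<and> vector_field A Y \<and> vector_field A Z" and c: "c \<in> A" "x \<in> img c"
    then have "((\<lambda>y. g c y (Y c y) (Z c y)) has_derivative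
      (\<lambda>u. g c x (cov p S Y c x u) (Z c x) + g c x (Y c x) (cov p S Z c x u))) (at x)"
      by (intro cov_metric[OF c _ _ S]) auto
    from frechet_derivative_at[OF this, symmetric]
    show "frechet_derivative (\<lambda>y. g c y (Y c y) (Z c y)) (at x) (X c x)
        = g c x (D X Y c x) (Z c x) + g c x (Y c x) (D X Z c x)"
      by (simp add: D_def)
  qed
  have Dp: "cov p S p c x u = 0" if c: "c \<in> A" "x \<in> img c" for c x u
  proof -
    have "g c x (p c x) (p c x) = 0" using I c by (simp add: isotropic_def)
    then show ?thesis using n[OF c, of u] by (simp add: cov_def S_def[abs_def])
  qed
  have s: "top_coeff S c x \<noteq> 0" if "c \<in> A" "x \<in> img c" for c x
    using kap[OF that] a by (auto simp: kap_def)
  \<comment> \<open>As kappa is constant, the right-hand side of the differentiated product identity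
    vanishes. A frame Z paired with itself gives 2 (D S)(Z) S(Z) = 0, hence (D S)(Z) = 0; pairing
    arbitrary fields with this frame then gives D S = 0 on them.\<close>
  have DS: "form_derivative p S Y1 Y2 Y3 c x u = 0"
    if Y: "vector_field A Y1" "vector_field A Y2" "vector_field A Y3" and c: "c \<in> A" "x \<in> img c" for Y1 Y2 Y3 c x u
  proof -
    obtain Z1 where Z1: "vector_field A Z1" "Z1 c x = axis 1 1" using extend_vector[OF c] by metis
    obtain Z2 where Z2: "vector_field A Z2" "Z2 c x = axis 2 1" using extend_vector[OF c] by metis
    obtain Z3 where Z3: "vector_field A Z3" "Z3 c x = axis 3 1" using extend_vector[OF c] by metis
    have "frechet_derivative (kap S c) (at x) = frechet_derivative (\<lambda>y. - a\<^sup>2) (at x)"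
      by (rule frechet_derivative_cong_open[OF open_img[OF c(1)] c(2)]) (rule kap[OF c(1)])
    then have dk: "frechet_derivative (kap S c) (at x) u = 0" by simp
    have "form_derivative p S Z1 Z2 Z3 c x u = 0"
      using form_derivative_mult[OF S c Z1(1) Z2(1) Z3(1) Z1(1) Z2(1) Z3(1), of p u] s[OF c] by (simp add: dk Z1 Z2 Z3)
    then show ?thesis
      using form_derivative_mult[OF S c Y Z1(1) Z2(1) Z3(1), of p u] s[OF c] by (simp add: dk Z1 Z2 Z3)
  qed
  have "parallel_torsion A D"
    unfolding parallel_torsion_iff[OF C tf] by (auto simp: Dp DS g_lin)
  moreover have "\<not> degenerate A g S"
  proof -
    obtain m where "m \<in> topspace M" using nonempty by blast
    then obtain c where c: "c \<in> A" "m \<in> fst c" by (rule in_some_chart)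
    then show ?thesis
      unfolding degenerate_def using gnorm3_nonzero[OF S c(1) chart_in_img[OF c(2)] s[OF c(1) chart_in_img[OF c(2)]]]
        c(1) chart_in_img[OF c(2)] by blast
  qed
  ultimately show ?thesis using m tf I by blast
qed

text \<open>Lowered with \<open>g\<close>, the derivative of \<open>p\<close> is -g(u, p) g(w, p) -
  S(u, p, w)/2, split into its symmetric and its skew part. Each contraction in the Kundt conditions
  is then a multiple of g(p, p) = 0 or contracts a skew with a symmetric tensor.\<close>

lemma adapted_imp_kundt:
  assumes Or: "orientation M A Or" and ad: "adapted_isotropic A g Or a p"
  shows "kundt_space M A g"
proof -
  obtain V where V: "volume_form A g Or V" and n: "\<And>c x u. c \<in> A \<Longrightarrow> x \<in> img c \<Longrightarrow>
      nabla_at g p c x u = - g c x u (p c x) *\<^sub>R p c x - (1/2) *\<^sub>R sharp g c x (\<lambda>z. a * V c x u (p c x) z)"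
    using adapted_nabla[OF ad] by metis
  define S where "S c x u w z = a * V c x u w z" for c x u w z
  have S: "three_form A S"
    using three_form_scale[of V a] V by (simp add: S_def[abs_def] volume_form_def)
  have n: "nabla_at g p c x u = - g c x u (p c x) *\<^sub>R p c x - (1/2) *\<^sub>R sharp g c x (S c x u (p c x))"
    if "c \<in> A" "x \<in> img c" for c x u
    using n[OF that] by (simp add: S_def[abs_def])
  have I: "isotropic A g p" using ad by (simp add: adapted_isotropic_def)
  have pp: "g c x (p c x) (p c x) = 0" if "c \<in> A" "x \<in> img c" for c x
    using I that by (simp add: isotropic_def)
  have "field_eq A (levi_civita g p p) (\<lambda>c x. 0)"
    unfolding field_eq_def
  proof (intro ballI)
    fix c x assume c: "c \<in> A" "x \<in> img c"
    have "S c x (p c x) (p c x) = (\<lambda>z. 0 * 0)"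
      using three_form_swap(1)[OF S c, of "p c x" "p c x"] by (simp add: fun_eq_iff)
    then have "sharp g c x (S c x (p c x) (p c x)) = 0"
      using sharp_scale[of c x 0 "\<lambda>z. 0"] by simp
    then show "levi_civita g p p c x = 0" by (simp add: levi_civita_def n[OF c] pp[OF c])
  qed
  moreover have "trace (matrix (nabla_at g p c x)) = 0 \<and>
           gnorm2 g c x (\<lambda>u w. (g c x (nabla_at g p c x u) w + g c x (nabla_at g p c x w) u) / 2) = 0 \<and>
           gnorm2 g c x (\<lambda>u w. (g c x (nabla_at g p c x u) w - g c x (nabla_at g p c x w) u) / 2) = 0"
    if c: "c \<in> A" "x \<in> img c" for c x
  proof -
    let ?H = "ginv g c x" and ?e = "\<lambda>i. axis i (1::real) :: real^3" and ?p = "p c x"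
    \<comment> \<open>The covariant components of \<open>p\<close>, in terms of which
      \<open>pq\<close> below is the equation g(p, p) = 0.\<close>
    define q where "q i = g c x (?e i) ?p" for i
    have e: "S c x u w z = top_coeff S c x * det3 u w z" for u w z by (rule three_form_det3[OF S c])
    have sy: "?H $ 2 $ 1 = ?H $ 1 $ 2" "?H $ 3 $ 1 = ?H $ 1 $ 3" "?H $ 3 $ 2 = ?H $ 2 $ 3"
      by (rule ginv_sym[OF c])+
    have "matrix_inv (gram g c x) *v (gram g c x *v ?p) = ?p"
      by (rule matrix_inv_mult_vector(2)[OF det_gram_nonzero[OF c]])
    moreover have "gram g c x *v ?p = (\<chi> i. q i)"
      using g_gram[OF c, of "?e _" ?p] by (simp add: vec_eq_iff q_def inner_axis')
    ultimately have Hq: "?H *v (\<chi> i. q i) = ?p" by (simp add: ginv_def)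
    have pi: "?p $ i = ?H $ i $ 1 * q 1 + ?H $ i $ 2 * q 2 + ?H $ i $ 3 * q 3" for i
      using Hq[symmetric] by (simp add: vec_eq_iff matrix_vector_mult_def sum_3)
    have "(gram g c x *v ?p) \<bullet> ?p = 0" using pp[OF c] g_gram[OF c, of ?p ?p] by (simp add: inner_commute)
    then have pq: "q 1 * ?p $ 1 + q 2 * ?p $ 2 + q 3 * ?p $ 3 = 0"
      using \<open>gram g c x *v ?p = (\<chi> i. q i)\<close> by (simp add: inner_vec_def sum_3)
    have B: "g c x (nabla_at g p c x u) w = - g c x u ?p * g c x w ?p - S c x u ?p w / 2" for u w
      using g_sharp[OF c three_form_linear[OF S c]] by (simp add: n[OF c] g_lin[OF c] g_sym[OF c, of ?p w])
    have 1: "trace (matrix (nabla_at g p c x)) = 0"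
    proof -
      have "trace (matrix (nabla_at g p c x)) = (\<Sum>i\<in>UNIV. - q i * ?p $ i
          - (1/2) * (\<Sum>j\<in>UNIV. ?H $ i $ j * S c x (?e i) ?p (?e j)))"
        by (simp add: trace_def matrix_def n[OF c] q_def sharp_def matrix_vector_mult_def)
      also have "\<dots> = 0"
        unfolding e[of "?e _" ?p "?e _"] using pq by (simp add: sum_3 det3_def sy algebra_simps)
      finally show ?thesis .
    qed
    have 2: "gnorm2 g c x (\<lambda>u w. (g c x (nabla_at g p c x u) w + g c x (nabla_at g p c x w) u) / 2) = 0"
    proof -
      have "(g c x (nabla_at g p c x (?e i)) (?e j) + g c x (nabla_at g p c x (?e j)) (?e i)) / 2 = - q i * q j" for i j
      proof -
        have "S c x (?e j) ?p (?e i) = - S c x (?e i) ?p (?e j)"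
          unfolding e[of "?e _" ?p "?e _"] by (simp add: det3_def algebra_simps)
        then show ?thesis by (simp add: B q_def)
      qed
      then have "gnorm2 g c x (\<lambda>u w. (g c x (nabla_at g p c x u) w + g c x (nabla_at g p c x w) u) / 2)
        = sqrt \<bar>\<Sum>i\<in>UNIV. \<Sum>j\<in>UNIV. \<Sum>k\<in>UNIV. \<Sum>l\<in>UNIV. (q i * (?H $ i $ k * q k)) * (q j * (?H $ j $ l * q l))\<bar>"
        unfolding gnorm2_def by (simp add: mult_ac)
      also have "(\<Sum>i\<in>UNIV. \<Sum>j\<in>UNIV. \<Sum>k\<in>UNIV. \<Sum>l\<in>UNIV. (q i * (?H $ i $ k * q k)) * (q j * (?H $ j $ l * q l)))
        = (\<Sum>i\<in>UNIV. \<Sum>j\<in>UNIV. (q i * ?p $ i) * (q j * ?p $ j))"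
        by (intro sum.cong refl) (simp add: pi sum_3 ring_distribs)
      also have "\<dots> = (q 1 * ?p $ 1 + q 2 * ?p $ 2 + q 3 * ?p $ 3)\<^sup>2"
        by (simp add: sum_3 power2_eq_square algebra_simps)
      finally show ?thesis by (simp add: pq)
    qed
    have 3: "gnorm2 g c x (\<lambda>u w. (g c x (nabla_at g p c x u) w - g c x (nabla_at g p c x w) u) / 2) = 0"
    proof -
      have "(g c x (nabla_at g p c x (?e i)) (?e j) - g c x (nabla_at g p c x (?e j)) (?e i)) / 2 = - S c x (?e i) ?p (?e j) / 2" for i j
      proof -
        have "S c x (?e j) ?p (?e i) = - S c x (?e i) ?p (?e j)"
          unfolding e[of "?e _" ?p "?e _"] by (simp add: det3_def algebra_simps)
        then show ?thesis by (simp add: B mult.commute)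
      qed
      then have "gnorm2 g c x (\<lambda>u w. (g c x (nabla_at g p c x u) w - g c x (nabla_at g p c x w) u) / 2)
        = sqrt \<bar>\<Sum>i\<in>UNIV. \<Sum>j\<in>UNIV. (\<Sum>k\<in>UNIV. \<Sum>l\<in>UNIV. ?H $ i $ k * ?H $ j $ l * S c x (?e i) ?p (?e j) * S c x (?e k) ?p (?e l) / 4)\<bar>"
        unfolding gnorm2_def by simp
      also have "(\<Sum>i\<in>UNIV. \<Sum>j\<in>UNIV. (\<Sum>k\<in>UNIV. \<Sum>l\<in>UNIV. ?H $ i $ k * ?H $ j $ l * S c x (?e i) ?p (?e j) * S c x (?e k) ?p (?e l) / 4))
         = (\<Sum>i\<in>UNIV. \<Sum>j\<in>UNIV. S c x (?e i) ?p (?e j) * S c x (?H $ i) ?p (?H $ j)) / 4"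
        unfolding sum_divide_distrib
      proof (intro sum.cong refl)
        fix i j
        have "(\<Sum>k\<in>UNIV. \<Sum>l\<in>UNIV. ?H $ i $ k * ?H $ j $ l * S c x (?e i) ?p (?e j) * S c x (?e k) ?p (?e l) / 4)
          = S c x (?e i) ?p (?e j) * (top_coeff S c x * (\<Sum>k\<in>UNIV. \<Sum>l\<in>UNIV. ?H $ i $ k * ?H $ j $ l * det3 (?e k) ?p (?e l))) / 4"
          unfolding e[of "?e _" ?p "?e _"] sum_distrib_left sum_divide_distrib
          by (intro sum.cong refl) (simp add: mult_ac)
        also have "\<dots> = S c x (?e i) ?p (?e j) * S c x (?H $ i) ?p (?H $ j) / 4"
          by (simp only: det3_expand_outer e[of "?H $ i" ?p "?H $ j"])
        finally show "(\<Sum>k\<in>UNIV. \<Sum>l\<in>UNIV. ?H $ i $ k * ?H $ j $ l * S c x (?e i) ?p (?e j) * S c x (?e k) ?p (?e l) / 4)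
          = S c x (?e i) ?p (?e j) * S c x (?H $ i) ?p (?H $ j) / 4" .
      qed
      also have "(\<Sum>i\<in>UNIV. \<Sum>j\<in>UNIV. S c x (?e i) ?p (?e j) * S c x (?H $ i) ?p (?H $ j)) = 0"
      proof -
        \<comment> \<open>The rows of the inverse Gram matrix form the basis dual to the coordinate
          basis under \<open>g\<close>. Raising both free indices of S(u, p, w) means inserting
          these rows, so \<open>three_form_mult\<close> evaluates the contraction.\<close>
        have gH: "g c x (?e i) (?H $ j) = (if i = j then 1 else 0)" for i j
        proof -
          have "?H $ j = ?H *v ?e j" using ginv_sym[OF c] by (simp add: vec_eq_iff matrix_vector_mult_def axis_def if_distrib cong: if_cong)
          then have "gram g c x *v (?H $ j) = ?e j"
            using matrix_inv_mult_vector(1)[OF det_gram_nonzero[OF c], of "?e j"] by (simp add: ginv_def)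
          then show ?thesis using g_gram[OF c, of "?e i" "?H $ j"] by (simp add: inner_axis_axis)
        qed
        have gp: "g c x ?p (?H $ j) = ?p $ j" for j
        proof -
          have "g c x ?p (?H $ j) = (\<Sum>i\<in>UNIV. ?p $ i * g c x (?e i) (?H $ j))"
          proof -
            have "g c x ?p (?H $ j) = g c x (\<Sum>i\<in>UNIV. ?p $ i *\<^sub>R ?e i) (?H $ j)" using vec_eq_sum_axis[of ?p] by simp
            then show ?thesis by (simp only: sum_3 g_lin[OF c] real_scaleR_def)
          qed
          then show ?thesis by (simp add: gH if_distrib cong: if_cong)
        qed
        have "S c x (?e i) ?p (?e j) * S c x (?H $ i) ?p (?H $ j)
            = (if i = j then 0 else - kap S c x * (q i * ?p $ i + q j * ?p $ j))" for i j
          unfolding three_form_mult[OF S c] gdet_def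
          by (simp add: gH gp pp[OF c] q_def[symmetric] algebra_simps)
        then have "(\<Sum>i\<in>UNIV. \<Sum>j\<in>UNIV. S c x (?e i) ?p (?e j) * S c x (?H $ i) ?p (?H $ j))
            = - 4 * kap S c x * (q 1 * ?p $ 1 + q 2 * ?p $ 2 + q 3 * ?p $ 3)"
          by (simp add: sum_3 algebra_simps)
        then show ?thesis by (simp only: pq mult_zero_right)
      qed
      finally show ?thesis by simp
    qed
    show ?thesis using 1 2 3 by blast
  qed
  ultimately show ?thesis
    unfolding kundt_space_def lorentzian_manifold_def Let_def
    using smooth_manifold lorentzian_metric I by blast
qed

end

section \<open>The local normal form\<close>

lemma constant_along_direction:
  fixes h :: "'a::real_normed_vector \<Rightarrow> real"
  assumes "convex S" "y \<in> S" "y + t *\<^sub>R e \<in> S"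
    and d: "\<And>z. z \<in> S \<Longrightarrow> (h has_derivative h' z) (at z)" and 0: "\<And>z. z \<in> S \<Longrightarrow> h' z e = 0"
  shows "h (y + t *\<^sub>R e) = h y"
proof -
  have mem: "y + (r * t) *\<^sub>R e \<in> S" if "r \<in> {0..1}" for r
  proof -
    have "y + (r * t) *\<^sub>R e = (1 - r) *\<^sub>R y + r *\<^sub>R (y + t *\<^sub>R e)" by (simp add: algebra_simps)
    then show ?thesis using assms(1-3) that by (simp add: convex_alt)
  qed
  have "((\<lambda>r. h (y + (r * t) *\<^sub>R e)) has_derivative (\<lambda>_. 0)) (at r within {0..1})" if r: "r \<in> {0..1}" for r
  proof -
    have "((\<lambda>r. h (y + (r * t) *\<^sub>R e)) has_derivative (\<lambda>s. h' (y + (r * t) *\<^sub>R e) ((s * t) *\<^sub>R e))) (at r within {0..1})"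
      by (rule has_derivative_compose[where f = "\<lambda>r. y + (r * t) *\<^sub>R e" and g = h, OF _ d[OF mem[OF r]]]) (auto intro!: derivative_eq_intros)
    moreover have "h' (y + (r * t) *\<^sub>R e) ((s * t) *\<^sub>R e) = 0" for s
      using linear_scale[OF has_derivative_linear[OF d[OF mem[OF r]]]] 0[OF mem[OF r]] by simp
    ultimately show ?thesis by simp
  qed
  then obtain k where "\<And>r. r \<in> {0..1} \<Longrightarrow> h (y + (r * t) *\<^sub>R e) = k"
    using has_derivative_zero_constant[of "{0..1::real}" "\<lambda>r. h (y + (r * t) *\<^sub>R e)"] convex_real_interval by blast
  from this[of 0] this[of 1] show ?thesis by simp
qed

text \<open>The integral of \<open>N\<close> from \<open>l\<close> to \<open>y $ 2\<close> along the
  second axis, rescaled to {0..1}, so that smoothness in \<open>y\<close> is smoothness of an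
  integral in its parameters. For \<open>y $ 2 > l\<close> the interval has positive length and the
  fundamental theorem applies at an interior point.\<close>

lemma smooth_antiderivative:
  fixes N :: "real^3 \<Rightarrow> real"
  assumes "smooth_on UNIV N"
  obtains \<mu> where "smooth_on UNIV \<mu>" "\<And>y. y $ 2 > l \<Longrightarrow> frechet_derivative \<mu> (at y) (axis 2 1) = N y"
proof -
  let ?pt = "\<lambda>r y. y + ((r - 1) * (y $ 2 - l)) *\<^sub>R axis 2 1 :: real^3"
  define \<mu> where "\<mu> y = (y $ 2 - l) * integral {0..1} (\<lambda>r. N (?pt r y))" for y
  have o: "open (UNIV :: (real^3) set)" by simp
  have ptk: "Ck_family k {0..1} UNIV ?pt" for k
  proof -
    have 1: "Ck_family k {0..1} UNIV (\<lambda>r y :: real^3. y $ 2)"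
      by (rule Ck_family_bounded_linear[OF o bounded_linear_vec_nth Ck_family_id[OF o]])
    have 2: "Ck_family k {0..1} UNIV (\<lambda>r y :: real^3. (r - 1) * (y $ 2 + (- l)))"
      by (rule Ck_family_bilinear[OF o bounded_bilinear_mult Ck_family_param Ck_family_add[OF o 1 Ck_family_const]])
        (intro continuous_intros)
    have "Ck_family k {0..1} UNIV (\<lambda>r y :: real^3. y + ((r - 1) * (y $ 2 + (- l))) *\<^sub>R axis 2 1)"
      by (rule Ck_family_add[OF o Ck_family_id[OF o] Ck_family_bilinear[OF o bounded_bilinear_scaleR 2 Ck_family_const]])
    then show ?thesis by simp
  qed
  have Nk: "Ck_family k {0..1::real} UNIV (\<lambda>r. N)" for k
    using smooth_family_of_smooth_on[OF assms, of "{0..1::real}"] by (simp add: smooth_family_def)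
  have pt: "smooth_family {0..1} UNIV (\<lambda>r y. N (?pt r y))"
    unfolding smooth_family_def
  proof
    show "Ck_family k {0..1} UNIV (\<lambda>r y. N (?pt r y))" for k
      by (rule Ck_family_compose[OF o o Nk ptk]) simp
  qed
  have sm: "smooth_on UNIV \<mu>"
    unfolding \<mu>_def[abs_def]
    by (intro smooth_on_mult smooth_on_diff smooth_on_vec_nth smooth_on_id smooth_on_const smooth_integral_param[OF pt] o)
  have "frechet_derivative \<mu> (at y) (axis 2 1) = N y" if y: "y $ 2 > l" for y
  proof -
    let ?u = "\<lambda>s. N (y + (s - (y $ 2 - l)) *\<^sub>R axis 2 1)"
    have cu: "continuous_on S ?u" for S
      by (rule continuous_on_compose2[OF smooth_on_imp_continuous_on[OF assms]]) (auto intro!: continuous_intros)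
    have eq: "\<mu> (y + t *\<^sub>R axis 2 1) = integral {0..y $ 2 - l + t} ?u" if t: "y $ 2 - l + t \<ge> 0" for t
    proof -
      have "integral {0..y $ 2 - l + t} ?u = (y $ 2 - l + t) *\<^sub>R integral {0..1} (\<lambda>r. ?u ((y $ 2 - l + t) * r))"
        by (rule integral_rescale[OF cu t])
      moreover have "?pt r (y + t *\<^sub>R axis 2 1) = y + ((y $ 2 - l + t) * r - (y $ 2 - l)) *\<^sub>R axis 2 1" for r
        by (simp add: vec_eq_iff forall_3 algebra_simps)
      ultimately show ?thesis by (simp add: \<mu>_def algebra_simps)
    qed
    define b where "b = y $ 2 - l"
    have b: "b > 0" using y by (simp add: b_def)
    have "((\<lambda>s. integral {0..s} ?u) has_vector_derivative ?u b) (at b within {0..2 * b})"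
      by (rule integral_has_vector_derivative[OF cu]) (use b in auto)
    moreover have "at b within {0..2 * b} = at b"
      by (rule at_within_interior) (use b in \<open>simp add: interior_atLeastAtMost_real\<close>)
    ultimately have "((\<lambda>s. integral {0..s} ?u) has_vector_derivative N y) (at (b + 0))"
      by (simp add: b_def)
    moreover have "((\<lambda>t. b + t) has_vector_derivative 1) (at 0)"
      by (auto intro!: derivative_eq_intros)
    ultimately have "((\<lambda>t. integral {0..b + t} ?u) has_vector_derivative 1 *\<^sub>R N y) (at 0)"
      using vector_diff_chain_at[of "\<lambda>t. b + t" 1 0 "\<lambda>s. integral {0..s} ?u" "N y"] by (simp add: o_def)
    then have D: "((\<lambda>t. integral {0..b + t} ?u) has_derivative (\<lambda>t. t * N y)) (at 0)"
      by (simp add: has_vector_derivative_def)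
    have 1: "((\<lambda>t. \<mu> (y + t *\<^sub>R axis 2 1)) has_derivative (\<lambda>t. t * N y)) (at 0)"
      by (rule has_derivative_transform_within_open[OF D, of "{- b<..}"]) (use b eq in \<open>auto simp: b_def\<close>)
    have \<mu>d: "(\<mu> has_derivative frechet_derivative \<mu> (at (y + 0 *\<^sub>R axis 2 1))) (at (y + 0 *\<^sub>R axis 2 1))"
      by (rule smooth_on_has_derivative[OF sm]) simp
    have "((\<lambda>t. \<mu> (y + t *\<^sub>R axis 2 1)) has_derivative
        (\<lambda>t. frechet_derivative \<mu> (at (y + 0 *\<^sub>R axis 2 1)) (t *\<^sub>R axis 2 1))) (at 0)"
      by (rule has_derivative_compose[where f = "\<lambda>t. y + t *\<^sub>R axis 2 1" and g = \<mu>, OF _ \<mu>d])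
        (auto intro!: derivative_eq_intros)
    from fun_cong[OF has_derivative_unique[OF this 1], of 1] show ?thesis by simp
  qed
  with sm show ?thesis by (rule that)
qed

lemma smooth_diffeo_restrict:
  assumes "smooth_diffeo U V f h" "open B"
  shows "smooth_diffeo (U \<inter> B) (f ` (U \<inter> B)) f h"
proof -
  have f: "open U" "open V" "\<And>x. x \<in> U \<Longrightarrow> h (f x) = x" "f ` U = V" "\<And>y. y \<in> V \<Longrightarrow> f (h y) = y" "h ` V = U"
    "smooth_on U f" "smooth_on V h" "continuous_on U f" "continuous_on V h"
    using assms by (auto simp: smooth_diffeo_def homeomorphism_def)
  have im: "f ` (U \<inter> B) = V \<inter> h -` B"
  proof (intro set_eqI iffI)
    fix y assume "y \<in> f ` (U \<inter> B)"
    then obtain x where "y = f x" "x \<in> U" "x \<in> B" by blast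
    then show "y \<in> V \<inter> h -` B" using f(3,4) by auto
  next
    fix y assume "y \<in> V \<inter> h -` B"
    then show "y \<in> f ` (U \<inter> B)" using f(5,6) by (intro image_eqI[of _ _ "h y"]) auto
  qed
  have "open (f ` (U \<inter> B))" unfolding im using continuous_open_preimage[OF f(10,2) assms(2)] .
  moreover have "homeomorphism (U \<inter> B) (f ` (U \<inter> B)) f h"
    by (rule homeomorphism_of_subsets[of U V]) (use assms(1) im in \<open>auto simp: smooth_diffeo_def\<close>)
  ultimately show ?thesis
    using f assms(2) smooth_on_subset[OF f(7), of "U \<inter> B"] smooth_on_subset[OF f(8), of "f ` (U \<inter> B)"] im
    by (auto simp: smooth_diffeo_def open_Int)
qed

section \<open>Planar coordinate changes extended along the first axis\<close>

definition proj23 :: "real^3 \<Rightarrow> real^2" where "proj23 y = vector [y $ 2, y $ 3]"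
definition cons1 :: "real \<Rightarrow> real^2 \<Rightarrow> real^3" where "cons1 t w = vector [t, w $ 1, w $ 2]"

lemma proj23_cons1_simps [simp]:
  "proj23 y $ 1 = y $ 2" "proj23 y $ 2 = y $ 3" "cons1 t w $ 1 = t" "cons1 t w $ 2 = w $ 1" "cons1 t w $ 3 = w $ 2"
  by (simp_all add: proj23_def cons1_def vector_2 vector_3)

lemma proj23_cons1 [simp]: "proj23 (cons1 t w) = w" "cons1 (y $ 1) (proj23 y) = y"
  by (simp_all add: vec_eq_iff forall_2 forall_3)

lemma linear_proj23: "linear proj23"
  by (rule linearI) (simp_all add: vec_eq_iff forall_2)

lemma linear_cons1: "linear (\<lambda>w. cons1 0 w)"
  by (rule linearI) (simp_all add: vec_eq_iff forall_3)

lemma cons1_eq: "cons1 t w = t *\<^sub>R axis 1 1 + cons1 0 w"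
  by (simp add: vec_eq_iff forall_3)

lemma smooth_on_cons1:
  assumes "open S" "smooth_on S f" "smooth_on S h"
  shows "smooth_on S (\<lambda>y. cons1 (f y) (h y))"
proof -
  have "bounded_linear (\<lambda>w. cons1 0 w)" using linear_cons1 by (simp add: linear_conv_bounded_linear)
  from smooth_on_bounded_linear[OF assms(1) this assms(3)]
  show ?thesis unfolding cons1_eq[of "f _"]
    by (intro smooth_on_add smooth_on_scaleR assms smooth_on_const)
qed

text \<open>Straightening in the last two coordinates has to keep a field that already equals
  \<open>axis 1 1\<close>; a planar map that leaves the first coordinate alone does so.\<close>

lemma smooth_diffeo_cylinder:
  assumes "smooth_diffeo U V f h"
  shows "smooth_diffeo (proj23 -` U) (proj23 -` V) (\<lambda>y. cons1 (y $ 1) (f (proj23 y))) (\<lambda>y. cons1 (y $ 1) (h (proj23 y)))"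
proof -
  have f: "open U" "open V" "\<And>x. x \<in> U \<Longrightarrow> h (f x) = x" "\<And>x. x \<in> U \<Longrightarrow> f x \<in> V" "\<And>y. y \<in> V \<Longrightarrow> f (h y) = y"
    "\<And>y. y \<in> V \<Longrightarrow> h y \<in> U" "smooth_on U f" "smooth_on V h"
    using assms by (auto simp: smooth_diffeo_def homeomorphism_def)
  have c: "continuous_on UNIV proj23"
    using linear_proj23 by (simp add: linear_conv_bounded_linear linear_continuous_on)
  have o: "open (proj23 -` U)" "open (proj23 -` V)"
    using open_vimage[OF f(1) c] open_vimage[OF f(2) c] by auto
  have sm: "smooth_on (proj23 -` W) (\<lambda>y. cons1 (y $ 1) (k (proj23 y)))"
    if "open W" "smooth_on W k" for W and k :: "real^2 \<Rightarrow> real^2"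
  proof -
    have oW: "open (proj23 -` W)" using open_vimage[OF that(1) c] .
    show ?thesis
      by (rule smooth_on_cons1[OF oW smooth_on_vec_nth[OF oW smooth_on_id[OF oW]]
            smooth_on_compose[OF oW that smooth_on_linear[OF oW linear_proj23]]]) simp
  qed
  have "homeomorphism (proj23 -` U) (proj23 -` V) (\<lambda>y. cons1 (y $ 1) (f (proj23 y))) (\<lambda>y. cons1 (y $ 1) (h (proj23 y)))"
    by (rule homeomorphismI) (use f smooth_on_imp_continuous_on[OF sm] in auto)
  then show ?thesis
    using o sm f by (simp add: smooth_diffeo_def)
qed

lemma has_derivative_cylinder:
  assumes "(f has_derivative f') (at (proj23 y))"
  shows "((\<lambda>y. cons1 (y $ 1) (f (proj23 y))) has_derivative (\<lambda>v. cons1 (v $ 1) (f' (proj23 v)))) (at y)"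
proof -
  have lb: "bounded_linear (\<lambda>w. cons1 0 w)" "bounded_linear proj23"
    using linear_cons1 linear_proj23 by (simp_all add: linear_conv_bounded_linear)
  have "((\<lambda>y. f (proj23 y)) has_derivative (\<lambda>v. f' (proj23 v))) (at y)"
    by (rule has_derivative_compose[OF bounded_linear_imp_has_derivative[OF lb(2)] assms])
  from bounded_linear.has_derivative[OF lb(1) this]
  show ?thesis unfolding cons1_eq[of "_ $ 1"]
    by (intro has_derivative_add has_derivative_scaleR_left bounded_linear_imp_has_derivative[OF bounded_linear_vec_nth])
qed

section \<open>Adapted null fields in straightened coordinates\<close>

locale adapted3 = lorentz3 M A g for M :: "'a topology" and A :: "('a, 3) chart set" and g :: "('a, 3) form2" +
  fixes Or :: "('a, 3) chart set" and a :: real and p :: "('a, 3) vfield" and V :: "('a, 3) form3"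
  assumes Or: "orientation M A Or" and a_nonzero: "a \<noteq> 0" and isotropic_p: "isotropic A g p" and V: "volume_form A g Or V"
    and nabla_p: "\<And>c x u. c \<in> A \<Longrightarrow> x \<in> img c \<Longrightarrow>
      nabla_at g p c x u = - g c x u (p c x) *\<^sub>R p c x - (1/2) *\<^sub>R sharp g c x (\<lambda>z. a * V c x u (p c x) z)"
begin

lemma p_field: "vector_field A p" and p_nonzero: "c \<in> A \<Longrightarrow> x \<in> img c \<Longrightarrow> p c x \<noteq> 0"
  and p_null: "c \<in> A \<Longrightarrow> x \<in> img c \<Longrightarrow> g c x (p c x) (p c x) = 0"
  using isotropic_p by (auto simp: isotropic_def)

lemma V_form: "three_form A V" using V by (simp add: volume_form_def)

lemma g_nabla_p:
  assumes c: "c \<in> A" "x \<in> img c"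
  shows "2 * g c x (nabla_at g p c x u) z = - 2 * g c x u (p c x) * g c x z (p c x) - a * V c x u (p c x) z"
proof -
  have "linear (\<lambda>z. a * V c x u (p c x) z)" using three_form_linear[OF three_form_scale[OF V_form] c] .
  from g_sharp[OF c this] show ?thesis
    by (simp add: nabla_p[OF c] g_lin[OF c] g_sym[OF c, of "p c x"])
qed

lemma g_nabla_p_sym:
  assumes c: "c \<in> A" "x \<in> img c"
  shows "g c x (nabla_at g p c x u) z + g c x (nabla_at g p c x z) u = - 2 * g c x u (p c x) * g c x z (p c x)"
proof -
  have "V c x z (p c x) u = - V c x u (p c x) z"
    unfolding three_form_det3[OF V_form c, of z] three_form_det3[OF V_form c, of u "p c x" z] by (simp add: det3_def algebra_simps)
  then show ?thesis using g_nabla_p[OF c, of u z] g_nabla_p[OF c, of z u] by (simp add: algebra_simps)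
qed

lemma g_nabla_p_alt:
  assumes c: "c \<in> A" "x \<in> img c"
  shows "g c x (nabla_at g p c x u) z - g c x (nabla_at g p c x z) u = - a * V c x u (p c x) z"
proof -
  have "V c x z (p c x) u = - V c x u (p c x) z"
    unfolding three_form_det3[OF V_form c, of z] three_form_det3[OF V_form c, of u "p c x" z] by (simp add: det3_def algebra_simps)
  then show ?thesis using g_nabla_p[OF c, of u z] g_nabla_p[OF c, of z u] by (simp add: algebra_simps)
qed

lemma V_square:
  assumes c: "c \<in> A" "x \<in> img c"
  shows "(top_coeff V c x)\<^sup>2 = - det (gram g c x)"
  using kap_volume_form[OF Or V c, of 1] det_gram_nonzero[OF c] by (simp add: kap_def field_simps)

text \<open>For a field of constant components the covariant derivative is the Christoffel term
  alone. Its symmetrisation is the derivative of \<open>g\<close> along \<open>p\<close>, its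
  antisymmetrisation the exterior derivative of g(p, .).\<close>

lemma straight_p_metric:
  assumes c: "c \<in> A" "x \<in> img c" and p: "\<And>y. y \<in> img c \<Longrightarrow> p c y = axis 1 1"
  shows "dmetric c x (axis 1 1) u z = - 2 * g c x (axis 1 1) u * g c x (axis 1 1) z"
    and "dmetric c x u (axis 1 1) z - dmetric c x z (axis 1 1) u = - a * V c x u (axis 1 1) z"
proof -
  have "frechet_derivative (p c) (at x) = frechet_derivative (\<lambda>y. axis 1 1) (at x)"
    by (rule frechet_derivative_cong_open[OF open_img[OF c(1)] c(2) p])
  then have n: "nabla_at g p c x u = christoffel g c x u (axis 1 1)" for u
    by (simp add: nabla_at_def p[OF c(2)])
  show "dmetric c x (axis 1 1) u z = - 2 * g c x (axis 1 1) u * g c x (axis 1 1) z"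
    using g_nabla_p_sym[OF c, of u z] g_sym[OF c, of "axis 1 1"] dmetric_sym[OF c]
    by (simp add: n g_christoffel[OF c] p[OF c(2)] field_simps)
  show "dmetric c x u (axis 1 1) z - dmetric c x z (axis 1 1) u = - a * V c x u (axis 1 1) z"
    using g_nabla_p_alt[OF c, of u z] dmetric_sym[OF c, of z u "axis 1 1"] dmetric_sym[OF c, of u z "axis 1 1"]
      dmetric_sym[OF c, of "axis 1 1" z u]
    by (simp add: n g_christoffel[OF c] p[OF c(2)] field_simps)
qed

lemma straight_chart:
  assumes q: "q \<in> topspace M"
  obtains d where "d \<in> A" "q \<in> fst d" "\<And>y. y \<in> img d \<Longrightarrow> p d y = axis 1 1"
proof -
  obtain c where c: "c \<in> A" "q \<in> fst c" using q by (rule in_some_chart)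
  have x: "snd c q \<in> img c" using c by simp
  obtain U' V' and \<psi> :: "real^3 \<Rightarrow> real^3" and \<phi>
    where f: "smooth_diffeo V' U' \<psi> \<phi>" "U' \<subseteq> img c" "snd c q \<in> U'"
    "\<And>y. y \<in> V' \<Longrightarrow> frechet_derivative \<psi> (at y) (axis 1 1) = p c (\<psi> y)"
    by (rule flow_box[OF open_img[OF c(1)] vector_field_smooth[OF p_field c(1)] x p_nonzero[OF c(1) x], where k = 1], rule that)
  note f' = smooth_diffeo_sym[OF f(1)]
  obtain d where d: "d \<in> A" "fst d = param c ` U'" "img d = V'" "overlap c d = U'"
    "\<And>x. x \<in> U' \<Longrightarrow> transition c d x = \<phi> x" "\<And>x. x \<in> U' \<Longrightarrow> jac c d x = frechet_derivative \<phi> (at x)"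
    using new_chart[OF c(1) f' f(2)] by blast
  show ?thesis
  proof (rule that[OF d(1)])
    show "q \<in> fst d" unfolding d(2) using c f(3) by (intro image_eqI[of _ _ "snd c q"]) simp_all
    fix y assume "y \<in> img d"
    then have y: "y \<in> V'" by (simp add: d(3))
    then have \<psi>: "\<psi> y \<in> U'" "\<phi> (\<psi> y) = y" using f(1) by (auto simp: smooth_diffeo_def homeomorphism_def)
    show "p d y = axis 1 1"
      using vector_field_transition[OF p_field c(1) d(1), of "\<psi> y"] \<psi> d(4,5,6)
        smooth_diffeo_derivative_inverse[OF f' y, of "axis 1 1"] f(4)[OF y] by simp
  qed
qed

end

text \<open>A function on a ball that is constant along the first axis is thus determined by its
  values on the slice through the centre, which lies in the same ball.\<close>

lemma proj_xu_ball:
  fixes y0 :: "real^3"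
  assumes "y \<in> ball y0 r"
  shows "cons1 (y0 $ 1) (proj23 y) \<in> ball y0 r"
proof -
  have "norm (cons1 (y0 $ 1) (proj23 y) - y0) \<le> norm (y - y0)"
  proof (rule norm_le_componentwise_cart)
    show "norm ((cons1 (y0 $ 1) (proj23 y) - y0) $ i) \<le> norm ((y - y0) $ i)" for i
      using exhaust_3[of i] by auto
  qed
  then show ?thesis using assms by (simp add: dist_norm norm_minus_commute)
qed

lemma cons1_proj23_eq: "cons1 t (proj23 y) = y + (t - y $ 1) *\<^sub>R axis 1 1"
  by (simp add: vec_eq_iff forall_3)

context adapted3
begin

lemma null_chart:
  assumes q: "q \<in> topspace M"
  obtains d where "d \<in> A" "q \<in> fst d" "\<And>y. y \<in> img d \<Longrightarrow> p d y = axis 1 1"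
    "\<And>y. y \<in> img d \<Longrightarrow> g d y (axis 1 1) (axis 2 1) = 0"
proof -
  let ?e = "\<lambda>i. axis i (1::real) :: real^3"
  obtain c where c: "c \<in> A" "q \<in> fst c" "\<And>y. y \<in> img c \<Longrightarrow> p c y = ?e 1"
    using straight_chart[OF q] by metis
  define y0 where "y0 = snd c q"
  have y0: "y0 \<in> img c" using c by (simp add: y0_def)
  obtain r where r: "r > 0" "ball y0 r \<subseteq> img c" using open_img[OF c(1)] y0 open_contains_ball by blast
  let ?B = "ball y0 r"
  have g11: "g c y (?e 1) (?e 1) = 0" if "y \<in> img c" for y using p_null[OF c(1) that] c(3)[OF that] by simp
  \<comment> \<open>Since g(p, p) = 0, the derivative along \<open>p\<close> given by
    \<open>straight_p_metric\<close> vanishes as soon as one argument is \<open>p\<close>.\<close>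
  have inv: "g c (cons1 t (proj23 y)) (?e 1) w = g c y (?e 1) w" if "y \<in> ?B" "cons1 t (proj23 y) \<in> ?B" for y t w
    unfolding cons1_proj23_eq
  proof (rule constant_along_direction[of ?B])
    show "((\<lambda>z. g c z (?e 1) w) has_derivative (\<lambda>u. dmetric c z u (?e 1) w)) (at z)" if "z \<in> ?B" for z
      by (rule metric_has_derivative[OF c(1)]) (use that r in auto)
    show "dmetric c z (?e 1) (?e 1) w = 0" if "z \<in> ?B" for z
    proof -
      have z: "z \<in> img c" using that r by auto
      show ?thesis using straight_p_metric(1)[OF c(1) z c(3)] g11[OF z] by simp
    qed
  qed (use that in \<open>auto simp: cons1_proj23_eq\<close>)
  let ?i = "\<lambda>w. cons1 (y0 $ 1) w"
  define Q where "Q = ?i -` ?B"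
  have ism: "smooth_on S ?i" if "open S" for S
    by (rule smooth_on_cons1[OF that smooth_on_const smooth_on_id[OF that]])
  have Q: "open Q" unfolding Q_def
    by (rule open_vimage[OF open_ball smooth_on_imp_continuous_on[OF ism[OF open_UNIV]]])
  \<comment> \<open>The planar vector annihilated by g(p, .), obtained by exchanging its two
    components with a sign. It is not 0 at the centre, for otherwise \<open>p\<close> would be
    orthogonal to everything.\<close>
  define X :: "real^2 \<Rightarrow> real^2" where "X w = (\<chi> i. if i = 1 then - g c (?i w) (?e 1) (?e 3) else g c (?i w) (?e 1) (?e 2))" for w
  have gQ: "smooth_on Q (\<lambda>w. g c (?i w) (?e 1) u)" for u
    by (rule smooth_on_compose[OF Q open_ball smooth_on_subset[OF g_smooth[OF c(1)] r(2)] ism[OF Q]]) (simp add: Q_def)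
  have Xsm: "smooth_on Q X"
    unfolding X_def[abs_def]
  proof (rule smooth_on_vec_lambda[OF Q])
    show "smooth_on Q (\<lambda>w. if i = 1 then - g c (?i w) (?e 1) (?e 3) else g c (?i w) (?e 1) (?e 2))" for i :: 2
      using gQ[of "?e 2"] smooth_on_uminus[OF Q gQ[of "?e 3"]] by (cases "i = 1") auto
  qed
  have w0: "proj23 y0 \<in> Q" using r(1) by (simp add: Q_def)
  have X0: "X (proj23 y0) \<noteq> 0"
  proof
    assume "X (proj23 y0) = 0"
    then have "g c y0 (?e 1) (?e 3) = 0" "g c y0 (?e 1) (?e 2) = 0" by (auto simp: X_def vec_eq_iff forall_2)
    then have "g c y0 (?e 1) z = g c y0 0 z" for z
      by (subst vec3_eq[of z]) (simp add: g_lin[OF c(1) y0] g11[OF y0])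
    from nondegenerate[OF c(1) y0 this] show False by (simp add: vec_eq_iff forall_3)
  qed
  obtain U2 V2 and \<psi> :: "real^2 \<Rightarrow> real^2" and \<phi>
    where f: "smooth_diffeo V2 U2 \<psi> \<phi>" "U2 \<subseteq> Q" "proj23 y0 \<in> U2"
      "\<And>w. w \<in> V2 \<Longrightarrow> frechet_derivative \<psi> (at w) (axis 1 1) = X (\<psi> w)"
    by (rule flow_box[OF Q Xsm w0 X0, where k = 1], rule that)
  note f' = smooth_diffeo_sym[OF f(1)]
  have mem: "\<phi> w \<in> V2" "\<psi> (\<phi> w) = w" if "w \<in> U2" for w
    using f(1) that by (auto simp: smooth_diffeo_def homeomorphism_def)
  let ?F = "\<lambda>y. cons1 (y $ 1) (\<phi> (proj23 y))"
  note df = smooth_diffeo_restrict[OF smooth_diffeo_cylinder[OF f'] open_ball[of y0 r]]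
  obtain d where d: "d \<in> A" "fst d = param c ` (proj23 -` U2 \<inter> ?B)" "img d = ?F ` (proj23 -` U2 \<inter> ?B)"
    "overlap c d = proj23 -` U2 \<inter> ?B"
    "\<And>x. x \<in> proj23 -` U2 \<inter> ?B \<Longrightarrow> transition c d x = ?F x"
    "\<And>x. x \<in> proj23 -` U2 \<inter> ?B \<Longrightarrow> jac c d x = frechet_derivative ?F (at x)"
    using new_chart[OF c(1) df] r(2) by blast
  have main: "p d y = ?e 1 \<and> g d y (?e 1) (?e 2) = 0" if "y \<in> img d" for y
  proof -
    obtain z where z: "y = ?F z" "z \<in> proj23 -` U2 \<inter> ?B" using \<open>y \<in> img d\<close> d(3) by auto
    have zc: "z \<in> img c" and zo: "z \<in> overlap c d" using z r d(4) by auto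
    have zU: "proj23 z \<in> U2" using z by simp
    have D\<phi>: "(\<phi> has_derivative frechet_derivative \<phi> (at (proj23 z))) (at (proj23 z))"
      by (rule smooth_on_has_derivative[of U2]) (use f' zU in \<open>auto simp: smooth_diffeo_def\<close>)
    have J: "jac c d z v = cons1 (v $ 1) (frechet_derivative \<phi> (at (proj23 z)) (proj23 v))" for v
      unfolding d(6)[OF z(2)] by (rule fun_cong[OF frechet_derivative_at[OF has_derivative_cylinder[OF D\<phi>], symmetric]])
    have J1: "jac c d z (?e 1) = ?e 1"
    proof -
      have P0: "proj23 (?e 1) = 0" by (simp add: vec_eq_iff forall_2)
      show ?thesis
        by (simp only: J P0 linear_0[OF has_derivative_linear[OF D\<phi>]]) (simp add: vec_eq_iff forall_3)
    qed
    have "p d y = ?e 1"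
      using vector_field_transition[OF p_field c(1) d(1) zo] by (simp add: d(5)[OF z(2)] z(1)[symmetric] c(3)[OF zc] J1)
    moreover have "g d y (?e 1) (?e 2) = 0"
    proof -
      define v where "v = cons1 0 (X (proj23 z))"
      have "frechet_derivative \<phi> (at (proj23 z)) (X (proj23 z)) = axis 1 1"
        using smooth_diffeo_derivative_inverse[OF f' mem(1)[OF zU], of "axis 1 1"] f(4)[OF mem(1)[OF zU]] mem(2)[OF zU] by simp
      then have "jac c d z v = ?e 2" by (simp add: J v_def vec_eq_iff forall_3 axis_def)
      then have "g d y (?e 1) (?e 2) = g c z (?e 1) v"
        using g_transition[OF c(1) d(1) zo, of "?e 1" v] by (simp add: d(5)[OF z(2)] z(1)[symmetric] J1)
      also have "\<dots> = v $ 2 * g c z (?e 1) (?e 2) + v $ 3 * g c z (?e 1) (?e 3)"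
        by (subst vec3_eq[of v]) (simp add: g_lin[OF c(1) zc] v_def)
      also have "\<dots> = 0"
      proof -
        have "?i (proj23 z) \<in> ?B" using zU f(2) by (auto simp: Q_def)
        then show ?thesis using inv[of z "y0 $ 1"] z(2) by (simp add: v_def X_def)
      qed
      finally show ?thesis .
    qed
    ultimately show ?thesis ..
  qed
  show ?thesis
  proof (rule that[OF d(1)])
    have "y0 \<in> proj23 -` U2 \<inter> ?B" using f(3) r(1) by simp
    then show "q \<in> fst d" unfolding d(2) using c by (intro image_eqI[of _ _ y0]) (simp_all add: y0_def)
  qed (use main in auto)
qed

theorem normal_form_chart:
  assumes q: "q \<in> topspace M"
  shows "\<exists>c\<in>A. q \<in> fst c \<and> (\<exists>C. smooth_on (proj_xu (img c)) C \<and>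
    (\<forall>y\<in>img c. g c y = normal_metric a C y \<and> p c y = normal_null_field a y))"
proof -
  let ?e = "\<lambda>i. axis i (1::real) :: real^3"
  obtain d where d: "d \<in> A" "q \<in> fst d" "\<And>y. y \<in> img d \<Longrightarrow> p d y = ?e 1"
    "\<And>y. y \<in> img d \<Longrightarrow> g d y (?e 1) (?e 2) = 0"
    using null_chart[OF q] by metis
  have o: "open (img d)" by (rule open_img[OF d(1)])
  define y0 where "y0 = snd d q"
  have y0: "y0 \<in> img d" using d by (simp add: y0_def)
  define F where "F y = g d y (?e 1) (?e 3)" for y
  define G where "G y = g d y (?e 2) (?e 2)" for y
  define K where "K y = g d y (?e 2) (?e 3)" for y
  have g11: "g d y (?e 1) (?e 1) = 0" if "y \<in> img d" for y using p_null[OF d(1) that] d(3)[OF that] by simp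
  \<comment> \<open>As g(p, p) and g(p, d_2) vanish, one product of the expansion survives. Hence
    \<open>F\<close> and \<open>G\<close> are nowhere 0, and by \<open>V_square\<close> the
    coefficient of \<open>V\<close> is a square root of F^2 G.\<close>
  have detg: "det (gram g d y) = - ((F y)\<^sup>2 * G y)" if y: "y \<in> img d" for y
    using g_sym[OF d(1) y] g11[OF y] d(4)[OF y]
    by (simp add: det_3 gram_def F_def G_def g_sym[OF d(1) y, of "?e 2" "?e 1"] g_sym[OF d(1) y, of "?e 3" "?e 1"] power2_eq_square)
  have F0: "F y \<noteq> 0" and G0: "G y \<noteq> 0" if "y \<in> img d" for y
    using det_gram_nonzero[OF d(1) that] detg[OF that] by auto
  have tV: "(top_coeff V d y)\<^sup>2 = (F y)\<^sup>2 * G y" if "y \<in> img d" for y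
    using V_square[OF d(1) that] detg[OF that] by simp
  have Fsm: "smooth_on (img d) F" and Ksm: "smooth_on (img d) K"
    unfolding F_def[abs_def] K_def[abs_def] by (rule g_smooth[OF d(1)])+
  let ?DF = "\<lambda>y. frechet_derivative F (at y)"
  have Fd: "(F has_derivative ?DF y) (at y)" if "y \<in> img d" for y by (rule smooth_on_has_derivative[OF Fsm that])
  have DFeq: "?DF y v = dmetric d y v (?e 1) (?e 3)" if "y \<in> img d" for y v
    by (simp add: dmetric_def F_def[abs_def])
  have DF1: "?DF y (?e 1) = 0" if y: "y \<in> img d" for y
    using straight_p_metric(1)[OF d(1) y d(3)] by (simp add: DFeq[OF y] g11[OF y])
  \<comment> \<open>Since g(p, d_2) vanishes identically, the exterior derivative of g(p, .) on
    (d_2, d_3) is d_2 F alone.\<close>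
  have DF2: "?DF y (?e 2) = a * top_coeff V d y" if y: "y \<in> img d" for y
  proof -
    have "frechet_derivative (\<lambda>y. g d y (?e 1) (?e 2)) (at y) = frechet_derivative (\<lambda>y. 0) (at y)"
      by (rule frechet_derivative_cong_open[OF o y d(4)])
    then have "dmetric d y (?e 3) (?e 1) (?e 2) = 0" by (simp add: dmetric_def)
    then show ?thesis
      using straight_p_metric(2)[OF d(1) y d(3), of "?e 2" "?e 3"] three_form_swap(1)[OF V_form d(1) y, of "?e 2" "?e 1" "?e 3"]
      by (simp add: DFeq[OF y])
  qed
  \<comment> \<open>The sign of \<open>F\<close> near the point, which makes f = |F| smooth; the
    third new coordinate carries it so that g(d_v, d_u) becomes 1 and not -1.\<close>
  define \<sigma> where "\<sigma> = sgn (F y0)"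
  have \<sigma>: "\<sigma> * \<sigma> = 1" using F0[OF y0] by (simp add: \<sigma>_def sgn_if)
  have "open {y \<in> img d. \<sigma> * F y > 0}"
  proof -
    have "continuous_on (img d) (\<lambda>y. \<sigma> * F y)"
      by (intro continuous_on_mult continuous_on_const smooth_on_imp_continuous_on[OF Fsm])
    from continuous_open_preimage[OF this o open_greaterThan[of 0]] show ?thesis
      by (simp add: vimage_def Int_def)
  qed
  moreover have "y0 \<in> {y \<in> img d. \<sigma> * F y > 0}" using y0 F0[OF y0] by (simp add: \<sigma>_def sgn_if)
  ultimately obtain r0 where r0: "r0 > 0" "ball y0 r0 \<subseteq> {y \<in> img d. \<sigma> * F y > 0}"
    using open_contains_ball by meson
  let ?B = "ball y0 r0"
  have Bd: "y \<in> img d" if "y \<in> ?B" for y using that r0 by auto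
  \<comment> \<open>Projection to the slice through \<open>y0\<close>; composing with it exhibits a
    function as independent of the first coordinate.\<close>
  let ?P = "\<lambda>y. cons1 (y0 $ 1) (proj23 y)"
  let ?P' = "\<lambda>v. cons1 0 (proj23 v)"
  have P'lin: "bounded_linear ?P'"
    using linear_compose[OF linear_proj23 linear_cons1] by (simp add: o_def linear_conv_bounded_linear)
  have Pd: "(?P has_derivative ?P') (at y)" for y
    unfolding cons1_eq[of "y0 $ 1"]
    using has_derivative_add[OF has_derivative_const bounded_linear_imp_has_derivative[OF P'lin]] by simp
  have P'e: "?P' (?e 1) = 0" "?P' (?e 2) = ?e 2" "?P' (?e 3) = ?e 3"
    by (simp_all add: vec_eq_iff forall_3)
  have PB: "?P y \<in> ball y0 r" if "y \<in> ball y0 r" for y r using proj_xu_ball[OF that] .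
  have inv: "h (?P y) = h y" if y: "y \<in> ?B"
    and h: "\<And>z. z \<in> ?B \<Longrightarrow> (h has_derivative h' z) (at z)" "\<And>z. z \<in> ?B \<Longrightarrow> h' z (?e 1) = 0" for h :: "real^3 \<Rightarrow> real" and h' y
    unfolding cons1_proj23_eq
    by (rule constant_along_direction[OF convex_ball y _ h]) (use PB[OF y] in \<open>simp_all add: cons1_proj23_eq\<close>)
  have FP: "F (?P y) = F y" if "y \<in> ?B" for y
    by (rule inv[OF that Fd[OF Bd] DF1[OF Bd]])
  have KP: "K (?P y) = K y" if "y \<in> ?B" for y
  proof (rule inv[OF that])
    show "(K has_derivative (\<lambda>u. dmetric d z u (?e 2) (?e 3))) (at z)" if "z \<in> ?B" for z
      unfolding K_def[abs_def] by (rule metric_has_derivative[OF d(1) Bd[OF that]])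
    show "dmetric d z (?e 1) (?e 2) (?e 3) = 0" if "z \<in> ?B" for z
      using straight_p_metric(1)[OF d(1) Bd[OF that] d(3)] d(4)[OF Bd[OF that]] by simp
  qed
  have DFP: "?DF (?P y) (?P' v) = ?DF y v" if y: "y \<in> ?B" for y v
  proof -
    have "((\<lambda>y. F (?P y)) has_derivative (\<lambda>v. ?DF (?P y) (?P' v))) (at y)"
      by (rule has_derivative_compose[OF Pd Fd[OF Bd[OF PB[OF y]]]])
    then have "(F has_derivative (\<lambda>v. ?DF (?P y) (?P' v))) (at y)"
      by (rule has_derivative_transform_within_open[OF _ open_ball y]) (rule FP)
    from fun_cong[OF has_derivative_unique[OF this Fd[OF Bd[OF y]]], of v] show ?thesis .
  qed
  define f where "f y = \<sigma> * F y" for y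
  have fpos: "f y > 0" if "y \<in> ?B" for y using that r0(2) by (auto simp: f_def)
  \<comment> \<open>The derivative of the new coordinate x = - ln f / a in direction d_i.\<close>
  define X where "X i y = - (\<sigma> * ?DF y (?e i)) / (a * f y)" for i y
  \<comment> \<open>An antiderivative of \<open>N\<close> along the second coordinate is the shift of the coordinate \<open>v\<close> that makes
    \<open>g(\<partial>\<^sub>x, \<partial>\<^sub>u) = a v\<close>.\<close>
  define N where "N y = \<sigma> * (K y - X 2 y * X 3 y) / f y" for y
  have NP: "N (?P y) = N y" if "y \<in> ?B" for y
    using DFP[OF that, of "?e 2"] DFP[OF that, of "?e 3"] by (simp add: N_def X_def f_def FP[OF that] KP[OF that] P'e)
  have fsm: "smooth_on ?B f"
    unfolding f_def[abs_def] by (intro smooth_on_mult smooth_on_const smooth_on_subset[OF Fsm] open_ball) (use Bd in blast)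
  have "smooth_on ?B (\<lambda>y. X i y)" for i
    unfolding X_def
    by (intro smooth_on_divide smooth_on_uminus smooth_on_mult smooth_on_const smooth_on_subset[OF smooth_on_derivative[OF Fsm]] fsm open_ball)
      (use Bd fpos a_nonzero in force)+
  then have "smooth_on ?B N"
    unfolding N_def[abs_def]
    by (intro smooth_on_divide smooth_on_mult smooth_on_diff smooth_on_const smooth_on_subset[OF Ksm] fsm open_ball)
      (use Bd fpos in force)+
  then obtain r N' where r: "r > 0" "cball y0 (2 * r) \<subseteq> ?B" and N': "smooth_on UNIV N'" "\<And>y. y \<in> cball y0 r \<Longrightarrow> N' y = N y"
    using smooth_cutoff[OF open_ball, of y0 y0 r0 N] r0(1) by (metis centre_in_ball)
  \<comment> \<open>The base point y0 $ 2 - r lies below the second coordinate of every point of the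
    ball of radius r.\<close>
  obtain \<mu>0 where \<mu>0: "smooth_on UNIV \<mu>0" "\<And>y. y $ 2 > y0 $ 2 - r \<Longrightarrow> frechet_derivative \<mu>0 (at y) (?e 2) = N' y"
    using smooth_antiderivative[OF N'(1), where l = "y0 $ 2 - r"] by metis
  \<comment> \<open>Evaluated on the slice, the shift does not depend on the first coordinate, so
    the derivative of the new v along \<open>p\<close> is f alone.\<close>
  define \<mu> where "\<mu> y = \<mu>0 (?P y)" for y
  let ?U = "ball y0 r"
  have "?U \<subseteq> cball y0 (2 * r)" using r(1) by auto
  then have UB: "y \<in> ?B" if "y \<in> ?U" for y using that r(2) by blast
  have "smooth_on UNIV ?P"
    by (rule smooth_on_cons1[OF open_UNIV smooth_on_const smooth_on_linear[OF open_UNIV linear_proj23]])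
  then have \<mu>sm: "smooth_on UNIV \<mu>"
    unfolding \<mu>_def[abs_def] by (rule smooth_on_compose[OF open_UNIV open_UNIV \<mu>0(1)]) simp
  let ?D\<mu> = "\<lambda>y. frechet_derivative \<mu> (at y)"
  have \<mu>d: "(\<mu> has_derivative ?D\<mu> y) (at y)" for y using smooth_on_has_derivative[OF \<mu>sm] by simp
  have D\<mu>: "?D\<mu> y v = frechet_derivative \<mu>0 (at (?P y)) (?P' v)" for y v
  proof -
    have "(\<mu>0 has_derivative frechet_derivative \<mu>0 (at (?P y))) (at (?P y))"
      by (rule smooth_on_has_derivative[OF \<mu>0(1)]) simp
    from has_derivative_compose[OF Pd this] have "(\<mu> has_derivative (\<lambda>v. frechet_derivative \<mu>0 (at (?P y)) (?P' v))) (at y)"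
      by (simp add: \<mu>_def[abs_def])
    from fun_cong[OF has_derivative_unique[OF \<mu>d this]] show ?thesis .
  qed
  have D\<mu>1: "?D\<mu> y (?e 1) = 0" for y
    unfolding D\<mu> P'e by (rule linear_0[OF has_derivative_linear[OF smooth_on_has_derivative[OF \<mu>0(1)]]]) simp
  have D\<mu>2: "?D\<mu> y (?e 2) = N y" if y: "y \<in> ?U" for y
  proof -
    have "\<bar>(y - y0) $ 2\<bar> \<le> norm (y - y0)" by (rule component_le_norm_cart)
    then have "?P y $ 2 > y0 $ 2 - r" using y by (simp add: dist_norm norm_minus_commute)
    moreover have "?P y \<in> cball y0 r" using PB[OF y] by auto
    ultimately show ?thesis unfolding D\<mu> P'e using \<mu>0(2) N'(2) NP[OF UB[OF y]] by simp
  qed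
  define \<phi> :: "real^3 \<Rightarrow> real^3" where "\<phi> y = (\<chi> i. if i = 1 then f y * (y $ 1 + \<mu> y) else if i = 2 then - ln (f y) / a else \<sigma> * y $ 3)" for y
  have \<phi>c: "\<phi> y $ 1 = f y * (y $ 1 + \<mu> y)" "\<phi> y $ 2 = - ln (f y) / a" "\<phi> y $ 3 = \<sigma> * y $ 3" for y
    by (simp_all add: \<phi>_def)
  have oU: "open ?U" by simp
  have fsmU: "smooth_on ?U f" by (rule smooth_on_subset[OF fsm]) (use UB in blast)
  have "smooth_on ?U (\<lambda>y. if i = 1 then f y * (y $ 1 + \<mu> y) else if i = 2 then - ln (f y) / a else \<sigma> * y $ 3)" for i :: 3
  proof -
    have "smooth_on ?U (\<lambda>y. f y * (y $ 1 + \<mu> y))"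
      by (intro smooth_on_mult smooth_on_add smooth_on_vec_nth smooth_on_id smooth_on_subset[OF \<mu>sm] fsmU oU) simp
    moreover have "smooth_on ?U (\<lambda>y. - ln (f y) / a)"
      by (intro smooth_on_divide smooth_on_uminus smooth_on_ln fsmU oU smooth_on_const) (use UB fpos a_nonzero in auto)
    moreover have "smooth_on ?U (\<lambda>y. \<sigma> * y $ 3)"
      by (intro smooth_on_mult smooth_on_const smooth_on_vec_nth smooth_on_id oU)
    ultimately show ?thesis by (cases "i = 1"; cases "i = 2") simp_all
  qed
  then have \<phi>sm: "smooth_on ?U \<phi>"
    unfolding \<phi>_def[abs_def] by (rule smooth_on_vec_lambda[OF oU])
  let ?D\<phi> = "\<lambda>y. frechet_derivative \<phi> (at y)"
  have \<phi>d: "(\<phi> has_derivative ?D\<phi> y) (at y)" if "y \<in> ?U" for y by (rule smooth_on_has_derivative[OF \<phi>sm that])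
  have D\<phi>: "?D\<phi> y w $ 1 = \<sigma> * ?DF y w * (y $ 1 + \<mu> y) + f y * (w $ 1 + ?D\<mu> y w)"
    "?D\<phi> y w $ 2 = - (\<sigma> * ?DF y w) / (a * f y)" "?D\<phi> y w $ 3 = \<sigma> * w $ 3" if y: "y \<in> ?U" for y w
  proof -
    have fd: "(f has_derivative (\<lambda>w. \<sigma> * ?DF y w)) (at y)"
      unfolding f_def[abs_def] by (rule has_derivative_mult_right[OF Fd[OF Bd[OF UB[OF y]]]])
    have comp: "((\<lambda>y. \<phi> y $ i) has_derivative (\<lambda>w. ?D\<phi> y w $ i)) (at y)" for i
      by (rule bounded_linear.has_derivative[OF bounded_linear_vec_nth \<phi>d[OF y]])
    have vn: "((\<lambda>y. y $ i) has_derivative (\<lambda>w. w $ i)) (at y)" for i :: 3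
      by (rule bounded_linear_imp_has_derivative[OF bounded_linear_vec_nth])
    have "((\<lambda>y. \<phi> y $ 1) has_derivative (\<lambda>w. f y * (w $ 1 + ?D\<mu> y w) + \<sigma> * ?DF y w * (y $ 1 + \<mu> y))) (at y)"
      unfolding \<phi>c by (rule has_derivative_mult[OF fd has_derivative_add[OF vn \<mu>d]])
    from fun_cong[OF has_derivative_unique[OF comp this], of w]
    show "?D\<phi> y w $ 1 = \<sigma> * ?DF y w * (y $ 1 + \<mu> y) + f y * (w $ 1 + ?D\<mu> y w)" by simp
    have "((\<lambda>y. \<phi> y $ 2) has_derivative (\<lambda>w. - (\<sigma> * ?DF y w) / (a * f y))) (at y)"
      unfolding \<phi>c using fpos[OF UB[OF y]] a_nonzero
      by (auto intro!: derivative_eq_intros fd simp: field_simps)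
    from fun_cong[OF has_derivative_unique[OF comp this], of w]
    show "?D\<phi> y w $ 2 = - (\<sigma> * ?DF y w) / (a * f y)" .
    have "((\<lambda>y. \<phi> y $ 3) has_derivative (\<lambda>w. \<sigma> * w $ 3)) (at y)"
      unfolding \<phi>c by (rule has_derivative_mult_right[OF vn])
    from fun_cong[OF has_derivative_unique[OF comp this], of w]
    show "?D\<phi> y w $ 3 = \<sigma> * w $ 3" .
  qed
  \<comment> \<open>The skew part of the equation makes the squared derivative of x along the second
    axis equal to g(d_2, d_2); this is what gives the new vector d_x unit length.\<close>
  have X2sq: "(X 2 y)\<^sup>2 = G y" if y: "y \<in> ?U" for y
  proof -
    have yd: "y \<in> img d" by (rule Bd[OF UB[OF y]])
    have s2: "\<sigma>\<^sup>2 = 1" "\<sigma> \<noteq> 0" using \<sigma> by (auto simp: power2_eq_square)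
    show ?thesis
      using F0[OF yd] a_nonzero by (simp add: X_def f_def DF2[OF yd] power_mult_distrib power_divide tV[OF yd] s2)
  qed
  \<comment> \<open>The old coordinate vectors in terms of the new ones. The v-component of d_3 is
    left unspecified, because it affects none of the metric components except g(d_u, d_u).\<close>
  have J: "?D\<phi> y (?e 1) = f y *\<^sub>R ?e 1"
    "?D\<phi> y (?e 2) = (\<sigma> * (K y - X 2 y * X 3 y) - a * \<phi> y $ 1 * X 2 y) *\<^sub>R ?e 1 + X 2 y *\<^sub>R ?e 2"
    "\<exists>A3. ?D\<phi> y (?e 3) = A3 *\<^sub>R ?e 1 + X 3 y *\<^sub>R ?e 2 + \<sigma> *\<^sub>R ?e 3" if y: "y \<in> ?U" for y
  proof -
    have fp: "f y \<noteq> 0" using fpos[OF UB[OF y]] by simp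
    show "?D\<phi> y (?e 1) = f y *\<^sub>R ?e 1"
      by (simp add: vec_eq_iff forall_3 D\<phi>[OF y] DF1[OF Bd[OF UB[OF y]]] D\<mu>1)
    show "?D\<phi> y (?e 2) = (\<sigma> * (K y - X 2 y * X 3 y) - a * \<phi> y $ 1 * X 2 y) *\<^sub>R ?e 1 + X 2 y *\<^sub>R ?e 2"
    proof -
      have "a * \<phi> y $ 1 * X 2 y = - (\<sigma> * ?DF y (?e 2) * (y $ 1 + \<mu> y))"
        using fp a_nonzero by (simp add: \<phi>c X_def)
      moreover have "f y * N y = \<sigma> * (K y - X 2 y * X 3 y)" using fp by (simp add: N_def)
      ultimately show ?thesis
        by (simp add: vec_eq_iff forall_3 D\<phi>[OF y] D\<mu>2[OF y]) (simp add: X_def)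
    qed
    show "\<exists>A3. ?D\<phi> y (?e 3) = A3 *\<^sub>R ?e 1 + X 3 y *\<^sub>R ?e 2 + \<sigma> *\<^sub>R ?e 3"
      by (rule exI[of _ "?D\<phi> y (?e 3) $ 1"]) (simp add: vec_eq_iff forall_3 D\<phi>(2,3)[OF y] X_def)
  qed
  have y0U: "y0 \<in> ?U" using r(1) by simp
  \<comment> \<open>The Jacobian can be solved in turn: the third component gives w $ 3 = 0, the
    second then w $ 2 = 0 because d_2 F is not 0, and the first finally w $ 1 = 0.\<close>
  have "inj (?D\<phi> y0)"
    unfolding linear_injective_0[OF has_derivative_linear[OF \<phi>d[OF y0U]]]
  proof (intro allI impI)
    fix w assume w: "?D\<phi> y0 w = 0"
    note lin = has_derivative_linear[OF Fd[OF y0]] has_derivative_linear[OF \<mu>d[of y0]]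
    have \<sigma>0: "\<sigma> \<noteq> 0" using \<sigma> by auto
    have w3: "w $ 3 = 0" using arg_cong[OF w, of "\<lambda>v. v $ 3"] \<sigma>0 by (simp add: D\<phi>[OF y0U])
    have DFw: "?DF y0 w = 0"
      using arg_cong[OF w, of "\<lambda>v. v $ 2"] \<sigma>0 a_nonzero fpos[OF UB[OF y0U]] by (simp add: D\<phi>[OF y0U])
    have wexp: "w = w $ 1 *\<^sub>R ?e 1 + w $ 2 *\<^sub>R ?e 2" using vec3_eq[of w] w3 by simp
    have "w $ 2 * ?DF y0 (?e 2) = 0"
      using DFw DF1[OF y0] wexp by (metis linear_add[OF lin(1)] linear_scale[OF lin(1)] add_0 mult_zero_right real_scaleR_def)
    moreover have "?DF y0 (?e 2) \<noteq> 0"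
      using DF2[OF y0] tV[OF y0] F0[OF y0] G0[OF y0] a_nonzero by auto
    ultimately have w2: "w $ 2 = 0" by simp
    have "w = w $ 1 *\<^sub>R ?e 1" using wexp w2 by simp
    then have "?D\<mu> y0 w = 0" using D\<mu>1 linear_scale[OF lin(2)] by (metis scaleR_zero_right)
    then have "w $ 1 = 0" using arg_cong[OF w, of "\<lambda>v. v $ 1"] fpos[OF UB[OF y0U]] by (simp add: D\<phi>[OF y0U] DFw)
    then show "w = 0" using w2 w3 by (simp add: vec_eq_iff forall_3)
  qed
  from smooth_inverse_function[OF oU \<phi>sm y0U this]
  obtain U' V' \<psi> where U': "U' \<subseteq> ?U" "y0 \<in> U'" "smooth_diffeo U' V' \<phi> \<psi>" by metis
  have "\<phi> y0 \<in> V'" "open V'" using U' by (auto simp: smooth_diffeo_def homeomorphism_def)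
  \<comment> \<open>A ball in the new coordinates, so that lines in the v-direction can be followed
    to a slice without leaving the chart.\<close>
  then obtain \<rho> where \<rho>: "\<rho> > 0" "ball (\<phi> y0) \<rho> \<subseteq> V'" using open_contains_ball by blast
  let ?W = "ball (\<phi> y0) \<rho>"
  have VW: "V' \<inter> ?W = ?W" using \<rho>(2) by auto
  have df: "smooth_diffeo (\<psi> ` ?W) ?W \<phi> \<psi>"
    using smooth_diffeo_sym[OF smooth_diffeo_restrict[OF smooth_diffeo_sym[OF U'(3)] open_ball[of "\<phi> y0" \<rho>]]]
    unfolding VW .
  have \<psi>W: "\<psi> y' \<in> U'" "\<phi> (\<psi> y') = y'" if "y' \<in> ?W" for y'
    using U'(3) \<rho>(2) that by (auto simp: smooth_diffeo_def homeomorphism_def)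
  have sub: "\<psi> ` ?W \<subseteq> img d" using \<psi>W(1) U'(1) UB Bd by blast
  obtain c where c: "c \<in> A" "fst c = param d ` \<psi> ` ?W" "img c = ?W" "overlap d c = \<psi> ` ?W"
    "\<And>x. x \<in> \<psi> ` ?W \<Longrightarrow> transition d c x = \<phi> x" "\<And>x. x \<in> \<psi> ` ?W \<Longrightarrow> jac d c x = ?D\<phi> x"
    using new_chart[OF d(1) df sub] by blast
  have qc: "q \<in> fst c"
  proof -
    have "\<psi> (\<phi> y0) = y0" using U' by (auto simp: smooth_diffeo_def homeomorphism_def)
    then have "y0 \<in> \<psi> ` ?W" using \<rho>(1) by (intro image_eqI[of _ _ "\<phi> y0"]) auto
    moreover have "q = param d y0" using d by (simp add: y0_def)
    ultimately show ?thesis unfolding c(2) by (rule image_eqI[rotated])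
  qed
  \<comment> \<open>The old metric is transported through the triangular Jacobian. The new
    components come out one after another, each from the preceding ones after division by a power of
    f or \<open>X 2\<close>, or by the sign.\<close>
  have pc: "p c y' = exp (- a * y' $ 2) *\<^sub>R ?e 1"
    and g1: "g c y' (?e 1) (?e 1) = 0" "g c y' (?e 1) (?e 2) = 0" "g c y' (?e 1) (?e 3) = 1"
    and g2: "g c y' (?e 2) (?e 2) = 1" "g c y' (?e 2) (?e 3) = a * y' $ 1" if y': "y' \<in> ?W" for y'
  proof -
    define y where "y = \<psi> y'"
    have yU: "y \<in> ?U" and y: "y \<in> \<psi> ` ?W" "\<phi> y = y'" using \<psi>W[OF y'] U'(1) y' by (auto simp: y_def)
    have yd: "y \<in> img d" by (rule Bd[OF UB[OF yU]])
    have yo: "y \<in> overlap d c" using y c(4) by simp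
    have y'c: "y' \<in> img c" using y' c(3) by simp
    have fp: "f y > 0" by (rule fpos[OF UB[OF yU]])
    have fe: "f y = exp (- a * y' $ 2)" using fp a_nonzero y(2) \<phi>c(2)[of y] by simp
    show "p c y' = exp (- a * y' $ 2) *\<^sub>R ?e 1"
      using vector_field_transition[OF p_field d(1) c(1) yo] by (simp add: c(5,6)[OF y(1)] y(2) d(3)[OF yd] J[OF yU] fe)
    obtain A3 where A3: "?D\<phi> y (?e 3) = A3 *\<^sub>R ?e 1 + X 3 y *\<^sub>R ?e 2 + \<sigma> *\<^sub>R ?e 3" using J(3)[OF yU] by blast
    define A2 where "A2 = \<sigma> * (K y - X 2 y * X 3 y) - a * y' $ 1 * X 2 y"
    have J2: "?D\<phi> y (?e 2) = A2 *\<^sub>R ?e 1 + X 2 y *\<^sub>R ?e 2" using J(2)[OF yU] y(2) by (simp add: A2_def)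
    have tr: "g c y' (?D\<phi> y u) (?D\<phi> y w) = g d y u w" for u w
      using g_transition[OF d(1) c(1) yo] by (simp add: c(5,6)[OF y(1)] y(2))
    note lin = g_lin[OF c(1) y'c]
    have X2: "X 2 y \<noteq> 0" using X2sq[OF yU] G0[OF yd] by auto
    have s: "g c y' (?e 2) (?e 1) = g c y' (?e 1) (?e 2)" "g c y' (?e 3) (?e 1) = g c y' (?e 1) (?e 3)"
      "g c y' (?e 3) (?e 2) = g c y' (?e 2) (?e 3)" by (rule g_sym[OF c(1) y'c])+
    show h1: "g c y' (?e 1) (?e 1) = 0" using tr[of "?e 1" "?e 1"] fp by (simp add: J(1)[OF yU] lin g11[OF yd])
    show h2: "g c y' (?e 1) (?e 2) = 0" using tr[of "?e 1" "?e 2"] fp X2 by (simp add: J(1)[OF yU] J2 lin h1 d(4)[OF yd])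
    have "f y * (\<sigma> * g c y' (?e 1) (?e 3)) = F y" using tr[of "?e 1" "?e 3"] by (simp add: J(1)[OF yU] A3 lin h1 h2 F_def mult_ac)
    then have "f y * (\<sigma> * \<sigma> * g c y' (?e 1) (?e 3)) = f y" by (simp add: f_def mult_ac)
    then show h3: "g c y' (?e 1) (?e 3) = 1" using fp by (simp add: \<sigma>)
    have "(X 2 y)\<^sup>2 * g c y' (?e 2) (?e 2) = (X 2 y)\<^sup>2" using tr[of "?e 2" "?e 2"]
      by (simp add: J2 lin h1 h2 s X2sq[OF yU] G_def[symmetric]) (simp add: X2sq[OF yU, symmetric] power2_eq_square mult_ac)
    then show h4: "g c y' (?e 2) (?e 2) = 1" using X2 by simp
    have "A2 * \<sigma> + X 2 y * X 3 y + X 2 y * \<sigma> * g c y' (?e 2) (?e 3) = K y"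
      using tr[of "?e 2" "?e 3"] by (simp add: J2 A3 lin h1 h2 h3 h4 s K_def[symmetric] algebra_simps)
    moreover have "A2 * \<sigma> = K y - X 2 y * X 3 y - \<sigma> * X 2 y * (a * y' $ 1)"
    proof -
      have "A2 * \<sigma> = \<sigma> * \<sigma> * (K y - X 2 y * X 3 y) - \<sigma> * X 2 y * (a * y' $ 1)" by (simp add: A2_def algebra_simps)
      then show ?thesis by (simp add: \<sigma>)
    qed
    ultimately have "\<sigma> * X 2 y * (g c y' (?e 2) (?e 3) - a * y' $ 1) = 0" by (simp add: algebra_simps)
    then show "g c y' (?e 2) (?e 3) = a * y' $ 1" using X2 \<sigma> by auto
  qed
  \<comment> \<open>What is left of g(d_u, d_u) after the forced v-dependence has been removed;
    \<open>C\<close> will be its value on the slice v = v0.\<close>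
  define h where "h y = g c y (?e 3) (?e 3) + 2 * y $ 1 * exp (- a * y $ 2)" for y
  define v0 where "v0 = \<phi> y0 $ 1"
  define emb where "emb z = cons1 v0 (vector [fst z, snd z])" for z :: "real \<times> real"
  have emb_simps: "emb z $ 1 = v0" "emb z $ 2 = fst z" "emb z $ 3 = snd z" for z
    by (simp_all add: emb_def vector_2)
  define C where "C z = h (emb z)" for z
  have embW: "emb (y $ 2, y $ 3) = cons1 v0 (proj23 y)" for y by (simp add: vec_eq_iff forall_3 emb_simps)
  \<comment> \<open>The symmetric part of the equation on (d_u, d_u), with p = exp(- a x) d_v and
    g(d_v, d_u) = 1, gives -2 exp(- a x) for the v-derivative of g(d_u, d_u).\<close>
  have hC: "h y = C (y $ 2, y $ 3)" if y: "y \<in> ?W" for y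
  proof -
    have "h (y + (v0 - y $ 1) *\<^sub>R ?e 1) = h y"
    proof (rule constant_along_direction[OF convex_ball y])
      show "y + (v0 - y $ 1) *\<^sub>R ?e 1 \<in> ?W" using proj_xu_ball[OF y] by (simp add: cons1_proj23_eq v0_def)
      fix z assume z: "z \<in> ?W"
      have zc: "z \<in> img c" using z c(3) by simp
      have vn: "((\<lambda>y. y $ i) has_derivative (\<lambda>w. w $ i)) (at z)" for i :: 3
        by (rule bounded_linear_imp_has_derivative[OF bounded_linear_vec_nth])
      show "(h has_derivative (\<lambda>w. dmetric c z w (?e 3) (?e 3) + (2 * w $ 1 * exp (- a * z $ 2)
          - 2 * z $ 1 * (a * w $ 2 * exp (- a * z $ 2))))) (at z)"
        unfolding h_def[abs_def]
        by (rule has_derivative_add[OF metric_has_derivative[OF c(1) zc]])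
          (auto intro!: derivative_eq_intros vn simp: algebra_simps)
      let ?f = "exp (- a * z $ 2)"
      have "(p c has_derivative (\<lambda>w. (- a * w $ 2 * ?f) *\<^sub>R ?e 1)) (at z)"
      proof (rule has_derivative_transform_within_open[OF _ open_ball z])
        show "((\<lambda>y. exp (- a * y $ 2) *\<^sub>R ?e 1) has_derivative (\<lambda>w. (- a * w $ 2 * ?f) *\<^sub>R ?e 1)) (at z)"
          by (auto intro!: derivative_eq_intros vn simp: algebra_simps)
      qed (simp add: pc)
      from fun_cong[OF frechet_derivative_at[OF this, symmetric], of "?e 3"]
      have "nabla_at g p c z (?e 3) = ?f *\<^sub>R christoffel g c z (?e 3) (?e 1)"
        by (simp add: nabla_at_def pc[OF z] linear_scale[OF linear_christoffel(2)[OF c(1) zc]])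
      then have "?f * (2 * g c z (christoffel g c z (?e 3) (?e 1)) (?e 3)) = - 2 * ?f * ?f"
        using g_nabla_p_sym[OF c(1) zc, of "?e 3" "?e 3"] g1(3)[OF z] g_sym[OF c(1) zc, of "?e 3" "?e 1"]
        by (simp add: pc[OF z] g_lin[OF c(1) zc])
      then have "?f * (2 * g c z (christoffel g c z (?e 3) (?e 1)) (?e 3) + 2 * ?f) = 0" by (simp only: distrib_left)
      then have "2 * g c z (christoffel g c z (?e 3) (?e 1)) (?e 3) = - 2 * ?f"
        by (simp only: mult_eq_0_iff exp_not_eq_zero simp_thms)
      then show "dmetric c z (?e 1) (?e 3) (?e 3) + (2 * ?e 1 $ 1 * ?f - 2 * z $ 1 * (a * ?e 1 $ 2 * ?f)) = 0"
        using dmetric_sym[OF c(1) zc, of "?e 3" "?e 1" "?e 3"] by (simp add: g_christoffel[OF c(1) zc])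
    qed
    then show ?thesis by (simp add: C_def embW cons1_proj23_eq)
  qed
  have im: "proj_xu (img c) = emb -` ?W"
  proof (intro set_eqI iffI)
    fix z assume "z \<in> proj_xu (img c)"
    then obtain y where "z = (y $ 2, y $ 3)" "y \<in> ?W" by (auto simp: proj_xu_def c(3))
    then show "z \<in> emb -` ?W" using proj_xu_ball[of y "\<phi> y0" \<rho>] by (simp add: embW v0_def)
  next
    fix z assume "z \<in> emb -` ?W"
    then show "z \<in> proj_xu (img c)"
      unfolding proj_xu_def c(3) by (intro image_eqI[of _ _ "emb z"]) (auto simp: emb_simps)
  qed
  have embsm: "smooth_on S emb" if "open S" for S
  proof -
    have "smooth_on S (\<lambda>z. \<chi> i. if i = 1 then v0 else if i = 2 then fst z else snd z :: real^3)"
    proof (rule smooth_on_vec_lambda[OF that])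
      show "smooth_on S (\<lambda>z. if i = 1 then v0 else if i = 2 then fst z else snd z)" for i :: 3
        using smooth_on_fst[OF that smooth_on_id[OF that]] smooth_on_snd[OF that smooth_on_id[OF that]]
        by (cases "i = 1"; cases "i = 2") auto
    qed
    then show ?thesis by (rule smooth_on_cong[OF that]) (simp add: vec_eq_iff forall_3 emb_simps)
  qed
  have oim: "open (proj_xu (img c))" unfolding im
    by (rule open_vimage[OF open_ball smooth_on_imp_continuous_on[OF embsm[OF open_UNIV]]])
  have "smooth_on ?W h"
    unfolding h_def[abs_def]
    using g_smooth[OF c(1), of "?e 3" "?e 3"] unfolding c(3)
    by (intro smooth_on_add smooth_on_mult smooth_on_const smooth_on_exp smooth_on_vec_nth smooth_on_id open_ball)
  then have "smooth_on (proj_xu (img c)) C"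
    unfolding C_def[abs_def]
    by (rule smooth_on_compose[OF oim open_ball _ embsm[OF oim]]) (simp add: im)
  moreover have "g c y = normal_metric a C y" if y: "y \<in> img c" for y
  proof (intro ext)
    fix s t
    have yW: "y \<in> ?W" using y c(3) by simp
    have sy: "g c y (?e 2) (?e 1) = g c y (?e 1) (?e 2)" "g c y (?e 3) (?e 1) = g c y (?e 1) (?e 3)"
      "g c y (?e 3) (?e 2) = g c y (?e 2) (?e 3)" by (rule g_sym[OF c(1) y])+
    have g33: "g c y (?e 3) (?e 3) = - 2 * y $ 1 * exp (- a * y $ 2) + C (y $ 2, y $ 3)"
      using hC[OF yW] by (simp add: h_def)
    show "g c y s t = normal_metric a C y s t"
      unfolding g_expand[OF c(1) y, of s t]
      by (simp add: sum_3 sy g1[OF yW] g2[OF yW] g33 normal_metric_def algebra_simps)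
  qed
  moreover have "p c y = normal_null_field a y" if "y \<in> img c" for y
    using pc[of y] that c(3) by (simp add: normal_null_field_def)
  ultimately show ?thesis using c(1) qc by blast
qed

end

section \<open>Manifolds with a global chart\<close>

lemma second_countable_euclidean: "second_countable (euclidean :: 'a::second_countable_topology topology)"
proof -
  obtain \<B> :: "'a set set" where B: "countable \<B>" "\<And>V. V \<in> \<B> \<Longrightarrow> open V" "\<And>U. open U \<Longrightarrow> \<exists>\<U>. \<U> \<subseteq> \<B> \<and> U = \<Union>\<U>"
    using univ_second_countable by metis
  show ?thesis
    unfolding second_countable_def
  proof (intro exI[of _ \<B>] conjI ballI allI impI)
    fix U and x :: 'a assume "openin euclidean U \<and> x \<in> U"
    then show "\<exists>V\<in>\<B>. x \<in> V \<and> V \<subseteq> U" using B(3)[of U] by auto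
  qed (use B in auto)
qed

text \<open>A chart compatible with the identity chart is smooth with smooth inverse as a map
  between open sets. The transition between two such charts is then a composition of smooth maps, so
  the charts form a maximal atlas.\<close>

lemma smooth_manifold_global_chart:
  fixes W :: "(real^'n::finite) set"
  assumes W: "open W" "connected W" "W \<noteq> {}"
  shows "smooth_manifold (top_of_set W) (max_atlas (top_of_set W) {(W, id)})" and
    "(W, id) \<in> max_atlas (top_of_set W) {(W, id)}"
proof -
  define o0 :: "(real^'n, 'n) chart" where "o0 = (W, id)"
  define N where "N = top_of_set W"
  define B where "B = max_atlas N {o0}"
  have o0: "fst o0 = W" "img o0 = W" "snd o0 = id" by (auto simp: o0_def img_def)
  have param_o: "param o0 y = y" if "y \<in> W" for y
    unfolding param_def o0 using inv_into_f_f[of id W y] that by simp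
  have N: "topspace N = W" by (simp add: N_def)
  have chart_o: "is_chart N o0"
    using W(1) by (simp add: is_chart_def o0 N_def subtopology_subtopology homeomorphic_map_id)
  have "overlap o0 o0 = W" by (simp add: overlap_def o0)
  moreover have "smooth_on W (transition o0 o0)"
    by (rule smooth_on_cong[OF W(1) smooth_on_id[OF W(1)]]) (simp add: transition_def o0 param_o)
  ultimately have o_B: "o0 \<in> B" using chart_o by (simp add: B_def max_atlas_def compatible_def)
  have B: "is_chart N c" "compatible c o0" if "c \<in> B" for c using that by (auto simp: B_def max_atlas_def)
  have dom: "openin N (fst c)" "fst c \<subseteq> W" "open (fst c)" "open (img c)" if "c \<in> B" for c
  proof -
    show "openin N (fst c)" "open (img c)" using B(1)[OF that] by (auto simp: is_chart_def)
    then show "fst c \<subseteq> W" "open (fst c)" using W(1) by (auto simp: N_def openin_open_eq)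
  qed
  have inj: "inj_on (snd c) (fst c)" if "c \<in> B" for c
    using B(1)[OF that] dom(2)[OF that] unfolding is_chart_def
    by (metis N homeomorphic_imp_injective_map inf.absorb_iff2 topspace_subtopology)
  have smooth: "smooth_on (fst c) (snd c)" "smooth_on (img c) (param c)" if c: "c \<in> B" for c
  proof -
    have ov: "overlap o0 c = fst c" "overlap c o0 = img c"
      using dom(2)[OF c] by (auto simp: overlap_def o0 img_def)
    have s: "smooth_on (img c) (transition c o0)" "smooth_on (fst c) (transition o0 c)"
      using B(2)[OF c] by (simp_all add: compatible_def ov)
    show "smooth_on (fst c) (snd c)"
      by (rule smooth_on_cong[OF dom(3)[OF c] s(2)]) (use dom(2)[OF c] in \<open>auto simp: transition_def param_o\<close>)
    show "smooth_on (img c) (param c)"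
      by (rule smooth_on_cong[OF dom(4)[OF c] s(1)]) (simp add: transition_def o0)
  qed
  have half: "smooth_on (overlap c d) (transition c d)" if c: "c \<in> B" and d: "d \<in> B" for c d
  proof -
    have "overlap c d = img c \<inter> param c -` fst d"
    proof (intro set_eqI iffI)
      fix x assume "x \<in> overlap c d"
      then obtain m where "m \<in> fst c" "m \<in> fst d" "x = snd c m" by (auto simp: overlap_def)
      then show "x \<in> img c \<inter> param c -` fst d"
        using inv_into_f_f[OF inj[OF c]] by (auto simp: img_def param_def)
    next
      fix x assume x: "x \<in> img c \<inter> param c -` fst d"
      then have "x = snd c (param c x)" "param c x \<in> fst c"
        by (auto simp: img_def param_def f_inv_into_f inv_into_into)
      then show "x \<in> overlap c d" using x unfolding overlap_def by blast
    qed
    note eq = this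
    have op: "open (overlap c d)" unfolding eq
      by (rule continuous_open_preimage[OF smooth_on_imp_continuous_on[OF smooth(2)[OF c]] dom(4)[OF c] dom(3)[OF d]])
    show ?thesis
      unfolding transition_def o_def
      by (rule smooth_on_compose[OF op dom(3)[OF d] smooth(1)[OF d] smooth_on_subset[OF smooth(2)[OF c]]])
        (auto simp: eq)
  qed
  have "smooth_manifold N B"
    unfolding smooth_manifold_def
  proof (intro conjI ballI)
    show "topspace N \<noteq> {}" using W(3) N by simp
    show "Hausdorff_space N" unfolding N_def by (rule Hausdorff_space_subtopology[OF Hausdorff_space_euclidean])
    show "second_countable N" unfolding N_def by (rule second_countable_subtopology[OF second_countable_euclidean])
    show "connected_space N" using W(2) by (simp add: N_def connected_space_subtopology)
    show "is_chart N c" if "c \<in> B" for c by (rule B(1)[OF that])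
    show "(\<Union>c\<in>B. fst c) = topspace N" using dom(2) o_B o0(1) N by blast
    show "compatible c d" if "c \<in> B" "d \<in> B" for c d using half that by (simp add: compatible_def)
    show "max_atlas N B \<subseteq> B"
    proof
      fix c assume "c \<in> max_atlas N B"
      then have "is_chart N c" "\<forall>d\<in>B. compatible c d" unfolding max_atlas_def by simp_all
      with o_B have "is_chart N c" "compatible c o0" by blast+
      then show "c \<in> B" unfolding B_def max_atlas_def by simp
    qed
  qed
  with o_B show "smooth_manifold (top_of_set W) (max_atlas (top_of_set W) {(W, id)})"
    "(W, id) \<in> max_atlas (top_of_set W) {(W, id)}"
    unfolding N_def B_def o0_def by simp_all
qed

locale global_chart = smooth_mfd M A for M :: "'a topology" and A :: "('a, 'n::finite) chart set" +
  fixes b :: "('a, 'n) chart"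
  assumes global: "b \<in> A" "fst b = topspace M"
begin

text \<open>Tensor fields are families over all charts of the atlas, so an expression given in the
  global chart has to be supplied in every other chart as well; the pullbacks do this with the
  transformation law built in.\<close>

abbreviation pull_vector :: "(real^'n \<Rightarrow> real^'n) \<Rightarrow> ('a, 'n) vfield" where
  "pull_vector X c x \<equiv> jac b c (transition c b x) (X (transition c b x))"

abbreviation pull_form2 :: "(real^'n \<Rightarrow> real^'n \<Rightarrow> real^'n \<Rightarrow> real) \<Rightarrow> ('a, 'n) form2" where
  "pull_form2 h c x u w \<equiv> h (transition c b x) (jac c b x u) (jac c b x w)"

lemma overlap_global: "c \<in> A \<Longrightarrow> overlap c b = img c"
  using domain_subset[of c] by (auto simp: overlap_def img_def global(2))

lemma global_in: "c \<in> A \<Longrightarrow> x \<in> img c \<Longrightarrow> transition c b x \<in> img b"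
  and global_in_overlap: "c \<in> A \<Longrightarrow> x \<in> img c \<Longrightarrow> transition c b x \<in> overlap b c"
  and global_inverse: "c \<in> A \<Longrightarrow> x \<in> img c \<Longrightarrow> transition b c (transition c b x) = x"
  and global_jac_inverse': "c \<in> A \<Longrightarrow> x \<in> img c \<Longrightarrow> jac c b x (jac b c (transition c b x) u) = u"
  and linear_jac_global: "c \<in> A \<Longrightarrow> x \<in> img c \<Longrightarrow> linear (jac c b x)"
  using transition_in_img transition_in_overlap transition_inverse jac_inverse' linear_jac overlap_global global(1)
  by simp_all

lemma smooth_on_global: "c \<in> A \<Longrightarrow> smooth_on (img c) (transition c b)"
  and smooth_on_jac_global: "c \<in> A \<Longrightarrow> smooth_on (img c) (\<lambda>x. jac c b x u)"
  using smooth_on_transition smooth_on_jac overlap_global global(1) by metis+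

lemma transition_self: "y \<in> img b \<Longrightarrow> transition b b y = y"
  by (simp add: transition_eq)

lemma global_trans:
  assumes "c \<in> A" "d \<in> A" "x \<in> overlap c d"
  shows "transition d b (transition c d x) = transition c b x"
    "jac d b (transition c d x) (jac c d x u) = jac c b x u"
  using transition_trans jac_trans[OF assms(1,2) global(1)] assms overlap_global overlap_iff by simp_all

lemma vector_field_pull:
  assumes X: "smooth_on (img b) X"
  shows "vector_field A (pull_vector X)"
  unfolding vector_field_def
proof (intro conjI ballI)
  fix c assume c: "c \<in> A"
  have "smooth_on (overlap b c) (\<lambda>y. jac b c y (X y))"
    unfolding jac_def
    by (rule smooth_on_derivative_apply[OF open_overlap smooth_on_transition smooth_on_subset[OF X]])
      (simp_all add: c global(1) overlap_iff[OF global(1)] subset_iff)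
  from smooth_on_compose[OF open_img[OF c] open_overlap[OF global(1) c] this smooth_on_global[OF c]]
  show "smooth_on (img c) (pull_vector X c)" using global_in_overlap[OF c] by simp
next
  fix c d x assume c: "c \<in> A" and d: "d \<in> A" and x: "x \<in> overlap c d"
  have xc: "x \<in> img c" "param c x \<in> fst d" using x c by (simp_all add: overlap_iff)
  have "transition c b x \<in> overlap b d"
    using global_in[OF c xc(1)] param_transition[OF c global(1)] xc overlap_global[OF c] global(1) by (simp add: overlap_iff)
  from jac_trans[OF global(1) c d global_in_overlap[OF c xc(1)] this]
  show "pull_vector X d (transition c d x) = jac c d x (pull_vector X c x)"
    by (simp add: global_trans(1)[OF c d x] global_inverse[OF c xc(1)])
qed

lemma field_eq_global:
  assumes X: "vector_field A X" and Y: "vector_field A Y" and eq: "\<And>y. y \<in> img b \<Longrightarrow> X b y = Y b y"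
  shows "field_eq A X Y"
  unfolding field_eq_def
proof (intro ballI)
  fix c x assume c: "c \<in> A" and x: "x \<in> img c"
  note t = global_in_overlap[OF c x]
  show "X c x = Y c x"
    using vector_field_transition[OF X global(1) c t] vector_field_transition[OF Y global(1) c t] eq[OF global_in[OF c x]]
    by (simp add: global_inverse[OF c x])
qed

lemma lorentzian_metric_pull:
  assumes h: "\<And>y. y \<in> img b \<Longrightarrow> bilinear (h y)" "\<And>y u w. y \<in> img b \<Longrightarrow> h y u w = h y w u"
    "\<And>u w. smooth_on (img b) (\<lambda>y. h y u w)"
    and frame: "\<And>y. y \<in> img b \<Longrightarrow> \<exists>(e :: 'n \<Rightarrow> real^'n) k. \<forall>i j. h y (e i) (e j) = (if i \<noteq> j then 0 else if i = k then -1 else 1)"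
  shows "lorentzian_metric A (pull_form2 h)"
  unfolding lorentzian_metric_def tensor2_def
proof (intro conjI ballI allI)
  fix c x assume c: "c \<in> A" and x: "x \<in> img c"
  note y = global_in[OF c x]
  note l = linear_jac_global[OF c x]
  show "bilinear (pull_form2 h c x)"
    unfolding bilinear_def
    by (auto intro!: linearI simp: linear_add[OF l] linear_scale[OF l] bilinear_ladd[OF h(1)[OF y]] bilinear_radd[OF h(1)[OF y]]
        bilinear_lmul[OF h(1)[OF y]] bilinear_rmul[OF h(1)[OF y]])
  show "pull_form2 h c x u w = pull_form2 h c x w u" for u w by (rule h(2)[OF y])
  obtain e :: "'n \<Rightarrow> real^'n" and k where
    e: "\<And>i j. h (transition c b x) (e i) (e j) = (if i \<noteq> j then 0 else if i = k then -1 else 1)"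
    using frame[OF y] by blast
  show "\<exists>(e :: 'n \<Rightarrow> real^'n) k. \<forall>i j. pull_form2 h c x (e i) (e j) = (if i \<noteq> j then 0 else if i = k then -1 else 1)"
    by (rule exI[of _ "\<lambda>i. jac b c (transition c b x) (e i)"], rule exI[of _ k]) (simp add: global_jac_inverse'[OF c x] e)
next
  fix c :: "('a, 'n) chart" and u w assume c: "c \<in> A"
  have "smooth_on (img c) (\<lambda>x. \<Sum>i\<in>UNIV. \<Sum>j\<in>UNIV. jac c b x u $ i * jac c b x w $ j * h (transition c b x) (axis i 1) (axis j 1))"
    by (intro smooth_on_sum smooth_on_mult smooth_on_vec_nth smooth_on_jac_global[OF c] open_img[OF c]
        smooth_on_compose[OF open_img[OF c] open_img[OF global(1)] h(3) smooth_on_global[OF c]] global_in[OF c])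
  then show "smooth_on (img c) (\<lambda>x. pull_form2 h c x u w)"
    by (rule smooth_on_cong[OF open_img[OF c]]) (rule bilinear_expand[OF h(1)[OF global_in[OF c]], symmetric])
next
  fix c d x u w assume "c \<in> A" "d \<in> A" "x \<in> overlap c d"
  then show "pull_form2 h d (transition c d x) (jac c d x u) (jac c d x w) = pull_form2 h c x u w"
    by (simp add: global_trans)
qed

end

lemma three_form_pull_det3:
  fixes A :: "('a, 3) chart set" 
  assumes "global_chart M A b"
  shows "three_form A (\<lambda>c x u w z. r * det3 (jac c b x u) (jac c b x w) (jac c b x z))"
proof -
  interpret global_chart M A b by fact
  show ?thesis
    unfolding three_form_def
  proof (intro conjI ballI allI)
    fix c x u w z assume c: "c \<in> A" and x: "x \<in> img c"
    note l = linear_jac_global[OF c x]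
    show "linear (\<lambda>z. r * det3 (jac c b x u) (jac c b x w) (jac c b x z))"
      by (rule linearI) (simp_all add: linear_add[OF l] linear_scale[OF l] det3_def algebra_simps)
    show "r * det3 (jac c b x u) (jac c b x w) (jac c b x z) = - (r * det3 (jac c b x w) (jac c b x u) (jac c b x z))"
      "r * det3 (jac c b x u) (jac c b x w) (jac c b x z) = - (r * det3 (jac c b x u) (jac c b x z) (jac c b x w))"
      by (simp_all add: det3_def algebra_simps)
  next
    fix c :: "('a, 3) chart" and u w z assume c: "c \<in> A"
    show "smooth_on (img c) (\<lambda>x. r * det3 (jac c b x u) (jac c b x w) (jac c b x z))"
      unfolding det3_def
      by (intro smooth_on_add smooth_on_diff smooth_on_mult smooth_on_const smooth_on_vec_nth smooth_on_jac_global[OF c] open_img[OF c])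
  next
    fix c d x u w z assume "c \<in> A" "d \<in> A" "x \<in> overlap c d"
    then show "r * det3 (jac d b (transition c d x) (jac c d x u)) (jac d b (transition c d x) (jac c d x w))
        (jac d b (transition c d x) (jac c d x z)) = r * det3 (jac c b x u) (jac c b x w) (jac c b x z)"
      by (simp add: global_trans)
  qed
qed

section \<open>The model\<close>

lemma open_proj_xu: "open W \<Longrightarrow> open (proj_xu W)"
  unfolding proj_xu_def
proof (rule open_surjective_linear_image)
  show "linear (\<lambda>y::real^3. (y $ 2, y $ 3))" by (rule linearI) auto
  show "surj (\<lambda>y::real^3. (y $ 2, y $ 3))"
  proof (rule surjI)
    show "(\<lambda>y::real^3. (y $ 2, y $ 3)) (fst z *\<^sub>R axis 2 1 + snd z *\<^sub>R axis 3 1) = z" for z :: "real \<times> real"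
      by simp
  qed
qed

lemma bilinear_normal_metric: "bilinear (normal_metric a C y)"
  by (auto intro!: linearI simp: bilinear_def normal_metric_def algebra_simps)

lemma normal_metric_sym: "normal_metric a C y u w = normal_metric a C y w u"
  by (simp add: normal_metric_def algebra_simps)

lemma normal_metric_axis:
  "normal_metric a C y (axis 1 1) z = z $ 3"
  "normal_metric a C y (axis 2 1) z = a * y $ 1 * z $ 3 + z $ 2"
  "normal_metric a C y (axis 3 1) z =
    z $ 1 + a * y $ 1 * z $ 2 + (- 2 * y $ 1 * exp (- a * y $ 2) + C (y $ 2, y $ 3)) * z $ 3"
  by (simp_all add: normal_metric_def)

lemma normal_metric_frame:
  "\<exists>(e :: 3 \<Rightarrow> real^3) k. \<forall>i j. normal_metric a C y (e i) (e j) = (if i \<noteq> j then 0 else if i = k then -1 else 1)"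
proof -
  let ?e = "\<lambda>i. axis i (1::real) :: real^3"
  define K where "K = a * y $ 1"
  define H where "H = - 2 * y $ 1 * exp (- a * y $ 2) + C (y $ 2, y $ 3)"
  \<comment> \<open>\<open>m\<close> is the null vector orthogonal to \<open>e\<^sub>2\<close> with \<open>g(e\<^sub>1, m) = 1\<close>.\<close>
  define m where "m = ?e 3 - K *\<^sub>R ?e 2 - ((H - K\<^sup>2) / 2) *\<^sub>R ?e 1"
  define e where "e i = (if i = 1 then ?e 1 - (1/2) *\<^sub>R m else if i = 2 then ?e 2 else ?e 1 + (1/2) *\<^sub>R m)" for i :: 3
  have nm: "normal_metric a C y s t = s $ 1 * t $ 3 + s $ 3 * t $ 1 + K * (s $ 2 * t $ 3 + s $ 3 * t $ 2)
      + s $ 2 * t $ 2 + H * (s $ 3 * t $ 3)" for s t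
    by (simp add: normal_metric_def K_def H_def)
  have "normal_metric a C y (e i) (e j) = (if i \<noteq> j then 0 else if i = 1 then -1 else 1)" for i j
    using exhaust_3[of i] exhaust_3[of j]
    by (auto simp: e_def m_def nm power2_eq_square field_simps)
  then show ?thesis by blast
qed

locale normal_model = global_chart "top_of_set W" A b
  for W :: "(real^3) set" and A :: "(real^3, 3) chart set" and b +
  fixes a :: real and C :: "real \<times> real \<Rightarrow> real"
  assumes b: "b = (W, id)" and open_W: "open W" and C: "smooth_on (proj_xu W) C"
begin

abbreviation h :: "(real^3, 3) form2" where "h \<equiv> pull_form2 (normal_metric a C)"
abbreviation p :: "(real^3, 3) vfield" where "p \<equiv> pull_vector (normal_null_field a)"
text \<open>The volume density is 1, since the normal metric has determinant -1 at every
  point.\<close>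

abbreviation V :: "(real^3, 3) form3" where
  "V c x u w z \<equiv> - 1 * det3 (jac c b x u) (jac c b x w) (jac c b x z)"

lemma img_b: "img b = W"
  by (simp add: img_def b)

lemma smooth_on_proj: "smooth_on W (\<lambda>y. (y $ 2, y $ 3))"
  by (intro smooth_on_Pair smooth_on_vec_nth smooth_on_id open_W)

lemma smooth_normal_metric: "smooth_on W (\<lambda>y. normal_metric a C y u w)"
proof -
  have "smooth_on W (\<lambda>y. C (y $ 2, y $ 3))"
    by (rule smooth_on_compose[OF open_W open_proj_xu[OF open_W] C smooth_on_proj]) (auto simp: proj_xu_def)
  then show ?thesis
    unfolding normal_metric_def
    by (intro smooth_on_add smooth_on_mult smooth_on_exp smooth_on_const smooth_on_vec_nth smooth_on_id open_W)
qed

sublocale lorentz3 "top_of_set W" A h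
proof (intro lorentz3.intro lorentz_mfd.intro lorentz_mfd_axioms.intro smooth_mfd_axioms)
  show "lorentzian_metric A h"
    by (rule lorentzian_metric_pull)
      (simp_all add: img_b bilinear_normal_metric normal_metric_frame smooth_normal_metric, rule normal_metric_sym)
qed

lemma h_b: "y \<in> W \<Longrightarrow> h b y u w = normal_metric a C y u w"
  and p_b: "y \<in> W \<Longrightarrow> p b y = normal_null_field a y"
  and V_b: "y \<in> W \<Longrightarrow> V b y u w z = - det3 u w z"
  by (simp_all add: transition_self jac_self[OF global(1)] img_b)

lemma three_form_V: "three_form A V"
  by (rule three_form_pull_det3) (rule global_chart_axioms)

lemma vector_field_p: "vector_field A p"
proof (rule vector_field_pull)
  show "smooth_on (img b) (normal_null_field a)"
    unfolding normal_null_field_def[abs_def] img_b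
    by (intro smooth_on_scaleR smooth_on_exp smooth_on_mult smooth_on_const smooth_on_vec_nth smooth_on_id open_W)
qed

lemma isotropic_p: "isotropic A h p"
  unfolding isotropic_def
proof (intro conjI ballI vector_field_p)
  fix c x assume c: "c \<in> A" and x: "x \<in> img c"
  show "h c x (p c x) (p c x) = 0"
    by (simp add: global_jac_inverse'[OF c x] normal_null_field_def normal_metric_def)
  show "p c x \<noteq> 0"
  proof
    assume "p c x = 0"
    then have "jac c b x (p c x) = 0" by (simp add: linear_0[OF linear_jac_global[OF c x]])
    then show False by (simp add: global_jac_inverse'[OF c x] normal_null_field_def)
  qed
qed

text \<open>The coefficients of the terms with dv are constant, and \<open>C\<close> does not depend
  on v; the v-derivative therefore sees the explicit factors v alone.\<close>

lemma dmetric_b: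
  assumes y: "y \<in> W"
  shows "dmetric b y u (axis 1 1) z = 0" "dmetric b y u w (axis 1 1) = 0"
    "dmetric b y (axis 1 1) u w = a * (u $ 2 * w $ 3 + u $ 3 * w $ 2) - 2 * exp (- a * y $ 2) * (u $ 3 * w $ 3)"
proof -
  have yb: "y \<in> img b" using y by (simp add: img_b)
  have D: "dmetric b y v u w = D v" if "((\<lambda>y. normal_metric a C y u w) has_derivative D) (at y)" for u w v D
  proof -
    have "((\<lambda>y. h b y u w) has_derivative D) (at y)"
      by (rule has_derivative_transform_within_open[OF that open_W y]) (simp add: h_b)
    from fun_cong[OF has_derivative_unique[OF metric_has_derivative[OF global(1) yb] this]] show ?thesis .
  qed
  show 1: "dmetric b y u (axis 1 1) z = 0" for u z
    by (rule D) (simp add: normal_metric_axis)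
  then show "dmetric b y u w (axis 1 1) = 0" by (simp add: dmetric_sym[OF global(1) yb, of u w])
  have vn: "((\<lambda>y. y $ i) has_derivative (\<lambda>w. w $ i)) (at y)" for i :: 3
    by (rule bounded_linear_imp_has_derivative[OF bounded_linear_vec_nth])
  have "(C has_derivative frechet_derivative C (at (y $ 2, y $ 3))) (at (y $ 2, y $ 3))"
    by (rule smooth_on_has_derivative[OF C]) (use y in \<open>auto simp: proj_xu_def\<close>)
  note dC = has_derivative_compose[OF has_derivative_Pair[OF vn vn] this]
  let ?C' = "\<lambda>v :: real^3. frechet_derivative C (at (y $ 2, y $ 3)) (v $ 2, v $ 3)"
  have "((\<lambda>y. normal_metric a C y u w) has_derivative (\<lambda>v. a * v $ 1 * (u $ 2 * w $ 3 + u $ 3 * w $ 2)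
      + (- 2 * v $ 1 * exp (- a * y $ 2) + 2 * a * y $ 1 * v $ 2 * exp (- a * y $ 2) + ?C' v) * (u $ 3 * w $ 3))) (at y)"
    unfolding normal_metric_def
    by (auto intro!: derivative_eq_intros vn dC simp: algebra_simps)
  moreover have "?C' (axis 1 1) = 0"
    using linear_0[OF has_derivative_linear[OF smooth_on_has_derivative[OF C]], of "(y $ 2, y $ 3)"] y
    by (auto simp: proj_xu_def zero_prod_def)
  ultimately show "dmetric b y (axis 1 1) u w = a * (u $ 2 * w $ 3 + u $ 3 * w $ 2) - 2 * exp (- a * y $ 2) * (u $ 3 * w $ 3)"
    by (simp add: D algebra_simps)
qed

text \<open>Both sides are paired with \<open>z\<close>. In the common value in the middle of the
  chain the part skew in (u, z) is the volume form term, and the symmetric part is - g(u, p) g(p,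
  z).\<close>

lemma nabla_p_b:
  assumes y: "y \<in> W"
  shows "nabla_at h p b y u = - h b y u (p b y) *\<^sub>R p b y - (1/2) *\<^sub>R sharp h b y (\<lambda>z. a * V b y u (p b y) z)"
proof -
  have yb: "y \<in> img b" using y by (simp add: img_b)
  let ?f = "exp (- a * y $ 2)" and ?e = "axis 1 (1::real) :: real^3"
  have vn: "((\<lambda>y. y $ i) has_derivative (\<lambda>w. w $ i)) (at y)" for i :: 3
    by (rule bounded_linear_imp_has_derivative[OF bounded_linear_vec_nth])
  have "((\<lambda>y. exp (- a * y $ 2) *\<^sub>R ?e) has_derivative (\<lambda>w. (- a * w $ 2 * ?f) *\<^sub>R ?e)) (at y)"
    by (auto intro!: derivative_eq_intros vn simp: algebra_simps)
  then have "(p b has_derivative (\<lambda>w. (- a * w $ 2 * ?f) *\<^sub>R ?e)) (at y)"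
    by (rule has_derivative_transform_within_open[OF _ open_W y]) (simp only: p_b normal_null_field_def[symmetric])
  note F = fun_cong[OF frechet_derivative_at[OF this, symmetric], of u]
  have N: "nabla_at h p b y u = (- a * u $ 2 * ?f) *\<^sub>R ?e + ?f *\<^sub>R christoffel h b y u ?e"
    unfolding nabla_at_def F p_b[OF y] unfolding normal_null_field_def linear_scale[OF linear_christoffel(2)[OF global(1) yb]] ..
  show ?thesis
  proof (rule nondegenerate[OF global(1) yb])
    fix z
    have lin: "linear (\<lambda>z. a * V b y u (p b y) z)"
      using three_form_linear[OF three_form_scale[OF three_form_V] global(1) yb] .
    have "h b y (nabla_at h p b y u) z = (- a * u $ 2 * ?f) * h b y ?e z + ?f * h b y (christoffel h b y u ?e) z"
      unfolding N by (simp only: g_lin[OF global(1) yb] real_scaleR_def)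
    also have "\<dots> = ?f * a / 2 * (u $ 3 * z $ 2 - u $ 2 * z $ 3) - ?f * ?f * (u $ 3 * z $ 3)"
      unfolding g_christoffel[OF global(1) yb] unfolding dmetric_b[OF y] h_b[OF y] normal_metric_axis by (simp add: field_simps)
    also have "\<dots> = - h b y u (p b y) * h b y (p b y) z - 1/2 * (a * V b y u (p b y) z)"
      unfolding h_b[OF y] V_b[OF y] p_b[OF y] unfolding normal_null_field_def by (simp add: normal_metric_def det3_def field_simps)
    also have "\<dots> = h b y (- h b y u (p b y) *\<^sub>R p b y - (1/2) *\<^sub>R sharp h b y (\<lambda>z. a * V b y u (p b y) z)) z"
      by (simp only: g_lin[OF global(1) yb] g_sharp[OF global(1) yb lin] real_scaleR_def)
    finally show "h b y (nabla_at h p b y u) z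
      = h b y (- h b y u (p b y) *\<^sub>R p b y - (1/2) *\<^sub>R sharp h b y (\<lambda>z. a * V b y u (p b y) z)) z" .
  qed
qed

text \<open>The equation says that D_X p vanishes, and D_X p is a vector field, so the computation
  in the global chart is enough.\<close>

lemma levi_civita_p:
  assumes X: "vector_field A X" and c: "c \<in> A" and x: "x \<in> img c"
  shows "levi_civita h X p c x = - h c x (X c x) (p c x) *\<^sub>R p c x
    - (1/2) *\<^sub>R form3_vec h (\<lambda>c x u w z. a * V c x u w z) X p c x"
proof -
  let ?S = "\<lambda>c x u w z. a * V c x u w z"
  have cov: "cov p ?S p c x u = nabla_at h p c x u + h c x u (p c x) *\<^sub>R p c x + (1/2) *\<^sub>R sharp h c x (?S c x u (p c x))"
    if "c \<in> A" "x \<in> img c" for c x u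
    using isotropic_p that unfolding isotropic_def cov_def by simp
  have z: "vector_field A (\<lambda>c x. 0)"
    unfolding vector_field_def using linear_0[OF linear_jac] smooth_on_const by simp
  have "field_eq A (\<lambda>c x. cov p ?S p c x (X c x)) (\<lambda>c x. 0)"
  proof (rule field_eq_global[OF vector_field_cov[OF vector_field_p three_form_scale[OF three_form_V] X vector_field_p] z])
    fix y assume y: "y \<in> img b"
    show "cov p ?S p b y (X b y) = 0"
      unfolding cov[OF global(1) y] nabla_p_b[OF y[unfolded img_b]] by simp
  qed
  then have "cov p ?S p c x (X c x) = 0" using c x by (simp add: field_eq_def)
  moreover have "n = - k *\<^sub>R q - r" if "n + k *\<^sub>R q + r = 0" for n q r :: "real^3" and k
  proof -
    have "n = (n + k *\<^sub>R q + r) + (- k *\<^sub>R q - r)" by simp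
    then show ?thesis unfolding that by simp
  qed
  ultimately show ?thesis
    unfolding cov[OF c x] levi_civita_def form3_vec_def by blast
qed

text \<open>The oriented subatlas is the single chart obtained from the global one by a reflection,
  in which the coefficient of \<open>V\<close> is positive; the Jacobian of its transition to itself
  is the identity.\<close>

lemma volume_form_V: obtains Or where "orientation (top_of_set W) A Or" "volume_form A h Or V"
proof -
  define R where "R y = ((\<chi> i. if i = 1 then - y$i else y$i) :: real^3)" for y
  have Rdef: "R = (\<lambda>y. \<chi> i. if i = 1 then - y$i else y$i)" by (simp add: R_def[abs_def])
  have RR: "R (R y) = y" for y by (simp add: R_def vec_eq_iff)
  have sd: "smooth_diffeo W (R ` W) R R" and lin: "linear R"
    unfolding Rdef by (rule smooth_diffeo_reflection[OF open_W])+
  obtain d where d: "d \<in> A" "fst d = param b ` W" "overlap b d = W"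
    "\<And>x. x \<in> W \<Longrightarrow> transition b d x = R x" "\<And>x. x \<in> W \<Longrightarrow> jac b d x = frechet_derivative R (at x)"
    using new_chart[OF global(1) sd] by (metis img_b order_refl)
  have pW: "param b ` W = W" unfolding param_def b by (auto simp: inv_into_f_f[of id W, simplified])
  have J: "jac d b x u = R u" if x: "x \<in> img d" for x u
  proof -
    have t: "transition d b x \<in> W" using global_in[OF d(1) x] by (simp add: img_b)
    have "jac b d (transition d b x) (R u) = u"
      using d(5)[OF t] frechet_derivative_at[OF bounded_linear_imp_has_derivative, of R] lin RR
      by (metis linear_conv_bounded_linear)
    then show ?thesis using global_jac_inverse'[OF d(1) x, of "R u"] by simp
  qed
  have "orientation (top_of_set W) A {d}"
  proof -
    have "jac d d x = id" if "x \<in> img d" for x using jac_self[OF d(1) that] by auto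
    then show ?thesis using d(1,2) pW by (simp add: orientation_def overlap_self matrix_id_mat_1)
  qed
  moreover have "V d x u w z = sqrt \<bar>det (gram h d x)\<bar> * det (vector [u, w, z] :: real ^ 3 ^ 3)" if x: "x \<in> img d" for x u w z
  proof -
    have "det (gram h d x) = -1"
      by (simp add: det_3 gram_def J[OF x] R_def normal_metric_def)
    then show ?thesis unfolding det_vector3 J[OF x] by (simp add: R_def det3_def algebra_simps)
  qed
  ultimately show ?thesis using three_form_V by (intro that[of "{d}"]) (simp_all add: volume_form_def)
qed

lemma adapted: obtains Or where "orientation (top_of_set W) A Or" "adapted_isotropic A h Or a p"
proof -
  obtain Or where Or: "orientation (top_of_set W) A Or" "volume_form A h Or V" by (rule volume_form_V)
  have "adapted_isotropic A h Or a p"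
    unfolding adapted_isotropic_def Let_def field_eq_def using isotropic_p Or(2) levi_civita_p by blast
  with Or(1) show ?thesis by (rule that)
qed

end

text \<open>Every smooth \<open>C\<close> occurs, which is the sense in which the function in the
  normal form is arbitrary. The underlying manifold is the coordinate domain itself with its
  identity chart.\<close>

theorem normal_form_realised:
  fixes W :: "(real^3) set"
  assumes W: "open W" "connected W" "W \<noteq> {}" and C: "smooth_on (proj_xu W) C"
  defines "A \<equiv> max_atlas (top_of_set W) {(W, id)}"
  shows "\<exists>h Or p. lorentzian_manifold (top_of_set W) A h \<and> orientation (top_of_set W) A Or \<and> adapted_isotropic A h Or a p \<and>
    (\<forall>y\<in>W. h (W, id) y = normal_metric a C y \<and> p (W, id) y = normal_null_field a y)"
proof -
  interpret normal_model W A "(W, id)" a C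
    using smooth_manifold_global_chart[OF W] W(1) C by unfold_locales (auto simp: A_def)
  obtain Or where "orientation (top_of_set W) A Or" "adapted_isotropic A h Or a p" by (rule adapted)
  moreover have "lorentzian_manifold (top_of_set W) A h"
    using smooth_manifold lorentzian_metric by (simp add: lorentzian_manifold_def)
  moreover have "h (W, id) y = normal_metric a C y" "p (W, id) y = normal_null_field a y" if "y \<in> W" for y
    using h_b[OF that] p_b[OF that] by (auto intro!: ext)
  ultimately show ?thesis by blast
qed

theorem theorem7:
  fixes M :: "'a topology" and A :: "('a, 3) chart set" and g :: "('a, 3) form2"
  assumes "lorentzian_manifold M A g"
  shows
    "((\<exists>D p S. metric_connection A g D \<and> twistor_free_torsion A g D p S \<and> parallel_torsion A D \<and>
          isotropic A g p \<and> \<not> degenerate A g S)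
      \<longleftrightarrow> (\<exists>Or. orientation M A Or \<and> (\<exists>p a. a \<noteq> 0 \<and> adapted_isotropic A g Or a p)))
    \<and> (\<forall>Or p a. orientation M A Or \<and> a \<noteq> 0 \<and> adapted_isotropic A g Or a p \<longrightarrow>
          kundt_space M A g \<and>
          (\<forall>q\<in>topspace M. \<exists>c\<in>A. q \<in> fst c \<and>
             (\<exists>C. smooth_on (proj_xu (img c)) C \<and>
                (\<forall>y\<in>img c. g c y = normal_metric a C y \<and> p c y = normal_null_field a y))))
    \<and> (\<forall>(a::real) (W :: (real ^ 3) set) (C :: real \<times> real \<Rightarrow> real).
          a \<noteq> 0 \<and> open W \<and> connected W \<and> W \<noteq> {} \<and> smooth_on (proj_xu W) C \<longrightarrow>
          (let N = top_of_set W; B = max_atlas N {(W, id)} in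
           \<exists>h Or p. lorentzian_manifold N B h \<and> orientation N B Or \<and> adapted_isotropic B h Or a p \<and>
             (\<forall>y\<in>W. h (W, id) y = normal_metric a C y \<and> p (W, id) y = normal_null_field a y)))"
proof -
  interpret lorentz3 M A g
    using assms by unfold_locales (simp_all add: lorentzian_manifold_def)
  have chart: "\<exists>c\<in>A. q \<in> fst c \<and> (\<exists>C. smooth_on (proj_xu (img c)) C \<and>
      (\<forall>y\<in>img c. g c y = normal_metric a C y \<and> p c y = normal_null_field a y))"
    if Or: "orientation M A Or" and a: "a \<noteq> 0" and ad: "adapted_isotropic A g Or a p" and q: "q \<in> topspace M" for Or p a q
  proof -
    obtain V where V: "volume_form A g Or V" "\<And>c x u. c \<in> A \<Longrightarrow> x \<in> img c \<Longrightarrow>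
        nabla_at g p c x u = - g c x u (p c x) *\<^sub>R p c x - (1/2) *\<^sub>R sharp g c x (\<lambda>z. a * V c x u (p c x) z)"
      using adapted_nabla[OF ad] by metis
    have I: "isotropic A g p" using ad by (simp add: adapted_isotropic_def)
    interpret adapted3 M A g Or a p V
      by (rule adapted3.intro[OF lorentz3_axioms adapted3_axioms.intro[OF Or a I V]])
    show ?thesis by (rule normal_form_chart[OF q])
  qed
  show ?thesis
  proof (intro conjI iffI allI impI ballI)
    assume "\<exists>D p S. metric_connection A g D \<and> twistor_free_torsion A g D p S \<and> parallel_torsion A D \<and>
      isotropic A g p \<and> \<not> degenerate A g S"
    then show "\<exists>Or. orientation M A Or \<and> (\<exists>p a. a \<noteq> 0 \<and> adapted_isotropic A g Or a p)"
      using parallel_torsion_imp_adapted unfolding metric_connection_def by blast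
  next
    assume "\<exists>Or. orientation M A Or \<and> (\<exists>p a. a \<noteq> 0 \<and> adapted_isotropic A g Or a p)"
    then show "\<exists>D p S. metric_connection A g D \<and> twistor_free_torsion A g D p S \<and> parallel_torsion A D \<and>
        isotropic A g p \<and> \<not> degenerate A g S"
      using adapted_imp_parallel_torsion by blast
  next
    fix Or p and a :: real
    assume "orientation M A Or \<and> a \<noteq> 0 \<and> adapted_isotropic A g Or a p"
    then show "kundt_space M A g" using adapted_imp_kundt by blast
  next
    fix Or p and a :: real and q
    assume "orientation M A Or \<and> a \<noteq> 0 \<and> adapted_isotropic A g Or a p" and "q \<in> topspace M"
    then show "\<exists>c\<in>A. q \<in> fst c \<and> (\<exists>C. smooth_on (proj_xu (img c)) C \<and>
        (\<forall>y\<in>img c. g c y = normal_metric a C y \<and> p c y = normal_null_field a y))"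
      using chart by blast
  next
    fix a :: real and W :: "(real^3) set" and C :: "real \<times> real \<Rightarrow> real"
    assume "a \<noteq> 0 \<and> open W \<and> connected W \<and> W \<noteq> {} \<and> smooth_on (proj_xu W) C"
    then show "let N = top_of_set W; B = max_atlas N {(W, id)} in
        \<exists>h Or p. lorentzian_manifold N B h \<and> orientation N B Or \<and> adapted_isotropic B h Or a p \<and>
          (\<forall>y\<in>W. h (W, id) y = normal_metric a C y \<and> p (W, id) y = normal_null_field a y)"
      using normal_form_realised[of W C a] by (simp add: Let_def)
  qed
qed

end
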